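(* Let $G_1,G_2$ be groups from the list $C_2,C_3,C_4,C_6,D_3,D_2,D_4,D_6,T,O,I$ of finite subgroups of $\mathrm{SO}(3)$, with $G_1$ not later than $G_2$ in this list. Then the fundamental group $\pi_1(X(G_1,G_2))$ is, up to isomorphism, as in the following table (row $G_1$, column $G_2$; $1$ is the trivial group): \[ \begin{array}{c|ccccccccccc} & C_2 & C_3 & C_4 & C_6 & D_3 & D_2 & D_4 & D_6 & T & O & I\\ \hline C_2 & \mathbb{Z}_2 & \mathbb{Z}_{12} & \mathbb{Z}_4 & \mathbb{Z}_6 & \mathbb{Z}_2 & 1 & 1 & 1 & \mathbb{Z}_3 & 1 & 1\\ C_3 & & \mathbb{Z}_2 & \mathbb{Z}_{24} & \mathbb{Z}_4 & \mathbb{Z}_4 & \mathbb{Z}_3\times Q_8 & \mathbb{Z}_3\times 2D_4 & Q_8 & 1 & \mathbb{Z}_2 & 1\\ C_4 & & & \mathbb{Z}_2 & \mathbb{Z}_{12} & \mathbb{Z}_4 & \mathbb{Z}_2 & 1 & \mathbb{Z}_2 & \mathbb{Z}_6 & 1 & \mathbb{Z}_2\\ C_6 & & & & \mathbb{Z}_2 & \mathbb{Z}_2 & \mathbb{Z}_3 & \mathbb{Z}_3 & 1 & 1 & 1 & 1\\ D_3 & & & & & \mathbb{Z}_2 & 1 & 1 & 1 & 1 & 1 & 1\\ D_2 & & & & & & 1 & 1 & 1 & \mathbb{Z}_3 & 1 & 1\\ D_4 & & & & & & & 1 & 1 & \mathbb{Z}_3 & 1 & 1\\ D_6 & & & & &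 & & & 1 & 1 & 1 & 1\\ T & & & & & & & & & 1 & 1 & 1\\ O & & & & & & & & & & 1 & 1\\ I & & & & & & & & & & & 1 \end{array} \]
   Context: For finite subgroups $G_1,G_2\subset \mathrm{SO}(3)$, the misorientation space is the topological orbit space $X(G_1,G_2)=\mathrm{SO}(3)/(G_1\times G_2)=G_1\backslash \mathrm{SO}(3)/G_2$, where $(g_1,g_2)\cdot A=g_1Ag_2^{-1}$. Up to homeomorphism it depends only on the conjugacy classes of $G_1,G_2$ in $\mathrm{SO}(3)$, so the groups are specified up to conjugacy. Also $X(G_1,G_2)\cong X(G_2,G_1)$. Groups: $C_n$ is generated by an axial rotation of order $n$; $D_n$ (order $2n$) is generated by an axial rotation of order $n$ and a rotation of order $2$ about an axis orthogonal to the first axis; $T,O,I$ are the groups of orientation-preserving (rotational) symmetries of a regular tetrahedron, octahedron, icosahedron respectively. $Q_8=\{\pm1,\pm i,\pm j,\pm k\}$ is the quaternion group. For $G\subset\mathrm{SO}(3)$, $2G$ denotes the preimage of $G$ under the standard double cover $\mathrm{Sp}(1)\to\mathrm{SO}(3)$ from the unit quaternions; in particular $2D_4$ has order $16$ and is generated by $\cos\frac{\pi}{4}+i\sin\frac{\pi}{4}$ and $j$. *)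

theory Defs
  imports "HOL-Analysis.Analysis" "HOL-Algebra.Elementary_Groups" "HOL-Algebra.Multiplicative_Group" "HOL-Algebra.Group_Action"
begin

section \<open>The rotation group and its finite subgroups\<close>

definition SO3 :: "(real^3^3) monoid" where
  "SO3 = \<lparr>carrier = {A. rotation_matrix A}, mult = (**), one = mat 1\<rparr>"

lemma group_SO3: "group SO3"
proof (rule groupI)
  fix A assume "A \<in> carrier SO3"
  then have "rotation_matrix (transpose A)" "transpose A ** A = mat 1"
    by (auto simp: SO3_def rotation_matrix_def orthogonal_matrix_def)
  then show "\<exists>B\<in>carrier SO3. B \<otimes>\<^bsub>SO3\<^esub> A = \<one>\<^bsub>SO3\<^esub>"
    by (auto simp: SO3_def)
qed (auto simp: SO3_def rotation_matrix_def orthogonal_matrix_mul det_mul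
    matrix_mul_assoc orthogonal_matrix_id)

definition axial_rotation :: "real^3 \<Rightarrow> nat \<Rightarrow> real^3^3 \<Rightarrow> bool" where
  "axial_rotation u n A \<longleftrightarrow>
     u \<noteq> 0 \<and> A \<in> carrier SO3 \<and> A *v u = u \<and> group.ord SO3 A = n"

text \<open>
  Elements of \<^term>\<open>SO3\<close> are linear, so a polyhedron has to be centred at the origin for
  \<open>rotational_symmetries\<close> to be its whole group of orientation-preserving symmetries.
  The regular polyhedra below are therefore centred at \<open>0\<close>, with arbitrary
  size and orientation.
\<close>

definition rotational_symmetries :: "(real^3) set \<Rightarrow> (real^3^3) set" where
  "rotational_symmetries P = {A \<in> carrier SO3. (\<lambda>x. A *v x) ` P = P}"

definition regular_tetrahedron :: "(real^3) set \<Rightarrow> bool" where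
  "regular_tetrahedron P \<longleftrightarrow>
     (\<exists>V r. card V = 4 \<and> r > 0 \<and> (\<forall>x\<in>V. \<forall>y\<in>V. x \<noteq> y \<longrightarrow> dist x y = r) \<and>
        (\<Sum>x\<in>V. x) = 0 \<and> P = convex hull V)"

definition orthogonal_frame :: "real^3 \<Rightarrow> real^3 \<Rightarrow> real^3 \<Rightarrow> bool" where
  "orthogonal_frame a b c \<longleftrightarrow>
     a \<noteq> 0 \<and> norm a = norm b \<and> norm b = norm c \<and> a \<bullet> b = 0 \<and> b \<bullet> c = 0 \<and> c \<bullet> a = 0"

definition regular_octahedron :: "(real^3) set \<Rightarrow> bool" where
  "regular_octahedron P \<longleftrightarrow>
     (\<exists>a b c. orthogonal_frame a b c \<and> P = convex hull {a, -a, b, -b, c, -c})"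

text \<open>
  In coordinates with respect to the frame, the vertices are the cyclic permutations of
  \<open>(\<plusminus>1, \<plusminus>\<phi>, 0)\<close>, where \<open>\<phi>\<close> is the golden ratio.
\<close>

definition regular_icosahedron :: "(real^3) set \<Rightarrow> bool" where
  "regular_icosahedron P \<longleftrightarrow>
     (\<exists>a b c. orthogonal_frame a b c \<and>
        P = convex hull {s *\<^sub>R x + (t * ((1 + sqrt 5) / 2)) *\<^sub>R y | s t x y.
              s \<in> {-1, 1} \<and> t \<in> {-1, 1} \<and> (x, y) \<in> {(a, b), (b, c), (c, a)}})"

datatype rotation_group_type =
  Cyclic nat | Dihedral nat | Tetrahedral | Octahedral | Icosahedral

text \<open>
  \<open>has_type \<tau> G\<close> singles out a whole conjugacy class of subgroups of \<^term>\<open>SO3\<close>: axes,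
  polyhedra and frames are arbitrary.
\<close>

fun has_type :: "rotation_group_type \<Rightarrow> (real^3^3) set \<Rightarrow> bool" where
  "has_type (Cyclic n) G \<longleftrightarrow> (\<exists>u A. axial_rotation u n A \<and> G = generate SO3 {A})"
| "has_type (Dihedral n) G \<longleftrightarrow>
     (\<exists>u A v B. axial_rotation u n A \<and> axial_rotation v 2 B \<and> orthogonal u v \<and>
        G = generate SO3 {A, B})"
| "has_type Tetrahedral G \<longleftrightarrow> (\<exists>P. regular_tetrahedron P \<and> G = rotational_symmetries P)"
| "has_type Octahedral G \<longleftrightarrow> (\<exists>P. regular_octahedron P \<and> G = rotational_symmetries P)"
| "has_type Icosahedral G \<longleftrightarrow> (\<exists>P. regular_icosahedron P \<and> G = rotational_symmetries P)"


section \<open>The misorientation space\<close>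

definition quotient_topology :: "'a topology \<Rightarrow> ('a \<Rightarrow> 'b) \<Rightarrow> 'b topology" where
  "quotient_topology X f =
     topology (\<lambda>U. U \<subseteq> f ` topspace X \<and> openin X {x \<in> topspace X. f x \<in> U})"

lemma openin_quotient_topology:
  "openin (quotient_topology X f) U \<longleftrightarrow>
     U \<subseteq> f ` topspace X \<and> openin X {x \<in> topspace X. f x \<in> U}"
proof -
  have "istopology (\<lambda>U. U \<subseteq> f ` topspace X \<and> openin X {x \<in> topspace X. f x \<in> U})"
    unfolding istopology_def
  proof (intro conjI allI impI)
    fix S T assume "S \<subseteq> f ` topspace X \<and> openin X {x \<in> topspace X. f x \<in> S}"
      and "T \<subseteq> f ` topspace X \<and> openin X {x \<in> topspace X. f x \<in> T}"
    moreover have "{x \<in> topspace X. f x \<in> S \<inter> T} =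
        {x \<in> topspace X. f x \<in> S} \<inter> {x \<in> topspace X. f x \<in> T}" by auto
    ultimately show "S \<inter> T \<subseteq> f ` topspace X" "openin X {x \<in> topspace X. f x \<in> S \<inter> T}"
      by (auto intro: openin_Int)
  next
    fix \<K> assume *: "\<forall>K\<in>\<K>. K \<subseteq> f ` topspace X \<and> openin X {x \<in> topspace X. f x \<in> K}"
    have "{x \<in> topspace X. f x \<in> \<Union>\<K>} = (\<Union>K\<in>\<K>. {x \<in> topspace X. f x \<in> K})" by auto
    with * show "\<Union>\<K> \<subseteq> f ` topspace X" "openin X {x \<in> topspace X. f x \<in> \<Union>\<K>}"
      by auto
  qed
  then show ?thesis
    by (simp add: quotient_topology_def topology_inverse')
qed

lemma topspace_quotient_topology: "topspace (quotient_topology X f) = f ` topspace X"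
proof -
  have "{x \<in> topspace X. f x \<in> f ` topspace X} = topspace X" by auto
  then have "openin (quotient_topology X f) (f ` topspace X)"
    by (simp add: openin_quotient_topology)
  then show ?thesis
    by (meson openin_quotient_topology openin_subset openin_topspace subset_antisym)
qed

lemma quotient_map_quotient_topology: "quotient_map X (quotient_topology X f) f"
  by (auto simp: quotient_map_def openin_quotient_topology topspace_quotient_topology)

definition misorientation_action :: "(real^3^3) \<times> (real^3^3) \<Rightarrow> real^3^3 \<Rightarrow> real^3^3" where
  "misorientation_action = (\<lambda>(g1, g2) A. g1 ** A ** inv\<^bsub>SO3\<^esub> g2)"

definition misorientation_space ::
    "(real^3^3) set \<Rightarrow> (real^3^3) set \<Rightarrow> (real^3^3) set topology" where
  "misorientation_space G1 G2 =
     quotient_topology (top_of_set (carrier SO3))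
       (orbit (SO3\<lparr>carrier := G1\<rparr> \<times>\<times> SO3\<lparr>carrier := G2\<rparr>) misorientation_action)"


section \<open>The fundamental group of an abstract topological space\<close>

text \<open>
  A loop is a function on \<^typ>\<open>real\<close> whose values outside \<open>[0, 1]\<close> are irrelevant:
  functions agreeing on \<open>[0, 1]\<close> are homotopic in the sense below.  The library's paths
  and \<^const>\<open>homotopic_paths\<close> only cover subspaces of topological type classes.
\<close>

definition loops :: "'a topology \<Rightarrow> 'a \<Rightarrow> (real \<Rightarrow> 'a) set" where
  "loops X x = {p. pathin X p \<and> p 0 = x \<and> p 1 = x}"

definition homotopic_loops_at :: "'a topology \<Rightarrow> 'a \<Rightarrow> (real \<Rightarrow> 'a) \<Rightarrow> (real \<Rightarrow> 'a) \<Rightarrow> bool" where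
  "homotopic_loops_at X x =
     homotopic_with (\<lambda>r. r 0 = x \<and> r 1 = x) (top_of_set {0..1}) X"

definition loop_class :: "'a topology \<Rightarrow> 'a \<Rightarrow> (real \<Rightarrow> 'a) \<Rightarrow> (real \<Rightarrow> 'a) set" where
  "loop_class X x p = {q. homotopic_loops_at X x p q}"

definition loop_join :: "(real \<Rightarrow> 'a) \<Rightarrow> (real \<Rightarrow> 'a) \<Rightarrow> real \<Rightarrow> 'a" where
  "loop_join p q = (\<lambda>t. if t \<le> 1/2 then p (2 * t) else q (2 * t - 1))"

text \<open>
  The product of two homotopy classes is written as a union over representatives; all the
  classes in that union coincide.
\<close>

definition fundamental_group :: "'a topology \<Rightarrow> 'a \<Rightarrow> (real \<Rightarrow> 'a) set monoid" where
  "fundamental_group X x =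
     \<lparr>carrier = loop_class X x ` loops X x,
      mult = (\<lambda>a b. \<Union>p\<in>a. \<Union>q\<in>b. loop_class X x (loop_join p q)),
      one = loop_class X x (\<lambda>_. x)\<rparr>"


section \<open>Quaternions and binary groups\<close>

text \<open>
  The pair \<open>(a, u)\<close> stands for \<open>a + u\<^sub>1 i + u\<^sub>2 j + u\<^sub>3 k\<close>; the product norm
  is the usual norm of a quaternion.
\<close>

type_synonym quaternion = "real \<times> (real^3)"

definition quat_mult :: "quaternion \<Rightarrow> quaternion \<Rightarrow> quaternion" where
  "quat_mult = (\<lambda>(a, u) (b, v). (a * b - u \<bullet> v, a *\<^sub>R v + b *\<^sub>R u + cross3 u v))"

definition quat_cnj :: "quaternion \<Rightarrow> quaternion" where
  "quat_cnj = (\<lambda>(a, u). (a, - u))"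

definition quat_1 :: quaternion where "quat_1 = (1, 0)"
definition quat_i :: quaternion where "quat_i = (0, axis 1 1)"
definition quat_j :: quaternion where "quat_j = (0, axis 2 1)"
definition quat_k :: quaternion where "quat_k = (0, axis 3 1)"

definition Sp1 :: "quaternion monoid" where
  "Sp1 = \<lparr>carrier = {q. norm q = 1}, mult = quat_mult, one = quat_1\<rparr>"

definition double_cover :: "quaternion \<Rightarrow> real^3^3" where
  "double_cover q = matrix (\<lambda>v. snd (quat_mult (quat_mult q (0, v)) (quat_cnj q)))"

definition binary_group :: "(real^3^3) set \<Rightarrow> quaternion monoid" where
  "binary_group G = Sp1\<lparr>carrier := {q \<in> carrier Sp1. double_cover q \<in> G}\<rparr>"

definition Q8 :: "quaternion monoid" where
  "Q8 = Sp1\<lparr>carrier :=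
     {quat_1, - quat_1, quat_i, - quat_i, quat_j, - quat_j, quat_k, - quat_k}\<rparr>"

text \<open>
  Generated by the quarter turn about the first coordinate axis and the half turn about the
  second one.
\<close>

definition standard_D4 :: "(real^3^3) set" where
  "standard_D4 = generate SO3
     {vector [vector [1, 0, 0], vector [0, 0, -1], vector [0, 1, 0]],
      vector [vector [-1, 0, 0], vector [0, 1, 0], vector [0, 0, -1]]}"

lemma double_cover_D4_generators:
  "double_cover (cos (pi/4), sin (pi/4) *\<^sub>R axis 1 1) =
     vector [vector [1, 0, 0], vector [0, 0, -1], vector [0, 1, 0]]"
  "double_cover quat_j = vector [vector [-1, 0, 0], vector [0, 1, 0], vector [0, 0, -1]]"
  by (simp_all add: double_cover_def quat_mult_def quat_cnj_def quat_j_def matrix_def vec_eq_iff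
      forall_3 cross3_def inner_vec_def sum_3 axis_def cos_45 sin_45 algebra_simps)


section \<open>The table\<close>

datatype table_entry = Trivial | Z nat | Quat | Z_Quat nat | Z_2D4 nat

fun is_entry :: "table_entry \<Rightarrow> 'a monoid \<Rightarrow> bool" where
  "is_entry Trivial H \<longleftrightarrow> trivial_group H"
| "is_entry (Z n) H \<longleftrightarrow> H \<cong> integer_mod_group n"
| "is_entry Quat H \<longleftrightarrow> H \<cong> Q8"
| "is_entry (Z_Quat n) H \<longleftrightarrow> H \<cong> integer_mod_group n \<times>\<times> Q8"
| "is_entry (Z_2D4 n) H \<longleftrightarrow> H \<cong> integer_mod_group n \<times>\<times> binary_group standard_D4"

definition group_list :: "rotation_group_type list" where
  "group_list =
     [Cyclic 2, Cyclic 3, Cyclic 4, Cyclic 6, Dihedral 3, Dihedral 2, Dihedral 4, Dihedral 6,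
      Tetrahedral, Octahedral, Icosahedral]"

text \<open>
  Rows and columns follow \<^const>\<open>group_list\<close>.  Row \<open>i\<close> starts at the diagonal, so the
  entry in row \<open>i\<close> and column \<open>j \<ge> i\<close> is \<open>pi1_table ! i ! (j - i)\<close>.
\<close>

definition pi1_table :: "table_entry list list" where
  "pi1_table =
     [[Z 2, Z 12, Z 4, Z 6, Z 2, Trivial, Trivial, Trivial, Z 3, Trivial, Trivial],
      [Z 2, Z 24, Z 4, Z 4, Z_Quat 3, Z_2D4 3, Quat, Trivial, Z 2, Trivial],
      [Z 2, Z 12, Z 4, Z 2, Trivial, Z 2, Z 6, Trivial, Z 2],
      [Z 2, Z 2, Z 3, Z 3, Trivial, Trivial, Trivial, Trivial],
      [Z 2, Trivial, Trivial, Trivial, Trivial, Trivial, Trivial],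
      [Trivial, Trivial, Trivial, Z 3, Trivial, Trivial],
      [Trivial, Trivial, Z 3, Trivial, Trivial],
      [Trivial, Trivial, Trivial, Trivial],
      [Trivial, Trivial, Trivial],
      [Trivial, Trivial],
      [Trivial]]"

end

theory Submission
  imports Defs
begin

text \<open>
  Write \<open>A\<close> and \<open>B\<close> for the binary groups over \<open>G1\<close> and \<open>G2\<close>, finite groups of unit
  quaternions.  The misorientation space is the orbit space of the unit quaternions, a
  3-sphere, under the action of \<open>A \<times> B\<close> by \<open>q \<mapsto> a q b\<^sup>-\<^sup>1\<close>.  The sphere is simply connected,
  so by a theorem of Armstrong the fundamental group of the orbit space is the quotient of
  \<open>A \<times> B\<close> by the subgroup generated by all elements that have a fixed point: a loop downstairs
  lifts to a path from \<open>x\<close> to some translate \<open>g x\<close>, and \<open>g\<close> is determined by the homotopy class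
  exactly up to this subgroup (\<open>fundamental_group_orbit_space\<close>; the lifting of paths is
  \<open>orbit_path_lift\<close>).

  The pair \<open>(a, b)\<close> fixes \<open>p\<close> iff \<open>b = p\<^sup>-\<^sup>1 a p\<close>, and two unit quaternions are conjugate iff
  their real parts agree.  So the fundamental group is \<open>A \<times> B\<close> modulo the subgroup \<open>N\<close>
  generated by the pairs of equal real part (\<open>fundamental_group_misorientation_space\<close>).  Up to
  isomorphism nothing changes when \<open>A\<close> and \<open>B\<close> are rotated, and every group of a given type can
  be rotated into a standard position (\<open>has_type_cover_preimage\<close>).  What remains is algebra
  with explicit groups of quaternions.

  Two observations settle most entries.  If some element of \<open>A\<close> has real part \<open>s\<close>, then
  \<open>(1, p q\<^sup>-\<^sup>1)\<close> lies in \<open>N\<close> for all \<open>p\<close>, \<open>q\<close> in \<open>B\<close> of real part \<open>s\<close>, and for a suitable \<open>s\<close> these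
  quotients often generate \<open>B\<close>.  In that case \<open>N\<close> also contains \<open>(a, 1)\<close> for every \<open>a\<close> whose real
  part occurs in \<open>B\<close>, and the fundamental group is \<open>A\<close> modulo the subgroup generated by these
  \<open>a\<close>.  It is trivial if they generate \<open>A\<close> (\<open>quotient_group_trivial\<close>), and otherwise cyclic in
  the cases at hand (\<open>quotient_group_cyclic_left\<close>, for two entries after exchanging \<open>A\<close> and
  \<open>B\<close>).  In the other entries, where \<open>G1\<close> is cyclic or dihedral of order 6, \<open>N\<close> is determined
  explicitly; the quotient is then read off from a cyclic subgroup that surjects onto it
  (\<open>quotient_group_cyclic\<close>) or from a complement of \<open>N\<close> (\<open>Mod_complement\<close>).
\<close>

section \<open>Lifting paths from an orbit space\<close>

locale isometric_action = group G for G :: "('g, 'm) monoid_scheme" (structure) +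
  fixes act :: "'g \<Rightarrow> 'a::metric_space \<Rightarrow> 'a" and M :: "'a set"
  assumes finite_group: "finite (carrier G)"
    and act_closed: "\<lbrakk>g \<in> carrier G; p \<in> M\<rbrakk> \<Longrightarrow> act g p \<in> M"
    and act_one: "p \<in> M \<Longrightarrow> act \<one> p = p"
    and act_mult: "\<lbrakk>g \<in> carrier G; h \<in> carrier G; p \<in> M\<rbrakk> \<Longrightarrow> act (g \<otimes> h) p = act g (act h p)"
    and act_dist: "\<lbrakk>g \<in> carrier G; p \<in> M; q \<in> M\<rbrakk> \<Longrightarrow> dist (act g p) (act g q) = dist p q"
begin

lemma act_inv: "\<lbrakk>g \<in> carrier G; p \<in> M\<rbrakk> \<Longrightarrow> act (inv g) (act g p) = p"
  by (metis act_mult act_one inv_closed l_inv)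

lemma act_inv': "\<lbrakk>g \<in> carrier G; p \<in> M\<rbrakk> \<Longrightarrow> act g (act (inv g) p) = p"
  by (metis act_mult act_one inv_closed r_inv)

lemma continuous_on_act: "g \<in> carrier G \<Longrightarrow> continuous_on M (act g)"
  by (metis (no_types, lifting) act_dist continuous_on_iff)

definition orb :: "'g set \<Rightarrow> 'a \<Rightarrow> 'a set" where
  "orb H p = (\<lambda>h. act h p) ` H"

lemma orb_refl: "\<lbrakk>subgroup H G; p \<in> M\<rbrakk> \<Longrightarrow> p \<in> orb H p"
  unfolding orb_def by (metis act_one imageI subgroup.one_closed)

lemma orb_subset: "\<lbrakk>subgroup H G; p \<in> M\<rbrakk> \<Longrightarrow> orb H p \<subseteq> M"
  unfolding orb_def using act_closed subgroup.mem_carrier[of H G] by auto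

lemma orb_eq:
  assumes "subgroup H G" "p \<in> M" "q \<in> orb H p"
  shows "orb H q = orb H p"
proof -
  obtain k where k: "k \<in> H" "q = act k p" using assms(3) unfolding orb_def by auto
  have H: "H \<subseteq> carrier G" by (simp add: assms(1) subgroup.subset)
  have "act h q = act (h \<otimes> k) p" if "h \<in> H" for h
    using that k H assms(2) by (simp add: act_mult subset_iff)
  moreover have "act h p = act (h \<otimes> inv k) q" if "h \<in> H" for h
    using that k H assms(2) by (simp add: act_mult subset_iff act_closed act_inv)
  ultimately show ?thesis unfolding orb_def
    using k(1) assms(1) by (fastforce simp: image_iff subgroup.m_closed subgroup.m_inv_closed)
qed

text \<open>
  A path in the orbit space, recorded as a set-valued map.  The second clause is continuity
  for the quotient topology: the condition \<open>\<Phi> t \<inter> U \<noteq> {}\<close> says that the path is in the image of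
  \<open>U\<close> at time \<open>t\<close>, and the images of open sets are the open sets of the quotient.
\<close>

definition orbit_path :: "'g set \<Rightarrow> real set \<Rightarrow> (real \<Rightarrow> 'a set) \<Rightarrow> bool" where
  "orbit_path H J \<Phi> \<longleftrightarrow> (\<forall>t\<in>J. \<exists>p\<in>M. \<Phi> t = orb H p) \<and>
     (\<forall>U. open U \<longrightarrow> open {t \<in> J. \<Phi> t \<inter> U \<noteq> {}})"

definition lifts :: "real set \<Rightarrow> (real \<Rightarrow> 'a set) \<Rightarrow> (real \<Rightarrow> 'a) \<Rightarrow> bool" where
  "lifts S \<Phi> p \<longleftrightarrow> continuous_on S p \<and> (\<forall>t\<in>S. p t \<in> \<Phi> t)"

lemma lifts_subset: "lifts S \<Phi> p \<Longrightarrow> T \<subseteq> S \<Longrightarrow> lifts T \<Phi> p"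
  unfolding lifts_def by (meson continuous_on_subset subsetD)

lemma lifts_act:
  assumes "subgroup H G" "\<forall>t\<in>S. \<exists>p\<in>M. \<Phi> t = orb H p" "lifts S \<Phi> p" "h \<in> H"
  shows "lifts S \<Phi> (\<lambda>t. act h (p t))"
proof -
  have H: "H \<subseteq> carrier G" by (simp add: assms(1) subgroup.subset)
  have M: "p t \<in> M" "\<Phi> t = orb H (p t)" if t: "t \<in> S" for t
  proof -
    obtain x where x: "x \<in> M" "\<Phi> t = orb H x" using assms(2) t by blast
    have "p t \<in> \<Phi> t" using assms(3) t by (simp add: lifts_def)
    then have p: "p t \<in> orb H x" using x by simp
    show "p t \<in> M" using p orb_subset[OF assms(1) x(1)] by blast
    show "\<Phi> t = orb H (p t)" using x orb_eq[OF assms(1) x(1) p] by simp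
  qed
  have "continuous_on S p" "p ` S \<subseteq> M" using assms(3) M(1) by (auto simp: lifts_def)
  then have "continuous_on S (\<lambda>t. act h (p t))"
    using continuous_on_compose2[OF continuous_on_act] assms(4) H by blast
  moreover have "act h (p t) \<in> \<Phi> t" if "t \<in> S" for t
    using M(2)[OF that] assms(4) by (simp add: orb_def)
  ultimately show ?thesis unfolding lifts_def by blast
qed

text \<open>
  At the common time \<open>b\<close> both lifts lie in the same orbit, so some group element moves the
  second lift to where the first one ends.
\<close>

lemma lifts_join:
  assumes H: "subgroup H G" and \<Phi>: "\<forall>t\<in>S \<union> T. \<exists>p\<in>M. \<Phi> t = orb H p"
    and cl: "closed S" "closed T" "S \<inter> T = {b}"
    and p: "lifts S \<Phi> p" and q: "lifts T \<Phi> q"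
  obtains r where "lifts (S \<union> T) \<Phi> r" "\<And>t. t \<in> S \<Longrightarrow> r t = p t"
proof -
  have b: "b \<in> S" "b \<in> T" using cl by auto
  obtain x where x: "x \<in> M" "\<Phi> b = orb H x" using \<Phi> b by blast
  have pq: "p b \<in> orb H x" "q b \<in> orb H x" using p q b x unfolding lifts_def by auto
  then have M: "p b \<in> \<Phi> b" "\<Phi> b = orb H (q b)"
    using orb_eq[OF H x(1) pq(2)] x by simp_all
  then obtain h where h: "h \<in> H" "p b = act h (q b)" unfolding orb_def by auto
  define r where "r = (\<lambda>t. if t \<in> S then p t else act h (q t))"
  have q': "lifts T \<Phi> (\<lambda>t. act h (q t))" using lifts_act[OF H _ q h(1)] \<Phi> by auto
  have "continuous_on (S \<union> T) r" unfolding r_def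
    by (rule continuous_on_cases) (use cl p q' h in \<open>auto simp: lifts_def\<close>)
  then have "lifts (S \<union> T) \<Phi> r" using p q' unfolding lifts_def r_def by auto
  then show ?thesis by (rule that) (simp add: r_def)
qed

text \<open>
  The open interval is exhausted by compact ones.  At each stage the lift is extended by
  \<open>lifts_join\<close> on both sides without changing the values chosen before, so the stages have a
  common extension.
\<close>

lemma lift_open_interval:
  assumes H: "subgroup H G" and \<Phi>: "\<forall>t\<in>{c<..<d}. \<exists>p\<in>M. \<Phi> t = orb H p" and "c < d"
    and ex: "\<And>a b. \<lbrakk>c < a; a \<le> b; b < d\<rbrakk> \<Longrightarrow> \<exists>p. lifts {a..b} \<Phi> p"
  shows "\<exists>p. lifts {c<..<d} \<Phi> p"
proof -
  define a b where "a n = c + (d - c) / (n + 3)" and "b n = d - (d - c) / (n + 3)" for n :: nat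
  have ab: "c < a n" "a n \<le> b n" "b n < d" for n
  proof -
    define k where "k = (d - c) / (n + 3)"
    have "0 < k" using \<open>c < d\<close> by (simp add: k_def)
    moreover have "k \<le> (d - c) / 2"
      unfolding k_def by (rule divide_left_mono) (use \<open>c < d\<close> in auto)
    ultimately show "c < a n" "a n \<le> b n" "b n < d"
      unfolding a_def b_def k_def[symmetric] by simp_all
  qed
  have step: "a (Suc n) \<le> a n" "b n \<le> b (Suc n)" for n
    using \<open>c < d\<close> by (auto simp: a_def b_def intro!: divide_left_mono)
  define I where "I n = {a n..b n}" for n
  have orb: "\<forall>t\<in>S. \<exists>p\<in>M. \<Phi> t = orb H p" if "S \<subseteq> {c<..<d}" for S
    using \<Phi> that by blast
  have "\<exists>f. \<forall>n. lifts (I n) \<Phi> (f n) \<and> (\<forall>t\<in>I n. f (Suc n) t = f n t)"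
  proof (rule dependent_nat_choice)
    show "\<exists>p. lifts (I 0) \<Phi> p" unfolding I_def using ab by (intro ex)
    fix p n assume p: "lifts (I n) \<Phi> p"
    obtain q where q: "lifts {b n..b (Suc n)} \<Phi> q"
      using ex[of "b n" "b (Suc n)"] ab[of n] ab[of "Suc n"] step[of n] by force
    obtain r where r: "lifts (I n \<union> {b n..b (Suc n)}) \<Phi> r" "\<And>t. t \<in> I n \<Longrightarrow> r t = p t"
    proof (rule lifts_join[OF H _ _ _ _ p q])
      show "\<forall>t\<in>I n \<union> {b n..b (Suc n)}. \<exists>p\<in>M. \<Phi> t = orb H p"
        using ab[of n] ab[of "Suc n"] step[of n] by (intro orb) (auto simp: I_def)
      show "I n \<inter> {b n..b (Suc n)} = {b n}" using ab[of n] step[of n] by (auto simp: I_def)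
    qed (auto simp: I_def)
    have eq: "I n \<union> {b n..b (Suc n)} = {a n..b (Suc n)}"
      using ab[of n] step[of n] by (auto simp: I_def)
    obtain q' where q': "lifts {a (Suc n)..a n} \<Phi> q'"
      using ex[of "a (Suc n)" "a n"] ab[of n] ab[of "Suc n"] step[of n] by force
    obtain r' where r': "lifts ({a n..b (Suc n)} \<union> {a (Suc n)..a n}) \<Phi> r'"
        "\<And>t. t \<in> {a n..b (Suc n)} \<Longrightarrow> r' t = r t"
    proof (rule lifts_join[OF H _ _ _ _ r(1)[unfolded eq] q'])
      show "\<forall>t\<in>{a n..b (Suc n)} \<union> {a (Suc n)..a n}. \<exists>p\<in>M. \<Phi> t = orb H p"
        using ab[of n] ab[of "Suc n"] step[of n] by (intro orb) auto
      show "{a n..b (Suc n)} \<inter> {a (Suc n)..a n} = {a n}" using ab[of n] step[of n] by auto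
    qed auto
    have "{a n..b (Suc n)} \<union> {a (Suc n)..a n} = I (Suc n)"
      using ab[of n] step[of n] by (auto simp: I_def)
    then show "\<exists>r. lifts (I (Suc n)) \<Phi> r \<and> (\<forall>t\<in>I n. r t = p t)"
      using r r' ab[of n] step[of n] by (intro exI[of _ r']) (auto simp: I_def)
  qed
  then obtain f where f: "\<And>n. lifts (I n) \<Phi> (f n)" "\<And>n t. t \<in> I n \<Longrightarrow> f (Suc n) t = f n t"
    by auto
  have mono: "I n \<subseteq> I (n + k) \<and> (\<forall>t\<in>I n. f (n + k) t = f n t)" for n k
  proof (induction k)
    case (Suc k)
    moreover have "I (n + k) \<subseteq> I (n + Suc k)" using step[of "n + k"] by (auto simp: I_def)
    ultimately show ?case using f(2)[of _ "n + k"] by auto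
  qed auto
  define g where "g t = f (LEAST n. t \<in> I n) t" for t
  have g: "g t = f n t" if "t \<in> I n" for t n
  proof -
    have "t \<in> I (LEAST n. t \<in> I n)" "(LEAST n. t \<in> I n) \<le> n"
      using that by (auto intro: LeastI Least_le)
    then show ?thesis using mono[of "LEAST n. t \<in> I n" "n - (LEAST n. t \<in> I n)"]
      by (simp add: g_def)
  qed
  have cover: "\<exists>n. t \<in> {a n<..<b n}" if t: "t \<in> {c<..<d}" for t
  proof -
    define e where "e = min (t - c) (d - t)"
    have "e > 0" using t by (auto simp: e_def)
    obtain n :: nat where "(d - c) / e < n" using reals_Archimedean2 by blast
    then have "(d - c) / (n + 3) < e"
      using \<open>e > 0\<close> \<open>c < d\<close> by (simp add: field_simps)
    then show ?thesis by (intro exI[of _ n]) (auto simp: a_def b_def e_def)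
  qed
  have U: "{c<..<d} = (\<Union>n. {a n<..<b n})"
  proof
    show "{c<..<d} \<subseteq> (\<Union>n. {a n<..<b n})" using cover by auto
    show "(\<Union>n. {a n<..<b n}) \<subseteq> {c<..<d}" using ab by (fastforce intro: less_trans)
  qed
  have "continuous_on (\<Union>n. {a n<..<b n}) g"
  proof (rule continuous_on_open_UN)
    fix n
    have "continuous_on {a n<..<b n} (f n)"
      using f(1)[of n] unfolding lifts_def I_def
      by (meson continuous_on_subset greaterThanLessThan_subseteq_atLeastAtMost_iff order_refl)
    then show "continuous_on {a n<..<b n} g"
      by (rule continuous_on_eq) (use g[of _ n] in \<open>simp add: I_def\<close>)
  qed auto
  then have "continuous_on {c<..<d} g" by (simp add: U)
  moreover have "g t \<in> \<Phi> t" if t: "t \<in> {c<..<d}" for t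
  proof -
    obtain n where "t \<in> I n" using cover[OF t] by (auto simp: I_def intro: less_imp_le)
    then show ?thesis using g f(1)[of n] by (auto simp: lifts_def)
  qed
  ultimately show ?thesis unfolding lifts_def by blast
qed

text \<open>
  Lifts over adjacent compact intervals can be joined, so Bolzano's bisection principle leads
  from local lifts to lifts over compact subintervals.
\<close>

lemma lift_from_local:
  assumes H: "subgroup H G" and \<Phi>: "\<forall>t\<in>{c<..<d}. \<exists>p\<in>M. \<Phi> t = orb H p" and "c < d"
    and loc: "\<And>t. t \<in> {c<..<d} \<Longrightarrow> \<exists>e>0. \<exists>p. lifts {t-e<..<t+e} \<Phi> p"
  shows "\<exists>p. lifts {c<..<d} \<Phi> p"
proof (rule lift_open_interval[OF H \<Phi> \<open>c < d\<close>])
  fix a b assume ab: "c < a" "a \<le> b" "b < d"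
  have "c < a \<longrightarrow> b < d \<longrightarrow> (\<exists>p. lifts {a..b} \<Phi> p)"
    using \<open>a \<le> b\<close>
  proof (induction rule: Bolzano)
    case (trans x y z)
    show ?case
    proof (intro impI)
      assume "c < x" "z < d"
      then obtain p q where pq: "lifts {x..y} \<Phi> p" "lifts {y..z} \<Phi> q" using trans by force
      have "{x..y} \<union> {y..z} = {x..z}" using trans by auto
      moreover have "{x..y} \<inter> {y..z} = {y}" using trans by auto
      moreover have "\<forall>t\<in>{x..y} \<union> {y..z}. \<exists>p\<in>M. \<Phi> t = orb H p"
      proof
        fix t assume "t \<in> {x..y} \<union> {y..z}"
        then have "t \<in> {c<..<d}" using \<open>c < x\<close> \<open>z < d\<close> trans(3,4) by auto
        then show "\<exists>p\<in>M. \<Phi> t = orb H p" using \<Phi> by blast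
      qed
      ultimately show "\<exists>p. lifts {x..z} \<Phi> p"
        using lifts_join[OF H _ _ _ _ pq, of y] by (metis closed_atLeastAtMost)
    qed
  next
    case (local t)
    then have "t \<in> {c<..<d}" using ab by auto
    from loc[OF this] obtain e p where "e > 0" and p: "lifts {t-e<..<t+e} \<Phi> p" by blast
    have "\<exists>p. lifts {x..y} \<Phi> p" if "x \<le> t \<and> t \<le> y \<and> y - x < e" for x y
      by (rule exI, rule lifts_subset[OF p]) (use that in auto)
    with \<open>e > 0\<close> show ?case by blast
  qed
  then show "\<exists>p. lifts {a..b} \<Phi> p" using ab by auto
qed

lemma stabilizer_subgroup:
  assumes H: "subgroup H G" and x: "x \<in> M"
  shows "subgroup {h \<in> H. act h x = x} G"
proof -
  have sub: "H \<subseteq> carrier G" using H by (rule subgroup.subset)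
  show ?thesis
  proof (rule subgroupI)
    show "{h \<in> H. act h x = x} \<noteq> {}" using H x act_one subgroup.one_closed by blast
    show "inv a \<in> {h \<in> H. act h x = x}" if "a \<in> {h \<in> H. act h x = x}" for a
      using that sub x act_inv[of a x] H by (auto simp: subgroup.m_inv_closed)
    show "a \<otimes> b \<in> {h \<in> H. act h x = x}"
      if "a \<in> {h \<in> H. act h x = x}" "b \<in> {h \<in> H. act h x = x}" for a b
      using that sub x act_mult[of a b x] H by (auto simp: subgroup.m_closed)
  qed (use sub in auto)
qed

text \<open>
  Intersecting the orbits with a small ball around a point \<open>x\<close> of the orbit at time \<open>t\<close> gives a
  path of orbits of the stabilizer of \<open>x\<close>.  The radius is at most half the distance from \<open>x\<close> to
  the other points of its orbit; the group acts by isometries, so two points in the ball that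
  lie in the same \<open>H\<close>-orbit differ by an element of the stabilizer.
\<close>

lemma local_slice:
  assumes H: "subgroup H G" and \<Phi>: "orbit_path H J \<Phi>" and J: "open J" "t \<in> J"
    and x: "x \<in> M" "\<Phi> t = orb H x"
  obtains e \<Psi> where "e > 0" "{t-e<..<t+e} \<subseteq> J"
    "orbit_path {h \<in> H. act h x = x} {t-e<..<t+e} \<Psi>" "\<And>s. \<Psi> s \<subseteq> \<Phi> s"
proof -
  let ?K = "{h \<in> H. act h x = x}"
  have K: "subgroup ?K G" by (rule stabilizer_subgroup[OF H x(1)])
  have sub: "H \<subseteq> carrier G" using H by (rule subgroup.subset)
  have finH: "finite H" using sub finite_group finite_subset by blast
  define D where "D = insert 1 ((\<lambda>h. dist x (act h x)) ` (H - ?K))"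
  have D: "finite D" "D \<noteq> {}" "\<forall>d\<in>D. d > 0" using finH by (auto simp: D_def)
  define r where "r = Min D / 2"
  have r: "r > 0" "2 * r \<le> dist x (act h x)" if "h \<in> H - ?K" for h
    using D that Min_in[of D] Min_le[of D "dist x (act h x)"] by (auto simp: r_def D_def)
  have r0: "r > 0" using D Min_in[of D] by (auto simp: r_def)
  have "open {s \<in> J. \<Phi> s \<inter> ball x r \<noteq> {}}" using \<Phi> by (auto simp: orbit_path_def)
  moreover have "t \<in> {s \<in> J. \<Phi> s \<inter> ball x r \<noteq> {}}"
    using J x orb_refl[OF H x(1)] r0 by auto
  ultimately obtain e where e: "e > 0" "ball t e \<subseteq> {s \<in> J. \<Phi> s \<inter> ball x r \<noteq> {}}"
    using openE by meson
  have be: "ball t e = {t-e<..<t+e}" by (auto simp: dist_real_def)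
  define \<Psi> where "\<Psi> s = \<Phi> s \<inter> ball x r" for s
  have "orbit_path ?K {t-e<..<t+e} \<Psi>" unfolding orbit_path_def
  proof (intro conjI ballI allI impI)
    fix s assume s: "s \<in> {t-e<..<t+e}"
    then have sJ: "s \<in> J" "\<Phi> s \<inter> ball x r \<noteq> {}" using e be by auto
    then obtain y where y: "y \<in> \<Phi> s" "y \<in> ball x r" by blast
    obtain p where p: "p \<in> M" "\<Phi> s = orb H p" using \<Phi> sJ(1) by (auto simp: orbit_path_def)
    have yM: "y \<in> M" and ys: "\<Phi> s = orb H y"
      using orb_subset[OF H p(1)] orb_eq[OF H p(1), of y] p(2) y(1) by auto
    have "act h y \<in> ball x r \<longleftrightarrow> h \<in> ?K" if h: "h \<in> H" for h
    proof
      have hG: "h \<in> carrier G" using h sub by auto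
      assume "act h y \<in> ball x r"
      then have "dist x (act h x) < 2 * r"
        using y act_dist[OF hG yM x(1)] dist_triangle[of x "act h x" "act h y"]
        by (auto simp: dist_commute)
      then show "h \<in> ?K" using r[of h] h by force
    next
      have hG: "h \<in> carrier G" using h sub by auto
      assume "h \<in> ?K"
      then show "act h y \<in> ball x r" using act_dist[OF hG x(1) yM] y by auto
    qed
    then have "\<Psi> s = orb ?K y" unfolding \<Psi>_def ys orb_def by auto
    then show "\<exists>p\<in>M. \<Psi> s = orb ?K p" using yM by blast
  next
    fix U :: "'a set" assume "open U"
    have "{s \<in> {t-e<..<t+e}. \<Psi> s \<inter> U \<noteq> {}} = {t-e<..<t+e} \<inter> {s \<in> J. \<Phi> s \<inter> (ball x r \<inter> U) \<noteq> {}}"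
      using e be by (auto simp: \<Psi>_def)
    moreover have "open {s \<in> J. \<Phi> s \<inter> (ball x r \<inter> U) \<noteq> {}}"
      using \<Phi> \<open>open U\<close> by (simp add: orbit_path_def open_Int)
    ultimately show "open {s \<in> {t-e<..<t+e}. \<Psi> s \<inter> U \<noteq> {}}" by (simp add: open_Int)
  qed
  then show ?thesis using that[of e \<Psi>] e be by (auto simp: \<Psi>_def)
qed

text \<open>
  By induction on the order of \<open>H\<close>.  Let \<open>W\<close> be the open set of times at which the orbit has at
  least two points.  Around such a time \<open>local_slice\<close> replaces \<open>H\<close> by a proper subgroup, so local
  lifts exist by induction, and therefore lifts over the components of \<open>W\<close>, which are open
  intervals.  At all other times the orbit is a single point, fixed by \<open>H\<close>, and leaves no
  choice.  At these times every selection from the orbits is continuous: some point of a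
  nearby orbit is close to the fixed point, and by isometry all points of that orbit are.
\<close>

proposition orbit_path_lift:
  assumes "subgroup H G" and "orbit_path H {a<..<b} \<Phi>" and "a < b"
  shows "\<exists>p. lifts {a<..<b} \<Phi> p"
  using assms
proof (induction "card H" arbitrary: H a b \<Phi> rule: less_induct)
  case less
  note H = \<open>subgroup H G\<close> and \<Phi> = \<open>orbit_path H {a<..<b} \<Phi>\<close>
  let ?J = "{a<..<b}"
  have sub: "H \<subseteq> carrier G" using H by (rule subgroup.subset)
  have finH: "finite H" using sub finite_group finite_subset by blast
  have orb: "\<forall>t\<in>?J. \<exists>p\<in>M. \<Phi> t = orb H p" using \<Phi> by (simp add: orbit_path_def)
  define W where "W = {t \<in> ?J. \<exists>x\<in>\<Phi> t. \<exists>y\<in>\<Phi> t. x \<noteq> y}"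
  have "open W"
  proof (subst open_subopen, intro ballI)
    fix t assume "t \<in> W"
    then obtain x y where t: "t \<in> ?J" "x \<in> \<Phi> t" "y \<in> \<Phi> t" "x \<noteq> y" by (auto simp: W_def)
    then obtain U V where UV: "open U" "open V" "x \<in> U" "y \<in> V" "U \<inter> V = {}"
      by (meson hausdorff)
    let ?A = "{t \<in> ?J. \<Phi> t \<inter> U \<noteq> {}} \<inter> {t \<in> ?J. \<Phi> t \<inter> V \<noteq> {}}"
    have "open {t \<in> ?J. \<Phi> t \<inter> U' \<noteq> {}}" if "open U'" for U'
      using \<Phi> that by (simp add: orbit_path_def)
    then have "open ?A" using UV by (simp add: open_Int)
    moreover have "t \<in> ?A" using t UV by auto
    moreover have "?A \<subseteq> W" using UV by (fastforce simp: W_def)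
    ultimately show "\<exists>T. open T \<and> t \<in> T \<and> T \<subseteq> W" by blast
  qed
  have comp: "\<exists>p. lifts (connected_component_set W t) \<Phi> p" if tW: "t \<in> W" for t
  proof -
    let ?C = "connected_component_set W t"
    have C: "open ?C" "connected ?C" "t \<in> ?C" "?C \<subseteq> W" "?C \<subseteq> ?J"
      using \<open>open W\<close> tW connected_component_subset[of W t]
      by (auto simp: open_connected_component W_def)
    obtain c d where cd: "?C = {c<..<d}"
    proof -
      have "?C \<noteq> {}" using C(3) by blast
      have "bdd_below ?C" using bdd_below_mono[OF _ C(5)] by simp
      have "bdd_above ?C" using bdd_above_mono[OF _ C(5)] by simp
      have "is_interval ?C" using C(2) is_interval_connected_1 by blast
      have "?C = {Inf ?C<..<Sup ?C}"
      proof
        show "?C \<subseteq> {Inf ?C<..<Sup ?C}"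
        proof
          fix s assume s: "s \<in> ?C"
          obtain e where e: "e > 0" "ball s e \<subseteq> ?C" using C(1) s openE by blast
          have "s - e/2 \<in> ?C" "s + e/2 \<in> ?C" using e by (auto simp: dist_real_def subset_iff)
          then show "s \<in> {Inf ?C<..<Sup ?C}"
            using cInf_lower[of "s - e/2" ?C] cSup_upper[of "s + e/2" ?C] e(1)
              \<open>bdd_below ?C\<close> \<open>bdd_above ?C\<close> by auto
        qed
        show "{Inf ?C<..<Sup ?C} \<subseteq> ?C"
        proof
          fix s assume s: "s \<in> {Inf ?C<..<Sup ?C}"
          then obtain u v where "u \<in> ?C" "u < s" "v \<in> ?C" "s < v"
            using cInf_lessD[OF \<open>?C \<noteq> {}\<close>] less_cSupD[OF \<open>?C \<noteq> {}\<close>]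
            by (metis greaterThanLessThan_iff)
          then show "s \<in> ?C" using \<open>is_interval ?C\<close> unfolding is_interval_1
            by (meson less_imp_le)
        qed
      qed
      then show ?thesis by (rule that)
    qed
    have "t \<in> {c<..<d}" using C(3) unfolding cd .
    then have "c < d" by simp
    have "\<exists>p. lifts {c<..<d} \<Phi> p"
    proof (rule lift_from_local[OF H _ \<open>c < d\<close>])
      show "\<forall>t\<in>{c<..<d}. \<exists>p\<in>M. \<Phi> t = orb H p" using orb C(5) cd by blast
      fix s assume "s \<in> {c<..<d}"
      then have sW: "s \<in> W" using C(4) cd by auto
      then have sJ: "s \<in> ?J" by (simp add: W_def)
      then obtain x where x: "x \<in> M" "\<Phi> s = orb H x" using orb by blast
      let ?K = "{h \<in> H. act h x = x}"
      have K: "subgroup ?K G" by (rule stabilizer_subgroup[OF H x(1)])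
      obtain y z where "y \<in> orb H x" "z \<in> orb H x" "y \<noteq> z" using sW x(2) by (auto simp: W_def)
      then obtain h where "h \<in> H" "act h x \<noteq> x" unfolding orb_def by (metis imageE)
      then have "?K \<noteq> H" by blast
      then have "card ?K < card H" using finH by (simp add: psubset_card_mono psubset_eq)
      moreover obtain e \<Psi> where e: "e > 0" "{s-e<..<s+e} \<subseteq> ?J"
        "orbit_path ?K {s-e<..<s+e} \<Psi>" "\<And>s. \<Psi> s \<subseteq> \<Phi> s"
        using local_slice[OF H \<Phi> _ sJ x] by auto
      ultimately obtain p where "lifts {s-e<..<s+e} \<Psi> p" using less.hyps[OF _ K e(3)] by auto
      then have "lifts {s-e<..<s+e} \<Phi> p" using e(4) unfolding lifts_def by blast
      then show "\<exists>e>0. \<exists>p. lifts {s-e<..<s+e} \<Phi> p" using e(1) by blast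
    qed
    then show ?thesis by (simp add: cd)
  qed
  have "\<exists>P. \<forall>C\<in>components W. lifts C \<Phi> (P C)"
    by (rule bchoice) (use comp in \<open>auto simp: components_def\<close>)
  then obtain P where P: "\<And>C. C \<in> components W \<Longrightarrow> lifts C \<Phi> (P C)" by blast
  define p where "p t = (if t \<in> W then P (connected_component_set W t) t else the_elem (\<Phi> t))" for t
  have single: "\<Phi> t = {p t}" "p t \<in> M" "\<forall>h\<in>H. act h (p t) = p t" if t: "t \<in> ?J" "t \<notin> W" for t
  proof -
    obtain x where x: "x \<in> M" "\<Phi> t = orb H x" using orb t by blast
    then have "\<Phi> t = {x}" using t orb_refl[OF H x(1)] by (auto simp: W_def)
    then show "\<Phi> t = {p t}" "p t \<in> M" "\<forall>h\<in>H. act h (p t) = p t"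
      using t x by (auto simp: p_def orb_def)
  qed
  have inPhi: "p t \<in> \<Phi> t" if "t \<in> ?J" for t
  proof (cases "t \<in> W")
    case True
    then have "t \<in> connected_component_set W t" "connected_component_set W t \<in> components W"
      by (auto simp: components_def)
    then show ?thesis using P True by (auto simp: lifts_def p_def)
  qed (use single that in auto)
  have cont: "isCont p t" if t: "t \<in> ?J" for t
  proof (cases "t \<in> W")
    case True
    let ?C = "connected_component_set W t"
    have C: "open ?C" "t \<in> ?C" "?C \<in> components W" "?C \<subseteq> W"
      using True \<open>open W\<close> connected_component_subset by (auto simp: open_connected_component components_def)
    have "continuous_on ?C p"
    proof (rule continuous_on_eq)
      show "continuous_on ?C (P ?C)" using P C by (auto simp: lifts_def)
      show "P ?C s = p s" if "s \<in> ?C" for s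
        using that C(4) connected_component_eq[OF that] by (auto simp: p_def)
    qed
    then show ?thesis using C by (simp add: continuous_on_eq_continuous_at)
  next
    case False
    note s = single[OF t False]
    show ?thesis unfolding continuous_at_eps_delta
    proof (intro allI impI)
      fix e :: real assume "e > 0"
      have "open {s \<in> ?J. \<Phi> s \<inter> ball (p t) e \<noteq> {}}" using \<Phi> by (auto simp: orbit_path_def)
      moreover have "t \<in> {s \<in> ?J. \<Phi> s \<inter> ball (p t) e \<noteq> {}}" using t s \<open>e > 0\<close> by auto
      ultimately obtain d where d: "d > 0" "ball t d \<subseteq> {s \<in> ?J. \<Phi> s \<inter> ball (p t) e \<noteq> {}}"
        using openE by meson
      have "dist (p s) (p t) < e" if sd: "dist s t < d" for s
      proof -
        have sJ: "s \<in> ?J" "\<Phi> s \<inter> ball (p t) e \<noteq> {}" using d(2) sd by (auto simp: dist_commute subset_iff)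
        then obtain y where y: "y \<in> \<Phi> s" "dist (p t) y < e" by auto
        obtain x where x: "x \<in> M" "\<Phi> s = orb H x" using orb sJ by blast
        have yM: "y \<in> M" "\<Phi> s = orb H y" using orb_subset orb_eq H x y by blast+
        then obtain h where h: "h \<in> H" "p s = act h y" using inPhi[OF sJ(1)] by (auto simp: orb_def)
        have "dist (act h (p t)) (act h y) = dist (p t) y"
          using act_dist h sub s(2) yM by blast
        then show ?thesis using h s y by (simp add: dist_commute)
      qed
      with d(1) show "\<exists>d>0. \<forall>s. dist s t < d \<longrightarrow> dist (p s) (p t) < e" by blast
    qed
  qed
  have "lifts ?J \<Phi> p"
    using cont inPhi by (simp add: lifts_def continuous_at_imp_continuous_on)
  then show ?case by blast
qed

end

section \<open>The fundamental group of an orbit space\<close>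

locale orbit_space = isometric_action G act M
  for G :: "('g, 'm) monoid_scheme" (structure)
    and act :: "'g \<Rightarrow> 'a::euclidean_space \<Rightarrow> 'a" and M :: "'a set" +
  fixes X :: "'b topology" and proj :: "'a \<Rightarrow> 'b"
  assumes compact_M: "compact M"
    and simply_connected_M: "simply_connected M"
    and quotient_proj: "quotient_map (top_of_set M) X proj"
    and fibre: "\<lbrakk>p \<in> M; q \<in> M\<rbrakk> \<Longrightarrow> proj p = proj q \<longleftrightarrow> (\<exists>g\<in>carrier G. q = act g p)"
begin

lemma proj_act: "\<lbrakk>g \<in> carrier G; p \<in> M\<rbrakk> \<Longrightarrow> proj (act g p) = proj p"
  using fibre[of p "act g p"] act_closed by auto

lemma proj_image: "proj ` M = topspace X"
  using quotient_proj by (simp add: quotient_map_def)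

lemma continuous_proj: "continuous_map (top_of_set M) X proj"
  using quotient_proj by (rule quotient_imp_continuous_map)

text \<open>
  The set of all points in the orbits that meet \<open>U\<close> is a union of translates of \<open>U\<close>.
\<close>

lemma openin_proj_image:
  assumes "open U"
  shows "openin X (proj ` (M \<inter> U))"
proof -
  have "openin (top_of_set M) {x \<in> M. proj x \<in> proj ` (M \<inter> U)}"
    unfolding openin_euclidean_subtopology_iff
  proof (intro conjI ballI)
    fix x assume "x \<in> {x \<in> M. proj x \<in> proj ` (M \<inter> U)}"
    then obtain u where x: "x \<in> M" and u: "u \<in> M" "u \<in> U" "proj u = proj x" by auto
    then obtain g where g: "g \<in> carrier G" "x = act g u" using fibre[OF u(1) x] by auto
    obtain e where e: "e > 0" "ball u e \<subseteq> U" using assms u(2) openE by blast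
    have "proj y \<in> proj ` (M \<inter> U)" if y: "y \<in> M" "dist y x < e" for y
    proof -
      let ?v = "act (inv g) y"
      have v: "?v \<in> M" using act_closed g y by simp
      have "dist ?v u = dist y x"
        using act_dist[OF g(1) v u(1)] act_inv'[OF g(1) y(1)] g(2) by simp
      then have "?v \<in> U" using y e by (auto simp: dist_commute subset_iff)
      moreover have "proj ?v = proj y" using proj_act g y by simp
      ultimately show ?thesis using v by (metis IntI imageI)
    qed
    then show "\<exists>e>0. \<forall>y\<in>M. dist y x < e \<longrightarrow> y \<in> {x \<in> M. proj x \<in> proj ` (M \<inter> U)}"
      using e(1) by blast
  qed auto
  moreover have "proj ` (M \<inter> U) \<subseteq> topspace X" using proj_image by auto
  ultimately show ?thesis using quotient_proj by (simp add: quotient_map_def)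
qed

text \<open>
  Clamping the parameter to the unit interval extends the path to an open interval, as
  \<open>orbit_path_lift\<close> requires.  The lift starts somewhere in the orbit of \<open>x\<close> and is then moved to
  \<open>x\<close> by a group element.
\<close>

lemma pathin_lift:
  assumes \<gamma>: "pathin X \<gamma>" and x: "x \<in> M" "\<gamma> 0 = proj x"
  obtains p where "path p" "path_image p \<subseteq> M" "p 0 = x" "\<And>t. t \<in> {0..1} \<Longrightarrow> proj (p t) = \<gamma> t"
proof -
  define cl where "cl t = max 0 (min 1 t)" for t :: real
  define \<Phi> where "\<Phi> t = {p \<in> M. proj p = \<gamma> (cl t)}" for t
  have cl: "cl t \<in> {0..1}" for t by (auto simp: cl_def)
  have cl_id: "cl t = t" if "t \<in> {0..1}" for t using that by (auto simp: cl_def)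
  have G: "subgroup (carrier G) G" by (rule subgroup_self)
  have contcl: "continuous_map euclideanreal X (\<gamma> \<circ> cl)"
  proof (rule continuous_map_compose)
    show "continuous_map euclideanreal (top_of_set {0..1}) cl"
      unfolding continuous_map_in_subtopology cl_def by (auto intro!: continuous_intros)
    show "continuous_map (top_of_set {0..1}) X \<gamma>" using \<gamma> by (simp add: pathin_def)
  qed
  have orb: "\<exists>p\<in>M. \<Phi> t = orb (carrier G) p" for t
  proof -
    have "\<gamma> (cl t) \<in> topspace X" using continuous_map_funspace[OF contcl] by auto
    then obtain p where p: "p \<in> M" "\<gamma> (cl t) = proj p" using proj_image by auto
    have "\<Phi> t = orb (carrier G) p"
      using p fibre[OF p(1)] act_closed proj_act by (auto simp: \<Phi>_def orb_def eq_commute)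
    then show ?thesis using p by blast
  qed
  have "orbit_path (carrier G) {-1<..<2} \<Phi>" unfolding orbit_path_def
  proof (intro conjI ballI allI impI)
    show "\<exists>p\<in>M. \<Phi> t = orb (carrier G) p" for t by (rule orb)
    fix U :: "'a set" assume "open U"
    then have "openin euclideanreal {t \<in> topspace euclideanreal. (\<gamma> \<circ> cl) t \<in> proj ` (M \<inter> U)}"
      by (intro openin_continuous_map_preimage[OF contcl] openin_proj_image)
    then have "open ({-1<..<2} \<inter> {t. (\<gamma> \<circ> cl) t \<in> proj ` (M \<inter> U)})" by (simp add: open_Int)
    moreover have "{t \<in> {-1<..<2}. \<Phi> t \<inter> U \<noteq> {}} = {-1<..<2} \<inter> {t. (\<gamma> \<circ> cl) t \<in> proj ` (M \<inter> U)}"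
      by (auto simp: \<Phi>_def image_iff eq_commute)
    ultimately show "open {t \<in> {-1<..<2}. \<Phi> t \<inter> U \<noteq> {}}" by simp
  qed
  from orbit_path_lift[OF G this] obtain p where p: "lifts {-1<..<2} \<Phi> p" by auto
  have p: "lifts {0..1} \<Phi> p" by (rule lifts_subset[OF p]) auto
  have "p 0 \<in> M" "proj (p 0) = proj x" using p x cl_id[of 0] by (auto simp: lifts_def \<Phi>_def)
  then obtain g where g: "g \<in> carrier G" "x = act g (p 0)" using fibre x by blast
  have q: "lifts {0..1} \<Phi> (\<lambda>t. act g (p t))" by (rule lifts_act[OF G _ p g(1)]) (use orb in blast)
  show ?thesis
  proof (rule that)
    show "path (\<lambda>t. act g (p t))" using q by (simp add: lifts_def path_def)
    show "path_image (\<lambda>t. act g (p t)) \<subseteq> M" using q by (auto simp: lifts_def \<Phi>_def path_image_def)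
    show "act g (p 0) = x" by (simp add: g)
    show "proj (act g (p t)) = \<gamma> t" if "t \<in> {0..1}" for t
      using q that cl_id by (auto simp: lifts_def \<Phi>_def)
  qed
qed

text \<open>
  These are exactly the group elements that become trivial in the fundamental group of the
  orbit space, by \<open>homotopic_iff_same_coset\<close> below.
\<close>

definition isotropy :: "'g set" where
  "isotropy = generate G {g \<in> carrier G. \<exists>p\<in>M. act g p = p}"

lemma normal_isotropy: "isotropy \<lhd> G"
  unfolding isotropy_def
proof (rule normal_generateI)
  fix h g assume h: "h \<in> {g \<in> carrier G. \<exists>p\<in>M. act g p = p}" and g: "g \<in> carrier G"
  then obtain p where p: "p \<in> M" "act h p = p" and hG: "h \<in> carrier G" by auto
  have "act (g \<otimes> h \<otimes> inv g) (act g p) = act g p"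
    using p g hG by (simp add: act_mult act_closed act_inv)
  then show "g \<otimes> h \<otimes> inv g \<in> {g \<in> carrier G. \<exists>p\<in>M. act g p = p}"
    using p g hG act_closed by auto
qed auto

lemma subgroup_isotropy: "subgroup isotropy G"
  using normal_isotropy by (rule normal_imp_subgroup)

lemma isotropy_subset: "isotropy \<subseteq> carrier G"
  using subgroup_isotropy by (rule subgroup.subset)

lemma fixes_point_isotropy: "\<lbrakk>g \<in> carrier G; p \<in> M; act g p = p\<rbrakk> \<Longrightarrow> g \<in> isotropy"
  unfolding isotropy_def by (rule generate.incl) auto

text \<open>
  An element outside \<open>isotropy\<close> has no fixed point, so on the compact space \<open>M\<close> it moves points by
  at least a positive distance; there are finitely many elements.
\<close>

lemma displacement:
  obtains \<delta> where "\<delta> > 0" "\<And>g p. \<lbrakk>g \<in> carrier G; g \<notin> isotropy; p \<in> M\<rbrakk> \<Longrightarrow> \<delta> \<le> dist p (act g p)"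
proof -
  have "\<exists>d>0. \<forall>p\<in>M. d \<le> dist p (act g p)" if g: "g \<in> carrier G - isotropy" for g
  proof (cases "M = {}")
    case False
    have "continuous_on M (\<lambda>p. dist p (act g p))"
      using g continuous_on_act by (intro continuous_intros) auto
    then obtain x where x: "x \<in> M" "\<forall>y\<in>M. dist x (act g x) \<le> dist y (act g y)"
      using continuous_attains_inf[OF compact_M False] by blast
    have "act g x \<noteq> x" using g x fixes_point_isotropy by auto
    then show ?thesis using x by (intro exI[of _ "dist x (act g x)"]) auto
  qed (auto intro: exI[of _ 1])
  then obtain d where d: "\<And>g. g \<in> carrier G - isotropy \<Longrightarrow> d g > 0 \<and> (\<forall>p\<in>M. d g \<le> dist p (act g p))"
    by metis
  define \<delta> where "\<delta> = Min (insert 1 (d ` (carrier G - isotropy)))"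
  have fin: "finite (insert 1 (d ` (carrier G - isotropy)))" using finite_group by simp
  show ?thesis
  proof (rule that)
    show "\<delta> > 0" unfolding \<delta>_def using fin d by (subst Min_gr_iff) auto
    show "\<delta> \<le> dist p (act g p)" if "g \<in> carrier G" "g \<notin> isotropy" "p \<in> M" for g p
    proof -
      have "\<delta> \<le> d g" unfolding \<delta>_def using fin that by (intro Min_le) auto
      then show ?thesis using d that by force
    qed
  qed
qed

lemma isotropy_coset_eqI:
  assumes g: "g \<in> carrier G" and h: "h \<in> carrier G" and k: "k \<in> isotropy"
    and m: "inv (k \<otimes> h) \<otimes> g \<in> isotropy"
  shows "isotropy #> g = isotropy #> h"
proof -
  have kG: "k \<in> carrier G" using k isotropy_subset by auto
  let ?m = "inv (k \<otimes> h) \<otimes> g"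
  have "h \<otimes> ?m \<otimes> inv h \<in> isotropy" using normal.inv_op_closed2[OF normal_isotropy h m] .
  then have "k \<otimes> (h \<otimes> ?m \<otimes> inv h) \<in> isotropy" using k subgroup_isotropy by (simp add: subgroup.m_closed)
  moreover have "k \<otimes> (h \<otimes> ?m \<otimes> inv h) = g \<otimes> inv h"
  proof -
    have "k \<otimes> (h \<otimes> ?m \<otimes> inv h) = (k \<otimes> h) \<otimes> (inv (k \<otimes> h) \<otimes> g) \<otimes> inv h"
      using kG g h by (simp add: m_assoc)
    also have "\<dots> = g \<otimes> inv h" using kG g h by (simp add: inv_solve_left' m_assoc[symmetric])
    finally show ?thesis .
  qed
  ultimately have "g \<otimes> inv h \<in> isotropy" by simp
  moreover have "g = (g \<otimes> inv h) \<otimes> h" using g h by (simp add: m_assoc)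
  ultimately have "g \<in> isotropy #> h" by (auto simp: r_coset_def)
  then show ?thesis using repr_independence[OF _ h subgroup_isotropy] by simp
qed

text \<open>
  At every time some \<open>k\<close> brings \<open>q\<close> close to \<open>p\<close>.  The times at which \<open>k\<close> can be taken in
  \<open>isotropy\<close> and the times at which it can be taken outside form two open sets, which are
  disjoint because elements outside move all points by at least \<open>\<delta>\<close>.  The interval is connected
  and \<open>k = \<one>\<close> works at the start, so some \<open>k\<close> in \<open>isotropy\<close> works at the end.
\<close>

lemma near_paths_same_coset:
  assumes \<delta>: "\<And>g p. \<lbrakk>g \<in> carrier G; g \<notin> isotropy; p \<in> M\<rbrakk> \<Longrightarrow> \<delta> \<le> dist p (act g p)"
    and \<epsilon>: "\<epsilon> > 0" "2 * \<epsilon> \<le> \<delta>"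
    and p: "path p" "path_image p \<subseteq> M" and q: "path q" "path_image q \<subseteq> M"
    and near: "\<And>t. t \<in> {0..1} \<Longrightarrow> \<exists>k\<in>carrier G. dist (p t) (act k (q t)) < \<epsilon>"
    and start: "p 0 = q 0" and x: "x \<in> M"
    and g: "g \<in> carrier G" "p 1 = act g x" and h: "h \<in> carrier G" "q 1 = act h x"
  shows "isotropy #> g = isotropy #> h"
proof -
  have M: "p t \<in> M" "q t \<in> M" if "t \<in> {0..1}" for t
    using that p q by (auto simp: path_image_def)
  define T where "T k = {t \<in> {0..1}. dist (p t) (act k (q t)) < \<epsilon>}" for k
  have op: "openin (top_of_set {0..1}) (T k)" if "k \<in> carrier G" for k
  proof -
    have "continuous_on {0..1} (\<lambda>t. act k (q t))"
      by (rule continuous_on_compose2[OF continuous_on_act[OF that]]) (use q M in \<open>auto simp: path_def\<close>)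
    then have "continuous_on {0..1} (\<lambda>t. dist (p t) (act k (q t)))"
      using p by (intro continuous_intros) (auto simp: path_def)
    then have "openin (top_of_set {0..1}) ({0..1} \<inter> (\<lambda>t. dist (p t) (act k (q t))) -` {..<\<epsilon>})"
      by (rule continuous_openin_preimage_gen) auto
    moreover have "{0..1} \<inter> (\<lambda>t. dist (p t) (act k (q t))) -` {..<\<epsilon>} = T k" by (auto simp: T_def)
    ultimately show ?thesis by simp
  qed
  let ?A = "\<Union>k\<in>isotropy. T k" and ?B = "\<Union>k\<in>carrier G - isotropy. T k"
  have "openin (top_of_set {0..1}) ?A" "openin (top_of_set {0..1}) ?B"
    using op isotropy_subset by blast+
  moreover have cover: "{0..1} \<subseteq> ?A \<union> ?B"
  proof
    fix t :: real assume t: "t \<in> {0..1}"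
    then obtain k where "k \<in> carrier G" "t \<in> T k" using near[OF t] by (auto simp: T_def)
    then show "t \<in> ?A \<union> ?B" by (cases "k \<in> isotropy") auto
  qed
  moreover have "?A \<inter> ?B = {}"
  proof (rule ccontr)
    assume "?A \<inter> ?B \<noteq> {}"
    then obtain t k l where t: "t \<in> {0..1}" and k: "k \<in> isotropy" "dist (p t) (act k (q t)) < \<epsilon>"
      and l: "l \<in> carrier G" "l \<notin> isotropy" "dist (p t) (act l (q t)) < \<epsilon>"
      by (auto simp: T_def)
    have kG: "k \<in> carrier G" using k isotropy_subset by auto
    have "dist (act k (q t)) (act l (q t)) < 2 * \<epsilon>"
      using k(2) l(3) dist_triangle3[of "act k (q t)" "act l (q t)" "p t"] by simp
    moreover have "act l (q t) = act (l \<otimes> inv k) (act k (q t))"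
      using kG l M[OF t] by (simp add: act_mult[symmetric] act_closed m_assoc)
    moreover have "l \<otimes> inv k \<notin> isotropy"
    proof
      assume "l \<otimes> inv k \<in> isotropy"
      then have "(l \<otimes> inv k) \<otimes> k \<in> isotropy" using k subgroup_isotropy by (simp add: subgroup.m_closed)
      then show False using l kG by (simp add: m_assoc)
    qed
    ultimately show False
      using \<delta>[of "l \<otimes> inv k" "act k (q t)"] \<epsilon> kG l(1) M[OF t] act_closed by simp
  qed
  moreover have "0 \<in> ?A"
  proof -
    have "0 \<in> T \<one>" using start \<epsilon> M[of 0] by (simp add: T_def act_one)
    then show ?thesis using subgroup_isotropy subgroup.one_closed by blast
  qed
  ultimately have B: "?B = {}" using connected_Icc[of 0 "1::real"] unfolding connected_openin by blast
  have "1 \<in> ?A"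
  proof -
    have "(1::real) \<in> {0..1}" by simp
    then have "1 \<in> ?A \<union> ?B" using cover by (rule rev_subsetD)
    then show ?thesis unfolding B by simp
  qed
  then obtain k where k: "k \<in> isotropy" "dist (act g x) (act k (act h x)) < \<epsilon>"
    using g h by (auto simp: T_def)
  have kG: "k \<in> carrier G" using k isotropy_subset by auto
  let ?m = "inv (k \<otimes> h) \<otimes> g"
  have mG: "?m \<in> carrier G" using kG g h by simp
  have "act (k \<otimes> h) (act ?m x) = act g x"
    using kG g(1) h(1) x by (simp add: act_mult[symmetric] m_assoc[symmetric])
  then have "dist (act ?m x) x = dist (act g x) (act k (act h x))"
    using act_dist[of "k \<otimes> h" "act ?m x" x] kG h(1) mG x act_closed by (simp add: act_mult)
  then have "dist x (act ?m x) < \<delta>" using k \<epsilon> by (simp add: dist_commute)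
  then have "?m \<in> isotropy" using \<delta>[OF mG _ x] by force
  then show ?thesis by (rule isotropy_coset_eqI[OF g(1) h(1) k(1)])
qed

text \<open>
  This is uniform continuity of a map to the orbit space, measured upstairs and up to the
  group; \<open>d\<close> is a Lebesgue number.
\<close>

lemma uniformly_near_lifts:
  fixes f :: "'c::metric_space \<Rightarrow> 'b"
  assumes K: "compact K" and f: "continuous_map (top_of_set K) X f" and "\<epsilon> > 0"
  obtains d where "d > 0"
    "\<And>s t p q. \<lbrakk>s \<in> K; t \<in> K; dist s t < d; p \<in> M; q \<in> M; proj p = f s; proj q = f t\<rbrakk>
      \<Longrightarrow> \<exists>k\<in>carrier G. dist p (act k q) < \<epsilon>"
proof -
  have "\<exists>W. open W \<and> {s \<in> K. f s \<in> proj ` (M \<inter> ball y (\<epsilon>/2))} = K \<inter> W" for y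
    using openin_continuous_map_preimage[OF f openin_proj_image[OF open_ball]]
    by (simp add: openin_open)
  then obtain W where W: "\<And>y. open (W y)"
    "\<And>y. {s \<in> K. f s \<in> proj ` (M \<inter> ball y (\<epsilon>/2))} = K \<inter> W y" by metis
  have "K \<subseteq> \<Union>(range W)"
  proof
    fix s assume s: "s \<in> K"
    then have "f s \<in> topspace X" using continuous_map_funspace[OF f] by auto
    then obtain y where "y \<in> M" "f s = proj y" using proj_image by auto
    then have "s \<in> {s \<in> K. f s \<in> proj ` (M \<inter> ball y (\<epsilon>/2))}" using s \<open>\<epsilon> > 0\<close> by auto
    then show "s \<in> \<Union>(range W)" using W(2) by blast
  qed
  moreover have "open V" if "V \<in> range W" for V using that W(1) by auto
  ultimately obtain d where d: "d > 0" "\<And>s. s \<in> K \<Longrightarrow> \<exists>V\<in>range W. ball s d \<subseteq> V"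
    using Heine_Borel_lemma[OF K] by metis
  show ?thesis
  proof (rule that[OF d(1)])
    fix s t p q assume st: "s \<in> K" "t \<in> K" "dist s t < d" and p: "p \<in> M" "proj p = f s"
      and q: "q \<in> M" "proj q = f t"
    obtain y where y: "ball s d \<subseteq> W y" using d(2)[OF st(1)] by auto
    then have "s \<in> K \<inter> W y" "t \<in> K \<inter> W y" using st d(1) by auto
    then have "f s \<in> proj ` (M \<inter> ball y (\<epsilon>/2))" "f t \<in> proj ` (M \<inter> ball y (\<epsilon>/2))"
      using W(2)[of y] by blast+
    then obtain a b where ab: "a \<in> M" "dist y a < \<epsilon>/2" "f s = proj a" "b \<in> M" "dist y b < \<epsilon>/2" "f t = proj b"
      by auto
    obtain g where g: "g \<in> carrier G" "p = act g a" using fibre[OF ab(1) p(1)] p ab by auto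
    obtain h where h: "h \<in> carrier G" "b = act h q" using fibre[OF q(1) ab(4)] q ab by auto
    have "dist p (act (g \<otimes> h) q) = dist a b"
      using act_dist[OF g(1) ab(1) ab(4)] g h q by (simp add: act_mult)
    also have "\<dots> < \<epsilon>" using ab(2,5) dist_triangle3[of a b y] by simp
    finally show "\<exists>k\<in>carrier G. dist p (act k q) < \<epsilon>" using g(1) h(1) by blast
  qed
qed

text \<open>
  The element \<open>g\<close> records the end of a lift that starts at \<open>x\<close>.  Neither the lift nor \<open>g\<close> is
  unique, but the coset of \<open>g\<close> modulo \<open>isotropy\<close> is.
\<close>

definition lifts_to :: "'a \<Rightarrow> (real \<Rightarrow> 'b) \<Rightarrow> 'g \<Rightarrow> bool" where
  "lifts_to x \<gamma> g \<longleftrightarrow> g \<in> carrier G \<and> (\<exists>p. path p \<and> path_image p \<subseteq> M \<and> p 0 = x \<and> p 1 = act g x \<and>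
     (\<forall>t\<in>{0..1}. proj (p t) = \<gamma> t))"

lemma lifts_to_exists:
  assumes "\<gamma> \<in> loops X (proj x)" "x \<in> M"
  shows "\<exists>g. lifts_to x \<gamma> g"
proof -
  obtain p where p: "path p" "path_image p \<subseteq> M" "p 0 = x" "\<And>t. t \<in> {0..1} \<Longrightarrow> proj (p t) = \<gamma> t"
    using pathin_lift assms by (auto simp: loops_def)
  have "p 1 \<in> M" using p by (auto simp: path_image_def)
  moreover have "proj x = proj (p 1)" using p(4)[of 1] assms by (simp add: loops_def)
  ultimately obtain g where "g \<in> carrier G" "p 1 = act g x" using fibre assms(2) by blast
  then show ?thesis using p unfolding lifts_to_def by blast
qed

lemma continuous_proj_path: "path p \<Longrightarrow> path_image p \<subseteq> M \<Longrightarrow> pathin X (proj \<circ> p)"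
  unfolding pathin_def path_def path_image_def
  by (rule continuous_map_compose[OF _ continuous_proj]) (simp add: image_subset_iff_funcset)

lemma lifts_to_loop:
  assumes "lifts_to x \<gamma> g" "x \<in> M"
  shows "\<gamma> \<in> loops X (proj x)"
proof -
  obtain p where p: "g \<in> carrier G" "path p" "path_image p \<subseteq> M" "p 0 = x" "p 1 = act g x"
      "\<forall>t\<in>{0..1}. proj (p t) = \<gamma> t"
    using assms unfolding lifts_to_def by blast
  have "pathin X \<gamma>" unfolding pathin_def
    by (rule continuous_map_eq[OF continuous_proj_path[OF p(2,3), unfolded pathin_def]]) (use p(6) in auto)
  moreover have "\<gamma> 0 = proj (p 0)" "\<gamma> 1 = proj (p 1)" using p(6) by simp_all
  then have "\<gamma> 0 = proj x" "\<gamma> 1 = proj x" using p(1,4,5) assms(2) proj_act by simp_all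
  ultimately show ?thesis by (simp add: loops_def)
qed

lemma lifts_to_proj:
  assumes "path p" "path_image p \<subseteq> M" "pathstart p = x" "pathfinish p = act g x" "g \<in> carrier G"
  shows "lifts_to x (proj \<circ> p) g"
  unfolding lifts_to_def using assms by (auto simp: pathstart_def pathfinish_def)

lemma lifts_to_realized:
  assumes "g \<in> carrier G" "x \<in> M"
  obtains \<gamma> where "lifts_to x \<gamma> g"
proof -
  have "act g x \<in> M" using assms act_closed by simp
  then obtain p where "path p" "path_image p \<subseteq> M" "pathstart p = x" "pathfinish p = act g x"
    using simply_connected_imp_path_connected[OF simply_connected_M] assms
    unfolding path_connected_def by blast
  then show ?thesis using that lifts_to_proj assms by blast
qed

text \<open>
  Loops at nearby stages of the homotopy have lifts that are uniformly close up to the group,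
  hence the same coset by \<open>near_paths_same_coset\<close>.  Bisection passes from nearby stages to the
  two ends.
\<close>

lemma homotopic_loops_same_coset:
  assumes x: "x \<in> M" and hom: "homotopic_loops_at X (proj x) \<gamma> \<gamma>'"
    and g: "lifts_to x \<gamma> g" and h: "lifts_to x \<gamma>' h"
  shows "isotropy #> g = isotropy #> h"
proof -
  obtain H :: "real \<times> real \<Rightarrow> 'b" where H: "continuous_map (prod_topology (top_of_set {0..1}) (top_of_set {0..1})) X H"
    "\<forall>t. H (0, t) = \<gamma> t" "\<forall>t. H (1, t) = \<gamma>' t"
    "\<forall>s\<in>{0..1}. H (s, 0) = proj x \<and> H (s, 1) = proj x"
    using hom unfolding homotopic_loops_at_def homotopic_with_def by (elim exE conjE) (rule that)
  let ?S = "{0..1::real} \<times> {0..1::real}"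
  have contH: "continuous_map (top_of_set ?S) X H" using H(1) by simp
  have loop: "(\<lambda>t. H (s, t)) \<in> loops X (proj x)" if "s \<in> {0..1}" for s
  proof -
    have "continuous_map (top_of_set {0..1}) X (H \<circ> Pair s)"
      by (rule continuous_map_o_Pair[OF H(1)]) (use that in simp)
    then show ?thesis using H(4) that by (simp add: loops_def pathin_def o_def)
  qed
  obtain \<delta> where \<delta>: "\<delta> > 0" "\<And>g p. \<lbrakk>g \<in> carrier G; g \<notin> isotropy; p \<in> M\<rbrakk> \<Longrightarrow> \<delta> \<le> dist p (act g p)"
    using displacement by blast
  obtain d where d: "d > 0"
    "\<And>s t p q. \<lbrakk>s \<in> ?S; t \<in> ?S; dist s t < d; p \<in> M; q \<in> M; proj p = H s; proj q = H t\<rbrakk>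
      \<Longrightarrow> \<exists>k\<in>carrier G. dist p (act k q) < \<delta>/2"
    using uniformly_near_lifts[OF _ contH, of "\<delta>/2"] \<delta>(1) by (auto simp: compact_Times)
  define P where "P a b \<longleftrightarrow> (0 \<le> a \<longrightarrow> b \<le> 1 \<longrightarrow> (\<forall>g h. lifts_to x (\<lambda>t. H (a, t)) g \<longrightarrow>
      lifts_to x (\<lambda>t. H (b, t)) h \<longrightarrow> isotropy #> g = isotropy #> h))" for a b
  have "P 0 1"
  proof (rule Bolzano)
    fix a b c assume trans: "P a b" "P b c" "a \<le> b" "b \<le> c"
    show "P a c" unfolding P_def
    proof (intro impI allI)
      fix g h assume ac: "0 \<le> a" "c \<le> 1" "lifts_to x (\<lambda>t. H (a, t)) g" "lifts_to x (\<lambda>t. H (c, t)) h"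
      have "b \<in> {0..1}" using ac trans(3,4) by auto
      from lifts_to_exists[OF loop[OF this] x] obtain k where k: "lifts_to x (\<lambda>t. H (b, t)) k" by blast
      have "isotropy #> g = isotropy #> k"
        using trans(1,4) ac(1,2,3) k unfolding P_def by auto
      also have "\<dots> = isotropy #> h"
        using trans(2,3) ac(1,2,4) k unfolding P_def by auto
      finally show "isotropy #> g = isotropy #> h" .
    qed
  next
    fix s
    have "P a b" if ab: "a \<le> s \<and> s \<le> b \<and> b - a < d" for a b
      unfolding P_def
    proof (intro impI allI)
      fix g h assume ac: "0 \<le> a" "b \<le> 1" and l: "lifts_to x (\<lambda>t. H (a, t)) g" "lifts_to x (\<lambda>t. H (b, t)) h"
      obtain p where p: "path p" "path_image p \<subseteq> M" "p 0 = x" "p 1 = act g x" "g \<in> carrier G"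
        "\<forall>t\<in>{0..1}. proj (p t) = H (a, t)" using l(1) unfolding lifts_to_def by blast
      obtain q where q: "path q" "path_image q \<subseteq> M" "q 0 = x" "q 1 = act h x" "h \<in> carrier G"
        "\<forall>t\<in>{0..1}. proj (q t) = H (b, t)" using l(2) unfolding lifts_to_def by blast
      show "isotropy #> g = isotropy #> h"
      proof (rule near_paths_same_coset[OF \<delta>(2) _ _ p(1,2) q(1,2) _ _ x p(5,4) q(5,4)])
        show "\<exists>k\<in>carrier G. dist (p t) (act k (q t)) < \<delta>/2" if t: "t \<in> {0..1}" for t
        proof (rule d(2))
          show "(a, t) \<in> ?S" "(b, t) \<in> ?S" using t ac ab by auto
          show "dist (a, t) (b, t) < d" using ab by (simp add: dist_Pair_Pair dist_real_def)
          show "p t \<in> M" "q t \<in> M" using t p q by (auto simp: path_image_def)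
          show "proj (p t) = H (a, t)" "proj (q t) = H (b, t)" using t p q by auto
        qed
      qed (use \<delta> p q in auto)
    qed
    then show "\<exists>d>0. \<forall>a b. a \<le> s \<and> s \<le> b \<and> b - a < d \<longrightarrow> P a b" using d(1) by blast
  qed simp
  then show ?thesis using g h H(2,3) unfolding P_def by simp
qed

lemma homotopic_loops_at_refl_on:
  assumes "\<gamma> \<in> loops X u" "\<And>t. t \<in> {0..1} \<Longrightarrow> \<gamma>' t = \<gamma> t"
  shows "homotopic_loops_at X u \<gamma> \<gamma>'"
  unfolding homotopic_loops_at_def
  by (rule homotopic_with_equal) (use assms in \<open>auto simp: loops_def pathin_def\<close>)

lemma homotopic_loops_at_trans:
  "\<lbrakk>homotopic_loops_at X u \<alpha> \<beta>; homotopic_loops_at X u \<beta> \<gamma>\<rbrakk> \<Longrightarrow> homotopic_loops_at X u \<alpha> \<gamma>"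
  unfolding homotopic_loops_at_def by (rule homotopic_with_trans)

text \<open>
  The two lifts have the same ends, so they are homotopic in the simply connected space \<open>M\<close>;
  the projection of the homotopy is a homotopy of loops.
\<close>

lemma lifts_same_end_homotopic:
  assumes x: "x \<in> M" and l: "lifts_to x \<gamma> g" "lifts_to x \<gamma>' g"
  shows "homotopic_loops_at X (proj x) \<gamma> \<gamma>'"
proof -
  obtain p where p: "path p" "path_image p \<subseteq> M" "p 0 = x" "p 1 = act g x" "g \<in> carrier G"
    "\<forall>t\<in>{0..1}. proj (p t) = \<gamma> t" using l(1) unfolding lifts_to_def by blast
  obtain q where q: "path q" "path_image q \<subseteq> M" "q 0 = x" "q 1 = act g x"
    "\<forall>t\<in>{0..1}. proj (q t) = \<gamma>' t" using l(2) unfolding lifts_to_def by blast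
  have "homotopic_paths M p q"
    using simply_connected_M p q unfolding simply_connected_eq_homotopic_paths
    by (simp add: pathstart_def pathfinish_def)
  then have "homotopic_loops_at X (proj x) (proj \<circ> p) (proj \<circ> q)"
    unfolding homotopic_loops_at_def homotopic_paths_def
    by (rule homotopic_with_compose_continuous_map_left[OF _ continuous_proj])
      (use p x proj_act in \<open>auto simp: pathstart_def pathfinish_def\<close>)
  then show ?thesis unfolding homotopic_loops_at_def
    by (rule homotopic_with_eq) (use p q in auto)
qed

text \<open>
  Travel from \<open>x\<close> to \<open>y\<close> and then to \<open>g x\<close>.  Applying \<open>k\<close> to the second half only, which is
  possible as \<open>k\<close> fixes \<open>y\<close>, gives a path from \<open>x\<close> to \<open>k g x\<close> with the same projection.  By
  \<open>lifts_same_end_homotopic\<close> the given loops are homotopic to the projections of these two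
  paths.
\<close>

lemma lifts_fixed_point_homotopic:
  assumes x: "x \<in> M" and k: "k \<in> carrier G" "y \<in> M" "act k y = y"
    and l: "lifts_to x \<gamma> g" "lifts_to x \<gamma>' (k \<otimes> g)"
  shows "homotopic_loops_at X (proj x) \<gamma> \<gamma>'"
proof -
  have g: "g \<in> carrier G" using l(1) by (simp add: lifts_to_def)
  have gx: "act g x \<in> M" using g x act_closed by simp
  note pc = simply_connected_imp_path_connected[OF simply_connected_M, unfolded path_connected_def]
  obtain \<alpha> where \<alpha>: "path \<alpha>" "path_image \<alpha> \<subseteq> M" "pathstart \<alpha> = x" "pathfinish \<alpha> = y"
    using pc x k by blast
  obtain \<beta> where \<beta>: "path \<beta>" "path_image \<beta> \<subseteq> M" "pathstart \<beta> = y" "pathfinish \<beta> = act g x"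
    using pc gx k by blast
  let ?\<beta> = "\<lambda>t. act k (\<beta> t)"
  have b: "path ?\<beta>" "path_image ?\<beta> \<subseteq> M"
    using \<beta>(1,2) k(1) act_closed
    by (auto simp: path_def path_image_def intro!: continuous_on_compose2[OF continuous_on_act])
  have b': "pathstart ?\<beta> = y" "pathfinish ?\<beta> = act (k \<otimes> g) x"
    using \<beta>(3,4) k g x by (simp_all add: pathstart_def pathfinish_def act_mult)
  have 1: "lifts_to x (proj \<circ> (\<alpha> +++ \<beta>)) g"
    by (rule lifts_to_proj) (use \<alpha> \<beta> g in \<open>auto simp: path_image_join\<close>)
  have 2: "lifts_to x (proj \<circ> (\<alpha> +++ ?\<beta>)) (k \<otimes> g)"
    by (rule lifts_to_proj) (use \<alpha> b b' g k in \<open>auto simp: path_image_join\<close>)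
  have 3: "(proj \<circ> (\<alpha> +++ ?\<beta>)) t = (proj \<circ> (\<alpha> +++ \<beta>)) t" if "t \<in> {0..1}" for t
  proof -
    have "proj (act k (\<beta> (2 * t - 1))) = proj (\<beta> (2 * t - 1))" if "\<not> t \<le> 1/2"
    proof (rule proj_act[OF k(1)])
      show "\<beta> (2 * t - 1) \<in> M" using \<beta>(2) that \<open>t \<in> {0..1}\<close> by (auto simp: path_image_def subset_iff)
    qed
    then show ?thesis by (auto simp: joinpaths_def)
  qed
  have "homotopic_loops_at X (proj x) (proj \<circ> (\<alpha> +++ \<beta>)) (proj \<circ> (\<alpha> +++ ?\<beta>))"
    by (rule homotopic_loops_at_refl_on[OF lifts_to_loop[OF 1 x] 3])
  then show ?thesis
    using lifts_same_end_homotopic[OF x l(1) 1] lifts_same_end_homotopic[OF x 2 l(2)]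
      homotopic_loops_at_trans by blast
qed

lemma isotropy_homotopic:
  assumes x: "x \<in> M" and k: "k \<in> isotropy"
    and l: "lifts_to x \<gamma> g" "lifts_to x \<gamma>' (k \<otimes> g)"
  shows "homotopic_loops_at X (proj x) \<gamma> \<gamma>'"
  using k[unfolded isotropy_def] l
proof (induction k arbitrary: g \<gamma> \<gamma>' rule: generate.induct)
  case one
  have "g \<in> carrier G" using one(1) by (simp add: lifts_to_def)
  then show ?case using one lifts_same_end_homotopic[OF x] by simp
next
  case (incl h)
  then show ?case using lifts_fixed_point_homotopic[OF x] by blast
next
  case (inv h)
  then obtain y where y: "y \<in> M" "act h y = y" and h: "h \<in> carrier G" by blast
  have "act (inv h) y = y" using act_inv[OF h y(1)] y(2) by simp
  then show ?case using lifts_fixed_point_homotopic[OF x _ y(1)] inv h by blast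
next
  case (eng k1 k2)
  have sub: "generate G {g \<in> carrier G. \<exists>p\<in>M. act g p = p} \<subseteq> carrier G"
    by (rule generate_incl) auto
  have k: "k1 \<in> carrier G" "k2 \<in> carrier G" using eng(1,2) sub by auto
  have g: "g \<in> carrier G" using eng.prems by (simp add: lifts_to_def)
  obtain \<beta> where b: "lifts_to x \<beta> (k2 \<otimes> g)" using lifts_to_realized[OF _ x] k g by (meson m_closed)
  have "homotopic_loops_at X (proj x) \<gamma> \<beta>" using eng.IH(2)[OF eng.prems(1) b] .
  moreover have "homotopic_loops_at X (proj x) \<beta> \<gamma>'"
    using eng.IH(1)[OF b] eng.prems(2) k g by (simp add: m_assoc)
  ultimately show ?case by (rule homotopic_loops_at_trans)
qed

lemma homotopic_iff_same_coset:
  assumes x: "x \<in> M" and l: "lifts_to x \<gamma> g" "lifts_to x \<gamma>' h"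
  shows "homotopic_loops_at X (proj x) \<gamma> \<gamma>' \<longleftrightarrow> isotropy #> g = isotropy #> h"
proof
  have gh: "g \<in> carrier G" "h \<in> carrier G" using l by (auto simp: lifts_to_def)
  assume "isotropy #> g = isotropy #> h"
  then have "h \<in> isotropy #> g" using rcos_self[OF gh(2) subgroup_isotropy] by simp
  then obtain k where "k \<in> isotropy" "h = k \<otimes> g" by (auto simp: r_coset_def)
  then show "homotopic_loops_at X (proj x) \<gamma> \<gamma>'" using isotropy_homotopic[OF x] l by blast
qed (use homotopic_loops_same_coset[OF x _ l] in auto)

text \<open>
  The lift of the second loop is translated by \<open>g\<close> so that it starts where the first one ends.
\<close>

lemma lifts_to_join:
  assumes x: "x \<in> M" and l: "lifts_to x \<gamma> g" "lifts_to x \<gamma>' h"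
  shows "lifts_to x (loop_join \<gamma> \<gamma>') (g \<otimes> h)"
proof -
  obtain p where p: "path p" "path_image p \<subseteq> M" "p 0 = x" "p 1 = act g x" "g \<in> carrier G"
    "\<forall>t\<in>{0..1}. proj (p t) = \<gamma> t" using l(1) unfolding lifts_to_def by blast
  obtain q where q: "path q" "path_image q \<subseteq> M" "q 0 = x" "q 1 = act h x" "h \<in> carrier G"
    "\<forall>t\<in>{0..1}. proj (q t) = \<gamma>' t" using l(2) unfolding lifts_to_def by blast
  let ?q = "\<lambda>t. act g (q t)"
  have q': "path ?q" "path_image ?q \<subseteq> M"
    using q(1,2) p(5) act_closed
    by (auto simp: path_def path_image_def intro!: continuous_on_compose2[OF continuous_on_act])
  have join: "pathfinish p = pathstart ?q" using p q by (simp add: pathstart_def pathfinish_def)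
  have qM: "q t \<in> M" if "t \<in> {0..1}" for t using q that by (auto simp: path_image_def)
  have "path (p +++ ?q)" "path_image (p +++ ?q) \<subseteq> M"
    using p q' join by (auto simp: path_image_join)
  moreover have "(p +++ ?q) 0 = x" "(p +++ ?q) 1 = act (g \<otimes> h) x"
    using p q x by (simp_all add: joinpaths_def act_mult)
  moreover have "\<forall>t\<in>{0..1}. proj ((p +++ ?q) t) = loop_join \<gamma> \<gamma>' t"
    using p(5,6) q(6) qM by (auto simp: joinpaths_def loop_join_def proj_act)
  ultimately show ?thesis using p(5) q(5) unfolding lifts_to_def by blast
qed

definition coset_loops :: "'a \<Rightarrow> 'g set \<Rightarrow> (real \<Rightarrow> 'b) set" where
  "coset_loops x C = {\<gamma>. \<exists>g\<in>C. lifts_to x \<gamma> g}"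

lemma coset_loops_eq:
  assumes x: "x \<in> M" and l: "lifts_to x \<gamma> g"
  shows "coset_loops x (isotropy #> g) = loop_class X (proj x) \<gamma>"
proof (intro subset_antisym subsetI)
  have g: "g \<in> carrier G" using l by (auto simp: lifts_to_def)
  fix q
  show "q \<in> loop_class X (proj x) \<gamma>" if q: "q \<in> coset_loops x (isotropy #> g)"
  proof -
    obtain h where h: "h \<in> isotropy #> g" "lifts_to x q h" using q by (auto simp: coset_loops_def)
    have "isotropy #> g = isotropy #> h" using repr_independence[OF h(1) g subgroup_isotropy] .
    then show ?thesis using homotopic_iff_same_coset[OF x l h(2)] by (simp add: loop_class_def)
  qed
  show "q \<in> coset_loops x (isotropy #> g)" if "q \<in> loop_class X (proj x) \<gamma>"
  proof -
    have hom: "homotopic_loops_at X (proj x) \<gamma> q" using that by (simp add: loop_class_def)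
    then have "q \<in> loops X (proj x)"
      unfolding homotopic_loops_at_def loops_def pathin_def
      using homotopic_with_imp_continuous_maps homotopic_with_imp_property by blast
    then obtain h where h: "lifts_to x q h" using lifts_to_exists x by blast
    have "isotropy #> g = isotropy #> h" using hom homotopic_iff_same_coset[OF x l h] by simp
    moreover have "h \<in> isotropy #> h" using h rcos_self subgroup_isotropy by (simp add: lifts_to_def)
    ultimately show ?thesis using h by (auto simp: coset_loops_def)
  qed
qed

text \<open>
  Armstrong's theorem.  Taking a loop to the coset of the end of its lift turns homotopy into
  equality of cosets (\<open>homotopic_iff_same_coset\<close>), every coset arises because \<open>M\<close> is path
  connected, and joining loops multiplies the ends (\<open>lifts_to_join\<close>).
\<close>

theorem fundamental_group_orbit_space:
  assumes x: "x \<in> M"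
  shows "coset_loops x \<in> iso (G Mod isotropy) (fundamental_group X (proj x))"
    and "group (fundamental_group X (proj x))"
proof -
  let ?F = "fundamental_group X (proj x)" and ?Q = "G Mod isotropy"
  have carQ: "\<exists>g\<in>carrier G. C = isotropy #> g" if "C \<in> carrier ?Q" for C
    using that by (auto simp: FactGroup_def RCOSETS_def)
  have image: "coset_loops x ` carrier ?Q = carrier ?F"
  proof
    show "coset_loops x ` carrier ?Q \<subseteq> carrier ?F"
    proof
      fix a assume "a \<in> coset_loops x ` carrier ?Q"
      then obtain g where g: "g \<in> carrier G" "a = coset_loops x (isotropy #> g)" using carQ by blast
      obtain \<gamma> where l: "lifts_to x \<gamma> g" using lifts_to_realized[OF g(1) x] by blast
      then show "a \<in> carrier ?F"
        using g coset_loops_eq[OF x l] lifts_to_loop[OF l x] by (simp add: fundamental_group_def)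
    qed
    show "carrier ?F \<subseteq> coset_loops x ` carrier ?Q"
    proof
      fix a assume "a \<in> carrier ?F"
      then obtain \<gamma> where \<gamma>: "\<gamma> \<in> loops X (proj x)" "a = loop_class X (proj x) \<gamma>"
        by (auto simp: fundamental_group_def)
      obtain g where l: "lifts_to x \<gamma> g" using lifts_to_exists \<gamma>(1) x by blast
      then have "isotropy #> g \<in> carrier ?Q" by (auto simp: FactGroup_def RCOSETS_def lifts_to_def)
      then show "a \<in> coset_loops x ` carrier ?Q" using coset_loops_eq[OF x l] \<gamma> by blast
    qed
  qed
  have inj: "inj_on (coset_loops x) (carrier ?Q)"
  proof (rule inj_onI)
    fix C D assume "C \<in> carrier ?Q" "D \<in> carrier ?Q" and eq: "coset_loops x C = coset_loops x D"
    then obtain g h where g: "g \<in> carrier G" "C = isotropy #> g" and h: "h \<in> carrier G" "D = isotropy #> h"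
      using carQ by metis
    obtain \<gamma> where l: "lifts_to x \<gamma> g" using lifts_to_realized[OF g(1) x] by blast
    obtain \<gamma>' where l': "lifts_to x \<gamma>' h" using lifts_to_realized[OF h(1) x] by blast
    have "\<gamma>' \<in> loop_class X (proj x) \<gamma>'"
      using homotopic_loops_at_refl_on[OF lifts_to_loop[OF l' x]] by (simp add: loop_class_def)
    then have "\<gamma>' \<in> loop_class X (proj x) \<gamma>"
      using eq g h coset_loops_eq[OF x l] coset_loops_eq[OF x l'] by simp
    then show "C = D" using homotopic_iff_same_coset[OF x l l'] g h by (simp add: loop_class_def)
  qed
  have "coset_loops x \<in> hom ?Q ?F"
  proof (rule homI)
    show "coset_loops x C \<in> carrier ?F" if "C \<in> carrier ?Q" for C using image that by blast
    fix C D assume "C \<in> carrier ?Q" "D \<in> carrier ?Q"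
    then obtain g h where g: "g \<in> carrier G" "C = isotropy #> g" and h: "h \<in> carrier G" "D = isotropy #> h"
      using carQ by metis
    obtain \<gamma> where l: "lifts_to x \<gamma> g" using lifts_to_realized[OF g(1) x] by blast
    obtain \<gamma>' where l': "lifts_to x \<gamma>' h" using lifts_to_realized[OF h(1) x] by blast
    have CD: "C \<otimes>\<^bsub>?Q\<^esub> D = isotropy #> (g \<otimes> h)"
      using normal.rcos_sum[OF normal_isotropy g(1) h(1)] g h by (simp add: FactGroup_def)
    have cl: "loop_class X (proj x) (loop_join p q) = coset_loops x (isotropy #> (g \<otimes> h))"
      if pq: "p \<in> coset_loops x C" "q \<in> coset_loops x D" for p q
    proof -
      obtain g' h' where g': "g' \<in> C" "lifts_to x p g'" and h': "h' \<in> D" "lifts_to x q h'"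
        using pq by (auto simp: coset_loops_def)
      have "isotropy #> g = isotropy #> g'" "isotropy #> h = isotropy #> h'"
        using repr_independence[OF _ _ subgroup_isotropy] g' h' g h by simp_all
      then have "isotropy #> (g \<otimes> h) = isotropy #> (g' \<otimes> h')"
        using normal.rcos_sum[OF normal_isotropy g(1) h(1)]
          normal.rcos_sum[OF normal_isotropy, of g' h'] g' h' by (simp add: lifts_to_def)
      then show ?thesis using coset_loops_eq[OF x lifts_to_join[OF x g'(2) h'(2)]] by simp
    qed
    have "\<gamma> \<in> coset_loops x C" "\<gamma>' \<in> coset_loops x D"
      using l l' g h rcos_self[OF _ subgroup_isotropy] by (auto simp: coset_loops_def)
    then have "(\<Union>p\<in>coset_loops x C. \<Union>q\<in>coset_loops x D. loop_class X (proj x) (loop_join p q))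
        = coset_loops x (isotropy #> (g \<otimes> h))"
      using cl by blast
    then show "coset_loops x (C \<otimes>\<^bsub>?Q\<^esub> D) = coset_loops x C \<otimes>\<^bsub>?F\<^esub> coset_loops x D"
      unfolding CD by (simp add: fundamental_group_def)
  qed
  then show iso: "coset_loops x \<in> iso ?Q ?F"
    using image inj by (simp add: iso_def bij_betw_def)
  have "lifts_to x (\<lambda>_. proj x) \<one>"
    unfolding lifts_to_def using x act_one
    by (intro conjI exI[of _ "\<lambda>_. x"]) (auto simp: path_def path_image_def)
  from coset_loops_eq[OF x this] have "coset_loops x isotropy = \<one>\<^bsub>?F\<^esub>"
    using isotropy_subset by (simp add: fundamental_group_def coset_mult_one)
  moreover have "group ?Q" by (rule normal.factorgroup_is_group[OF normal_isotropy])
  ultimately show "group ?F"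
    using group.iso_imp_img_group[OF _ iso] by (simp add: FactGroup_def)
qed

end

section \<open>Unit quaternions and rotations\<close>

notation quat_mult (infixl "\<star>" 70)

lemmas quat_simps = quat_mult_def quat_cnj_def quat_1_def prod_eq_iff case_prod_beta

lemma quat_mult_assoc: "(p \<star> q) \<star> r = p \<star> (q \<star> r)"
  by (simp add: quat_simps vec_eq_iff forall_3 cross3_def inner_vec_def sum_3 algebra_simps)

lemma quat_mult_1 [simp]: "quat_1 \<star> q = q" "q \<star> quat_1 = q"
  by (simp_all add: quat_simps)

lemma quat_mult_minus [simp]: "(- p) \<star> q = - (p \<star> q)" "p \<star> (- q) = - (p \<star> q)"
  by (simp_all add: quat_simps algebra_simps)

lemma quat_mult_add: "(p + q) \<star> r = p \<star> r + q \<star> r" "p \<star> (q + r) = p \<star> q + p \<star> r"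
  by (simp_all add: quat_simps cross_add_left cross_add_right algebra_simps)

lemma quat_mult_scaleR: "(c *\<^sub>R p) \<star> q = c *\<^sub>R (p \<star> q)" "p \<star> (c *\<^sub>R q) = c *\<^sub>R (p \<star> q)"
  by (simp_all add: quat_simps cross_mult_left cross_mult_right algebra_simps)

lemma quat_mult_diff: "(p - q) \<star> r = p \<star> r - q \<star> r" "p \<star> (q - r) = p \<star> q - p \<star> r"
  using quat_mult_add(1)[of p "- q" r] quat_mult_add(2)[of p q "- r"] by simp_all

lemma quat_cnj_mult: "quat_cnj (p \<star> q) = quat_cnj q \<star> quat_cnj p"
  by (simp add: quat_simps vec_eq_iff forall_3 cross3_def inner_vec_def sum_3 algebra_simps)

lemma quat_cnj_cnj [simp]: "quat_cnj (quat_cnj q) = q"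
  by (simp add: quat_simps)

lemma quat_cnj_minus [simp]: "quat_cnj (- q) = - quat_cnj q"
  by (simp add: quat_simps)

lemma quat_norm_sq: "(norm q)\<^sup>2 = (fst q)\<^sup>2 + snd q \<bullet> snd q" for q :: quaternion
  by (cases q) (simp add: norm_Pair dot_square_norm)

lemma norm_quat_mult: "norm (p \<star> q) = norm p * norm q"
proof -
  have "(norm (p \<star> q))\<^sup>2 = (norm p * norm q)\<^sup>2"
    unfolding quat_norm_sq power_mult_distrib
    by (simp add: quat_simps cross3_def inner_vec_def sum_3 power2_eq_square algebra_simps)
  then show ?thesis by (simp add: power2_eq_iff_nonneg)
qed

lemma norm_quat_cnj [simp]: "norm (quat_cnj q) = norm q"
  by (cases q) (simp add: quat_cnj_def norm_Pair)

lemma quat_mult_cnj: "norm q = 1 \<Longrightarrow> q \<star> quat_cnj q = quat_1" "norm q = 1 \<Longrightarrow> quat_cnj q \<star> q = quat_1"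
  using quat_norm_sq[of q] by (simp_all add: quat_simps power2_eq_square)

lemma carrier_Sp1 [simp]: "q \<in> carrier Sp1 \<longleftrightarrow> norm q = 1"
  by (simp add: Sp1_def)

lemma mult_Sp1 [simp]: "x \<otimes>\<^bsub>Sp1\<^esub> y = x \<star> y" and one_Sp1 [simp]: "\<one>\<^bsub>Sp1\<^esub> = quat_1"
  by (simp_all add: Sp1_def)

lemma norm_quat_1 [simp]: "norm quat_1 = 1"
  by (simp add: quat_1_def norm_Pair)

lemma group_Sp1: "group Sp1"
proof (rule groupI)
  show "\<exists>y\<in>carrier Sp1. y \<otimes>\<^bsub>Sp1\<^esub> x = \<one>\<^bsub>Sp1\<^esub>" if "x \<in> carrier Sp1" for x
    using that quat_mult_cnj by (intro bexI[of _ "quat_cnj x"]) auto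
qed (auto simp: norm_quat_mult quat_mult_assoc)

interpretation Sp1: group Sp1 by (rule group_Sp1)

lemma inv_Sp1 [simp]: "norm q = 1 \<Longrightarrow> inv\<^bsub>Sp1\<^esub> q = quat_cnj q"
  by (intro Sp1.inv_equality) (auto simp: quat_mult_cnj)

interpretation SO3: group SO3 by (rule group_SO3)

lemma carrier_SO3 [simp]: "A \<in> carrier SO3 \<longleftrightarrow> rotation_matrix A"
  and mult_SO3 [simp]: "A \<otimes>\<^bsub>SO3\<^esub> B = A ** B" and one_SO3 [simp]: "\<one>\<^bsub>SO3\<^esub> = mat 1"
  by (simp_all add: SO3_def)

lemma inv_SO3 [simp]: "rotation_matrix A \<Longrightarrow> inv\<^bsub>SO3\<^esub> A = transpose A"
  by (intro SO3.inv_equality) (auto simp: rotation_matrix_def orthogonal_matrix_def)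

lemma double_cover_apply:
  "double_cover q *v v = ((fst q)\<^sup>2 - snd q \<bullet> snd q) *\<^sub>R v + (2 * (snd q \<bullet> v)) *\<^sub>R snd q
     + (2 * fst q) *\<^sub>R cross3 (snd q) v"
  and double_cover_conj: "(0, double_cover q *v v) = q \<star> (0, v) \<star> quat_cnj q"
proof -
  let ?f = "\<lambda>v. snd (q \<star> (0, v) \<star> quat_cnj q)"
  have f: "?f v = ((fst q)\<^sup>2 - snd q \<bullet> snd q) *\<^sub>R v + (2 * (snd q \<bullet> v)) *\<^sub>R snd q
     + (2 * fst q) *\<^sub>R cross3 (snd q) v" for v
    by (simp add: quat_simps vec_eq_iff forall_3 cross3_def inner_vec_def sum_3 power2_eq_square algebra_simps)
  have "linear ?f" unfolding f
    by (rule linearI) (simp_all add: inner_add_right cross_add_right cross_mult_right algebra_simps)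
  then have *: "double_cover q *v v = ?f v" by (simp add: double_cover_def matrix_works)
  then show "double_cover q *v v = ((fst q)\<^sup>2 - snd q \<bullet> snd q) *\<^sub>R v + (2 * (snd q \<bullet> v)) *\<^sub>R snd q
     + (2 * fst q) *\<^sub>R cross3 (snd q) v" by (simp add: f)
  have "fst (q \<star> (0, v) \<star> quat_cnj q) = 0"
    by (simp add: quat_simps cross3_def inner_vec_def sum_3 algebra_simps)
  then show "(0, double_cover q *v v) = q \<star> (0, v) \<star> quat_cnj q" using * by (simp add: prod_eq_iff)
qed

lemma matrix_eqI: "(\<And>v. A *v v = B *v v) \<Longrightarrow> A = (B :: real^3^3)"
  by (simp add: matrix_eq)

lemma double_cover_mult: "double_cover (p \<star> q) = double_cover p ** double_cover q"
proof (rule matrix_eqI)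
  fix v
  have "(0, double_cover (p \<star> q) *v v) = p \<star> (0, double_cover q *v v) \<star> quat_cnj p"
    unfolding double_cover_conj quat_cnj_mult by (simp add: quat_mult_assoc)
  also have "\<dots> = (0, double_cover p *v (double_cover q *v v))" by (simp add: double_cover_conj)
  finally show "double_cover (p \<star> q) *v v = (double_cover p ** double_cover q) *v v"
    by (simp add: matrix_vector_mul_assoc)
qed

lemma double_cover_1 [simp]: "double_cover quat_1 = mat 1"
  by (rule matrix_eqI) (simp add: double_cover_apply quat_1_def)

lemma double_cover_minus [simp]: "double_cover (- q) = double_cover q"
  by (rule matrix_eqI) (simp add: double_cover_apply)

text \<open>
  Conjugation by a unit quaternion preserves the norm, so it is orthogonal.  It also preserves
  products, hence cross products of vectors, and this forces determinant 1.
\<close>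

lemma double_cover_rotation:
  assumes "norm q = 1"
  shows "rotation_matrix (double_cover q)"
proof -
  let ?A = "double_cover q"
  have "norm (?A *v v) = norm v" for v
  proof -
    have "norm ((0::real), ?A *v v) = norm ((0::real), v)"
      unfolding double_cover_conj by (simp add: norm_quat_mult assms)
    then show ?thesis by (simp add: norm_Pair)
  qed
  then have "orthogonal_transformation ((*v) ?A)"
    by (simp add: orthogonal_transformation)
  then have orth: "orthogonal_matrix ?A"
    by (simp add: orthogonal_transformation_matrix)
  have cross: "cross3 (?A *v x) (?A *v y) = ?A *v cross3 x y" for x y
  proof -
    have pure: "snd (q \<star> (c, w) \<star> quat_cnj q) = ?A *v w" for c w
    proof -
      have "q \<star> (c, w) \<star> quat_cnj q = q \<star> (c *\<^sub>R quat_1 + (0, w)) \<star> quat_cnj q"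
        by (simp add: quat_1_def)
      also have "\<dots> = c *\<^sub>R quat_1 + (0, ?A *v w)"
        unfolding double_cover_conj
        by (simp add: quat_mult_add quat_mult_scaleR quat_mult_cnj assms)
      finally show ?thesis by (simp add: quat_1_def)
    qed
    have "(0, ?A *v x) \<star> (0, ?A *v y) = q \<star> ((0, x) \<star> (0, y)) \<star> quat_cnj q"
    proof -
      have "(0, ?A *v x) \<star> (0, ?A *v y) = q \<star> (0, x) \<star> (quat_cnj q \<star> q) \<star> (0, y) \<star> quat_cnj q"
        unfolding double_cover_conj by (simp add: quat_mult_assoc)
      then show ?thesis by (simp add: quat_mult_cnj assms quat_mult_assoc)
    qed
    then have "snd ((0, ?A *v x) \<star> (0, ?A *v y)) = ?A *v snd ((0, x) \<star> (0, y))"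
      using pure[of "fst ((0, x) \<star> (0, y))" "snd ((0, x) \<star> (0, y))"] by simp
    then show ?thesis by (simp add: quat_mult_def)
  qed
  let ?e = "cross3 (axis 1 1) (axis 2 1)"
  have "det ?A *\<^sub>R ?e = transpose ?A *v (?A *v ?e)"
    by (simp add: cross_matrix_mult[symmetric] cross)
  also have "\<dots> = ?e"
    using orth by (simp add: matrix_vector_mul_assoc orthogonal_matrix_def)
  finally have "det ?A *\<^sub>R ?e = ?e" .
  moreover have "?e \<noteq> 0" by (simp add: cross_basis)
  ultimately have "det ?A = 1" by (metis scaleR_cancel_right scaleR_one)
  then show ?thesis using orth by (simp add: rotation_matrix_def)
qed

lemma double_cover_cnj: "norm q = 1 \<Longrightarrow> double_cover (quat_cnj q) = transpose (double_cover q)"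
proof -
  assume q: "norm q = 1"
  have "double_cover (quat_cnj q) \<otimes>\<^bsub>SO3\<^esub> double_cover q = \<one>\<^bsub>SO3\<^esub>"
    using q by (simp add: double_cover_mult[symmetric] quat_mult_cnj)
  then show ?thesis using SO3.inv_equality[of "double_cover (quat_cnj q)" "double_cover q"] q
    by (simp add: double_cover_rotation)
qed

text \<open>
  A unit quaternion that acts trivially commutes with all pure quaternions, hence is real.
\<close>

lemma double_cover_eq_1:
  assumes q: "norm q = 1" and dc: "double_cover q = mat 1"
  shows "q = quat_1 \<or> q = - quat_1"
proof -
  have "cross3 (snd q) v = 0" for v
  proof -
    have "(0, v) = q \<star> (0, v) \<star> quat_cnj q" using double_cover_conj[of q v] dc by simp
    then have "(0, v) \<star> q = q \<star> (0, v) \<star> quat_cnj q \<star> q" by (rule arg_cong)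
    also have "\<dots> = q \<star> (0, v)" using q by (simp add: quat_mult_assoc quat_mult_cnj)
    finally have "cross3 v (snd q) = cross3 (snd q) v" by (simp add: quat_simps)
    then show ?thesis using cross_skew[of v "snd q"]
      by (metis add.right_neutral add_left_cancel eq_neg_iff_add_eq_0 scaleR_2 scaleR_eq_0_iff zero_neq_numeral)
  qed
  from this[of "axis 1 1"] this[of "axis 2 1"] have "snd q = 0"
    by (simp add: vec_eq_iff forall_3 cross3_def axis_def)
  moreover from this have "(fst q)\<^sup>2 = 1" using quat_norm_sq[of q] q by simp
  ultimately show ?thesis by (auto simp: quat_1_def prod_eq_iff power2_eq_1_iff)
qed

lemma double_cover_eq_iff:
  assumes "norm p = 1" "norm q = 1"
  shows "double_cover p = double_cover q \<longleftrightarrow> p = q \<or> p = - q"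
proof
  assume eq: "double_cover p = double_cover q"
  have "double_cover (p \<star> quat_cnj q) = mat 1"
    using double_cover_rotation[OF assms(2)] assms eq
    by (simp add: double_cover_mult double_cover_cnj rotation_matrix_def orthogonal_matrix_def)
  then have "p \<star> quat_cnj q = quat_1 \<or> p \<star> quat_cnj q = - quat_1"
    using assms by (intro double_cover_eq_1) (auto simp: norm_quat_mult)
  then have "p \<star> quat_cnj q \<star> q = q \<or> p \<star> quat_cnj q \<star> q = - q" by auto
  then show "p = q \<or> p = - q" using assms by (simp add: quat_mult_assoc quat_mult_cnj)
qed auto

lemma orthogonal_to_frame:
  fixes y u v :: "real^3"
  assumes "cross3 u v \<noteq> 0" "y \<bullet> u = 0" "y \<bullet> v = 0" "y \<bullet> cross3 u v = 0"
  shows "y = 0"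
proof -
  have "cross3 y (cross3 u v) = 0" using Lagrange[of y u v] assms by simp
  then have "(norm y * norm (cross3 u v))\<^sup>2 = 0"
    using norm_cross_dot[of y "cross3 u v"] assms(4) by simp
  then show ?thesis using assms(1) by simp
qed

lemma rotation_inner: "rotation_matrix A \<Longrightarrow> (A *v x) \<bullet> (A *v y) = x \<bullet> y" for A :: "real^3^3"
  using orthogonal_transformation_matrix[of "(*v) A"]
  by (simp add: rotation_matrix_def orthogonal_transformation_def)

lemma rotation_fixing_two:
  assumes A: "rotation_matrix A" and fx: "A *v u = u" "A *v v = v" and uv: "cross3 u v \<noteq> 0"
  shows "A = mat 1"
proof (rule matrix_eqI)
  fix x
  have fixw: "A *v cross3 u v = cross3 u v" using cross_rotation_matrix[OF A, of u v] fx by simp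
  have "(A *v x - x) \<bullet> w = 0" if "A *v w = w" for w
    using rotation_inner[OF A, of x w] that by (simp add: inner_diff_left)
  then have "A *v x - x = 0" using fx fixw by (intro orthogonal_to_frame[OF uv]) auto
  then show "A *v x = mat 1 *v x" by simp
qed

text \<open>
  Since \<open>A A\<^sup>T = 1\<close> and \<open>det A = 1\<close>, the determinants of \<open>A - 1 = A (1 - A\<^sup>T)\<close> and of \<open>1 - A\<close>
  agree; in odd dimension this makes \<open>det (A - 1)\<close> zero.
\<close>

lemma rotation_axis:
  assumes A: "rotation_matrix (A :: real^3^3)"
  obtains u where "norm u = 1" "A *v u = u"
proof -
  have orth: "A ** transpose A = mat 1" "det A = 1"
    using A by (auto simp: rotation_matrix_def orthogonal_matrix_def)
  have "det (A - mat 1) = det (A - A ** transpose A)" using orth by simp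
  also have "A - A ** transpose A = A ** (mat 1 - transpose A)"
    by (simp add: matrix_matrix_mult_def vec_eq_iff forall_3 sum_3 mat_def algebra_simps)
  also have "det \<dots> = det (mat 1 - transpose A)" using orth by (simp add: det_mul)
  also have "mat 1 - transpose A = transpose (mat 1 - A)"
    by (simp add: transpose_def vec_eq_iff mat_def eq_commute)
  also have "det \<dots> = det (mat 1 - A)" by (simp add: det_transpose)
  also have "\<dots> = - det (A - mat 1)" by (simp add: det_3 algebra_simps)
  finally have "det (A - mat 1) = 0" by simp
  then have "\<not> invertible (A - mat 1)" by (simp add: invertible_det_nz)
  then obtain v where v: "v \<noteq> 0" "(A - mat 1) *v v = 0"
    unfolding invertible_left_inverse matrix_left_invertible_ker by blast
  then have "A *v v = v" by (simp add: matrix_vector_mult_diff_rdistrib)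
  then have "A *v (v /\<^sub>R norm v) = v /\<^sub>R norm v" by (simp add: matrix_vector_mult_scaleR)
  then show ?thesis using that[of "v /\<^sub>R norm v"] v(1) by simp
qed

lemma rotation_taking:
  assumes "norm u = norm (v :: real^3)"
  obtains R where "rotation_matrix R" "R *v u = v"
proof -
  obtain f where f: "orthogonal_transformation f" "det (matrix f) = 1" "f u = v"
    using rotation_exists[of u v] assms by auto
  have "rotation_matrix (matrix f)"
    using f orthogonal_transformation_matrix[of f] by (simp add: rotation_matrix_def)
  moreover have "matrix f *v u = v"
    using f by (simp add: orthogonal_transformation_linear matrix_works)
  ultimately show ?thesis by (rule that)
qed

lemma perpendicular_unit:
  assumes "norm (u :: real^3) = 1"
  obtains v where "norm v = 1" "u \<bullet> v = 0"
proof -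
  obtain R where R: "rotation_matrix R" "R *v axis 1 1 = u"
    using rotation_taking[of "axis 1 1" u] assms by auto
  have "u \<bullet> (R *v axis 2 1) = 0"
    unfolding R(2)[symmetric] rotation_inner[OF R(1)] by (simp add: inner_axis_axis)
  moreover have "norm (R *v axis 2 1) = 1"
    using rotation_inner[OF R(1), of "axis 2 1" "axis 2 1"] by (simp add: norm_eq_sqrt_inner inner_axis_axis)
  ultimately show ?thesis using that by blast
qed

text \<open>
  The unit quaternion over the rotation about \<open>u\<close> by the angle \<open>2 \<theta>\<close>.
\<close>

definition qrot :: "real^3 \<Rightarrow> real \<Rightarrow> quaternion" where
  "qrot u \<theta> = (cos \<theta>, sin \<theta> *\<^sub>R u)"

lemma norm_qrot [simp]: "norm u = 1 \<Longrightarrow> norm (qrot u \<theta>) = 1"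
  by (simp add: qrot_def norm_Pair)

lemma fst_qrot [simp]: "fst (qrot u \<theta>) = cos \<theta>" by (simp add: qrot_def)

lemma qrot_0 [simp]: "qrot u 0 = quat_1" by (simp add: qrot_def quat_1_def)

lemma qrot_add: "norm u = 1 \<Longrightarrow> qrot u (s + t) = qrot u s \<star> qrot u t"
  by (simp add: qrot_def quat_simps cos_add sin_add cross_mult_left cross_mult_right dot_square_norm algebra_simps)

lemma qrot_minus: "qrot u (- t) = quat_cnj (qrot u t)"
  by (simp add: qrot_def quat_simps)

text \<open>
  A rotation that fixes \<open>u\<close> is determined by the image of one vector \<open>v\<close> orthogonal to \<open>u\<close>; the
  required \<open>\<theta>\<close> is half the angle from \<open>v\<close> to its image.
\<close>

lemma rotation_about_axis:
  assumes A: "rotation_matrix A" and u: "norm u = 1" "A *v u = u"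
  obtains \<theta> where "A = double_cover (qrot u \<theta>)"
proof -
  obtain v where v: "norm v = 1" "u \<bullet> v = 0" using perpendicular_unit[OF u(1)] by blast
  define w where "w = cross3 u v"
  have uu: "u \<bullet> u = 1" "v \<bullet> v = 1" using u v by (simp_all add: dot_square_norm)
  have w: "w \<bullet> w = 1" "u \<bullet> w = 0" "v \<bullet> w = 0" "w \<noteq> 0"
  proof -
    have "(norm w)\<^sup>2 = 1" using norm_cross_dot[of u v] u v by (simp add: w_def)
    then show "w \<bullet> w = 1" "w \<noteq> 0" by (auto simp: dot_square_norm)
    show "u \<bullet> w = 0" "v \<bullet> w = 0" by (simp_all add: w_def dot_cross_self)
  qed
  define c s where "c = (A *v v) \<bullet> v" and "s = (A *v v) \<bullet> w"
  have Avu: "(A *v v) \<bullet> u = 0" using rotation_inner[OF A, of v u] u v by (simp add: inner_commute)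
  have Av: "A *v v = c *\<^sub>R v + s *\<^sub>R w"
  proof -
    have "A *v v - (c *\<^sub>R v + s *\<^sub>R w) = 0"
    proof (rule orthogonal_to_frame)
      show "cross3 u v \<noteq> 0" using w(4) by (simp add: w_def)
      show "(A *v v - (c *\<^sub>R v + s *\<^sub>R w)) \<bullet> u = 0"
        using Avu v w
        by (simp add: inner_diff_left inner_add_left inner_diff_right inner_add_right inner_commute)
      show "(A *v v - (c *\<^sub>R v + s *\<^sub>R w)) \<bullet> v = 0"
        using uu w unfolding inner_diff_left inner_add_left c_def by (simp add: inner_commute)
      show "(A *v v - (c *\<^sub>R v + s *\<^sub>R w)) \<bullet> cross3 u v = 0"
        unfolding w_def[symmetric] inner_diff_left inner_add_left s_def using uu w by simp
    qed
    then show ?thesis by simp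
  qed
  have "c\<^sup>2 + s\<^sup>2 = 1"
    using rotation_inner[OF A, of v v] uu w unfolding Av
    by (simp add: inner_add_left inner_add_right inner_commute power2_eq_square)
  then obtain t where t: "c = cos t" "s = sin t" using sincos_total_2pi by metis
  define \<theta> where "\<theta> = t / 2"
  have t2: "c = (cos \<theta>)\<^sup>2 - (sin \<theta>)\<^sup>2" "s = 2 * sin \<theta> * cos \<theta>"
    unfolding t \<theta>_def using cos_double[of "t/2"] sin_double[of "t/2"] by simp_all
  let ?B = "double_cover (qrot u \<theta>)"
  have B: "rotation_matrix ?B" using u by (simp add: double_cover_rotation)
  have "?B *v u = ((cos \<theta>)\<^sup>2 - (sin \<theta>)\<^sup>2) *\<^sub>R u + (2 * (sin \<theta>)\<^sup>2) *\<^sub>R u"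
    unfolding double_cover_apply using uu
    by (simp add: qrot_def cross_mult_left power2_eq_square mult.assoc)
  also have "\<dots> = ((cos \<theta>)\<^sup>2 - (sin \<theta>)\<^sup>2 + 2 * (sin \<theta>)\<^sup>2) *\<^sub>R u"
    by (rule scaleR_add_left[symmetric])
  also have "(cos \<theta>)\<^sup>2 - (sin \<theta>)\<^sup>2 + 2 * (sin \<theta>)\<^sup>2 = 1"
    using sin_cos_squared_add[of \<theta>] by simp
  finally have Bu: "?B *v u = u" by simp
  have Bv: "?B *v v = A *v v"
    unfolding double_cover_apply Av t2 w_def using uu v
    by (simp add: qrot_def cross_mult_left power2_eq_square algebra_simps)
  have tB: "transpose ?B ** ?B = mat 1" using B by (simp add: rotation_matrix_def orthogonal_matrix_def)
  have "transpose ?B ** A = mat 1"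
  proof (rule rotation_fixing_two)
    show "rotation_matrix (transpose ?B ** A)"
      using SO3.m_closed[of "transpose ?B" A] SO3.inv_closed[of ?B] A B by simp
    show "(transpose ?B ** A) *v u = u"
      using u(2) Bu tB by (metis matrix_vector_mul_assoc matrix_vector_mul_lid)
    show "(transpose ?B ** A) *v v = v"
      using Bv tB by (metis matrix_vector_mul_assoc matrix_vector_mul_lid)
    show "cross3 u v \<noteq> 0" using w(4) by (simp add: w_def)
  qed
  then have "A = ?B"
    using B by (metis matrix_mul_assoc matrix_mul_lid matrix_mul_rid orthogonal_matrix_def rotation_matrix_def)
  then show ?thesis by (rule that)
qed

lemma double_cover_surj:
  assumes "rotation_matrix A"
  obtains q where "norm q = 1" "double_cover q = A"
  using assms rotation_axis rotation_about_axis norm_qrot by metis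

text \<open>
  The equation says that \<open>b = p\<^sup>-\<^sup>1 a p\<close>.  Conjugation keeps the real part and rotates the
  imaginary part, and rotations act transitively on vectors of a given length.
\<close>

lemma conjugate_iff_same_real_part:
  assumes a: "norm a = 1" and b: "norm b = 1"
  shows "(\<exists>p. norm p = 1 \<and> a \<star> p \<star> quat_cnj b = p) \<longleftrightarrow> fst a = fst b"
proof
  have key: "a \<star> p \<star> quat_cnj b = p \<longleftrightarrow> b = quat_cnj p \<star> a \<star> p" if p: "norm p = 1" for p
  proof
    assume "a \<star> p \<star> quat_cnj b = p"
    then have "a \<star> p \<star> (quat_cnj b \<star> b) = p \<star> b" by (simp add: quat_mult_assoc[symmetric])
    then have "quat_cnj p \<star> (a \<star> p) = quat_cnj p \<star> (p \<star> b)" using b by (simp add: quat_mult_cnj)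
    then show "b = quat_cnj p \<star> a \<star> p" using p by (simp add: quat_mult_assoc[symmetric] quat_mult_cnj)
  next
    assume "b = quat_cnj p \<star> a \<star> p"
    then have "p \<star> b \<star> quat_cnj b = p \<star> quat_cnj p \<star> a \<star> p \<star> quat_cnj b" by (simp add: quat_mult_assoc)
    then show "a \<star> p \<star> quat_cnj b = p" using p b by (simp add: quat_mult_assoc quat_mult_cnj)
  qed
  have conj: "quat_cnj p \<star> a \<star> p = (fst a, double_cover (quat_cnj p) *v snd a)" if p: "norm p = 1" for p
  proof -
    have "quat_cnj p \<star> a \<star> p = quat_cnj p \<star> (fst a *\<^sub>R quat_1 + (0, snd a)) \<star> quat_cnj (quat_cnj p)"
      by (simp add: quat_1_def)
    also have "\<dots> = fst a *\<^sub>R quat_1 + (0, double_cover (quat_cnj p) *v snd a)"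
      unfolding double_cover_conj using p
      by (simp add: quat_mult_add quat_mult_scaleR quat_mult_cnj)
    finally show ?thesis by (simp add: quat_1_def)
  qed
  show "fst a = fst b" if "\<exists>p. norm p = 1 \<and> a \<star> p \<star> quat_cnj b = p"
    using that key conj by auto
  assume ab: "fst a = fst b"
  then have "snd a \<bullet> snd a = snd b \<bullet> snd b" using quat_norm_sq[of a] quat_norm_sq[of b] a b by simp
  then have "norm (snd a) = norm (snd b)" by (simp add: norm_eq_sqrt_inner)
  then obtain R where R: "rotation_matrix R" "R *v snd a = snd b" using rotation_taking by blast
  obtain q where q: "norm q = 1" "double_cover q = R" using double_cover_surj[OF R(1)] by blast
  have "quat_cnj (quat_cnj q) \<star> a \<star> quat_cnj q = b"
    using conj[of "quat_cnj q"] q R ab by (simp add: prod_eq_iff)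
  then show "\<exists>p. norm p = 1 \<and> a \<star> p \<star> quat_cnj b = p"
    using key[of "quat_cnj q"] q by (intro exI[of _ "quat_cnj q"]) simp
qed

section \<open>The fundamental group of a misorientation space\<close>

definition cover_preimage :: "(real^3^3) set \<Rightarrow> quaternion set" where
  "cover_preimage G = {q. norm q = 1 \<and> double_cover q \<in> G}"

lemma binary_group_eq: "binary_group G = Sp1\<lparr>carrier := cover_preimage G\<rparr>"
  by (simp add: binary_group_def cover_preimage_def)

lemma subgroup_cover_preimage:
  assumes G: "subgroup G SO3"
  shows "subgroup (cover_preimage G) Sp1"
proof (rule Sp1.subgroupI)
  have "mat 1 \<in> G" using subgroup.one_closed[OF G] by simp
  then have "quat_1 \<in> cover_preimage G" by (simp add: cover_preimage_def)
  then show "cover_preimage G \<noteq> {}" by blast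
  show "inv\<^bsub>Sp1\<^esub> q \<in> cover_preimage G" if q: "q \<in> cover_preimage G" for q
    using q subgroup.m_inv_closed[OF G, of "double_cover q"]
    by (auto simp: cover_preimage_def double_cover_cnj double_cover_rotation)
  show "p \<otimes>\<^bsub>Sp1\<^esub> q \<in> cover_preimage G" if "p \<in> cover_preimage G" "q \<in> cover_preimage G" for p q
    using that subgroup.m_closed[OF G, of "double_cover p" "double_cover q"]
    by (auto simp: cover_preimage_def double_cover_mult norm_quat_mult)
qed (auto simp: cover_preimage_def)

lemma finite_cover_preimage:
  assumes "finite G"
  shows "finite (cover_preimage G)"
proof -
  have "finite {q. norm q = 1 \<and> double_cover q = A}" for A
  proof (cases "\<exists>p. norm p = 1 \<and> double_cover p = A")
    case True
    then obtain p where "norm p = 1" "double_cover p = A" by blast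
    then have "q \<in> {p, - p}" if "norm q = 1" "double_cover q = A" for q
      using double_cover_eq_iff[of q p] that by simp
    then have "{q. norm q = 1 \<and> double_cover q = A} \<subseteq> {p, - p}" by blast
    then show ?thesis by (rule finite_subset) simp
  next
    case False
    then have "{q. norm q = 1 \<and> double_cover q = A} = {}" by blast
    then show ?thesis by (rule ssubst) (rule finite.emptyI)
  qed
  then have "finite (\<Union>A\<in>G. {q. norm q = 1 \<and> double_cover q = A})" using assms by simp
  moreover have "cover_preimage G = (\<Union>A\<in>G. {q. norm q = 1 \<and> double_cover q = A})"
    by (auto simp: cover_preimage_def)
  ultimately show ?thesis by simp
qed

text \<open>
  By \<open>conjugate_iff_same_real_part\<close> the generators are the pairs with a fixed point under the
  two-sided action of \<open>A \<times> B\<close> on the unit quaternions.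
\<close>

definition real_part_subgroup :: "quaternion set \<Rightarrow> quaternion set \<Rightarrow> (quaternion \<times> quaternion) set" where
  "real_part_subgroup A B = generate (Sp1 \<times>\<times> Sp1) {(a, b). a \<in> A \<and> b \<in> B \<and> fst a = fst b}"

definition pair_group :: "quaternion set \<Rightarrow> quaternion set \<Rightarrow> (quaternion \<times> quaternion) monoid" where
  "pair_group A B = (Sp1 \<times>\<times> Sp1)\<lparr>carrier := A \<times> B\<rparr>"

interpretation Sp1xSp1: group "Sp1 \<times>\<times> Sp1"
  by (intro DirProd_group group_Sp1)

lemma subgroup_pair: "subgroup A Sp1 \<Longrightarrow> subgroup B Sp1 \<Longrightarrow> subgroup (A \<times> B) (Sp1 \<times>\<times> Sp1)"
  by (intro DirProd_subgroups group_Sp1)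

lemma group_pair: "subgroup A Sp1 \<Longrightarrow> subgroup B Sp1 \<Longrightarrow> group (pair_group A B)"
  unfolding pair_group_def by (intro Sp1xSp1.subgroup_imp_group subgroup_pair)

lemma pair_group_simps [simp]:
  "carrier (pair_group A B) = A \<times> B"
  "(a, b) \<otimes>\<^bsub>pair_group A B\<^esub> (c, d) = (a \<star> c, b \<star> d)"
  "\<one>\<^bsub>pair_group A B\<^esub> = (quat_1, quat_1)"
  by (simp_all add: pair_group_def DirProd_def)

lemma real_part_subgroup_consistent:
  assumes "subgroup A Sp1" "subgroup B Sp1"
  shows "generate (pair_group A B) {(a, b). a \<in> A \<and> b \<in> B \<and> fst a = fst b} = real_part_subgroup A B"
  unfolding pair_group_def real_part_subgroup_def
  by (rule Sp1xSp1.generate_consistent) (use subgroup_pair[OF assms] in auto)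

definition two_sided :: "quaternion \<times> quaternion \<Rightarrow> quaternion \<Rightarrow> quaternion" where
  "two_sided = (\<lambda>(a, b) p. a \<star> p \<star> quat_cnj b)"

lemma continuous_double_cover: "continuous_on S double_cover"
proof -
  have "continuous_on S (\<lambda>q. double_cover q *v axis j 1)" for j
    unfolding double_cover_apply by (intro continuous_intros continuous_on_cross)
  then have "continuous_on S (\<lambda>q. (double_cover q *v axis j 1) $ i)" for i j
    by (rule continuous_on_component)
  then have "continuous_on S (\<lambda>q. double_cover q $ i $ j)" for i j
    by (simp add: matrix_vector_mult_basis column_def)
  then have "continuous_on S (\<lambda>q. \<chi> i j. double_cover q $ i $ j)"
    by (intro continuous_on_vec_lambda)
  then show ?thesis by (simp add: vec_nth_inverse)
qed

lemma quotient_map_double_cover: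
  "quotient_map (top_of_set (sphere 0 1)) (top_of_set (carrier SO3)) double_cover"
proof (rule continuous_imp_quotient_map)
  have im: "double_cover ` sphere 0 1 = carrier SO3"
  proof
    show "double_cover ` sphere 0 1 \<subseteq> carrier SO3" by (auto simp: double_cover_rotation)
    show "carrier SO3 \<subseteq> double_cover ` sphere 0 1"
    proof
      fix A assume "A \<in> carrier SO3"
      then obtain q where "norm q = 1" "double_cover q = A" using double_cover_surj[of A] by auto
      then show "A \<in> double_cover ` sphere 0 1" by force
    qed
  qed
  then show "double_cover ` topspace (top_of_set (sphere 0 1)) = topspace (top_of_set (carrier SO3))" by simp
  show "continuous_map (top_of_set (sphere 0 1)) (top_of_set (carrier SO3)) double_cover"
    using im continuous_double_cover[of "sphere 0 1"] by auto
  show "compact_space (top_of_set (sphere (0::quaternion) 1))"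
    by (simp add: compact_space_subtopology)
  show "Hausdorff_space (top_of_set (carrier SO3))"
    by (simp add: Hausdorff_space_subtopology)
qed

text \<open>
  The composite of the double cover with the projection of \<open>SO(3)\<close> identifies the misorientation
  space with the orbit space of the 3-sphere under the two-sided action; the kernel of the
  double cover lies in \<open>A\<close>, so the fibres are the orbits.
\<close>

theorem fundamental_group_misorientation_space:
  assumes G1: "subgroup G1 SO3" "finite G1" and G2: "subgroup G2 SO3" "finite G2"
    and x: "x \<in> topspace (misorientation_space G1 G2)"
  defines "A \<equiv> cover_preimage G1" and "B \<equiv> cover_preimage G2"
  shows "pair_group A B Mod real_part_subgroup A B \<cong> fundamental_group (misorientation_space G1 G2) x"
    and "group (fundamental_group (misorientation_space G1 G2) x)"
proof -
  let ?X = "misorientation_space G1 G2"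
  let ?orb = "orbit (SO3\<lparr>carrier := G1\<rparr> \<times>\<times> SO3\<lparr>carrier := G2\<rparr>) misorientation_action"
  let ?proj = "?orb \<circ> double_cover"
  have sub: "subgroup A Sp1" "subgroup B Sp1"
    using G1 G2 subgroup_cover_preimage by (simp_all add: A_def B_def)
  have AB: "\<And>a. a \<in> A \<Longrightarrow> norm a = 1" "\<And>b. b \<in> B \<Longrightarrow> norm b = 1"
    by (auto simp: A_def B_def cover_preimage_def)
  have Grot: "\<And>g. g \<in> G1 \<Longrightarrow> rotation_matrix g" "\<And>g. g \<in> G2 \<Longrightarrow> rotation_matrix g"
    using subgroup.mem_carrier[OF G1(1)] subgroup.mem_carrier[OF G2(1)] by auto
  have orbI: "?orb C = {g1 ** C ** transpose g2 | g1 g2. g1 \<in> G1 \<and> g2 \<in> G2}" for C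
    unfolding orbit_def misorientation_action_def using Grot(2) by (force simp: DirProd_def)
  interpret act: isometric_action "pair_group A B" two_sided "sphere 0 1"
  proof (intro isometric_action.intro isometric_action_axioms.intro group_pair sub)
    show "finite (carrier (pair_group A B))" using G1 G2 by (simp add: A_def B_def finite_cover_preimage)
    show "two_sided g p \<in> sphere 0 1" if "g \<in> carrier (pair_group A B)" "p \<in> sphere 0 1" for g p
      using that AB by (auto simp: two_sided_def norm_quat_mult)
    show "two_sided \<one>\<^bsub>pair_group A B\<^esub> p = p" for p
      by (simp add: two_sided_def) (simp add: quat_cnj_def quat_1_def quat_mult_def case_prod_beta)
    show "two_sided (g \<otimes>\<^bsub>pair_group A B\<^esub> h) p = two_sided g (two_sided h p)" for g h p
      by (cases g; cases h) (simp add: two_sided_def quat_cnj_mult quat_mult_assoc)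
    show "dist (two_sided g p) (two_sided g q) = dist p q" if "g \<in> carrier (pair_group A B)" for g p q
      using that AB
      by (cases g) (simp add: two_sided_def dist_norm quat_mult_diff[symmetric] norm_quat_mult)
  qed
  interpret orbit_space "pair_group A B" two_sided "sphere 0 1" ?X ?proj
  proof (intro orbit_space.intro act.isometric_action_axioms orbit_space_axioms.intro)
    show "simply_connected (sphere (0::quaternion) 1)"
      by (rule simply_connected_sphere) simp
    show "quotient_map (top_of_set (sphere 0 1)) ?X ?proj"
      unfolding misorientation_space_def
      by (rule quotient_map_compose[OF quotient_map_double_cover quotient_map_quotient_topology])
    show "?proj p = ?proj q \<longleftrightarrow> (\<exists>g\<in>carrier (pair_group A B). q = two_sided g p)"
      if "p \<in> sphere 0 1" "q \<in> sphere 0 1" for p q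
    proof
      have n: "norm p = 1" "norm q = 1" using that by auto
      assume eq: "?proj p = ?proj q"
      have one: "mat 1 \<in> G1" "mat 1 \<in> G2"
        using subgroup.one_closed[OF G1(1)] subgroup.one_closed[OF G2(1)] by simp_all
      have "double_cover q = mat 1 ** double_cover q ** transpose (mat 1)" by simp
      then have "double_cover q \<in> ?orb (double_cover q)" unfolding orbI using one by blast
      then have "double_cover q \<in> ?orb (double_cover p)" using eq by simp
      then obtain g1 g2 where g: "g1 \<in> G1" "g2 \<in> G2" "double_cover q = g1 ** double_cover p ** transpose g2"
        unfolding orbI by blast
      obtain a where a: "norm a = 1" "double_cover a = g1" using double_cover_surj Grot(1) g(1) by blast
      obtain b where b: "norm b = 1" "double_cover b = g2" using double_cover_surj Grot(2) g(2) by blast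
      have "double_cover q = double_cover (a \<star> p \<star> quat_cnj b)"
        using g a b by (simp add: double_cover_mult double_cover_cnj)
      then have "q = two_sided (a, b) p \<or> q = two_sided (- a, b) p"
        using double_cover_eq_iff n a b by (simp add: norm_quat_mult two_sided_def)
      moreover have "(a, b) \<in> carrier (pair_group A B)" "(- a, b) \<in> carrier (pair_group A B)"
        using a b g by (auto simp: A_def B_def cover_preimage_def)
      ultimately show "\<exists>g\<in>carrier (pair_group A B). q = two_sided g p" by blast
    next
      assume "\<exists>g\<in>carrier (pair_group A B). q = two_sided g p"
      then obtain a b where ab: "a \<in> A" "b \<in> B" "q = a \<star> p \<star> quat_cnj b" by (auto simp: two_sided_def)
      let ?a = "double_cover a" and ?b = "double_cover b"
      have G: "?a \<in> G1" "?b \<in> G2" using ab by (auto simp: A_def B_def cover_preimage_def)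
      have dq: "double_cover q = ?a ** double_cover p ** transpose ?b"
        using ab AB by (simp add: double_cover_mult double_cover_cnj)
      have tr: "transpose ?a ** ?a = mat 1" "transpose ?b ** ?b = mat 1"
        using Grot(1)[OF G(1)] Grot(2)[OF G(2)] by (simp_all add: rotation_matrix_def orthogonal_matrix_def)
      have dp: "double_cover p = transpose ?a ** double_cover q ** ?b"
        unfolding dq by (simp add: matrix_mul_assoc tr) (simp add: matrix_mul_assoc[symmetric] tr)
      have cl: "g ** ?a \<in> G1" "g ** transpose ?a \<in> G1" if "g \<in> G1" for g
        using that G(1) subgroup.m_closed[OF G1(1)] subgroup.m_inv_closed[OF G1(1) G(1)]
          Grot(1)[OF G(1)] by auto
      have cl': "g ** ?b \<in> G2" "g ** transpose ?b \<in> G2" if "g \<in> G2" for g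
        using that G(2) subgroup.m_closed[OF G2(1)] subgroup.m_inv_closed[OF G2(1) G(2)]
          Grot(2)[OF G(2)] by auto
      have "?orb (double_cover q) \<subseteq> ?orb (double_cover p)"
      proof
        fix C assume "C \<in> ?orb (double_cover q)"
        then obtain g1 g2 where g: "g1 \<in> G1" "g2 \<in> G2" "C = g1 ** double_cover q ** transpose g2"
          unfolding orbI by blast
        have "C = (g1 ** ?a) ** double_cover p ** transpose (g2 ** ?b)"
          unfolding g dq by (simp add: matrix_transpose_mul matrix_mul_assoc)
        then show "C \<in> ?orb (double_cover p)" unfolding orbI using cl(1)[OF g(1)] cl'(1)[OF g(2)] by blast
      qed
      moreover have "?orb (double_cover p) \<subseteq> ?orb (double_cover q)"
      proof
        fix C assume "C \<in> ?orb (double_cover p)"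
        then obtain g1 g2 where g: "g1 \<in> G1" "g2 \<in> G2" "C = g1 ** double_cover p ** transpose g2"
          unfolding orbI by blast
        have "C = (g1 ** transpose ?a) ** double_cover q ** transpose (g2 ** transpose ?b)"
          unfolding g(3) by (subst dp) (simp add: matrix_transpose_mul matrix_mul_assoc)
        then show "C \<in> ?orb (double_cover q)" unfolding orbI using cl(2)[OF g(1)] cl'(2)[OF g(2)] by blast
      qed
      ultimately show "?proj p = ?proj q" by simp
    qed
  qed simp
  have fixed: "(\<exists>p\<in>sphere 0 1. two_sided (a, b) p = p) \<longleftrightarrow> fst a = fst b" if "a \<in> A" "b \<in> B" for a b
    using conjugate_iff_same_real_part[of a b] AB that by (simp add: two_sided_def Bex_def)
  have "{g \<in> carrier (pair_group A B). \<exists>p\<in>sphere 0 1. two_sided g p = p} =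
      {(a, b). a \<in> A \<and> b \<in> B \<and> fst a = fst b}" (is "?L = ?R")
  proof (rule Set.set_eqI)
    show "g \<in> ?L \<longleftrightarrow> g \<in> ?R" for g
      using fixed[of "fst g" "snd g"]
      by (simp add: mem_Times_iff case_prod_beta) blast
  qed
  then have iso: "isotropy = real_part_subgroup A B"
    using real_part_subgroup_consistent[OF sub] by (simp add: isotropy_def)
  have "x \<in> ?proj ` sphere 0 1" unfolding proj_image by (rule x)
  then obtain p where p: "x = ?proj p" "p \<in> sphere 0 1" by (rule imageE)
  show "pair_group A B Mod real_part_subgroup A B \<cong> fundamental_group ?X x"
    using fundamental_group_orbit_space(1)[OF p(2)] unfolding iso p(1) by (rule is_isoI)
  show "group (fundamental_group ?X x)"
    using fundamental_group_orbit_space(2)[OF p(2)] unfolding p(1) .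
qed

section \<open>Quaternions in coordinates\<close>

lemma vector_3_eq_iff: "(vector [a, b, c] :: real^3) = vector [d, e, f] \<longleftrightarrow> a = d \<and> b = e \<and> c = f"
  by (simp add: vec_eq_iff forall_3)

lemma axis_vector: "axis 1 1 = (vector [1, 0, 0] :: real^3)" "axis 2 1 = (vector [0, 1, 0] :: real^3)"
  "axis 3 1 = (vector [0, 0, 1] :: real^3)"
  by (simp_all add: vec_eq_iff forall_3 axis_def)

lemma quat_mult_coords:
  "(a, vector [b, c, d]) \<star> (e, vector [f, g, h]) =
    (a * e - b * f - c * g - d * h, vector [a * f + b * e + c * h - d * g,
      a * g - b * h + c * e + d * f, a * h + b * g - c * f + d * e])"
  by (simp add: quat_mult_def vec_eq_iff forall_3 cross3_def inner_vec_def sum_3)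

lemma quat_cnj_coords: "quat_cnj (a, vector [b, c, d]) = (a, vector [- b, - c, - d])"
  by (simp add: quat_cnj_def vec_eq_iff forall_3)

lemma quat_minus_coords: "- (a, vector [b, c, d] :: real^3) = (- a, vector [- b, - c, - d])"
  by (simp add: vec_eq_iff forall_3)

lemma norm_quat_coords: "norm (a, vector [b, c, d] :: real^3) = sqrt (a\<^sup>2 + b\<^sup>2 + c\<^sup>2 + d\<^sup>2)"
  by (simp add: norm_Pair norm_vec_def L2_set_def sum_3)

lemma inner_coords: "(vector [a, b, c] :: real^3) \<bullet> vector [d, e, f] = a * d + b * e + c * f"
  by (simp add: inner_vec_def sum_3)

lemma double_cover_coords:
  "double_cover (a, vector [b, c, d]) *v vector [x, y, z] =
    vector [(a*a + b*b - c*c - d*d) * x + 2 * (b*c - a*d) * y + 2 * (b*d + a*c) * z,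
            2 * (b*c + a*d) * x + (a*a - b*b + c*c - d*d) * y + 2 * (c*d - a*b) * z,
            2 * (b*d - a*c) * x + 2 * (c*d + a*b) * y + (a*a - b*b - c*c + d*d) * z]"
  by (simp add: double_cover_apply vec_eq_iff forall_3 cross3_def inner_vec_def sum_3
      power2_eq_square algebra_simps)

lemma quat_unit_coords:
  "quat_1 = (1, vector [0, 0, 0])" "quat_i = (0, vector [1, 0, 0])" "quat_j = (0, vector [0, 1, 0])"
  "quat_k = (0, vector [0, 0, 1])"
  by (simp_all add: quat_1_def quat_i_def quat_j_def quat_k_def axis_vector)
    (simp add: vec_eq_iff forall_3)

section \<open>Binary cyclic and binary dihedral groups\<close>

definition quat_rotate :: "real^3^3 \<Rightarrow> quaternion \<Rightarrow> quaternion" where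
  "quat_rotate R q = (fst q, R *v snd q)"

lemma fst_quat_rotate [simp]: "fst (quat_rotate R q) = fst q"
  by (simp add: quat_rotate_def)

lemma quat_rotate_mult: "rotation_matrix R \<Longrightarrow> quat_rotate R (p \<star> q) = quat_rotate R p \<star> quat_rotate R q"
  by (simp add: quat_rotate_def quat_simps rotation_inner cross_rotation_matrix
      matrix_vector_right_distrib matrix_vector_mult_scaleR)

lemma norm_quat_rotate [simp]: "rotation_matrix R \<Longrightarrow> norm (quat_rotate R q) = norm q"
proof -
  assume "rotation_matrix R"
  then have "(norm (quat_rotate R q))\<^sup>2 = (norm q)\<^sup>2"
    unfolding quat_norm_sq by (simp add: quat_rotate_def rotation_inner)
  then show "norm (quat_rotate R q) = norm q" by (simp add: power2_eq_iff_nonneg)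
qed

lemma quat_rotate_transpose:
  assumes "rotation_matrix R"
  shows "quat_rotate R (quat_rotate (transpose R) q) = q" "quat_rotate (transpose R) (quat_rotate R q) = q"
  using assms by (simp_all add: quat_rotate_def matrix_vector_mul_assoc rotation_matrix_def orthogonal_matrix_def
    del: transpose_matrix_vector)

lemma rotation_transpose: "rotation_matrix R \<Longrightarrow> rotation_matrix (transpose R)" for R :: "real^3^3"
  using SO3.inv_closed[of R] by simp

text \<open>
  So conjugation by \<open>R\<close> in \<open>SO(3)\<close> lifts to the automorphism \<open>quat_rotate R\<close> of the quaternions.
\<close>

lemma double_cover_rotate:
  assumes R: "rotation_matrix R"
  shows "double_cover (quat_rotate R q) = R ** double_cover q ** transpose R"
proof (rule matrix_eqI)
  fix v
  let ?w = "transpose R *v v"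
  have v: "v = R *v ?w"
    using R by (simp add: matrix_vector_mul_assoc rotation_matrix_def orthogonal_matrix_def
      del: transpose_matrix_vector)
  have "double_cover (quat_rotate R q) *v (R *v ?w) = R *v (double_cover q *v ?w)"
    unfolding double_cover_apply
    by (simp add: quat_rotate_def rotation_inner[OF R] cross_rotation_matrix[OF R]
        matrix_vector_right_distrib matrix_vector_mult_scaleR)
  then show "double_cover (quat_rotate R q) *v v = (R ** double_cover q ** transpose R) *v v"
    using v by (simp add: matrix_vector_mul_assoc[symmetric] del: transpose_matrix_vector)
qed

text \<open>
  For a unit vector \<open>u\<close> and \<open>n > 0\<close> this is a cyclic group of order \<open>2 n\<close>, the preimage of the
  group of rotations about \<open>u\<close> of order dividing \<open>n\<close>.
\<close>

definition cyclic_quat :: "real^3 \<Rightarrow> nat \<Rightarrow> quaternion set" where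
  "cyclic_quat u n = range (\<lambda>k::int. qrot u (k * pi / n))"

text \<open>
  For orthogonal unit vectors \<open>u\<close>, \<open>v\<close> and \<open>n > 0\<close> this is the binary dihedral group of order
  \<open>4 n\<close>.
\<close>

definition dicyclic_quat :: "real^3 \<Rightarrow> real^3 \<Rightarrow> nat \<Rightarrow> quaternion set" where
  "dicyclic_quat u v n = cyclic_quat u n \<union> (\<lambda>q. q \<star> (0, v)) ` cyclic_quat u n"

lemma cyclic_quatI: "qrot u (of_int k * pi / n) \<in> cyclic_quat u n"
  by (auto simp: cyclic_quat_def)

lemma norm_cyclic_quat: "norm u = 1 \<Longrightarrow> q \<in> cyclic_quat u n \<Longrightarrow> norm q = 1"
  by (auto simp: cyclic_quat_def)

lemma subgroup_cyclic_quat: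
  assumes u: "norm u = 1"
  shows "subgroup (cyclic_quat u n) Sp1"
proof (rule Sp1.subgroupI)
  show "cyclic_quat u n \<noteq> {}" by (simp add: cyclic_quat_def)
  show "cyclic_quat u n \<subseteq> carrier Sp1" using u by (auto simp: cyclic_quat_def)
  fix p q assume "p \<in> cyclic_quat u n"
  then obtain k :: int where k: "p = qrot u (k * pi / n)" by (auto simp: cyclic_quat_def)
  have "quat_cnj p = qrot u ((- k) * pi / n)" unfolding k qrot_minus[symmetric] by simp
  then show "inv\<^bsub>Sp1\<^esub> p \<in> cyclic_quat u n" using u k by (simp add: cyclic_quatI del: of_int_minus)
  assume "q \<in> cyclic_quat u n"
  then obtain l :: int where l: "q = qrot u (l * pi / n)" by (auto simp: cyclic_quat_def)
  have "p \<star> q = qrot u (of_int (k + l) * pi / n)"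
    unfolding k l qrot_add[OF u, symmetric] by (simp add: add_divide_distrib distrib_right)
  then show "p \<otimes>\<^bsub>Sp1\<^esub> q \<in> cyclic_quat u n" by (simp add: cyclic_quatI del: of_int_add)
qed

lemma pure_qrot: "u \<bullet> v = 0 \<Longrightarrow> (0, v) \<star> qrot u t = qrot u (- t) \<star> (0, v)"
  using cross_skew[of v u] by (simp add: qrot_def quat_simps cross_mult_left cross_mult_right inner_commute)

lemma pure_square: "norm v = 1 \<Longrightarrow> (0, v) \<star> (0, v) = - quat_1"
  by (simp add: quat_simps dot_square_norm)

lemma qrot_pi: "qrot u (t + pi) = - qrot u t"
  by (simp add: qrot_def)

lemma minus_cyclic_quat: "n > 0 \<Longrightarrow> q \<in> cyclic_quat u n \<Longrightarrow> - q \<in> cyclic_quat u n"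
proof -
  assume n: "n > 0" and "q \<in> cyclic_quat u n"
  then obtain k :: int where k: "q = qrot u (k * pi / n)" by (auto simp: cyclic_quat_def)
  have "- q = qrot u (of_int (k + n) * pi / n)"
    unfolding k qrot_pi[symmetric] using n by (simp add: field_simps)
  then show "- q \<in> cyclic_quat u n" by (simp add: cyclic_quatI del: of_int_add)
qed

lemma subgroup_dicyclic_quat:
  assumes u: "norm u = 1" and v: "norm v = 1" "u \<bullet> v = 0" and n: "n > 0"
  shows "subgroup (dicyclic_quat u v n) Sp1"
proof -
  let ?C = "cyclic_quat u n" and ?v = "(0, v) :: quaternion"
  note C = subgroup_cyclic_quat[OF u, of n]
  have mC: "p \<star> q \<in> ?C" if "p \<in> ?C" "q \<in> ?C" for p q using subgroup.m_closed[OF C that] by simp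
  have cC: "quat_cnj p \<in> ?C" if "p \<in> ?C" for p
    using subgroup.m_inv_closed[OF C that] norm_cyclic_quat[OF u that] by simp
  have sw: "?v \<star> p = quat_cnj p \<star> ?v" if "p \<in> ?C" for p
    using that pure_qrot[OF v(2)] by (auto simp: cyclic_quat_def qrot_minus)
  have sq: "?v \<star> ?v = - quat_1" by (rule pure_square[OF v(1)])
  have nv: "norm ?v = 1" using v by (simp add: norm_Pair)
  show ?thesis unfolding dicyclic_quat_def
  proof (rule Sp1.subgroupI)
    show "?C \<union> (\<lambda>q. q \<star> ?v) ` ?C \<subseteq> carrier Sp1"
      using u nv norm_cyclic_quat by (auto simp: norm_quat_mult)
    show "?C \<union> (\<lambda>q. q \<star> ?v) ` ?C \<noteq> {}" using subgroup.one_closed[OF C] by auto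
    show "inv\<^bsub>Sp1\<^esub> p \<in> ?C \<union> (\<lambda>q. q \<star> ?v) ` ?C" if p: "p \<in> ?C \<union> (\<lambda>q. q \<star> ?v) ` ?C" for p
      using p
    proof
      assume "p \<in> (\<lambda>q. q \<star> ?v) ` ?C"
      then obtain q where q: "q \<in> ?C" "p = q \<star> ?v" by blast
      have "quat_cnj p = - (?v \<star> quat_cnj q)"
        unfolding q quat_cnj_mult by (simp add: quat_simps)
      also have "\<dots> = (- q) \<star> ?v" using sw[OF cC[OF q(1)]] by simp
      finally have "quat_cnj p \<in> (\<lambda>q. q \<star> ?v) ` ?C" using minus_cyclic_quat[OF n q(1)] by blast
      then show ?thesis using q nv norm_cyclic_quat[OF u q(1)] by (simp add: norm_quat_mult)
    qed (use cC norm_cyclic_quat[OF u] in auto)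
    show "p \<otimes>\<^bsub>Sp1\<^esub> q \<in> ?C \<union> (\<lambda>q. q \<star> ?v) ` ?C"
      if p: "p \<in> ?C \<union> (\<lambda>q. q \<star> ?v) ` ?C" and q: "q \<in> ?C \<union> (\<lambda>q. q \<star> ?v) ` ?C" for p q
    proof -
      have 1: "a \<star> (b \<star> ?v) = (a \<star> b) \<star> ?v" for a b by (simp add: quat_mult_assoc)
      have 2: "(a \<star> ?v) \<star> b = (a \<star> quat_cnj b) \<star> ?v" if "b \<in> ?C" for a b
        using sw[OF that] by (simp add: quat_mult_assoc)
      have 3: "(a \<star> ?v) \<star> ?v = - a" for a by (simp add: quat_mult_assoc sq)
      show ?thesis using p q
        by (auto simp: mC cC 1 2 3 minus_cyclic_quat[OF n])
    qed
  qed
qed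

lemma minus_dicyclic_quat:
  assumes n: "n > 0" and q: "q \<in> dicyclic_quat u v n"
  shows "- q \<in> dicyclic_quat u v n"
  using q unfolding dicyclic_quat_def
proof
  assume "q \<in> (\<lambda>q. q \<star> (0, v)) ` cyclic_quat u n"
  then obtain p where p: "p \<in> cyclic_quat u n" "- q = (- p) \<star> (0, v)" by auto
  then show "- q \<in> cyclic_quat u n \<union> (\<lambda>q. q \<star> (0, v)) ` cyclic_quat u n"
    using minus_cyclic_quat[OF n p(1)] by blast
qed (use minus_cyclic_quat[OF n] in blast)

lemma qrot_period: "qrot u (t + 2 * pi * of_int m) = qrot u t"
  by (simp add: qrot_def cos_add sin_add)

lemma finite_cyclic_quat:
  assumes n: "n > 0"
  shows "finite (cyclic_quat u n)"
proof -
  have "qrot u (k * pi / n) \<in> (\<lambda>k::int. qrot u (k * pi / n)) ` {0..<2 * int n}" for k :: int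
  proof
    let ?m = "k mod (2 * int n)"
    show "?m \<in> {0..<2 * int n}" using n by simp
    have "k = ?m + (2 * int n) * (k div (2 * int n))" by simp
    from arg_cong[OF this, of real_of_int]
    have "real_of_int k = real_of_int ?m + 2 * real n * real_of_int (k div (2 * int n))"
      by (simp only: of_int_add of_int_mult of_int_numeral of_int_of_nat_eq)
    then have "k * pi / n = ?m * pi / n + 2 * pi * of_int (k div (2 * int n))"
      using n by (simp add: field_simps)
    then show "qrot u (k * pi / n) = qrot u (?m * pi / n)"
      by (simp only: qrot_period)
  qed
  then have "cyclic_quat u n \<subseteq> (\<lambda>k::int. qrot u (k * pi / n)) ` {0..<2 * int n}"
    by (auto simp: cyclic_quat_def)
  then show ?thesis by (rule finite_subset) simp
qed

lemma quat_rotate_qrot: "quat_rotate R (qrot u t) = qrot (R *v u) t"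
  by (simp add: quat_rotate_def qrot_def matrix_vector_mult_scaleR)

lemma rotate_cyclic_quat: "quat_rotate R ` cyclic_quat u n = cyclic_quat (R *v u) n"
  by (simp add: cyclic_quat_def image_image quat_rotate_qrot)

lemma rotate_dicyclic_quat:
  assumes "rotation_matrix R"
  shows "quat_rotate R ` dicyclic_quat u v n = dicyclic_quat (R *v u) (R *v v) n"
proof -
  have "quat_rotate R (q \<star> (0, v)) = quat_rotate R q \<star> (0, R *v v)" for q
    unfolding quat_rotate_mult[OF assms] by (simp add: quat_rotate_def)
  then show ?thesis unfolding dicyclic_quat_def image_Un image_image
    by (simp add: rotate_cyclic_quat[symmetric] image_image)
qed

lemma double_cover_pow: "norm q = 1 \<Longrightarrow> double_cover q [^]\<^bsub>SO3\<^esub> (k::int) = double_cover (q [^]\<^bsub>Sp1\<^esub> k)"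
proof -
  assume q: "norm q = 1"
  have "double_cover \<in> hom Sp1 SO3" by (rule homI) (auto simp: double_cover_rotation double_cover_mult)
  then interpret h: group_hom Sp1 SO3 double_cover
    by (intro group_hom.intro group_hom_axioms.intro group_Sp1 group_SO3)
  show ?thesis using h.hom_int_pow[of q k] q by simp
qed

lemma qrot_pow_nat: "norm u = 1 \<Longrightarrow> qrot u t [^]\<^bsub>Sp1\<^esub> (k::nat) = qrot u (k * t)"
proof (induction k)
  case (Suc k)
  then show ?case using qrot_add[of u "k * t" t] by (simp add: distrib_right add.commute)
qed simp

lemma qrot_pow: "norm u = 1 \<Longrightarrow> qrot u t [^]\<^bsub>Sp1\<^esub> (k::int) = qrot u (k * t)"
  by (cases k rule: int_cases2)
    (simp_all add: int_pow_int Sp1.int_pow_neg qrot_pow_nat qrot_minus)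

lemma double_cover_qrot_eq_1:
  assumes u: "norm u = 1"
  shows "double_cover (qrot u t) = mat 1 \<longleftrightarrow> (\<exists>k::int. t = k * pi)"
proof
  assume "double_cover (qrot u t) = mat 1"
  then have "qrot u t = quat_1 \<or> qrot u t = - quat_1" using u by (intro double_cover_eq_1) auto
  then have "sin t *\<^sub>R u = 0" by (auto simp: qrot_def quat_1_def)
  then have "sin t = 0" using u by auto
  then show "\<exists>k::int. t = k * pi" by (simp add: sin_zero_iff_int2)
next
  assume "\<exists>k::int. t = k * pi"
  then have "sin t = 0" by (simp add: sin_zero_iff_int2)
  moreover from this have "cos t = 1 \<or> cos t = - 1" using sin_cos_squared_add[of t] by (simp add: power2_eq_1_iff)
  ultimately have "qrot u t = quat_1 \<or> qrot u t = - quat_1" by (auto simp: qrot_def quat_1_def)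
  then show "double_cover (qrot u t) = mat 1" by (metis double_cover_1 double_cover_minus)
qed

lemma axial_rotation_unit:
  assumes "axial_rotation u n A"
  shows "axial_rotation (u /\<^sub>R norm u) n A" "norm (u /\<^sub>R norm u) = 1"
  using assms by (auto simp: axial_rotation_def matrix_vector_mult_scaleR)

text \<open>
  The \<open>n\<close>-th power being trivial makes the angle a multiple \<open>m\<close> of \<open>\<pi>/n\<close>, and a common factor of
  \<open>m\<close> and \<open>n\<close> would make the order smaller than \<open>n\<close>.
\<close>

lemma axial_rotation_angle:
  assumes u: "norm u = 1" and A: "axial_rotation u n A" and n: "n > 0"
  obtains m :: int where "coprime m n" "A = double_cover (qrot u (m * pi / n))"
proof -
  have rot: "rotation_matrix A" "A *v u = u" and ord: "SO3.ord A = n"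
    using A by (auto simp: axial_rotation_def)
  obtain t where t: "A = double_cover (qrot u t)" using rotation_about_axis[OF rot(1) u rot(2)] by blast
  have pow: "A [^]\<^bsub>SO3\<^esub> k = double_cover (qrot u (real k * t))" for k :: nat
    using double_cover_pow[of "qrot u t" "int k"] u unfolding t by (simp add: qrot_pow_nat int_pow_int)
  have "A [^]\<^bsub>SO3\<^esub> n = mat 1" using SO3.pow_ord_eq_1[of A] rot ord by simp
  then obtain m :: int where m: "n * t = m * pi"
    using double_cover_qrot_eq_1[OF u] unfolding pow by blast
  then have tm: "t = m * pi / n" using n by (simp add: field_simps)
  have "coprime m n"
  proof (rule coprimeI)
    fix d assume d: "d dvd m" "d dvd int n"
    then obtain a b where a: "m = d * a" and b: "int n = d * b" by (auto simp: dvd_def)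
    define d' b' where "d' = nat \<bar>d\<bar>" and "b' = nat \<bar>b\<bar>"
    have nb: "n = d' * b'" using arg_cong[OF b, of "\<lambda>x. nat \<bar>x\<bar>"] by (simp add: d'_def b'_def abs_mult nat_mult_distrib)
    have "b \<noteq> 0" using b n by auto
    have bt: "b * t = a * pi"
    proof -
      have "real n = d * b" using b by (metis of_int_mult of_int_of_nat_eq)
      then have "d * (b * t) = d * (a * pi)" using m a by (simp add: mult.assoc)
      moreover have "d \<noteq> 0" using b n by auto
      ultimately show ?thesis by simp
    qed
    have "\<exists>k::int. real b' * t = k * pi"
    proof (cases "b \<ge> 0")
      case True
      then show ?thesis using bt by (intro exI[of _ a]) (simp add: b'_def)
    next
      case False
      then show ?thesis using bt by (intro exI[of _ "- a"]) (simp add: b'_def)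
    qed
    then have "A [^]\<^bsub>SO3\<^esub> b' = mat 1" unfolding pow double_cover_qrot_eq_1[OF u] .
    then have "n dvd b'" using SO3.pow_eq_id[of A b'] rot ord by simp
    then have "d' = 1" using nb n by (metis dvd_mult_cancel2 mult.commute nat_dvd_1_iff_1 gr0I mult_0_right)
    then show "is_unit d" by (simp add: d'_def nat_eq_iff) 
  qed
  then show ?thesis using that t tm by blast
qed

text \<open>
  The generator rotates by \<open>m\<close> steps with \<open>m\<close> prime to \<open>n\<close>, so by Bezout some power of it
  rotates by a single step.
\<close>

lemma generate_axial_rotation:
  assumes u: "norm u = 1" and A: "axial_rotation u n A" and n: "n > 0"
  shows "cover_preimage (generate SO3 {A}) = cyclic_quat u n"
proof -
  obtain m :: int where m: "coprime m n" "A = double_cover (qrot u (m * pi / n))"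
    using axial_rotation_angle[OF assms] by blast
  have gen: "generate SO3 {A} = {double_cover (qrot u (of_int k * (m * pi / n))) | k::int. True}"
    using SO3.generate_pow[of A] u unfolding m(2) by (auto simp: double_cover_pow qrot_pow double_cover_rotation)
  show ?thesis
  proof
    show "cover_preimage (generate SO3 {A}) \<subseteq> cyclic_quat u n"
    proof
      fix q assume "q \<in> cover_preimage (generate SO3 {A})"
      then obtain k :: int where q: "norm q = 1" "double_cover q = double_cover (qrot u (of_int k * (m * pi / n)))"
        unfolding gen cover_preimage_def by blast
      have C: "qrot u (of_int k * (m * pi / n)) \<in> cyclic_quat u n"
        using cyclic_quatI[of u "k * m" n] by (simp add: mult.assoc)
      have "q = qrot u (of_int k * (m * pi / n)) \<or> q = - qrot u (of_int k * (m * pi / n))"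
        using q u by (simp add: double_cover_eq_iff)
      then show "q \<in> cyclic_quat u n" using C minus_cyclic_quat[OF n C] by auto
    qed
    show "cyclic_quat u n \<subseteq> cover_preimage (generate SO3 {A})"
    proof
      fix q assume "q \<in> cyclic_quat u n"
      then obtain j :: int where j: "q = qrot u (j * pi / n)" by (auto simp: cyclic_quat_def)
      obtain x y where xy: "x * m + y * int n = 1" using bezout_int[of m "int n"] m(1) by (auto simp: coprime_iff_gcd_eq_1)
      have "real_of_int x * m + real_of_int y * n = 1"
        using arg_cong[OF xy, of real_of_int] by simp
      then have ym: "real_of_int x * m = 1 - real_of_int y * n" by simp
      have e: "of_int (j * x) * (m * pi / n) = j * pi / n + of_int (- j * y) * pi"
      proof -
        have "of_int (j * x) * (m * pi / n) = j * (real_of_int x * m) * pi / n" by simp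
        also have "\<dots> = j * pi / n + of_int (- j * y) * pi" unfolding ym using n by (simp add: field_simps)
        finally show ?thesis .
      qed
      have "double_cover (qrot u (of_int (- j * y) * pi)) = mat 1"
        using double_cover_qrot_eq_1[OF u] by blast
      then have "double_cover (qrot u (of_int (j * x) * (m * pi / n))) = double_cover q"
        unfolding e qrot_add[OF u] double_cover_mult j by (simp del: of_int_mult of_int_minus)
      then have "double_cover q \<in> generate SO3 {A}" unfolding gen by (metis (mono_tags, lifting) mem_Collect_eq)
      then show "q \<in> cover_preimage (generate SO3 {A})" using j u by (simp add: cover_preimage_def)
    qed
  qed
qed

lemma generate_dihedral:
  assumes u: "norm u = 1" and v: "norm v = 1" "u \<bullet> v = 0" and n: "n > 0"
    and A: "axial_rotation u n A" and B: "axial_rotation v 2 B"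
  shows "cover_preimage (generate SO3 {A, B}) = dicyclic_quat u v n"
proof -
  have AB: "{A, B} \<subseteq> carrier SO3" using A B by (auto simp: axial_rotation_def)
  note D = subgroup_dicyclic_quat[OF u v n]
  have CA: "cover_preimage (generate SO3 {A}) = cyclic_quat u n" by (rule generate_axial_rotation[OF u A n])
  have CB: "cover_preimage (generate SO3 {B}) = cyclic_quat v 2" by (rule generate_axial_rotation[OF v(1) B]) simp
  have G: "subgroup (generate SO3 {A, B}) SO3" by (rule SO3.generate_is_subgroup[OF AB])
  have mono: "generate SO3 {A} \<subseteq> generate SO3 {A, B}" "generate SO3 {B} \<subseteq> generate SO3 {A, B}"
    by (auto intro!: SO3.mono_generate)
  have pv: "(0, v) \<in> cyclic_quat v 2"
    using cyclic_quatI[of v 1 2] by (simp add: qrot_def)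
  have sub1: "cyclic_quat u n \<subseteq> cover_preimage (generate SO3 {A, B})"
    unfolding CA[symmetric] cover_preimage_def using mono by auto
  have sub2: "(0, v) \<in> cover_preimage (generate SO3 {A, B})"
    using pv unfolding CB[symmetric] cover_preimage_def using mono by auto
  have "subgroup (double_cover ` dicyclic_quat u v n) SO3"
  proof -
    have "double_cover \<in> hom Sp1 SO3" by (rule homI) (auto simp: double_cover_rotation double_cover_mult)
    then interpret h: group_hom Sp1 SO3 double_cover
      by (intro group_hom.intro group_hom_axioms.intro group_Sp1 group_SO3)
    show ?thesis by (rule h.subgroup_img_is_subgroup[OF D])
  qed
  moreover have "{A, B} \<subseteq> double_cover ` dicyclic_quat u v n"
  proof -
    obtain m :: int where "A = double_cover (qrot u (m * pi / n))"
      using axial_rotation_angle[OF u A n] by blast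
    then have "A \<in> double_cover ` dicyclic_quat u v n"
      using cyclic_quatI by (auto simp: dicyclic_quat_def)
    moreover have "B \<in> double_cover ` dicyclic_quat u v n"
    proof -
      have "axial_rotation v 2 B" by (rule B)
      then obtain m :: int where m: "coprime m 2" "B = double_cover (qrot v (m * pi / 2))"
        using axial_rotation_angle[OF v(1) B] by auto
      then obtain k where k: "m = 2 * k + 1" by (metis coprime_right_2_iff_odd oddE)
      have e: "m * pi / 2 = pi / 2 + of_int k * pi" by (simp add: k field_simps)
      have "B = double_cover (qrot v (pi / 2))"
        unfolding m(2) e qrot_add[OF v(1)] double_cover_mult
        using double_cover_qrot_eq_1[OF v(1), of "of_int k * pi"] by auto
      also have "qrot v (pi / 2) = quat_1 \<star> (0, v)" by (simp add: qrot_def)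
      finally have "B = double_cover (quat_1 \<star> (0, v))" .
      moreover have "quat_1 \<in> cyclic_quat u n"
        using subgroup.one_closed[OF subgroup_cyclic_quat[OF u]] by simp
      ultimately show ?thesis unfolding dicyclic_quat_def by blast
    qed
    ultimately show ?thesis by simp
  qed
  ultimately have gsub: "generate SO3 {A, B} \<subseteq> double_cover ` dicyclic_quat u v n"
    by (intro SO3.generate_subgroup_incl)
  show ?thesis
  proof
    show "cover_preimage (generate SO3 {A, B}) \<subseteq> dicyclic_quat u v n"
    proof
      fix q assume q: "q \<in> cover_preimage (generate SO3 {A, B})"
      then obtain p where p: "p \<in> dicyclic_quat u v n" "double_cover q = double_cover p"
        using gsub by (auto simp: cover_preimage_def)
      have "norm p = 1" using subgroup.mem_carrier[OF D p(1)] by simp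
      then have "q = p \<or> q = - p" using q p by (simp add: cover_preimage_def double_cover_eq_iff)
      then show "q \<in> dicyclic_quat u v n" using p(1) minus_dicyclic_quat[OF n p(1)] by auto
    qed
    show "dicyclic_quat u v n \<subseteq> cover_preimage (generate SO3 {A, B})"
      unfolding dicyclic_quat_def
      using sub1 sub2 subgroup.m_closed[OF subgroup_cover_preimage[OF G]] by auto
  qed
qed

section \<open>Regular polyhedra in standard position\<close>

lemma vector_3_ops:
  "- (vector [a, b, c] :: real^3) = vector [- a, - b, - c]"
  "(vector [a, b, c] :: real^3) + vector [d, e, f] = vector [a + d, b + e, c + f]"
  "(vector [a, b, c] :: real^3) - vector [d, e, f] = vector [a - d, b - e, c - f]"
  "s *\<^sub>R (vector [a, b, c] :: real^3) = vector [s * a, s * b, s * c]"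
  by (simp_all add: vec_eq_iff forall_3)

lemma Collect_as_image:
  "{f s t x y | s t x y. s \<in> S \<and> t \<in> T \<and> (x, y) \<in> U} = (\<lambda>(s, t, x, y). f s t x y) ` (S \<times> T \<times> U)"
  by (auto simp: image_iff) (metis (no_types, lifting) SigmaI case_prod_conv)

text \<open>
  All other points of the sphere lie strictly on one side of the tangent plane at \<open>x\<close>.
\<close>

lemma in_convex_hull_sphere:
  fixes V :: "'a::real_inner set"
  assumes V: "V \<subseteq> sphere 0 \<rho>" and x: "x \<in> convex hull V" "norm x = \<rho>"
  shows "x \<in> V"
proof (rule ccontr)
  assume "x \<notin> V"
  have "v \<bullet> x < \<rho>\<^sup>2" if "v \<in> V" for v
  proof -
    have "v \<noteq> x" using that \<open>x \<notin> V\<close> by auto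
    then have "0 < (v - x) \<bullet> (v - x)" by simp
    also have "(v - x) \<bullet> (v - x) = 2 * \<rho>\<^sup>2 - 2 * (v \<bullet> x)"
    proof -
      have "v \<bullet> v = \<rho>\<^sup>2" "x \<bullet> x = \<rho>\<^sup>2" using V x(2) that by (auto simp: dot_square_norm)
      then show ?thesis by (simp add: inner_diff_left inner_diff_right inner_commute)
    qed
    finally show ?thesis by simp
  qed
  then have "V \<subseteq> {y. x \<bullet> y < \<rho>\<^sup>2}" by (auto simp: inner_commute)
  then have "convex hull V \<subseteq> {y. x \<bullet> y < \<rho>\<^sup>2}" by (rule hull_minimal) (rule convex_halfspace_lt)
  then show False using x by (auto simp: dot_square_norm)
qed

text \<open>
  By \<open>in_convex_hull_sphere\<close> the points of \<open>V\<close> are the points of the hull with norm \<open>\<rho>\<close>, so a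
  rotation that preserves the hull preserves \<open>V\<close>.
\<close>

lemma rotation_convex_hull_iff:
  fixes V :: "(real^3) set"
  assumes V: "finite V" "V \<subseteq> sphere 0 \<rho>" and A: "rotation_matrix A"
  shows "(\<lambda>x. A *v x) ` (convex hull V) = convex hull V \<longleftrightarrow> (\<forall>v\<in>V. A *v v \<in> V)"
proof
  have norm: "norm (A *v x) = norm x" for x using rotation_inner[OF A, of x x] by (simp add: norm_eq_sqrt_inner)
  have inj: "inj_on (\<lambda>x. A *v x) V"
  proof (rule inj_onI)
    fix x y assume "A *v x = A *v y"
    then have "norm (A *v (x - y)) = 0" by (simp add: matrix_vector_mult_diff_distrib)
    then show "x = y" unfolding norm by simp
  qed
  show "\<forall>v\<in>V. A *v v \<in> V" if "(\<lambda>x. A *v x) ` (convex hull V) = convex hull V"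
  proof
    fix v assume v: "v \<in> V"
    then have "A *v v \<in> convex hull V" using that hull_inc[of v V] by blast
    moreover have "norm (A *v v) = \<rho>" using v V norm by auto
    ultimately show "A *v v \<in> V" using in_convex_hull_sphere[OF V(2)] by blast
  qed
  assume "\<forall>v\<in>V. A *v v \<in> V"
  then have "(\<lambda>x. A *v x) ` V = V" using inj V(1) by (intro endo_inj_surj) auto
  then show "(\<lambda>x. A *v x) ` (convex hull V) = convex hull V"
    by (simp add: convex_hull_linear_image)
qed

lemma subgroup_rotational_symmetries: "subgroup (rotational_symmetries P) SO3"
proof (rule SO3.subgroupI)
  show "rotational_symmetries P \<subseteq> carrier SO3" by (auto simp: rotational_symmetries_def)
  have "mat 1 \<in> rotational_symmetries P"
    using SO3.one_closed by (simp add: rotational_symmetries_def)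
  then show "rotational_symmetries P \<noteq> {}" by blast
  fix A assume A: "A \<in> rotational_symmetries P"
  then have rot: "rotation_matrix A" and AP: "(\<lambda>x. A *v x) ` P = P" by (auto simp: rotational_symmetries_def)
  have "(\<lambda>x. transpose A *v x) ` ((\<lambda>x. A *v x) ` P) = P"
    using rot by (simp add: image_image matrix_vector_mul_assoc rotation_matrix_def orthogonal_matrix_def
        del: transpose_matrix_vector)
  then show "inv\<^bsub>SO3\<^esub> A \<in> rotational_symmetries P"
    unfolding AP using rot rotation_transpose[OF rot]
    by (simp add: rotational_symmetries_def del: transpose_matrix_vector)
  fix B assume B: "B \<in> rotational_symmetries P"
  then have rotB: "rotation_matrix B" and BP: "(\<lambda>x. B *v x) ` P = P" by (auto simp: rotational_symmetries_def)
  have "(\<lambda>x. (A ** B) *v x) ` P = (\<lambda>x. A *v x) ` ((\<lambda>x. B *v x) ` P)"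
    by (simp add: image_image matrix_vector_mul_assoc)
  also have "\<dots> = P" by (simp add: AP BP)
  finally show "A \<otimes>\<^bsub>SO3\<^esub> B \<in> rotational_symmetries P"
    using rot rotB SO3.m_closed[of A B] by (simp add: rotational_symmetries_def)
qed

lemma rotational_symmetries_hull:
  assumes "finite V" "V \<subseteq> sphere 0 \<rho>"
  shows "rotational_symmetries (convex hull V) = {A. rotation_matrix A \<and> (\<forall>v\<in>V. A *v v \<in> V)}"
  using rotation_convex_hull_iff[OF assms] by (auto simp: rotational_symmetries_def)

text \<open>
  The scale factor may be negative, as \<open>orthogonal_frame_rotation\<close> requires: scalars commute with
  all rotations.
\<close>

lemma rotational_symmetries_rotate:
  assumes R: "rotation_matrix R" and s: "s \<noteq> 0"
  shows "cover_preimage (rotational_symmetries ((\<lambda>x. s *\<^sub>R (R *v x)) ` P)) =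
    quat_rotate R ` cover_preimage (rotational_symmetries P)"
proof -
  have RR: "transpose R *v (R *v x) = x" "R *v (transpose R *v x) = x" for x
    using R by (simp_all add: matrix_vector_mul_assoc rotation_matrix_def orthogonal_matrix_def
        del: transpose_matrix_vector)
  let ?f = "\<lambda>x. s *\<^sub>R (R *v x)"
  have inj: "inj ?f"
  proof (rule injI)
    fix x y assume "?f x = ?f y"
    then have "R *v x = R *v y" using s by simp
    then show "x = y" using RR(1) by metis
  qed
  have iff: "quat_rotate R q \<in> cover_preimage (rotational_symmetries (?f ` P)) \<longleftrightarrow>
      q \<in> cover_preimage (rotational_symmetries P)" for q
  proof -
    have "double_cover (quat_rotate R q) *v ?f x = ?f (double_cover q *v x)" for x
      unfolding double_cover_rotate[OF R]
      by (simp add: matrix_vector_mul_assoc[symmetric] matrix_vector_mult_scaleR RR del: transpose_matrix_vector)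
    then have "(\<lambda>x. double_cover (quat_rotate R q) *v x) ` (?f ` P) = ?f ` ((\<lambda>x. double_cover q *v x) ` P)"
      by (simp add: image_image)
    then show ?thesis using R inj_image_eq_iff[OF inj]
      by (auto simp: cover_preimage_def rotational_symmetries_def double_cover_rotation)
  qed
  show ?thesis
  proof
    show "quat_rotate R ` cover_preimage (rotational_symmetries P) \<subseteq> cover_preimage (rotational_symmetries (?f ` P))"
      using iff by auto
    show "cover_preimage (rotational_symmetries (?f ` P)) \<subseteq> quat_rotate R ` cover_preimage (rotational_symmetries P)"
    proof
      fix q assume q: "q \<in> cover_preimage (rotational_symmetries (?f ` P))"
      have e: "q = quat_rotate R (quat_rotate (transpose R) q)" by (simp add: quat_rotate_transpose[OF R])
      then have "quat_rotate (transpose R) q \<in> cover_preimage (rotational_symmetries P)"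
        using iff[of "quat_rotate (transpose R) q"] q by simp
      then show "q \<in> quat_rotate R ` cover_preimage (rotational_symmetries P)" using e by blast
    qed
  qed
qed

text \<open>
  First take the first axis to \<open>u\<close>, then turn about the first axis.
\<close>

lemma orthonormal_rotation:
  fixes u v :: "real^3"
  assumes u: "norm u = 1" and v: "norm v = 1" "u \<bullet> v = 0"
  obtains R where "rotation_matrix R" "R *v axis 1 1 = u" "R *v axis 2 1 = v" "R *v axis 3 1 = cross3 u v"
proof -
  obtain R where R: "rotation_matrix R" "R *v axis 1 1 = u" using rotation_taking[of "axis 1 1" u] u by auto
  let ?v = "transpose R *v v"
  have Rv: "R *v ?v = v" and RR: "transpose R ** R = mat 1"
    using R by (simp_all add: matrix_vector_mul_assoc rotation_matrix_def orthogonal_matrix_def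
        del: transpose_matrix_vector)
  have nv: "?v \<bullet> ?v = 1" using rotation_inner[OF R(1), of ?v ?v] v(1) unfolding Rv by (simp add: dot_square_norm)
  have ov: "axis 1 1 \<bullet> ?v = 0" using rotation_inner[OF R(1), of "axis 1 1" ?v] v(2) unfolding Rv R(2) by simp
  then have v1: "?v $ 1 = 0" by (simp add: inner_axis')
  then have "(?v $ 2)\<^sup>2 + (?v $ 3)\<^sup>2 = 1" using nv by (simp add: inner_vec_def sum_3 power2_eq_square del: transpose_matrix_vector)
  then obtain t where t: "?v $ 2 = cos t" "?v $ 3 = sin t" using sincos_total_2pi by metis
  let ?S = "double_cover (qrot (axis 1 1) (t / 2))"
  have S: "rotation_matrix ?S" by (simp add: double_cover_rotation)
  have S1: "?S *v axis 1 1 = axis 1 1"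
    using sin_cos_squared_add[of "t/2"]
    by (simp add: double_cover_apply qrot_def vec_eq_iff forall_3 axis_def cross3_def inner_vec_def sum_3
        power2_eq_square algebra_simps)
  have S2: "?S *v axis 2 1 = ?v"
    using v1 t cos_double[of "t/2"] sin_double[of "t/2"]
    by (simp add: double_cover_apply qrot_def vec_eq_iff forall_3 axis_def cross3_def inner_vec_def sum_3
        power2_eq_square algebra_simps del: transpose_matrix_vector)
  let ?Q = "R ** ?S"
  have Q: "rotation_matrix ?Q" using R(1) S SO3.m_closed[of R ?S] by simp
  have Q12: "?Q *v axis 1 1 = u" "?Q *v axis 2 1 = v"
    using S1 S2 R(2) Rv by (simp_all add: matrix_vector_mul_assoc[symmetric] del: transpose_matrix_vector)
  have "?Q *v axis 3 1 = cross3 u v"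
    using cross_rotation_matrix[OF Q, of "axis 1 1" "axis 2 1"] Q12 by (simp add: cross_basis)
  with Q Q12 show ?thesis by (rule that)
qed

text \<open>
  A left-handed frame is the negative of a right-handed one, so a negative \<open>s\<close> covers this case.
\<close>

lemma orthogonal_frame_rotation:
  assumes "orthogonal_frame a b c"
  obtains R s where "rotation_matrix R" "s \<noteq> 0"
    "a = s *\<^sub>R (R *v axis 1 1)" "b = s *\<^sub>R (R *v axis 2 1)" "c = s *\<^sub>R (R *v axis 3 1)"
proof -
  define t where "t = norm a"
  have t: "t > 0" "norm b = t" "norm c = t" and orth: "a \<bullet> b = 0" "b \<bullet> c = 0" "c \<bullet> a = 0"
    using assms by (auto simp: orthogonal_frame_def t_def)
  define u v where "u = a /\<^sub>R t" and "v = b /\<^sub>R t"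
  have uv: "norm u = 1" "norm v = 1" "u \<bullet> v = 0" "norm (- u) = 1" "norm (- v) = 1" "(- u) \<bullet> (- v) = 0"
    using t orth by (auto simp: u_def v_def t_def)
  let ?w = "cross3 u v"
  have nw: "(norm ?w)\<^sup>2 = 1" using norm_cross_dot[of u v] uv by simp
  then have w0: "?w \<noteq> 0" by auto
  have ww: "?w \<bullet> ?w = 1" using nw by (simp add: dot_square_norm)
  have cu: "c \<bullet> u = 0" "c \<bullet> v = 0" using orth by (simp_all add: u_def v_def inner_commute)
  have "c - (c \<bullet> ?w) *\<^sub>R ?w = 0"
  proof (rule orthogonal_to_frame[OF w0])
    show "(c - (c \<bullet> ?w) *\<^sub>R ?w) \<bullet> u = 0" "(c - (c \<bullet> ?w) *\<^sub>R ?w) \<bullet> v = 0"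
      using cu by (simp_all add: inner_diff_left dot_cross_self)
    show "(c - (c \<bullet> ?w) *\<^sub>R ?w) \<bullet> ?w = 0" using ww by (simp add: inner_diff_left)
  qed
  then have c: "c = (c \<bullet> ?w) *\<^sub>R ?w" by simp
  then have "t = \<bar>c \<bullet> ?w\<bar> * norm ?w" using t(3) by (metis norm_scaleR)
  moreover have "norm ?w = 1" using nw by (simp add: power2_eq_1_iff) (smt (verit) norm_ge_zero)
  ultimately consider "c \<bullet> ?w = t" | "c \<bullet> ?w = - t" by fastforce
  then show ?thesis
  proof cases
    case 1
    obtain R where R: "rotation_matrix R" "R *v axis 1 1 = u" "R *v axis 2 1 = v" "R *v axis 3 1 = ?w"
      using orthonormal_rotation[OF uv(1,2,3)] by blast
    show ?thesis by (rule that[of R t]) (use R t c 1 in \<open>auto simp: u_def v_def\<close>)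
  next
    case 2
    obtain R where R: "rotation_matrix R" "R *v axis 1 1 = - u" "R *v axis 2 1 = - v"
        "R *v axis 3 1 = cross3 (- u) (- v)"
      using orthonormal_rotation[OF uv(4,5,6)] by blast
    show ?thesis by (rule that[of R "- t"]) (use R t c 2 in \<open>auto simp: u_def v_def\<close>)
  qed
qed

definition tetra_vertices :: "(real^3) set" where
  "tetra_vertices = {vector [1, 1, 1], vector [1, -1, -1], vector [-1, 1, -1], vector [-1, -1, 1]}"

definition octa_vertices :: "(real^3) set" where
  "octa_vertices = {vector [1, 0, 0], vector [-1, 0, 0], vector [0, 1, 0], vector [0, -1, 0],
     vector [0, 0, 1], vector [0, 0, -1]}"

abbreviation golden :: real where "golden \<equiv> (1 + sqrt 5) / 2"

definition icosa_vertices :: "(real^3) set" where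
  "icosa_vertices = {vector [1, golden, 0], vector [1, - golden, 0], vector [-1, golden, 0], vector [-1, - golden, 0],
     vector [0, 1, golden], vector [0, 1, - golden], vector [0, -1, golden], vector [0, -1, - golden],
     vector [golden, 0, 1], vector [golden, 0, -1], vector [- golden, 0, 1], vector [- golden, 0, -1]}"

lemma octahedron_standard:
  assumes "regular_octahedron P"
  obtains R s where "rotation_matrix R" "s \<noteq> 0" "P = (\<lambda>x. s *\<^sub>R (R *v x)) ` (convex hull octa_vertices)"
proof -
  obtain a b c where abc: "orthogonal_frame a b c" "P = convex hull {a, -a, b, -b, c, -c}"
    using assms by (auto simp: regular_octahedron_def)
  obtain R s where R: "rotation_matrix R" "s \<noteq> 0"
    "a = s *\<^sub>R (R *v axis 1 1)" "b = s *\<^sub>R (R *v axis 2 1)" "c = s *\<^sub>R (R *v axis 3 1)"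
    using orthogonal_frame_rotation[OF abc(1)] by blast
  let ?f = "\<lambda>x. s *\<^sub>R (R *v x)"
  have lin: "linear ?f" by (intro linear_compose_scale_right matrix_vector_mul_linear)
  have oct: "octa_vertices = {axis 1 1, - axis 1 1, axis 2 1, - axis 2 1, axis 3 1, - axis 3 1}"
    unfolding octa_vertices_def by (simp add: axis_vector vector_3_ops)
  have neg: "?f (- x) = - ?f x" for x using linear_neg[OF lin] .
  have "?f ` octa_vertices = {a, -a, b, -b, c, -c}" unfolding oct by (simp add: neg R(3-5))
  then have "P = ?f ` (convex hull octa_vertices)"
    unfolding abc(2) by (simp add: convex_hull_linear_image[OF lin])
  then show ?thesis using that R by blast
qed

lemma icosahedron_standard:
  assumes "regular_icosahedron P"
  obtains R s where "rotation_matrix R" "s \<noteq> 0" "P = (\<lambda>x. s *\<^sub>R (R *v x)) ` (convex hull icosa_vertices)"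
proof -
  obtain a b c where abc: "orthogonal_frame a b c" and P: "P = convex hull {s *\<^sub>R x + (t * golden) *\<^sub>R y | s t x y.
              s \<in> {-1, 1} \<and> t \<in> {-1, 1} \<and> (x, y) \<in> {(a, b), (b, c), (c, a)}}"
    using assms by (auto simp: regular_icosahedron_def)
  obtain R r where R: "rotation_matrix R" "r \<noteq> 0"
    "a = r *\<^sub>R (R *v axis 1 1)" "b = r *\<^sub>R (R *v axis 2 1)" "c = r *\<^sub>R (R *v axis 3 1)"
    using orthogonal_frame_rotation[OF abc(1)] by blast
  let ?f = "\<lambda>x. r *\<^sub>R (R *v x)"
  have lin: "linear ?f" by (intro linear_compose_scale_right matrix_vector_mul_linear)
  let ?W = "\<lambda>a b c. {s *\<^sub>R x + (t * golden) *\<^sub>R y | s t x y.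
              s \<in> {-1, 1} \<and> t \<in> {-1, 1} \<and> (x, y) \<in> {(a, b), (b, c), (c, a)}}"
  have W: "?W a b c = (\<lambda>(s, t, x, y). s *\<^sub>R x + (t * golden) *\<^sub>R y) `
      ({-1, 1} \<times> {-1, 1} \<times> {(a, b), (b, c), (c, a)})" for a b c :: "real^3"
    by (rule Collect_as_image)
  have img: "?f ` ?W (axis 1 1) (axis 2 1) (axis 3 1) = ?W a b c"
  proof -
    have fl: "?f (s *\<^sub>R x + t *\<^sub>R y) = s *\<^sub>R ?f x + t *\<^sub>R ?f y" for s t x y
      using linear_add[OF lin] linear_scale[OF lin] by simp
    have gen: "?f ` ((\<lambda>(s, t, x, y). s *\<^sub>R x + (t * golden) *\<^sub>R y) ` (S \<times> T \<times> U)) =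
        (\<lambda>(s, t, x, y). s *\<^sub>R ?f x + (t * golden) *\<^sub>R ?f y) ` (S \<times> T \<times> U)"
      for S T :: "real set" and U :: "((real^3) \<times> (real^3)) set"
      unfolding image_image case_prod_beta fl ..
    show ?thesis unfolding W gen R(3-5) by (simp add: insert_Times_insert)
  qed
  have "icosa_vertices = ?W (axis 1 1) (axis 2 1) (axis 3 1)"
    unfolding W icosa_vertices_def axis_vector
    by (simp add: insert_Times_insert vector_3_ops insert_commute minus_divide_left)
  then have "P = ?f ` (convex hull icosa_vertices)"
    unfolding P img[symmetric] by (simp add: convex_hull_linear_image[OF lin])
  then show ?thesis using that R by blast
qed

text \<open>
  The midpoints \<open>a\<close>, \<open>b\<close>, \<open>c\<close> of the three edges at one vertex are orthogonal and of equal length,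
  and the vertices are the sums \<open>\<plusminus>a \<plusminus> b \<plusminus> c\<close> with an even number of minus signs.
\<close>

lemma tetrahedron_standard:
  assumes "regular_tetrahedron P"
  obtains R s where "rotation_matrix R" "s \<noteq> 0" "P = (\<lambda>x. s *\<^sub>R (R *v x)) ` (convex hull tetra_vertices)"
proof -
  obtain V r where V: "card V = 4" "r > 0" "\<forall>x\<in>V. \<forall>y\<in>V. x \<noteq> y \<longrightarrow> dist x y = r"
      "(\<Sum>x\<in>V. x) = 0" "P = convex hull V"
    using assms by (auto simp: regular_tetrahedron_def)
  obtain w x y z where wxyz: "V = {w, x, y, z}" "w \<noteq> x" "w \<noteq> y" "w \<noteq> z" "x \<noteq> y" "x \<noteq> z" "y \<noteq> z"
    using V(1) by (auto simp: numeral_eq_Suc card_Suc_eq)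
  have sum0: "w + x + y + z = 0" using V(4) wxyz by (simp add: add.assoc)
  have d: "(p - q) \<bullet> (p - q) = r\<^sup>2" if "p \<in> V" "q \<in> V" "p \<noteq> q" for p q
    using V(3) that by (metis dist_norm dot_square_norm)
  have dd: "(w - x) \<bullet> (w - x) = r\<^sup>2" "(w - y) \<bullet> (w - y) = r\<^sup>2" "(w - z) \<bullet> (w - z) = r\<^sup>2"
    "(x - y) \<bullet> (x - y) = r\<^sup>2" "(x - z) \<bullet> (x - z) = r\<^sup>2" "(y - z) \<bullet> (y - z) = r\<^sup>2"
    using wxyz by (auto intro!: d)
  have "z + (w + x + y) = 0" using sum0 by (simp add: ac_simps)
  then have z: "z = - (w + x + y)" by (simp only: eq_neg_iff_add_eq_0)
  note expand = inner_diff_left inner_diff_right inner_minus_left inner_minus_right inner_add_left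
    inner_add_right inner_commute[of x w] inner_commute[of y w] inner_commute[of y x]
  note dd = dd[unfolded z expand]
  define a b c where "a = (1/2) *\<^sub>R (w + x)" and "b = (1/2) *\<^sub>R (w + y)" and "c = (1/2) *\<^sub>R (w + z)"
  have exp: "w \<bullet> w = 3/8 * r\<^sup>2" "x \<bullet> x = 3/8 * r\<^sup>2" "y \<bullet> y = 3/8 * r\<^sup>2"
    "w \<bullet> x = - (1/8) * r\<^sup>2" "w \<bullet> y = - (1/8) * r\<^sup>2" "x \<bullet> y = - (1/8) * r\<^sup>2"
    using dd by - (linarith+)
  have norms: "a \<bullet> a = r\<^sup>2 / 8" "b \<bullet> b = r\<^sup>2 / 8" "c \<bullet> c = r\<^sup>2 / 8"
    "a \<bullet> b = 0" "b \<bullet> c = 0" "c \<bullet> a = 0"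
    unfolding a_def b_def c_def z inner_scaleR_left inner_scaleR_right expand exp by simp_all
  have "orthogonal_frame a b c"
    using norms V(2) by (auto simp: orthogonal_frame_def norm_eq_sqrt_inner)
  then obtain R s where R: "rotation_matrix R" "s \<noteq> 0"
    "a = s *\<^sub>R (R *v axis 1 1)" "b = s *\<^sub>R (R *v axis 2 1)" "c = s *\<^sub>R (R *v axis 3 1)"
    using orthogonal_frame_rotation by blast
  let ?f = "\<lambda>x. s *\<^sub>R (R *v x)"
  have lin: "linear ?f" by (intro linear_compose_scale_right matrix_vector_mul_linear)
  have tet: "tetra_vertices = {axis 1 1 + axis 2 1 + axis 3 1, axis 1 1 - axis 2 1 - axis 3 1,
      - axis 1 1 + axis 2 1 - axis 3 1, - axis 1 1 - axis 2 1 + axis 3 1}"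
    unfolding tetra_vertices_def axis_vector
    by (simp add: vector_3_ops)
  have "?f ` tetra_vertices = {a + b + c, a - b - c, - a + b - c, - a - b + c}"
    unfolding tet by (simp add: linear_add[OF lin] linear_diff[OF lin] linear_neg[OF lin] R(3-5))
  also have "\<dots> = {w, x, y, z}"
  proof -
    have "a + b + c = w" "a - b - c = x" "- a + b - c = y" "- a - b + c = z"
      by (simp_all add: a_def b_def c_def z vec_eq_iff field_simps)
    then show ?thesis by simp
  qed
  finally have "P = ?f ` (convex hull tetra_vertices)"
    unfolding V(5) wxyz(1) by (simp add: convex_hull_linear_image[OF lin])
  then show ?thesis using that R by blast
qed

text \<open>
  A rotation is determined by its values at two linearly independent vectors.
\<close>

lemma finite_rotations_preserving:
  assumes V: "finite V" "u \<in> V" "v \<in> V" and uv: "cross3 u v \<noteq> 0"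
  shows "finite {A. rotation_matrix A \<and> (\<forall>v\<in>V. A *v v \<in> V)}"
proof (rule inj_on_finite)
  let ?S = "{A. rotation_matrix A \<and> (\<forall>v\<in>V. A *v v \<in> V)}"
  show "inj_on (\<lambda>A. (A *v u, A *v v)) ?S"
  proof (rule inj_onI)
    fix A B assume AB: "A \<in> ?S" "B \<in> ?S" "(A *v u, A *v v) = (B *v u, B *v v)"
    then have rot: "rotation_matrix A" "rotation_matrix B" by auto
    have BB: "transpose B ** B = mat 1" "B ** transpose B = mat 1"
      using rot by (auto simp: rotation_matrix_def orthogonal_matrix_def)
    have "transpose B ** A = mat 1"
    proof (rule rotation_fixing_two[OF _ _ _ uv])
      show "rotation_matrix (transpose B ** A)"
        using SO3.m_closed[of "transpose B" A] rot rotation_transpose by simp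
      show "(transpose B ** A) *v u = u" "(transpose B ** A) *v v = v"
        using AB(3) BB(1) by (simp_all add: matrix_vector_mul_assoc[symmetric] del: transpose_matrix_vector)
          (simp_all add: matrix_vector_mul_assoc del: transpose_matrix_vector)
    qed
    then have "B ** (transpose B ** A) = B" by simp
    then show "A = B" using BB(2) by (simp add: matrix_mul_assoc)
  qed
  show "(\<lambda>A. (A *v u, A *v v)) ` ?S \<subseteq> V \<times> V" using V by auto
  show "finite (V \<times> V)" using V by simp
qed

section \<open>Binary polyhedral groups\<close>

definition stab :: "(real^3) set \<Rightarrow> quaternion set" where
  "stab V = {q. norm q = 1 \<and> (\<forall>v\<in>V. double_cover q *v v \<in> V)}"

lemma cover_preimage_hull:
  assumes "finite V" "V \<subseteq> sphere 0 \<rho>"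
  shows "cover_preimage (rotational_symmetries (convex hull V)) = stab V"
  unfolding rotational_symmetries_hull[OF assms] cover_preimage_def stab_def
  by (auto simp: double_cover_rotation)

lemma subgroup_stab:
  assumes "finite V" "V \<subseteq> sphere 0 \<rho>"
  shows "subgroup (stab V) Sp1"
  unfolding cover_preimage_hull[OF assms, symmetric]
  by (intro subgroup_cover_preimage subgroup_rotational_symmetries)

text \<open>
  Given \<open>q\<close> in \<open>stab V\<close>, an element of \<open>H\<close> moves the image of \<open>u\<close> back to \<open>u\<close> by \<open>t1\<close>, and a second
  one then moves the image of \<open>w\<close> back to \<open>w\<close> by \<open>t2\<close>.  The product fixes two independent vectors,
  so it is \<open>1\<close> or \<open>-1\<close>, and \<open>q\<close> lies in \<open>H\<close>.
\<close>

lemma stab_eqI: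
  assumes V: "finite V" "V \<subseteq> sphere 0 \<rho>" "u \<in> V" "w \<in> V" "cross3 u w \<noteq> 0"
    and H: "subgroup H Sp1" "H \<subseteq> stab V" "- quat_1 \<in> H"
    and t1: "\<And>v. v \<in> V \<Longrightarrow> \<exists>p\<in>H. double_cover p *v v = u"
    and t2: "\<And>v. \<lbrakk>v \<in> V; v \<bullet> u = w \<bullet> u\<rbrakk> \<Longrightarrow> \<exists>p\<in>H. double_cover p *v u = u \<and> double_cover p *v v = w"
  shows "stab V = H"
proof
  have nH: "norm p = 1" if "p \<in> H" for p using subgroup.mem_carrier[OF H(1) that] by simp
  have one: "quat_1 \<in> H" using subgroup.one_closed[OF H(1)] by simp
  have mul: "p \<star> q \<in> H" if "p \<in> H" "q \<in> H" for p q using subgroup.m_closed[OF H(1) that] by simp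
  have cnj: "quat_cnj p \<in> H" if "p \<in> H" for p
    using subgroup.m_inv_closed[OF H(1) that] nH[OF that] by simp
  show "stab V \<subseteq> H"
  proof
    fix q assume q: "q \<in> stab V"
    then have nq: "norm q = 1" and qV: "\<And>v. v \<in> V \<Longrightarrow> double_cover q *v v \<in> V" by (auto simp: stab_def)
    obtain p where p: "p \<in> H" "double_cover p *v (double_cover q *v u) = u" using t1[OF qV[OF V(3)]] by blast
    let ?q = "p \<star> q"
    have q': "norm ?q = 1" "double_cover ?q *v u = u"
      using p nq nH by (simp_all add: norm_quat_mult double_cover_mult matrix_vector_mul_assoc)
    have wV: "double_cover ?q *v w \<in> V"
      using qV[OF V(4)] p(1) H(2) by (auto simp: stab_def double_cover_mult matrix_vector_mul_assoc[symmetric])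
    have "(double_cover ?q *v w) \<bullet> u = w \<bullet> u"
      using rotation_inner[OF double_cover_rotation[OF q'(1)], of w u] q'(2) by simp
    then obtain r where r: "r \<in> H" "double_cover r *v u = u" "double_cover r *v (double_cover ?q *v w) = w"
      using t2[OF wV] by blast
    let ?r = "r \<star> ?q"
    have nr: "norm ?r = 1" using r nH q' by (simp add: norm_quat_mult)
    have "double_cover ?r = mat 1"
    proof (rule rotation_fixing_two[OF double_cover_rotation[OF nr] _ _ V(5)])
      show "double_cover ?r *v u = u" "double_cover ?r *v w = w"
        using r q' by (simp_all add: double_cover_mult[of r] matrix_vector_mul_assoc[symmetric])
    qed
    then have "?r \<in> H" using double_cover_eq_1[OF nr] one H(3) by auto
    then have "quat_cnj (r \<star> p) \<star> ?r \<in> H" using mul cnj r p by simp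
    moreover have "quat_cnj (r \<star> p) \<star> ?r = (quat_cnj (r \<star> p) \<star> (r \<star> p)) \<star> q"
      by (simp only: quat_mult_assoc)
    then have "quat_cnj (r \<star> p) \<star> ?r = q"
      using nH[OF mul[OF r(1) p(1)]] by (simp only: quat_mult_cnj quat_mult_1)
    ultimately show "q \<in> H" by simp
  qed
qed (rule H(2))

text \<open>
  Quaternions over a rotation of order 3 about \<open>(1, 1, 1)\<close>, a rotation of order 5 about the vertex
  \<open>(1, \<phi>, 0)\<close> of the icosahedron, and the quarter turns about the coordinate axes.
\<close>

definition quat_w :: quaternion where "quat_w = (1/2, vector [1/2, 1/2, 1/2])"
definition quat_r :: quaternion where "quat_r = ((1 + sqrt 5) / 4, vector [(sqrt 5 - 1) / 4, 1/2, 0])"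
definition quat_ti :: quaternion where "quat_ti = (sqrt 2 / 2, vector [sqrt 2 / 2, 0, 0])"
definition quat_tj :: quaternion where "quat_tj = (sqrt 2 / 2, vector [0, sqrt 2 / 2, 0])"
definition quat_tk :: quaternion where "quat_tk = (sqrt 2 / 2, vector [0, 0, sqrt 2 / 2])"

definition binary_T :: "quaternion set" where "binary_T = generate Sp1 {quat_i, quat_j, quat_w}"
definition binary_O :: "quaternion set" where "binary_O = generate Sp1 {quat_ti, quat_tj, quat_tk}"
definition binary_I :: "quaternion set" where "binary_I = generate Sp1 {quat_i, quat_j, quat_w, quat_r}"

lemma norm_unit_quats [simp]: "norm quat_i = 1" "norm quat_j = 1" "norm quat_k = 1" "norm quat_w = 1"
  "norm quat_r = 1" "norm quat_ti = 1" "norm quat_tj = 1" "norm quat_tk = 1"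
  by (simp_all add: quat_unit_coords quat_w_def quat_r_def quat_ti_def quat_tj_def quat_tk_def
      norm_quat_coords power2_eq_square field_simps)

lemma generate_Sp1_closed:
  assumes "H = generate Sp1 S" "S \<subseteq> carrier Sp1"
  shows "subgroup H Sp1" "S \<subseteq> H" "quat_1 \<in> H" "\<And>p q. p \<in> H \<Longrightarrow> q \<in> H \<Longrightarrow> p \<star> q \<in> H"
    "\<And>p. p \<in> H \<Longrightarrow> quat_cnj p \<in> H" "\<And>p. p \<in> H \<Longrightarrow> norm p = 1"
proof -
  show H: "subgroup H Sp1" using assms Sp1.generate_is_subgroup by simp
  show "S \<subseteq> H" using assms by (auto intro: generate.incl)
  show "quat_1 \<in> H" using subgroup.one_closed[OF H] by simp
  show "p \<star> q \<in> H" if "p \<in> H" "q \<in> H" for p q using subgroup.m_closed[OF H that] by simp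
  show "norm p = 1" if "p \<in> H" for p using subgroup.mem_carrier[OF H that] by simp
  then show "quat_cnj p \<in> H" if "p \<in> H" for p using subgroup.m_inv_closed[OF H that] that by simp
qed

lemmas binary_T = generate_Sp1_closed[OF binary_T_def, simplified]
lemmas binary_O = generate_Sp1_closed[OF binary_O_def, simplified]
lemmas binary_I = generate_Sp1_closed[OF binary_I_def, simplified]

lemma sphere_vertices:
  "tetra_vertices \<subseteq> sphere 0 (sqrt 3)" "octa_vertices \<subseteq> sphere 0 1"
  "icosa_vertices \<subseteq> sphere 0 (sqrt (1 + golden\<^sup>2))"
  by (auto simp: tetra_vertices_def octa_vertices_def icosa_vertices_def norm_eq_sqrt_inner inner_coords
      power2_eq_square)

lemma finite_vertices: "finite tetra_vertices" "finite octa_vertices" "finite icosa_vertices"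
  by (simp_all add: tetra_vertices_def octa_vertices_def icosa_vertices_def)

lemma double_cover_quats:
  "double_cover quat_1 *v vector [x, y, z] = vector [x, y, z]"
  "double_cover quat_i *v vector [x, y, z] = vector [x, - y, - z]"
  "double_cover quat_j *v vector [x, y, z] = vector [- x, y, - z]"
  "double_cover quat_k *v vector [x, y, z] = vector [- x, - y, z]"
  "double_cover quat_w *v vector [x, y, z] = vector [z, x, y]"
  "double_cover quat_ti *v vector [x, y, z] = vector [x, - z, y]"
  "double_cover quat_tj *v vector [x, y, z] = vector [z, y, - x]"
  "double_cover quat_tk *v vector [x, y, z] = vector [- y, x, z]"
  "double_cover (quat_cnj quat_ti) *v vector [x, y, z] = vector [x, z, - y]"
  "double_cover (quat_cnj quat_tj) *v vector [x, y, z] = vector [- z, y, x]"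
  "double_cover (quat_cnj quat_tk) *v vector [x, y, z] = vector [y, - x, z]"
  by (simp_all add: quat_unit_coords quat_w_def quat_ti_def quat_tj_def quat_tk_def quat_cnj_coords
      double_cover_coords vector_3_eq_iff)

lemma quat_units_mult:
  "quat_i \<star> quat_i = - quat_1" "quat_j \<star> quat_j = - quat_1" "quat_k \<star> quat_k = - quat_1"
  "quat_i \<star> quat_j = quat_k" "quat_j \<star> quat_k = quat_i" "quat_k \<star> quat_i = quat_j"
  "quat_j \<star> quat_i = - quat_k" "quat_k \<star> quat_j = - quat_i" "quat_i \<star> quat_k = - quat_j"
  by (simp_all add: quat_unit_coords quat_mult_coords quat_minus_coords vec_eq_iff forall_3)

lemma cross3_coords: "cross3 (vector [a, b, c]) (vector [d, e, f]) = vector [b * f - c * e, c * d - a * f, a * e - b * d]"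
  by (simp add: cross3_def)

lemma zero_vector_3: "(0 :: real^3) = vector [0, 0, 0]"
  by (simp add: vec_eq_iff forall_3)

theorem stab_tetra: "stab tetra_vertices = binary_T"
proof (rule stab_eqI[OF finite_vertices(1) sphere_vertices(1)])
  let ?u = "vector [1, 1, 1] :: real^3" and ?w = "vector [1, -1, -1] :: real^3"
  show "?u \<in> tetra_vertices" "?w \<in> tetra_vertices" by (auto simp: tetra_vertices_def)
  show "cross3 ?u ?w \<noteq> 0" by (simp add: cross3_coords zero_vector_3 vector_3_eq_iff)
  show "subgroup binary_T Sp1" by (rule binary_T)
  show "binary_T \<subseteq> stab tetra_vertices" unfolding binary_T_def
    by (rule Sp1.generate_subgroup_incl[OF _ subgroup_stab[OF finite_vertices(1) sphere_vertices(1)]])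
      (auto simp: stab_def tetra_vertices_def double_cover_quats)
  show "- quat_1 \<in> binary_T" using binary_T(4)[of quat_i quat_i] binary_T(2) by (simp add: quat_units_mult)
  have k: "quat_k \<in> binary_T" using binary_T(4)[of quat_i quat_j] binary_T(2) by (simp add: quat_units_mult)
  have ww: "quat_w \<star> quat_w \<in> binary_T" using binary_T by simp
  note mem = binary_T(2,3) k ww
  show "\<exists>p\<in>binary_T. double_cover p *v v = ?u" if "v \<in> tetra_vertices" for v
    using that mem unfolding tetra_vertices_def
    by (elim insertE emptyE)
      (force intro: bexI[of _ quat_1] bexI[of _ quat_i] bexI[of _ quat_j] bexI[of _ quat_k] simp: double_cover_quats)+
  show "\<exists>p\<in>binary_T. double_cover p *v ?u = ?u \<and> double_cover p *v v = ?w"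
    if "v \<in> tetra_vertices" "v \<bullet> ?u = ?w \<bullet> ?u" for v
  proof -
    from that consider "v = vector [1, -1, -1]" | "v = vector [-1, 1, -1]" | "v = vector [-1, -1, 1]"
      by (auto simp: tetra_vertices_def inner_coords)
    then show ?thesis
    proof cases
      case 1 then show ?thesis using mem by (intro bexI[of _ quat_1]) (simp_all add: double_cover_quats)
    next
      case 2 then show ?thesis using mem
        by (intro bexI[of _ "quat_w \<star> quat_w"])
          (simp_all add: double_cover_quats double_cover_mult matrix_vector_mul_assoc[symmetric])
    next
      case 3 then show ?thesis using mem by (intro bexI[of _ quat_w]) (simp_all add: double_cover_quats)
    qed
  qed
qed

theorem stab_octa: "stab octa_vertices = binary_O"
proof (rule stab_eqI[OF finite_vertices(2) sphere_vertices(2)])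
  let ?u = "vector [1, 0, 0] :: real^3" and ?w = "vector [0, 1, 0] :: real^3"
  show "?u \<in> octa_vertices" "?w \<in> octa_vertices" by (auto simp: octa_vertices_def)
  show "cross3 ?u ?w \<noteq> 0" by (simp add: cross3_coords zero_vector_3 vector_3_eq_iff)
  show "subgroup binary_O Sp1" by (rule binary_O)
  show "binary_O \<subseteq> stab octa_vertices" unfolding binary_O_def
    by (rule Sp1.generate_subgroup_incl[OF _ subgroup_stab[OF finite_vertices(2) sphere_vertices(2)]])
      (auto simp: stab_def octa_vertices_def double_cover_quats)
  have sq: "quat_ti \<star> quat_ti \<in> binary_O" "quat_tj \<star> quat_tj \<in> binary_O" using binary_O by auto
  have "quat_ti \<star> quat_ti \<star> (quat_ti \<star> quat_ti) = - quat_1"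
    by (simp add: quat_ti_def quat_unit_coords quat_mult_coords quat_minus_coords vec_eq_iff forall_3)
  then show "- quat_1 \<in> binary_O" using binary_O(4)[OF sq(1) sq(1)] by simp
  note mem = binary_O(2,3) sq binary_O(5)[of quat_ti] binary_O(5)[of quat_tj] binary_O(5)[of quat_tk]
  show "\<exists>p\<in>binary_O. double_cover p *v v = ?u" if "v \<in> octa_vertices" for v
  proof -
    from that consider "v = vector [1, 0, 0]" | "v = vector [-1, 0, 0]" | "v = vector [0, 1, 0]"
      | "v = vector [0, -1, 0]" | "v = vector [0, 0, 1]" | "v = vector [0, 0, -1]"
      by (auto simp: octa_vertices_def)
    then show ?thesis
    proof cases
      case 1 then show ?thesis using mem by (intro bexI[of _ quat_1]) (simp_all add: double_cover_quats)
    next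
      case 2 then show ?thesis using mem
        by (intro bexI[of _ "quat_tj \<star> quat_tj"])
          (simp_all add: double_cover_quats double_cover_mult matrix_vector_mul_assoc[symmetric])
    next
      case 3 then show ?thesis using mem by (intro bexI[of _ "quat_cnj quat_tk"]) (simp_all add: double_cover_quats)
    next
      case 4 then show ?thesis using mem by (intro bexI[of _ "quat_tk"]) (simp_all add: double_cover_quats)
    next
      case 5 then show ?thesis using mem by (intro bexI[of _ "quat_tj"]) (simp_all add: double_cover_quats)
    next
      case 6 then show ?thesis using mem by (intro bexI[of _ "quat_cnj quat_tj"]) (simp_all add: double_cover_quats)
    qed
  qed
  show "\<exists>p\<in>binary_O. double_cover p *v ?u = ?u \<and> double_cover p *v v = ?w"
    if "v \<in> octa_vertices" "v \<bullet> ?u = ?w \<bullet> ?u" for v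
  proof -
    from that consider "v = vector [0, 1, 0]" | "v = vector [0, -1, 0]" | "v = vector [0, 0, 1]" | "v = vector [0, 0, -1]"
      by (auto simp: octa_vertices_def inner_coords)
    then show ?thesis
    proof cases
      case 1 then show ?thesis using mem by (intro bexI[of _ quat_1]) (simp_all add: double_cover_quats)
    next
      case 2 then show ?thesis using mem
        by (intro bexI[of _ "quat_ti \<star> quat_ti"])
          (simp_all add: double_cover_quats double_cover_mult matrix_vector_mul_assoc[symmetric])
    next
      case 3 then show ?thesis using mem by (intro bexI[of _ "quat_cnj quat_ti"]) (simp_all add: double_cover_quats)
    next
      case 4 then show ?thesis using mem by (intro bexI[of _ "quat_ti"]) (simp_all add: double_cover_quats)
    qed
  qed
qed

lemma double_cover_quat_r:
  "double_cover quat_r *v vector [x, y, z] =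
    vector [x / 2 + (sqrt 5 - 1) / 4 * y + (1 + sqrt 5) / 4 * z,
      (sqrt 5 - 1) / 4 * x + (1 + sqrt 5) / 4 * y - z / 2,
      - (1 + sqrt 5) / 4 * x + y / 2 + (sqrt 5 - 1) / 4 * z]"
proof -
  have s5: "sqrt 5 * sqrt 5 = 5" "sqrt 5 * (sqrt 5 * c) = 5 * c" for c
    by (simp_all add: mult.assoc[symmetric])
  show ?thesis
    by (simp add: quat_r_def double_cover_coords vector_3_eq_iff field_simps s5)
qed

lemma quat_r_cycle:
  "double_cover quat_r *v vector [1, golden, 0] = vector [1, golden, 0]"
  "double_cover quat_r *v vector [-1, golden, 0] = vector [0, 1, golden]"
  "double_cover quat_r *v vector [0, 1, golden] = vector [golden, 0, 1]"
  "double_cover quat_r *v vector [golden, 0, 1] = vector [golden, 0, -1]"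
  "double_cover quat_r *v vector [golden, 0, -1] = vector [0, 1, - golden]"
  "double_cover quat_r *v vector [0, 1, - golden] = vector [-1, golden, 0]"
  by (simp_all add: double_cover_quat_r vector_3_eq_iff field_simps)

lemma quat_r_cycle_neg:
  "double_cover quat_r *v vector [-1, - golden, 0] = vector [-1, - golden, 0]"
  "double_cover quat_r *v vector [1, - golden, 0] = vector [0, -1, - golden]"
  "double_cover quat_r *v vector [0, -1, - golden] = vector [- golden, 0, -1]"
  "double_cover quat_r *v vector [- golden, 0, -1] = vector [- golden, 0, 1]"
  "double_cover quat_r *v vector [- golden, 0, 1] = vector [0, -1, golden]"
  "double_cover quat_r *v vector [0, -1, golden] = vector [1, - golden, 0]"
  by (simp_all add: double_cover_quat_r vector_3_eq_iff field_simps)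

text \<open>
  Here \<open>u\<close> is the vertex on the axis of \<open>quat_r\<close> and \<open>w\<close> one of its five neighbours, which the
  powers of \<open>quat_r\<close> permute cyclically.
\<close>

theorem stab_icosa: "stab icosa_vertices = binary_I"
proof (rule stab_eqI[OF finite_vertices(3) sphere_vertices(3)])
  let ?u = "vector [1, golden, 0] :: real^3" and ?w = "vector [-1, golden, 0] :: real^3"
  have g0: "golden > 0" by (simp add: add_pos_nonneg)
  show "?u \<in> icosa_vertices" "?w \<in> icosa_vertices" by (auto simp: icosa_vertices_def)
  show "cross3 ?u ?w \<noteq> 0" using g0 by (simp add: cross3_coords zero_vector_3 vector_3_eq_iff)
  show "subgroup binary_I Sp1" by (rule binary_I)
  show "binary_I \<subseteq> stab icosa_vertices" unfolding binary_I_def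
  proof (rule Sp1.generate_subgroup_incl[OF _ subgroup_stab[OF finite_vertices(3) sphere_vertices(3)]])
    have "quat_i \<in> stab icosa_vertices" "quat_j \<in> stab icosa_vertices" "quat_w \<in> stab icosa_vertices"
      unfolding stab_def icosa_vertices_def by (simp_all add: double_cover_quats)
    moreover have "quat_r \<in> stab icosa_vertices"
      unfolding stab_def icosa_vertices_def
      by (simp add: quat_r_cycle quat_r_cycle_neg)
    ultimately show "{quat_i, quat_j, quat_w, quat_r} \<subseteq> stab icosa_vertices" by simp
  qed
  show "- quat_1 \<in> binary_I" using binary_I(4)[of quat_i quat_i] binary_I(2) by (simp add: quat_units_mult)
  have k: "quat_k \<in> binary_I" using binary_I(4)[of quat_i quat_j] binary_I(2) by (simp add: quat_units_mult)
  have ww: "quat_w \<star> quat_w \<in> binary_I" using binary_I by simp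
  have rr: "quat_r \<star> quat_r \<in> binary_I" using binary_I by simp
  have mul: "p \<star> q \<in> binary_I" if "p \<in> binary_I" "q \<in> binary_I" for p q using that binary_I by simp
  note mem = binary_I(2,3) k ww rr
  note dc = double_cover_quats quat_r_cycle quat_r_cycle_neg double_cover_mult matrix_vector_mul_assoc[symmetric]
  show "\<exists>p\<in>binary_I. double_cover p *v v = ?u" if v: "v \<in> icosa_vertices" for v
  proof -
    define S where "S = {quat_1, quat_i, quat_j, quat_k}"
    have S: "S \<subseteq> binary_I" using mem by (auto simp: S_def)
    have flip: "\<exists>p\<in>S. double_cover p *v x = ?u"
      if "x \<in> {vector [1, golden, 0], vector [1, - golden, 0], vector [-1, golden, 0], vector [-1, - golden, 0]}" for x
      using that by (auto simp: S_def double_cover_quats)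
    have "v \<in> {vector [1, golden, 0], vector [1, - golden, 0], vector [-1, golden, 0], vector [-1, - golden, 0]} \<or>
      double_cover quat_w *v v \<in> {vector [1, golden, 0], vector [1, - golden, 0], vector [-1, golden, 0], vector [-1, - golden, 0]} \<or>
      double_cover (quat_w \<star> quat_w) *v v \<in> {vector [1, golden, 0], vector [1, - golden, 0], vector [-1, golden, 0], vector [-1, - golden, 0]}"
      using v unfolding icosa_vertices_def
      by (elim insertE emptyE) (simp_all add: double_cover_quats double_cover_mult matrix_vector_mul_assoc[symmetric])
    then obtain r where r: "r \<in> {quat_1, quat_w, quat_w \<star> quat_w}" "double_cover r *v v \<in>
        {vector [1, golden, 0], vector [1, - golden, 0], vector [-1, golden, 0], vector [-1, - golden, 0]}"
      by (metis double_cover_1 insertI1 insertI2 matrix_vector_mul_lid)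
    obtain p where p: "p \<in> S" "double_cover p *v (double_cover r *v v) = ?u" using flip[OF r(2)] by blast
    have "p \<in> binary_I" "r \<in> binary_I" using p(1) S r(1) mem by auto
    then have "p \<star> r \<in> binary_I" by (rule mul)
    then show ?thesis using p(2) by (intro bexI[of _ "p \<star> r"]) (simp_all add: double_cover_mult matrix_vector_mul_assoc)
  qed
  show "\<exists>p\<in>binary_I. double_cover p *v ?u = ?u \<and> double_cover p *v v = ?w"
    if "v \<in> icosa_vertices" "v \<bullet> ?u = ?w \<bullet> ?u" for v
  proof -
    have gg: "golden * golden = golden + 1" by (simp add: field_simps)
    have s5: "sqrt 5 > 1" by simp
    from that consider "v = vector [-1, golden, 0]" | "v = vector [0, 1, golden]" | "v = vector [golden, 0, 1]"
      | "v = vector [golden, 0, -1]" | "v = vector [0, 1, - golden]"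
      unfolding icosa_vertices_def using s5
      by (elim insertE emptyE) (simp_all add: inner_coords field_simps)
    then show ?thesis
    proof cases
      case 1 then show ?thesis using mem by (intro bexI[of _ quat_1]) (simp_all add: dc)
    next
      case 2 then show ?thesis using mul[OF rr rr]
        by (intro bexI[of _ "quat_r \<star> quat_r \<star> (quat_r \<star> quat_r)"]) (simp_all only: dc simp_thms)
    next
      case 3 then show ?thesis using mul[OF rr binary_I(2)[THEN conjunct2, THEN conjunct2, THEN conjunct2]]
        by (intro bexI[of _ "quat_r \<star> quat_r \<star> quat_r"]) (simp_all only: dc simp_thms)
    next
      case 4 then show ?thesis using rr
        by (intro bexI[of _ "quat_r \<star> quat_r"]) (simp_all only: dc simp_thms)
    next
      case 5 then show ?thesis using mem
        by (intro bexI[of _ "quat_r"]) (simp_all add: quat_r_cycle)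
    qed
  qed
qed

section \<open>Standard position for all types\<close>

fun standard_binary :: "rotation_group_type \<Rightarrow> quaternion set" where
  "standard_binary (Cyclic n) = cyclic_quat (axis 1 1) n"
| "standard_binary (Dihedral n) = dicyclic_quat (axis 1 1) (axis 2 1) n"
| "standard_binary Tetrahedral = binary_T"
| "standard_binary Octahedral = binary_O"
| "standard_binary Icosahedral = binary_I"

text \<open>
  Order \<open>0\<close> means infinite order, so with \<open>n = 0\<close> the types describe infinite groups.
\<close>

fun proper_type :: "rotation_group_type \<Rightarrow> bool" where
  "proper_type (Cyclic n) \<longleftrightarrow> n > 0"
| "proper_type (Dihedral n) \<longleftrightarrow> n > 0"
| "proper_type _ \<longleftrightarrow> True"

lemma subgroup_standard_binary: "proper_type \<tau> \<Longrightarrow> subgroup (standard_binary \<tau>) Sp1"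
  by (cases \<tau>) (auto intro!: subgroup_cyclic_quat subgroup_dicyclic_quat binary_T(1) binary_O(1) binary_I(1)
      simp: inner_axis_axis)

lemma finite_stab:
  assumes "finite V" "u \<in> V" "w \<in> V" "cross3 u w \<noteq> 0"
  shows "finite (stab V)"
proof -
  have "stab V = cover_preimage {A. rotation_matrix A \<and> (\<forall>v\<in>V. A *v v \<in> V)}"
    by (auto simp: stab_def cover_preimage_def double_cover_rotation)
  then show ?thesis using finite_cover_preimage[OF finite_rotations_preserving[OF assms]] by simp
qed

lemma finite_standard_binary: "proper_type \<tau> \<Longrightarrow> finite (standard_binary \<tau>)"
proof (cases \<tau>)
  case Tetrahedral
  have "finite (stab tetra_vertices)"
    by (rule finite_stab[of _ "vector [1, 1, 1]" "vector [1, -1, -1]"])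
      (auto simp: tetra_vertices_def cross3_coords zero_vector_3 vector_3_eq_iff)
  then show ?thesis by (simp add: Tetrahedral stab_tetra)
next
  case Octahedral
  have "finite (stab octa_vertices)"
    by (rule finite_stab[of _ "vector [1, 0, 0]" "vector [0, 1, 0]"])
      (auto simp: octa_vertices_def cross3_coords zero_vector_3 vector_3_eq_iff)
  then show ?thesis by (simp add: Octahedral stab_octa)
next
  case Icosahedral
  have g0: "golden > 0" by (simp add: add_pos_nonneg)
  have "finite (stab icosa_vertices)"
  proof (rule finite_stab)
    show "vector [1, golden, 0] \<in> icosa_vertices" "vector [-1, golden, 0] \<in> icosa_vertices"
      by (auto simp: icosa_vertices_def)
    show "cross3 (vector [1, golden, 0]) (vector [-1, golden, 0]) \<noteq> 0"
      using g0 by (simp add: cross3_coords zero_vector_3 vector_3_eq_iff)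
  qed (rule finite_vertices)
  then show ?thesis by (simp add: Icosahedral stab_icosa)
qed (auto simp: dicyclic_quat_def finite_cyclic_quat)

text \<open>
  Axes, polyhedra and frames are brought into standard position by a rotation, and conjugation
  by a rotation lifts to \<open>quat_rotate\<close>.
\<close>

lemma has_type_cover_preimage:
  assumes "has_type \<tau> G" "proper_type \<tau>"
  obtains R where "rotation_matrix R" "cover_preimage G = quat_rotate R ` standard_binary \<tau>"
proof (cases \<tau>)
  case (Cyclic n)
  then obtain u A where uA: "axial_rotation u n A" "G = generate SO3 {A}" using assms by auto
  let ?u = "u /\<^sub>R norm u"
  note A = axial_rotation_unit[OF uA(1)]
  obtain R where R: "rotation_matrix R" "R *v axis 1 1 = ?u"
    using rotation_taking[of "axis 1 1" ?u] A(2) by auto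
  have "cover_preimage G = cyclic_quat ?u n"
    unfolding uA(2) using generate_axial_rotation[OF A(2,1)] assms(2) Cyclic by simp
  then show ?thesis using that[OF R(1)] R(2) by (simp add: Cyclic rotate_cyclic_quat)
next
  case (Dihedral n)
  then obtain u A v B where uv: "axial_rotation u n A" "axial_rotation v 2 B" "orthogonal u v"
    "G = generate SO3 {A, B}" using assms by auto
  let ?u = "u /\<^sub>R norm u" and ?v = "v /\<^sub>R norm v"
  note A = axial_rotation_unit[OF uv(1)] and B = axial_rotation_unit[OF uv(2)]
  have orth: "?u \<bullet> ?v = 0" using uv(3) by (simp add: orthogonal_def)
  obtain R where R: "rotation_matrix R" "R *v axis 1 1 = ?u" "R *v axis 2 1 = ?v"
    using orthonormal_rotation[OF A(2) B(2) orth] by blast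
  have "cover_preimage G = dicyclic_quat ?u ?v n"
    unfolding uv(4) using generate_dihedral[OF A(2) B(2) orth _ A(1) B(1)] assms(2) Dihedral by simp
  then show ?thesis using that[OF R(1)] R by (simp add: Dihedral rotate_dicyclic_quat[OF R(1)])
next
  case Tetrahedral
  then obtain P where P: "regular_tetrahedron P" "G = rotational_symmetries P" using assms by auto
  obtain R s where R: "rotation_matrix R" "s \<noteq> 0" "P = (\<lambda>x. s *\<^sub>R (R *v x)) ` (convex hull tetra_vertices)"
    using tetrahedron_standard[OF P(1)] by blast
  show ?thesis using that[OF R(1)] unfolding P(2) R(3) rotational_symmetries_rotate[OF R(1,2)]
      cover_preimage_hull[OF finite_vertices(1) sphere_vertices(1)] by (simp add: Tetrahedral stab_tetra)
next
  case Octahedral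
  then obtain P where P: "regular_octahedron P" "G = rotational_symmetries P" using assms by auto
  obtain R s where R: "rotation_matrix R" "s \<noteq> 0" "P = (\<lambda>x. s *\<^sub>R (R *v x)) ` (convex hull octa_vertices)"
    using octahedron_standard[OF P(1)] by blast
  show ?thesis using that[OF R(1)] unfolding P(2) R(3) rotational_symmetries_rotate[OF R(1,2)]
      cover_preimage_hull[OF finite_vertices(2) sphere_vertices(2)] by (simp add: Octahedral stab_octa)
next
  case Icosahedral
  then obtain P where P: "regular_icosahedron P" "G = rotational_symmetries P" using assms by auto
  obtain R s where R: "rotation_matrix R" "s \<noteq> 0" "P = (\<lambda>x. s *\<^sub>R (R *v x)) ` (convex hull icosa_vertices)"
    using icosahedron_standard[OF P(1)] by blast
  show ?thesis using that[OF R(1)] unfolding P(2) R(3) rotational_symmetries_rotate[OF R(1,2)]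
      cover_preimage_hull[OF finite_vertices(3) sphere_vertices(3)] by (simp add: Icosahedral stab_icosa)
qed

lemma has_type_subgroup:
  assumes "has_type \<tau> G"
  shows "subgroup G SO3"
proof (cases \<tau>)
  case (Cyclic n)
  then show ?thesis using assms by (auto simp: axial_rotation_def intro!: SO3.generate_is_subgroup)
next
  case (Dihedral n)
  then show ?thesis using assms by (auto simp: axial_rotation_def intro!: SO3.generate_is_subgroup)
qed (use assms subgroup_rotational_symmetries in auto)

lemma has_type_finite:
  assumes "has_type \<tau> G" "proper_type \<tau>"
  shows "finite G"
proof -
  obtain R where "cover_preimage G = quat_rotate R ` standard_binary \<tau>"
    using has_type_cover_preimage[OF assms] by blast
  then have fin: "finite (cover_preimage G)" using finite_standard_binary[OF assms(2)] by simp
  have "G \<subseteq> double_cover ` cover_preimage G"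
  proof
    fix A assume A: "A \<in> G"
    then have "rotation_matrix A" using subgroup.mem_carrier[OF has_type_subgroup[OF assms(1)] A] by simp
    then obtain q where "norm q = 1" "double_cover q = A" by (rule double_cover_surj)
    then show "A \<in> double_cover ` cover_preimage G" using A by (auto simp: cover_preimage_def)
  qed
  then show ?thesis using fin by (rule finite_surj[rotated])
qed

section \<open>Quotients by pairs of equal real part\<close>

text \<open>
  Conjugation in \<open>A \<times> B\<close> preserves the set of generators, as it does not change real parts.
\<close>

lemma normal_real_part_subgroup:
  assumes A: "subgroup A Sp1" and B: "subgroup B Sp1"
  shows "real_part_subgroup A B \<lhd> pair_group A B"
proof -
  interpret P: group "pair_group A B" by (rule group_pair[OF A B])
  have nA: "norm a = 1" if "a \<in> A" for a using subgroup.mem_carrier[OF A that] by simp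
  have nB: "norm b = 1" if "b \<in> B" for b using subgroup.mem_carrier[OF B that] by simp
  have inv: "inv\<^bsub>pair_group A B\<^esub> (a, b) = (quat_cnj a, quat_cnj b)" if "a \<in> A" "b \<in> B" for a b
    using that subgroup.m_inv_closed[OF A that(1)] subgroup.m_inv_closed[OF B that(2)] nA nB
    by (intro P.inv_equality) (auto simp: quat_mult_cnj)
  have re: "fst (p \<star> q \<star> quat_cnj p) = fst q" if p: "norm p = 1" for p q
  proof -
    have "p \<star> q \<star> quat_cnj p = p \<star> (fst q *\<^sub>R quat_1 + (0, snd q)) \<star> quat_cnj p" by (simp add: quat_1_def)
    also have "\<dots> = fst q *\<^sub>R quat_1 + (0, double_cover p *v snd q)"
      unfolding double_cover_conj using p by (simp add: quat_mult_add quat_mult_scaleR quat_mult_cnj)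
    finally show ?thesis by (simp add: quat_1_def)
  qed
  show ?thesis
    unfolding real_part_subgroup_consistent[OF A B, symmetric]
  proof (rule P.normal_generateI)
    fix h g assume "h \<in> {(a, b). a \<in> A \<and> b \<in> B \<and> fst a = fst b}" "g \<in> carrier (pair_group A B)"
    then obtain a b c d where "h = (a, b)" "a \<in> A" "b \<in> B" "fst a = fst b" "g = (c, d)" "c \<in> A" "d \<in> B"
      by auto
    then show "g \<otimes>\<^bsub>pair_group A B\<^esub> h \<otimes>\<^bsub>pair_group A B\<^esub> inv\<^bsub>pair_group A B\<^esub> g \<in>
        {(a, b). a \<in> A \<and> b \<in> B \<and> fst a = fst b}"
      using subgroup.m_closed[OF A] subgroup.m_closed[OF B] subgroup.m_inv_closed[OF A] subgroup.m_inv_closed[OF B]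
        nA nB by (simp add: inv re)
  qed auto
qed

text \<open>
  By \<open>fundamental_group_misorientation_space\<close> these are the groups to be computed.
\<close>

definition quotient_group :: "quaternion set \<Rightarrow> quaternion set \<Rightarrow> (quaternion \<times> quaternion) set monoid" where
  "quotient_group A B = pair_group A B Mod real_part_subgroup A B"

lemma Mod_iso_if_hom:
  assumes G: "group G" and N: "N \<lhd> G" and H: "group H" and f: "f \<in> hom G H"
    and surj: "f ` carrier G = carrier H" and ker: "\<And>x. x \<in> carrier G \<Longrightarrow> f x = \<one>\<^bsub>H\<^esub> \<longleftrightarrow> x \<in> N"
  shows "G Mod N \<cong> H"
proof -
  interpret group_hom G H f using G H f by (intro group_hom.intro group_hom_axioms.intro)
  have "N \<subseteq> carrier G" using N by (meson normal_imp_subgroup subgroup.subset)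
  then have "kernel G H f = N" using ker by (auto simp: kernel_def)
  then show ?thesis using FactGroup_iso[OF surj] by simp
qed

lemma quotient_group_iso:
  assumes A: "subgroup A Sp1" and B: "subgroup B Sp1" and A': "subgroup A' Sp1" and B': "subgroup B' Sp1"
    and bij: "bij_betw (\<lambda>(a, b). (f a b, g a b)) (A \<times> B) (A' \<times> B')"
    and hom: "(\<lambda>(a, b). (f a b, g a b)) \<in> hom (pair_group A B) (pair_group A' B')"
    and re: "\<And>a b. a \<in> A \<Longrightarrow> b \<in> B \<Longrightarrow> fst (f a b) = fst (g a b) \<longleftrightarrow> fst a = fst b"
  shows "quotient_group A B \<cong> quotient_group A' B'"
proof -
  let ?h = "\<lambda>(a, b). (f a b, g a b)"
  let ?S = "{(a, b). a \<in> A \<and> b \<in> B \<and> fst a = fst b}" and ?S' = "{(a, b). a \<in> A' \<and> b \<in> B' \<and> fst a = fst b}"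
  interpret P: group "pair_group A B" by (rule group_pair[OF A B])
  interpret P': group "pair_group A' B'" by (rule group_pair[OF A' B'])
  interpret h: group_hom "pair_group A B" "pair_group A' B'" ?h
    by (intro group_hom.intro group_hom_axioms.intro P.is_group P'.is_group hom)
  have hS: "?h ` ?S = ?S'"
  proof
    have im: "?h ` (A \<times> B) = A' \<times> B'" using bij by (rule bij_betw_imp_surj_on)
    have mem: "(f a b, g a b) \<in> A' \<times> B'" if "a \<in> A" "b \<in> B" for a b
    proof -
      have "?h (a, b) \<in> ?h ` (A \<times> B)" by (rule imageI) (simp add: that)
      then show ?thesis unfolding im by simp
    qed
    show "?h ` ?S \<subseteq> ?S'"
    proof
      fix x assume "x \<in> ?h ` ?S"
      then obtain a b where "a \<in> A" "b \<in> B" "fst a = fst b" "x = (f a b, g a b)" by (elim imageE) auto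
      then show "x \<in> ?S'" using mem[of a b] re[of a b] by simp
    qed
    show "?S' \<subseteq> ?h ` ?S"
    proof
      fix x assume x: "x \<in> ?S'"
      then have "x \<in> ?h ` (A \<times> B)" unfolding im by blast
      then obtain a b where ab: "a \<in> A" "b \<in> B" "x = ?h (a, b)" by (elim imageE SigmaE) simp
      then have "(a, b) \<in> ?S" using x re[OF ab(1,2)] by simp
      then show "x \<in> ?h ` ?S" using ab(3) by blast
    qed
  qed
  note N = normal_real_part_subgroup[OF A B] and N' = normal_real_part_subgroup[OF A' B']
  have hN: "?h ` real_part_subgroup A B = real_part_subgroup A' B'"
    unfolding real_part_subgroup_consistent[OF A B, symmetric] real_part_subgroup_consistent[OF A' B', symmetric]
  proof -
    have "?S \<subseteq> carrier (pair_group A B)" by auto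
    from h.generate_img[OF this] show "?h ` generate (pair_group A B) ?S = generate (pair_group A' B') ?S'"
      unfolding hS by (rule sym)
  qed
  have sub: "real_part_subgroup A B \<subseteq> A \<times> B"
    using subgroup.subset[OF normal_imp_subgroup[OF N]] by simp
  let ?k = "\<lambda>x. real_part_subgroup A' B' #>\<^bsub>pair_group A' B'\<^esub> ?h x"
  have khom: "?k \<in> hom (pair_group A B) (quotient_group A' B')"
    unfolding quotient_group_def
  proof (rule homI)
    fix x y assume x: "x \<in> carrier (pair_group A B)" and y: "y \<in> carrier (pair_group A B)"
    show "?k x \<in> carrier (pair_group A' B' Mod real_part_subgroup A' B')"
      unfolding FactGroup_def RCOSETS_def partial_object.simps
      by (rule UN_I[OF h.hom_closed[OF x]], rule singletonI)
    show "?k (x \<otimes>\<^bsub>pair_group A B\<^esub> y) = ?k x \<otimes>\<^bsub>pair_group A' B' Mod real_part_subgroup A' B'\<^esub> ?k y"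
      unfolding h.hom_mult[OF x y]
      using normal.rcos_sum[OF N' h.hom_closed[OF x] h.hom_closed[OF y]] by (simp add: FactGroup_def)
  qed
  show ?thesis unfolding quotient_group_def[of A B]
  proof (rule Mod_iso_if_hom[OF P.is_group N _ khom])
    show "group (quotient_group A' B')"
      unfolding quotient_group_def by (rule normal.factorgroup_is_group[OF N'])
    show "?k ` carrier (pair_group A B) = carrier (quotient_group A' B')"
    proof -
      have "?h ` carrier (pair_group A B) = carrier (pair_group A' B')" using bij by (simp add: bij_betw_def)
      then have "?k ` carrier (pair_group A B) =
          (\<lambda>y. real_part_subgroup A' B' #>\<^bsub>pair_group A' B'\<^esub> y) ` carrier (pair_group A' B')"
        by (metis image_image)
      then show ?thesis by (auto simp: quotient_group_def FactGroup_def RCOSETS_def)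
    qed
    fix x assume x: "x \<in> carrier (pair_group A B)"
    have "?k x = \<one>\<^bsub>quotient_group A' B'\<^esub> \<longleftrightarrow> ?k x = real_part_subgroup A' B'"
      by (simp only: quotient_group_def FactGroup_def monoid.simps)
    also have "\<dots> \<longleftrightarrow> ?h x \<in> real_part_subgroup A' B'"
      using P'.coset_join1[OF _ h.hom_closed[OF x] normal_imp_subgroup[OF N']]
        P'.coset_join2[OF h.hom_closed[OF x] normal_imp_subgroup[OF N']] by (rule iffI)
    also have "\<dots> \<longleftrightarrow> x \<in> real_part_subgroup A B"
      unfolding hN[symmetric]
      using inj_on_image_mem_iff[of ?h "A \<times> B" x "real_part_subgroup A B"] bij x sub
      by (simp add: bij_betw_def)
    finally show "?k x = \<one>\<^bsub>quotient_group A' B'\<^esub> \<longleftrightarrow> x \<in> real_part_subgroup A B" .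
  qed
qed

lemma inj_quat_rotate: "rotation_matrix R \<Longrightarrow> inj (quat_rotate R)"
  by (rule inj_on_inverseI[of _ "quat_rotate (transpose R)"]) (rule quat_rotate_transpose(2))

lemma quotient_group_rotate:
  assumes R: "rotation_matrix R" and S: "rotation_matrix S" and A: "subgroup A Sp1" and B: "subgroup B Sp1"
    and A': "subgroup (quat_rotate R ` A) Sp1" and B': "subgroup (quat_rotate S ` B) Sp1"
  shows "quotient_group A B \<cong> quotient_group (quat_rotate R ` A) (quat_rotate S ` B)"
proof (rule quotient_group_iso[OF A B A' B'])
  let ?h = "\<lambda>(a, b). (quat_rotate R a, quat_rotate S b)"
  show "bij_betw ?h (A \<times> B) (quat_rotate R ` A \<times> quat_rotate S ` B)"
    unfolding bij_betw_def
  proof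
    show "inj_on ?h (A \<times> B)"
      using inj_quat_rotate[OF R] inj_quat_rotate[OF S] by (auto simp: inj_on_def dest: injD)
    show "?h ` (A \<times> B) = quat_rotate R ` A \<times> quat_rotate S ` B" by (simp add: image_paired_Times)
  qed
  show "?h \<in> hom (pair_group A B) (pair_group (quat_rotate R ` A) (quat_rotate S ` B))"
    by (rule homI) (auto simp: quat_rotate_mult[OF R] quat_rotate_mult[OF S])
qed simp

lemma quotient_group_swap:
  assumes A: "subgroup A Sp1" and B: "subgroup B Sp1"
  shows "quotient_group A B \<cong> quotient_group B A"
proof (rule quotient_group_iso[OF A B B A])
  show "bij_betw (\<lambda>(a, b). (b, a)) (A \<times> B) (B \<times> A)" by (auto simp: bij_betw_def inj_on_def)
  show "(\<lambda>(a, b). (b, a)) \<in> hom (pair_group A B) (pair_group B A)" by (rule homI) auto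
qed auto

text \<open>
  The homomorphism \<open>k \<mapsto> N g(k)\<close> from the integers is surjective with kernel the multiples of \<open>n\<close>.
\<close>

lemma Mod_cyclic:
  fixes g :: "int \<Rightarrow> 'a"
  assumes P: "group P" and N: "N \<lhd> P" and n: "n > 0"
    and g: "\<And>k. g k \<in> carrier P" and add: "\<And>k l. g (k + l) = g k \<otimes>\<^bsub>P\<^esub> g l"
    and gen: "\<And>x. x \<in> carrier P \<Longrightarrow> \<exists>k. \<exists>y\<in>N. x = y \<otimes>\<^bsub>P\<^esub> g k"
    and ord: "\<And>k. g k \<in> N \<longleftrightarrow> int n dvd k"
  shows "P Mod N \<cong> integer_mod_group n"
proof -
  interpret P: group P by (rule P)
  interpret Q: group "P Mod N" by (rule normal.factorgroup_is_group[OF N])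
  have sub: "subgroup N P" by (rule normal_imp_subgroup[OF N])
  have NP: "N \<subseteq> carrier P" using sub by (rule subgroup.subset)
  let ?f = "\<lambda>k. N #>\<^bsub>P\<^esub> g k"
  have ginv: "inv\<^bsub>P\<^esub> (g k) = g (- k)" for k
  proof -
    have "g 0 \<otimes>\<^bsub>P\<^esub> g 0 = g 0" using add[of 0 0] by simp
    then have "g 0 = \<one>\<^bsub>P\<^esub>" using g by (simp add: P.l_cancel_one')
    then show ?thesis using add[of "- k" k] g by (intro P.inv_equality) auto
  qed
  have eq: "?f k = ?f l \<longleftrightarrow> int n dvd (k - l)" for k l
  proof -
    have "?f k = ?f l \<longleftrightarrow> g k \<otimes>\<^bsub>P\<^esub> inv\<^bsub>P\<^esub> (g l) \<in> N"
    proof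
      assume "?f k = ?f l"
      then have "g k \<in> N #>\<^bsub>P\<^esub> g l" using P.rcos_self[OF g sub] by metis
      then obtain y where "y \<in> N" "g k = y \<otimes>\<^bsub>P\<^esub> g l" by (auto simp: r_coset_def)
      then show "g k \<otimes>\<^bsub>P\<^esub> inv\<^bsub>P\<^esub> (g l) \<in> N" using g NP by (simp add: P.m_assoc subset_iff)
    next
      assume y: "g k \<otimes>\<^bsub>P\<^esub> inv\<^bsub>P\<^esub> (g l) \<in> N"
      have "g k = (g k \<otimes>\<^bsub>P\<^esub> inv\<^bsub>P\<^esub> (g l)) \<otimes>\<^bsub>P\<^esub> g l" using g by (simp add: P.m_assoc)
      then have "g k \<in> N #>\<^bsub>P\<^esub> g l" using y by (auto simp: r_coset_def)
      then show "?f k = ?f l" using P.repr_independence[OF _ g sub] by simp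
    qed
    also have "\<dots> \<longleftrightarrow> int n dvd (k - l)" unfolding ginv add[symmetric] ord by simp
    finally show ?thesis .
  qed
  have "?f \<in> iso (integer_mod_group n) (P Mod N)"
    unfolding iso_def
  proof (intro CollectI conjI)
    show "?f \<in> hom (integer_mod_group n) (P Mod N)"
    proof (rule homI)
      show "?f k \<in> carrier (P Mod N)" for k using g by (auto simp: FactGroup_def RCOSETS_def)
      fix k l
      have "?f (k \<otimes>\<^bsub>integer_mod_group n\<^esub> l) = ?f (k + l)"
        unfolding eq by (simp add: mod_eq_dvd_iff[symmetric])
      also have "\<dots> = ?f k \<otimes>\<^bsub>P Mod N\<^esub> ?f l"
        unfolding add using normal.rcos_sum[OF N g g] by (simp add: FactGroup_def)
      finally show "?f (k \<otimes>\<^bsub>integer_mod_group n\<^esub> l) = ?f k \<otimes>\<^bsub>P Mod N\<^esub> ?f l" .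
    qed
    show "bij_betw ?f (carrier (integer_mod_group n)) (carrier (P Mod N))"
      unfolding bij_betw_def
    proof
      show "inj_on ?f (carrier (integer_mod_group n))"
      proof (rule inj_onI)
        fix k l assume kl: "k \<in> carrier (integer_mod_group n)" "l \<in> carrier (integer_mod_group n)" "?f k = ?f l"
        then have "k mod int n = l mod int n" unfolding eq by (simp add: mod_eq_dvd_iff)
        then show "k = l" using kl(1,2) n by (simp add: carrier_integer_mod_group)
      qed
      show "?f ` carrier (integer_mod_group n) = carrier (P Mod N)"
      proof
        show "?f ` carrier (integer_mod_group n) \<subseteq> carrier (P Mod N)"
          using g by (auto simp: FactGroup_def RCOSETS_def)
        show "carrier (P Mod N) \<subseteq> ?f ` carrier (integer_mod_group n)"
        proof
          fix c assume "c \<in> carrier (P Mod N)"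
          then obtain x where x: "x \<in> carrier P" "c = N #>\<^bsub>P\<^esub> x" by (auto simp: FactGroup_def RCOSETS_def)
          obtain k y where ky: "y \<in> N" "x = y \<otimes>\<^bsub>P\<^esub> g k" using gen[OF x(1)] by blast
          then have "x \<in> N #>\<^bsub>P\<^esub> g k" by (auto simp: r_coset_def)
          then have "c = ?f k" using P.repr_independence[OF _ g sub] x(2) by simp
          also have "\<dots> = ?f (k mod int n)" unfolding eq by (simp add: mod_eq_dvd_iff[symmetric])
          finally show "c \<in> ?f ` carrier (integer_mod_group n)"
            using n by (auto simp: carrier_integer_mod_group)
        qed
      qed
    qed
  qed
  then show ?thesis by (intro group.iso_sym[OF group_integer_mod_group]) (rule is_isoI)
qed

text \<open>
  Up to \<open>f\<close>, the group \<open>K\<close> is a complement of \<open>N\<close>.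
\<close>

lemma Mod_complement:
  assumes P: "group P" and N: "N \<lhd> P" and K: "group K" and f: "f \<in> hom K P"
    and int: "\<And>x. \<lbrakk>x \<in> carrier K; f x \<in> N\<rbrakk> \<Longrightarrow> x = \<one>\<^bsub>K\<^esub>"
    and gen: "\<And>x. x \<in> carrier P \<Longrightarrow> \<exists>k\<in>carrier K. \<exists>y\<in>N. x = y \<otimes>\<^bsub>P\<^esub> f k"
  shows "P Mod N \<cong> K"
proof -
  interpret P: group P by (rule P)
  interpret K: group K by (rule K)
  interpret Q: group "P Mod N" by (rule normal.factorgroup_is_group[OF N])
  interpret f: group_hom K P f by (intro group_hom.intro group_hom_axioms.intro K P f)
  have sub: "subgroup N P" by (rule normal_imp_subgroup[OF N])
  let ?f = "\<lambda>k. N #>\<^bsub>P\<^esub> f k"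
  have hom: "?f \<in> hom K (P Mod N)"
  proof (rule homI)
    show "?f x \<in> carrier (P Mod N)" if "x \<in> carrier K" for x
      using f.hom_closed[OF that] by (auto simp: FactGroup_def RCOSETS_def)
    show "?f (x \<otimes>\<^bsub>K\<^esub> y) = ?f x \<otimes>\<^bsub>P Mod N\<^esub> ?f y" if "x \<in> carrier K" "y \<in> carrier K" for x y
      unfolding f.hom_mult[OF that]
      using normal.rcos_sum[OF N f.hom_closed[OF that(1)] f.hom_closed[OF that(2)]] by (simp add: FactGroup_def)
  qed
  interpret q: group_hom K "P Mod N" ?f by (intro group_hom.intro group_hom_axioms.intro K Q.is_group hom)
  have "?f ` carrier K = carrier (P Mod N)"
  proof
    show "?f ` carrier K \<subseteq> carrier (P Mod N)" using q.hom_closed by blast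
    show "carrier (P Mod N) \<subseteq> ?f ` carrier K"
    proof
      fix c assume "c \<in> carrier (P Mod N)"
      then obtain x where x: "x \<in> carrier P" "c = N #>\<^bsub>P\<^esub> x" by (auto simp: FactGroup_def RCOSETS_def)
      obtain k y where ky: "k \<in> carrier K" "y \<in> N" "x = y \<otimes>\<^bsub>P\<^esub> f k" using gen[OF x(1)] by blast
      then have "x \<in> N #>\<^bsub>P\<^esub> f k" by (auto simp: r_coset_def)
      then have "c = ?f k" using P.repr_independence[OF _ f.hom_closed[OF ky(1)] sub] x(2) by simp
      then show "c \<in> ?f ` carrier K" using ky(1) by blast
    qed
  qed
  moreover have "inj_on ?f (carrier K)"
  proof (rule q.trivial_ker_imp_inj)
    show "kernel K (P Mod N) ?f = {\<one>\<^bsub>K\<^esub>}"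
    proof
      show "kernel K (P Mod N) ?f \<subseteq> {\<one>\<^bsub>K\<^esub>}"
      proof
        fix x assume "x \<in> kernel K (P Mod N) ?f"
        then have x: "x \<in> carrier K" "N #>\<^bsub>P\<^esub> f x = N" by (auto simp: kernel_def FactGroup_def)
        then have "f x \<in> N" using P.coset_join1[OF x(2) f.hom_closed[OF x(1)] sub] by simp
        then show "x \<in> {\<one>\<^bsub>K\<^esub>}" using int[OF x(1)] by simp
      qed
      show "{\<one>\<^bsub>K\<^esub>} \<subseteq> kernel K (P Mod N) ?f" using q.hom_one by (auto simp: kernel_def)
    qed
  qed
  ultimately have "?f \<in> iso K (P Mod N)" using hom by (simp add: iso_def bij_betw_def)
  then show ?thesis by (intro K.iso_sym) (rule is_isoI)
qed

locale binary_pair =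
  fixes A B :: "quaternion set"
  assumes subgroup_A: "subgroup A Sp1" and subgroup_B: "subgroup B Sp1"
begin

abbreviation N :: "(quaternion \<times> quaternion) set" where "N \<equiv> real_part_subgroup A B"

lemma normal_N: "N \<lhd> pair_group A B"
  by (rule normal_real_part_subgroup[OF subgroup_A subgroup_B])

lemma subgroup_N: "subgroup N (Sp1 \<times>\<times> Sp1)"
  unfolding real_part_subgroup_def
  using subgroup.subset[OF subgroup_A] subgroup.subset[OF subgroup_B]
  by (intro Sp1xSp1.generate_is_subgroup) auto

lemma N_subset: "N \<subseteq> A \<times> B"
  using subgroup.subset[OF normal_imp_subgroup[OF normal_N]] by simp

lemma A_closed: "quat_1 \<in> A" "a \<in> A \<Longrightarrow> a' \<in> A \<Longrightarrow> a \<star> a' \<in> A" "a \<in> A \<Longrightarrow> quat_cnj a \<in> A" "a \<in> A \<Longrightarrow> norm a = 1"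
  using subgroup.one_closed[OF subgroup_A] subgroup.m_closed[OF subgroup_A, of a a']
    subgroup.m_inv_closed[OF subgroup_A, of a] subgroup.mem_carrier[OF subgroup_A, of a] by auto

lemma B_closed: "quat_1 \<in> B" "b \<in> B \<Longrightarrow> b' \<in> B \<Longrightarrow> b \<star> b' \<in> B" "b \<in> B \<Longrightarrow> quat_cnj b \<in> B" "b \<in> B \<Longrightarrow> norm b = 1"
  using subgroup.one_closed[OF subgroup_B] subgroup.m_closed[OF subgroup_B, of b b']
    subgroup.m_inv_closed[OF subgroup_B, of b] subgroup.mem_carrier[OF subgroup_B, of b] by auto

lemma N_gen: "\<lbrakk>a \<in> A; b \<in> B; fst a = fst b\<rbrakk> \<Longrightarrow> (a, b) \<in> N"
  unfolding real_part_subgroup_def by (rule generate.incl) auto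

lemma N_one: "(quat_1, quat_1) \<in> N"
  by (rule N_gen) (simp_all add: A_closed B_closed)

lemma N_mult: "\<lbrakk>(a, b) \<in> N; (c, d) \<in> N\<rbrakk> \<Longrightarrow> (a \<star> c, b \<star> d) \<in> N"
  using subgroup.m_closed[OF subgroup_N, of "(a, b)" "(c, d)"] by simp

lemma N_cnj: "(a, b) \<in> N \<Longrightarrow> (quat_cnj a, quat_cnj b) \<in> N"
proof -
  assume ab: "(a, b) \<in> N"
  then have "a \<in> A" "b \<in> B" using N_subset by auto
  then have "norm a = 1" "norm b = 1" by (simp_all add: A_closed(4) B_closed(4))
  then show ?thesis using subgroup.m_inv_closed[OF subgroup_N ab] by (simp add: inv_DirProd[OF group_Sp1 group_Sp1])
qed

lemma N_minus: "(- quat_1, - quat_1) \<in> N" if "- quat_1 \<in> A" "- quat_1 \<in> B"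
  by (rule N_gen) (use that in auto)

lemma N_least:
  assumes H: "subgroup H (Sp1 \<times>\<times> Sp1)" and "\<And>a b. \<lbrakk>a \<in> A; b \<in> B; fst a = fst b\<rbrakk> \<Longrightarrow> (a, b) \<in> H"
  shows "N \<subseteq> H"
  unfolding real_part_subgroup_def
  by (rule Sp1xSp1.generate_subgroup_incl[OF _ H]) (use assms(2) in auto)

lemma left_kernel: "subgroup {a \<in> A. (a, quat_1) \<in> N} Sp1"
proof (rule Sp1.subgroupI)
  show "{a \<in> A. (a, quat_1) \<in> N} \<noteq> {}" using A_closed(1) N_one by blast
  show "inv\<^bsub>Sp1\<^esub> a \<in> {a \<in> A. (a, quat_1) \<in> N}" if "a \<in> {a \<in> A. (a, quat_1) \<in> N}" for a
    using that N_cnj[of a quat_1] A_closed by (auto simp: quat_cnj_def quat_1_def)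
  show "a \<otimes>\<^bsub>Sp1\<^esub> b \<in> {a \<in> A. (a, quat_1) \<in> N}"
    if "a \<in> {a \<in> A. (a, quat_1) \<in> N}" "b \<in> {a \<in> A. (a, quat_1) \<in> N}" for a b
    using that N_mult[of a quat_1 b quat_1] A_closed by auto
qed (use A_closed in auto)

lemma right_kernel: "subgroup {b \<in> B. (quat_1, b) \<in> N} Sp1"
proof (rule Sp1.subgroupI)
  show "{b \<in> B. (quat_1, b) \<in> N} \<noteq> {}" using B_closed(1) N_one by blast
  show "inv\<^bsub>Sp1\<^esub> a \<in> {b \<in> B. (quat_1, b) \<in> N}" if "a \<in> {b \<in> B. (quat_1, b) \<in> N}" for a
    using that N_cnj[of quat_1 a] B_closed by (auto simp: quat_cnj_def quat_1_def)
  show "a \<otimes>\<^bsub>Sp1\<^esub> b \<in> {b \<in> B. (quat_1, b) \<in> N}"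
    if "a \<in> {b \<in> B. (quat_1, b) \<in> N}" "b \<in> {b \<in> B. (quat_1, b) \<in> N}" for a b
    using that N_mult[of quat_1 a quat_1 b] B_closed by auto
qed (use B_closed in auto)

end

text \<open>
  Differences in the multiplicative sense; their role is shown by \<open>right_kernel_differences\<close>.
\<close>

definition differences :: "real \<Rightarrow> quaternion set \<Rightarrow> quaternion set" where
  "differences s B = {p \<star> quat_cnj q | p q. p \<in> B \<and> q \<in> B \<and> fst p = s \<and> fst q = s}"

lemma differencesI: "p \<in> B \<Longrightarrow> q \<in> B \<Longrightarrow> fst p = s \<Longrightarrow> fst q = s \<Longrightarrow> p \<star> quat_cnj q \<in> differences s B"
  unfolding differences_def by blast

context binary_pair
begin

text \<open>
  If \<open>p\<close> and \<open>q\<close> have the same real part as \<open>a\<close>, then \<open>N\<close> contains \<open>(a, p)\<close> and \<open>(a, q)\<close>, hence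
  \<open>(1, p q\<^sup>-\<^sup>1)\<close>.
\<close>

lemma right_kernel_differences:
  assumes "a \<in> A" "b \<in> generate Sp1 (differences (fst a) B)"
  shows "(quat_1, b) \<in> N"
proof -
  have "differences (fst a) B \<subseteq> {b \<in> B. (quat_1, b) \<in> N}"
  proof
    fix x assume "x \<in> differences (fst a) B"
    then obtain p q where x: "x = p \<star> quat_cnj q" "p \<in> B" "q \<in> B" "fst p = fst a" "fst q = fst a"
      unfolding differences_def by blast
    have "(a \<star> quat_cnj a, p \<star> quat_cnj q) \<in> N"
      by (rule N_mult[OF N_gen[OF assms(1) x(2) x(4)[symmetric]]
          N_cnj[OF N_gen[OF assms(1) x(3) x(5)[symmetric]]]])
    then have "(quat_1, x) \<in> N"
      unfolding x(1) by (simp only: quat_mult_cnj(1)[OF A_closed(4)[OF assms(1)]])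
    moreover have "x \<in> B" unfolding x(1) by (intro B_closed(2) B_closed(3) x(2,3))
    ultimately show "x \<in> {b \<in> B. (quat_1, b) \<in> N}" by blast
  qed
  then have "generate Sp1 (differences (fst a) B) \<subseteq> {b \<in> B. (quat_1, b) \<in> N}"
    by (rule Sp1.generate_subgroup_incl[OF _ right_kernel])
  then show ?thesis using assms(2) by blast
qed

text \<open>
  If \<open>a\<close> has the same real part as \<open>b\<close>, then \<open>N\<close> contains \<open>(a, b)\<close> and \<open>(1, b\<^sup>-\<^sup>1)\<close>.
\<close>

lemma left_kernel_shared:
  assumes full: "\<And>b. b \<in> B \<Longrightarrow> (quat_1, b) \<in> N"
    and a: "a \<in> generate Sp1 {a \<in> A. fst a \<in> fst ` B}"
  shows "(a, quat_1) \<in> N"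
proof -
  have "{a \<in> A. fst a \<in> fst ` B} \<subseteq> {a \<in> A. (a, quat_1) \<in> N}"
  proof
    fix x assume "x \<in> {a \<in> A. fst a \<in> fst ` B}"
    then obtain b where x: "x \<in> A" "b \<in> B" "fst x = fst b" by auto
    then have "(x \<star> quat_1, b \<star> quat_cnj b) \<in> N"
      using N_mult[OF N_gen full[OF B_closed(3)[OF x(2)]]] by blast
    then show "x \<in> {a \<in> A. (a, quat_1) \<in> N}" using x B_closed(4) by (simp add: quat_mult_cnj)
  qed
  then have "generate Sp1 {a \<in> A. fst a \<in> fst ` B} \<subseteq> {a \<in> A. (a, quat_1) \<in> N}"
    by (rule Sp1.generate_subgroup_incl[OF _ left_kernel])
  then show ?thesis using a by blast
qed

lemma trivial_quotient:
  assumes "\<And>a. a \<in> A \<Longrightarrow> (a, quat_1) \<in> N" "\<And>b. b \<in> B \<Longrightarrow> (quat_1, b) \<in> N"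
  shows "trivial_group (quotient_group A B)"
proof -
  interpret P: group "pair_group A B" by (rule group_pair[OF subgroup_A subgroup_B])
  have "N = A \<times> B"
  proof (rule subset_antisym)
    show "N \<subseteq> A \<times> B" by (rule N_subset)
    show "A \<times> B \<subseteq> N"
    proof
      fix x assume "x \<in> A \<times> B"
      then obtain a b where "x = (a, b)" "a \<in> A" "b \<in> B" by blast
      then show "x \<in> N" using N_mult[OF assms(1) assms(2), of a b] by simp
    qed
  qed
  have coset: "N #>\<^bsub>pair_group A B\<^esub> x = A \<times> B" if "x \<in> A \<times> B" for x
    using P.coset_join2[OF _ P.subgroup_self, of x] that unfolding \<open>N = A \<times> B\<close> by simp
  have "carrier (quotient_group A B) = (\<Union>x\<in>A \<times> B. {N #>\<^bsub>pair_group A B\<^esub> x})"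
    by (simp add: quotient_group_def FactGroup_def RCOSETS_def)
  also have "\<dots> = (\<Union>x\<in>A \<times> B. {A \<times> B})" by (rule SUP_cong[OF refl]) (simp only: coset)
  also have "\<dots> = {A \<times> B}" using A_closed(1) B_closed(1) by blast
  finally have "carrier (quotient_group A B) = {A \<times> B}" .
  moreover have "\<one>\<^bsub>quotient_group A B\<^esub> = A \<times> B"
    using \<open>N = A \<times> B\<close> by (simp add: quotient_group_def FactGroup_def)
  ultimately show ?thesis
    using normal.factorgroup_is_group[OF normal_N] by (simp add: trivial_group_def quotient_group_def)
qed

lemma quotient_group_trivial:
  assumes "s \<in> fst ` A" "B \<subseteq> generate Sp1 (differences s B)" "A \<subseteq> generate Sp1 {a \<in> A. fst a \<in> fst ` B}"
  shows "trivial_group (quotient_group A B)"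
proof (rule trivial_quotient)
  obtain a where a: "a \<in> A" "s = fst a" using assms(1) by blast
  show full: "(quat_1, b) \<in> N" if "b \<in> B" for b
    using right_kernel_differences[OF a(1)] assms(2) that a(2) by blast
  show "(a, quat_1) \<in> N" if "a \<in> A" for a
    using left_kernel_shared[OF full] assms(3) that by blast
qed

lemma quotient_group_cyclic:
  fixes g h :: "int \<Rightarrow> quaternion"
  assumes n: "n > 0" and g: "\<And>k. g k \<in> A" "\<And>k l. g (k + l) = g k \<star> g l"
    and h: "\<And>k. h k \<in> B" "\<And>k l. h (k + l) = h k \<star> h l"
    and gen: "\<And>a b. \<lbrakk>a \<in> A; b \<in> B\<rbrakk> \<Longrightarrow> \<exists>k c d. (c, d) \<in> N \<and> a = c \<star> g k \<and> b = d \<star> h k"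
    and ord: "\<And>k. (g k, h k) \<in> N \<longleftrightarrow> int n dvd k"
  shows "quotient_group A B \<cong> integer_mod_group n"
  unfolding quotient_group_def
proof (rule Mod_cyclic[OF group_pair[OF subgroup_A subgroup_B] normal_N n])
  show "\<exists>k. \<exists>y\<in>N. x = y \<otimes>\<^bsub>pair_group A B\<^esub> (g k, h k)" if carr: "x \<in> carrier (pair_group A B)" for x
  proof -
    obtain a b where x: "x = (a, b)" "a \<in> A" "b \<in> B"
      using carr unfolding pair_group_simps by (rule SigmaE)
    obtain k c d where "(c, d) \<in> N" "a = c \<star> g k" "b = d \<star> h k" using gen[OF x(2,3)] by blast
    then show ?thesis unfolding x(1) by (intro exI[of _ k] bexI[of _ "(c, d)"]) simp_all
  qed
qed (use g h ord in auto)

text \<open>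
  The first assumptions give \<open>N = A0 \<times> B\<close>, so the quotient is \<open>A\<close> modulo \<open>A0\<close>, generated by
  \<open>g 1\<close>.
\<close>

lemma quotient_group_cyclic_left:
  fixes g :: "int \<Rightarrow> quaternion"
  assumes s: "s \<in> fst ` A" and B: "B \<subseteq> generate Sp1 (differences s B)"
    and A0: "subgroup A0 Sp1" "\<And>a. \<lbrakk>a \<in> A; fst a \<in> fst ` B\<rbrakk> \<Longrightarrow> a \<in> A0"
      "A0 \<subseteq> generate Sp1 {a \<in> A. fst a \<in> fst ` B}"
    and n: "n > 0" and g: "\<And>k. g k \<in> A" "\<And>k l. g (k + l) = g k \<star> g l"
    and gen: "\<And>a. a \<in> A \<Longrightarrow> \<exists>k. \<exists>c\<in>A0. a = c \<star> g k" and ord: "\<And>k. g k \<in> A0 \<longleftrightarrow> int n dvd k"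
  shows "quotient_group A B \<cong> integer_mod_group n"
proof (rule quotient_group_cyclic[OF n g, of "\<lambda>_. quat_1"])
  obtain a where a: "a \<in> A" "s = fst a" using s by blast
  have full: "(quat_1, b) \<in> N" if "b \<in> B" for b
    using right_kernel_differences[OF a(1)] B that a(2) by blast
  have A0N: "(a, quat_1) \<in> N" if "a \<in> A0" for a
    using left_kernel_shared[OF full] A0(3) that by blast
  have "N \<subseteq> A0 \<times> B"
    by (rule N_least[OF subgroup_pair[OF A0(1) subgroup_B]]) (use A0(2) in force)
  then show "(g k, quat_1) \<in> N \<longleftrightarrow> int n dvd k" for k
    using ord A0N by blast
  show "\<exists>k c d. (c, d) \<in> N \<and> a = c \<star> g k \<and> b = d \<star> quat_1" if "a \<in> A" "b \<in> B" for a b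
  proof -
    obtain k c where c: "c \<in> A0" "a = c \<star> g k" using gen[OF \<open>a \<in> A\<close>] by blast
    have "(c, b) \<in> N" using N_mult[OF A0N[OF c(1)] full[OF \<open>b \<in> B\<close>]] by simp
    moreover have "b = b \<star> quat_1" by simp
    ultimately show ?thesis using c(2) by blast
  qed
qed (auto simp: B_closed)

end

section \<open>Real parts and generators of the standard groups\<close>

abbreviation cyc :: "nat \<Rightarrow> quaternion set" where "cyc n \<equiv> cyclic_quat (axis 1 1) n"
abbreviation dic :: "nat \<Rightarrow> quaternion set" where "dic n \<equiv> dicyclic_quat (axis 1 1) (axis 2 1) n"
abbreviation rot1 :: "real \<Rightarrow> quaternion" where "rot1 \<equiv> qrot (axis 1 1)"

lemma rot1_coords: "rot1 t = (cos t, vector [sin t, 0, 0])"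
  by (simp add: qrot_def axis_vector vector_3_ops)

lemma quat_j_axis: "(0, axis 2 1) = quat_j" by (simp add: quat_j_def)

lemma rot1_add: "rot1 (s + t) = rot1 s \<star> rot1 t" by (rule qrot_add) simp

lemma rot1_cnj: "quat_cnj (rot1 t) = rot1 (- t)" by (simp add: qrot_minus)

lemma rot1_pi2: "rot1 (pi / 2) = quat_i" by (simp add: rot1_coords quat_unit_coords)

lemma subgroup_cyc: "subgroup (cyc n) Sp1" by (rule subgroup_cyclic_quat) simp

lemma subgroup_dic: "n > 0 \<Longrightarrow> subgroup (dic n) Sp1"
  by (rule subgroup_dicyclic_quat) (simp_all add: inner_axis_axis)

lemma dic_eq: "dic n = cyc n \<union> (\<lambda>q. q \<star> quat_j) ` cyc n"
  by (simp add: dicyclic_quat_def quat_j_axis)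

lemma fst_rot1_j: "fst (rot1 t \<star> quat_j) = 0"
  by (simp add: rot1_coords quat_unit_coords quat_mult_coords)

lemma cyc_dvd:
  fixes m n :: nat
  assumes "m dvd n" "n > 0"
  shows "rot1 (of_int k * pi / m) \<in> cyc n"
proof -
  obtain d where "n = m * d" using assms(1) by (rule dvdE)
  then have d: "n = m * d" "m > 0" "d > 0" using assms(2) by auto
  have "of_int k * pi / m = of_int (k * d) * pi / n" using d by (simp add: field_simps)
  then show ?thesis using cyclic_quatI[of _ "k * d" n] by simp
qed

lemma cyc_dvd1: "(m::nat) dvd n \<Longrightarrow> n > 0 \<Longrightarrow> rot1 (pi / m) \<in> cyc n"
  using cyc_dvd[of m n 1] by simp

lemma real_parts_cyc:
  "even n \<Longrightarrow> n > 0 \<Longrightarrow> 0 \<in> fst ` cyc n"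
  "3 dvd n \<Longrightarrow> n > 0 \<Longrightarrow> 1/2 \<in> fst ` cyc n"
  "4 dvd n \<Longrightarrow> n > 0 \<Longrightarrow> sqrt 2 / 2 \<in> fst ` cyc n"
  using cyc_dvd1[of 2 n] cyc_dvd1[of 3 n] cyc_dvd1[of 4 n]
  by (force simp: cos_60 cos_45)+

lemma real_parts_dic:
  "n > 0 \<Longrightarrow> 0 \<in> fst ` dic n"
  "3 dvd n \<Longrightarrow> n > 0 \<Longrightarrow> 1/2 \<in> fst ` dic n"
  "4 dvd n \<Longrightarrow> n > 0 \<Longrightarrow> sqrt 2 / 2 \<in> fst ` dic n"
proof -
  assume "n > 0"
  have "rot1 0 \<in> cyc n" using cyclic_quatI[of _ 0 n] by simp
  then have "rot1 0 \<star> quat_j \<in> dic n" unfolding dic_eq by blast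
  then show "0 \<in> fst ` dic n" using fst_rot1_j by (metis imageI)
qed (use real_parts_cyc in \<open>simp_all add: dic_eq image_Un\<close>)

lemma unit_quats_in_T: "quat_i \<in> binary_T" "quat_j \<in> binary_T" "quat_k \<in> binary_T" "quat_w \<in> binary_T"
  "quat_1 \<in> binary_T" "- quat_1 \<in> binary_T"
  using binary_T(2,3) binary_T(4)[of quat_i quat_j] binary_T(4)[of quat_i quat_i] by (simp_all add: quat_units_mult)

lemma O_products:
  "quat_ti \<star> quat_ti = quat_i" "quat_tj \<star> quat_tj = quat_j" "quat_ti \<star> quat_tj = quat_w"
  by (simp_all add: quat_ti_def quat_tj_def quat_w_def quat_unit_coords quat_mult_coords vector_3_eq_iff)

lemma unit_quats_in_O: "quat_i \<in> binary_O" "quat_j \<in> binary_O" "quat_k \<in> binary_O" "quat_w \<in> binary_O"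
  "quat_ti \<in> binary_O" "quat_tj \<in> binary_O" "quat_tk \<in> binary_O" "quat_1 \<in> binary_O"
proof -
  show i: "quat_i \<in> binary_O" and j: "quat_j \<in> binary_O" and "quat_w \<in> binary_O"
    using binary_O(2) binary_O(4)[of quat_ti quat_ti] binary_O(4)[of quat_tj quat_tj] binary_O(4)[of quat_ti quat_tj]
    by (simp_all add: O_products)
  show "quat_k \<in> binary_O" using binary_O(4)[OF i j] by (simp add: quat_units_mult)
qed (use binary_O(2,3) in auto)

lemma unit_quats_in_I: "quat_i \<in> binary_I" "quat_j \<in> binary_I" "quat_k \<in> binary_I" "quat_w \<in> binary_I"
  "quat_r \<in> binary_I" "quat_1 \<in> binary_I"
  using binary_I(2,3) binary_I(4)[of quat_i quat_j] by (simp_all add: quat_units_mult)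

lemma real_parts_TOI:
  "0 \<in> fst ` binary_T" "1/2 \<in> fst ` binary_T"
  "0 \<in> fst ` binary_O" "1/2 \<in> fst ` binary_O" "sqrt 2 / 2 \<in> fst ` binary_O"
  "0 \<in> fst ` binary_I" "1/2 \<in> fst ` binary_I"
  using imageI[OF unit_quats_in_T(1), of fst] imageI[OF unit_quats_in_T(4), of fst]
    imageI[OF unit_quats_in_O(1), of fst] imageI[OF unit_quats_in_O(4), of fst] imageI[OF unit_quats_in_O(5), of fst]
    imageI[OF unit_quats_in_I(1), of fst] imageI[OF unit_quats_in_I(4), of fst]
  by (simp_all add: quat_i_def quat_w_def quat_ti_def)

lemma generate_Sp1I:
  assumes S: "S \<subseteq> carrier Sp1"
  shows "x \<in> S \<Longrightarrow> x \<in> generate Sp1 S" "quat_1 \<in> generate Sp1 S"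
    "p \<in> generate Sp1 S \<Longrightarrow> q \<in> generate Sp1 S \<Longrightarrow> p \<star> q \<in> generate Sp1 S"
    "p \<in> generate Sp1 S \<Longrightarrow> quat_cnj p \<in> generate Sp1 S"
  using generate_Sp1_closed[OF refl S] by blast+

lemma differences_carrier: "B \<subseteq> carrier Sp1 \<Longrightarrow> differences s B \<subseteq> carrier Sp1"
  by (auto simp: differences_def norm_quat_mult subset_iff)

text \<open>
  The elements outside \<open>cyc n\<close> have real part \<open>0\<close>, and their quotients fill \<open>cyc n\<close>.
\<close>

lemma dic_generated:
  assumes n: "n > 0"
  shows "dic n \<subseteq> generate Sp1 {a \<in> dic n. fst a = 0}"
proof -
  let ?S = "{a \<in> dic n. fst a = 0}"
  have S: "?S \<subseteq> carrier Sp1" using subgroup.subset[OF subgroup_dic[OF n]] by blast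
  have v: "q \<star> quat_j \<in> generate Sp1 ?S" if "q \<in> cyc n" for q
  proof -
    have "fst (q \<star> quat_j) = 0" using that fst_rot1_j by (auto simp: cyclic_quat_def)
    then show ?thesis using that by (intro generate_Sp1I(1)[OF S]) (auto simp: dic_eq)
  qed
  have one: "quat_1 \<in> cyc n" using subgroup.one_closed[OF subgroup_cyc] by simp
  have c: "q \<in> generate Sp1 ?S" if "q \<in> cyc n" for q
  proof -
    have "(q \<star> quat_j) \<star> quat_cnj (quat_1 \<star> quat_j) \<in> generate Sp1 ?S"
      by (rule generate_Sp1I(3)[OF S v[OF that] generate_Sp1I(4)[OF S v[OF one]]])
    moreover have "(q \<star> quat_j) \<star> quat_cnj (quat_1 \<star> quat_j) = q"
      by (simp add: quat_mult_assoc quat_mult_cnj)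
    ultimately show ?thesis by simp
  qed
  show ?thesis
  proof
    fix x assume "x \<in> dic n"
    then consider "x \<in> cyc n" | q where "q \<in> cyc n" "x = q \<star> quat_j" unfolding dic_eq by blast
    then show "x \<in> generate Sp1 ?S" using v c by cases simp_all
  qed
qed

lemma dic_differences:
  assumes n: "n > 0"
  shows "cyc n \<subseteq> differences 0 (dic n)"
proof
  fix q assume q: "q \<in> cyc n"
  have 1: "quat_1 \<in> cyc n" using subgroup.one_closed[OF subgroup_cyc] by simp
  have "q = (q \<star> quat_j) \<star> quat_cnj (quat_1 \<star> quat_j)" by (simp add: quat_mult_assoc quat_mult_cnj)
  moreover have "(q \<star> quat_j) \<star> quat_cnj (quat_1 \<star> quat_j) \<in> differences 0 (dic n)"
  proof (rule differencesI)
    show "q \<star> quat_j \<in> dic n" "quat_1 \<star> quat_j \<in> dic n" unfolding dic_eq using q 1 by blast+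
    show "fst (q \<star> quat_j) = 0" using q fst_rot1_j by (auto simp: cyclic_quat_def)
    show "fst (quat_1 \<star> quat_j) = 0" by (simp add: quat_j_def)
  qed
  ultimately show "q \<in> differences 0 (dic n)" by simp
qed

text \<open>
  For even \<open>n\<close> both cosets of \<open>cyc n\<close> contain elements of real part \<open>0\<close>, namely \<open>i\<close> and \<open>j\<close>.
\<close>

lemma dic_full:
  assumes n: "n > 0" "even n"
  shows "dic n \<subseteq> generate Sp1 (differences 0 (dic n))"
proof -
  let ?D = "differences 0 (dic n)"
  have S: "?D \<subseteq> carrier Sp1" using subgroup.subset[OF subgroup_dic[OF n(1)]] by (rule differences_carrier)
  have c: "q \<in> generate Sp1 ?D" if "q \<in> cyc n" for q
    using dic_differences[OF n(1)] that generate_Sp1I(1)[OF S] by blast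
  have i: "quat_i \<in> cyc n" using cyc_dvd1[of 2 n] n rot1_pi2 by simp
  have "quat_j \<star> quat_cnj quat_i \<in> ?D"
  proof (rule differencesI)
    have 1: "quat_1 \<in> cyc n" using subgroup.one_closed[OF subgroup_cyc] by simp
    then have "quat_1 \<star> quat_j \<in> dic n" unfolding dic_eq by blast
    then show "quat_j \<in> dic n" by simp
    show "quat_i \<in> dic n" using i by (simp add: dic_eq)
  qed (simp_all add: quat_i_def quat_j_def)
  then have "(quat_j \<star> quat_cnj quat_i) \<star> quat_i \<in> generate Sp1 ?D"
    using c[OF i] generate_Sp1I(1,3)[OF S] by blast
  then have "quat_j \<in> generate Sp1 ?D" by (simp add: quat_mult_assoc quat_mult_cnj)
  note j = this
  show ?thesis
  proof
    fix x assume "x \<in> dic n"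
    then consider "x \<in> cyc n" | q where "q \<in> cyc n" "x = q \<star> quat_j" unfolding dic_eq by blast
    then show "x \<in> generate Sp1 ?D" using c generate_Sp1I(3)[OF S c j] by cases simp_all
  qed
qed

lemma generate_full:
  assumes "subgroup B Sp1" "B = generate Sp1 S" "S \<subseteq> generate Sp1 (differences s B)"
  shows "B \<subseteq> generate Sp1 (differences s B)"
proof -
  have "differences s B \<subseteq> carrier Sp1" using subgroup.subset[OF assms(1)] by (rule differences_carrier)
  then have "subgroup (generate Sp1 (differences s B)) Sp1" by (rule Sp1.generate_is_subgroup)
  then have "generate Sp1 S \<subseteq> generate Sp1 (differences s B)"
    using Sp1.generate_subgroup_incl[OF assms(3)] by blast
  then show ?thesis using assms(2) by simp
qed

lemma difference_solve: "norm q = 1 \<Longrightarrow> p = (p \<star> q) \<star> quat_cnj q"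
  by (simp add: quat_mult_assoc quat_mult_cnj)

text \<open>
  Write \<open>x = (x q) q\<^sup>-\<^sup>1\<close>.
\<close>

lemma differences_solve:
  assumes B: "subgroup B Sp1" and "x \<in> B" "q \<in> B" "fst q = s" "fst (x \<star> q) = s"
  shows "x \<in> generate Sp1 (differences s B)"
proof -
  have "differences s B \<subseteq> carrier Sp1" using subgroup.subset[OF B] by (rule differences_carrier)
  moreover have "x \<star> q \<in> B" using subgroup.m_closed[OF B assms(2,3)] by simp
  then have "(x \<star> q) \<star> quat_cnj q \<in> differences s B" using assms by (intro differencesI)
  ultimately show ?thesis
    using difference_solve[of q x] subgroup.mem_carrier[OF B assms(3)] generate_Sp1I(1) by simp
qed

lemma O_full: "binary_O \<subseteq> generate Sp1 (differences 0 binary_O)"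
proof (rule generate_full[OF binary_O(1) binary_O_def])
  have "quat_ti \<in> generate Sp1 (differences 0 binary_O)"
    by (rule differences_solve[OF binary_O(1) _ unit_quats_in_O(2)])
      (simp_all add: unit_quats_in_O, simp_all add: quat_unit_coords quat_ti_def quat_mult_coords)
  moreover have "quat_tj \<in> generate Sp1 (differences 0 binary_O)"
    by (rule differences_solve[OF binary_O(1) _ unit_quats_in_O(1)])
      (simp_all add: unit_quats_in_O, simp_all add: quat_unit_coords quat_tj_def quat_mult_coords)
  moreover have "quat_tk \<in> generate Sp1 (differences 0 binary_O)"
    by (rule differences_solve[OF binary_O(1) _ unit_quats_in_O(1)])
      (simp_all add: unit_quats_in_O, simp_all add: quat_unit_coords quat_tk_def quat_mult_coords)
  ultimately show "{quat_ti, quat_tj, quat_tk} \<subseteq> generate Sp1 (differences 0 binary_O)" by simp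
qed

lemma I_full: "binary_I \<subseteq> generate Sp1 (differences 0 binary_I)"
proof (rule generate_full[OF binary_I(1) binary_I_def])
  have "quat_i \<in> generate Sp1 (differences 0 binary_I)"
    by (rule differences_solve[OF binary_I(1) _ unit_quats_in_I(2)])
      (simp_all add: unit_quats_in_I, simp_all add: quat_unit_coords quat_mult_coords)
  moreover have "quat_j \<in> generate Sp1 (differences 0 binary_I)"
    by (rule differences_solve[OF binary_I(1) _ unit_quats_in_I(1)])
      (simp_all add: unit_quats_in_I, simp_all add: quat_unit_coords quat_mult_coords)
  moreover have "quat_w \<in> generate Sp1 (differences 0 binary_I)"
  proof (rule differences_solve[OF binary_I(1) unit_quats_in_I(4)])
    show "quat_i \<star> quat_r \<star> quat_j \<in> binary_I" using binary_I(4) unit_quats_in_I by simp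
  qed (simp_all add: quat_unit_coords quat_mult_coords quat_r_def quat_w_def field_simps)
  moreover have "quat_r \<in> generate Sp1 (differences 0 binary_I)"
    by (rule differences_solve[OF binary_I(1) _ unit_quats_in_I(3)])
      (simp_all add: unit_quats_in_I, simp_all add: quat_unit_coords quat_r_def quat_mult_coords)
  ultimately show "{quat_i, quat_j, quat_w, quat_r} \<subseteq> generate Sp1 (differences 0 binary_I)" by simp
qed

text \<open>
  For the imaginary units take \<open>q = w\<^sup>-\<^sup>1\<close> in \<open>differences_solve\<close>.  The square \<open>w (w\<^sup>-\<^sup>1)\<^sup>-\<^sup>1\<close> is a
  difference, and \<open>w = - w\<^sup>-\<^sup>2\<close> because \<open>w\<^sup>3 = -1\<close>.
\<close>

lemma half_differences:
  assumes B: "subgroup B Sp1" and mem: "quat_i \<in> B" "quat_j \<in> B" "quat_k \<in> B" "quat_w \<in> B"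
  shows "{quat_i, quat_j, quat_k, quat_w} \<subseteq> generate Sp1 (differences (1/2) B)"
proof -
  have cw: "quat_cnj quat_w \<in> B" using subgroup.m_inv_closed[OF B mem(4)] by simp
  have D: "differences (1/2) B \<subseteq> carrier Sp1" using subgroup.subset[OF B] by (rule differences_carrier)
  note gen = generate_Sp1I[OF D]
  have i: "quat_i \<in> generate Sp1 (differences (1/2) B)"
    by (rule differences_solve[OF B mem(1) cw])
      (simp_all add: quat_unit_coords quat_mult_coords quat_cnj_coords quat_w_def)
  have "quat_j \<in> generate Sp1 (differences (1/2) B)" "quat_k \<in> generate Sp1 (differences (1/2) B)"
    by (rule differences_solve[OF B _ cw];
      simp add: mem; simp add: quat_unit_coords quat_mult_coords quat_cnj_coords quat_w_def)+
  moreover have "quat_w \<in> generate Sp1 (differences (1/2) B)"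
  proof -
    have "quat_w \<star> quat_cnj (quat_cnj quat_w) \<in> differences (1/2) B"
      by (rule differencesI[OF mem(4) cw]) (simp_all add: quat_w_def quat_cnj_coords)
    then have "(quat_i \<star> quat_i) \<star> quat_cnj (quat_w \<star> quat_cnj (quat_cnj quat_w)) \<in> generate Sp1 (differences (1/2) B)"
      by (intro gen(3)[OF gen(3)[OF i i]] gen(4)[OF gen(1)])
    moreover have "(quat_i \<star> quat_i) \<star> quat_cnj (quat_w \<star> quat_cnj (quat_cnj quat_w)) = quat_w"
      by (simp add: quat_unit_coords quat_mult_coords quat_cnj_coords quat_w_def vector_3_eq_iff)
    ultimately show ?thesis by simp
  qed
  ultimately show ?thesis using i by simp
qed

lemma T_full: "binary_T \<subseteq> generate Sp1 (differences (1/2) binary_T)"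
  by (rule generate_full[OF binary_T(1) binary_T_def])
    (use half_differences[OF binary_T(1)] unit_quats_in_T in simp)

lemma I_full_half: "binary_I \<subseteq> generate Sp1 (differences (1/2) binary_I)"
proof (rule generate_full[OF binary_I(1) binary_I_def])
  have "quat_r \<in> generate Sp1 (differences (1/2) binary_I)"
  proof (rule differences_solve[OF binary_I(1) unit_quats_in_I(5)])
    show "quat_cnj (quat_k \<star> quat_j \<star> quat_w) \<in> binary_I" using binary_I(4,5) unit_quats_in_I by simp
  qed (simp_all add: quat_unit_coords quat_mult_coords quat_r_def quat_w_def quat_cnj_coords field_simps)
  then show "{quat_i, quat_j, quat_w, quat_r} \<subseteq> generate Sp1 (differences (1/2) binary_I)"
    using half_differences[OF binary_I(1)] unit_quats_in_I by simp
qed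

section \<open>Angles\<close>

lemma rot1_eq_iff: "rot1 s = rot1 t \<longleftrightarrow> (\<exists>z::int. s = t + 2 * pi * z)"
  using sin_cos_eq_iff[of s t] by (auto simp: rot1_coords vector_3_eq_iff)

lemma rot1_multiple_eq:
  assumes n: "n > 0"
  shows "rot1 (real_of_int k * pi / real n) = rot1 (real_of_int l * pi / real n) \<longleftrightarrow> 2 * int n dvd (k - l)"
proof -
  have "real_of_int k * pi / n = real_of_int l * pi / n + 2 * pi * z \<longleftrightarrow> k = l + 2 * int n * z" for z :: int
  proof -
    have "real_of_int k * pi / n = real_of_int l * pi / n + 2 * pi * z \<longleftrightarrow>
        pi * real_of_int k = pi * (real_of_int l + 2 * real n * z)"
      using n by (simp add: field_simps)
    also have "\<dots> \<longleftrightarrow> real_of_int k = real_of_int l + 2 * real n * z" by simp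
    also have "\<dots> \<longleftrightarrow> real_of_int k = real_of_int (l + 2 * int n * z)" by simp
    finally show ?thesis by (simp only: of_int_eq_iff)
  qed
  then have "rot1 (real_of_int k * pi / n) = rot1 (real_of_int l * pi / n) \<longleftrightarrow> (\<exists>z. k = l + 2 * int n * z)"
    unfolding rot1_eq_iff by simp
  also have "\<dots> \<longleftrightarrow> 2 * int n dvd (k - l)" by (auto simp: dvd_def algebra_simps)
  finally show ?thesis .
qed

lemma cos_multiple_eq:
  assumes m: "m > 0" and n: "n > 0"
    and eq: "cos (real_of_int j * pi / real m) = cos (real_of_int k * pi / real n)"
  shows "\<exists>z::int. j * int n = k * int m + 2 * int m * int n * z \<or> j * int n = - k * int m + 2 * int m * int n * z"
proof -
  obtain x where "x \<in> \<int>" and x: "real_of_int j * pi / m = real_of_int k * pi / n + 2 * x * pi \<or>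
      real_of_int j * pi / m = - (real_of_int k * pi / n) + 2 * x * pi"
    using eq unfolding cos_eq by blast
  then obtain z :: int where z: "x = of_int z" by (auto elim: Ints_cases)
  have "pi * (real_of_int j * n) = pi * (real_of_int k * m + 2 * real m * n * z) \<or>
      pi * (real_of_int j * n) = pi * (- real_of_int k * m + 2 * real m * n * z)"
    using x m n unfolding z by (simp add: field_simps)
  then have "real_of_int j * n = real_of_int k * m + 2 * real m * n * z \<or>
      real_of_int j * n = - real_of_int k * m + 2 * real m * n * z"
    by (simp only: mult_cancel_left pi_neq_zero simp_thms)
  then have "real_of_int (j * int n) = real_of_int (k * int m + 2 * int m * int n * z) \<or>
      real_of_int (j * int n) = real_of_int (- k * int m + 2 * int m * int n * z)" by simp
  then show ?thesis unfolding of_int_eq_iff by blast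
qed

lemma rot1_in_cyc_iff:
  assumes d: "d > 0" and m: "m > 0"
  shows "rot1 (real_of_int k * pi / real (d * m)) \<in> cyc m \<longleftrightarrow> int d dvd k"
proof
  assume "int d dvd k"
  then obtain l where "k = int d * l" by (auto simp: dvd_def)
  then have "real_of_int k * pi / real (d * m) = real_of_int l * pi / m" using d by simp
  then show "rot1 (real_of_int k * pi / real (d * m)) \<in> cyc m" using cyclic_quatI[of _ l m] by simp
next
  assume "rot1 (real_of_int k * pi / real (d * m)) \<in> cyc m"
  then obtain l :: int where "rot1 (real_of_int k * pi / real (d * m)) = rot1 (real_of_int l * pi / m)"
    by (auto simp: cyclic_quat_def)
  also have "real_of_int l * pi / m = real_of_int (int d * l) * pi / real (d * m)" using d by simp
  finally have "2 * int (d * m) dvd k - int d * l"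
    using rot1_multiple_eq[of "d * m" k "int d * l"] d m by (simp only: nat_0_less_mult_iff simp_thms)
  then obtain c where "k - int d * l = 2 * int (d * m) * c" by (rule dvdE)
  then have "k = int d * (l + 2 * int m * c)" by (simp add: algebra_simps)
  then show "int d dvd k" by simp
qed

lemma rot1_cyc_2_iff: "rot1 (real_of_int k * pi / 4) \<in> cyc 2 \<longleftrightarrow> 2 dvd k"
  "rot1 (real_of_int k * pi / 6) \<in> cyc 2 \<longleftrightarrow> 3 dvd k"
  using rot1_in_cyc_iff[of 2 2 k] rot1_in_cyc_iff[of 3 2 k] by simp_all

lemma rot1_pi: "rot1 pi = - quat_1"
  by (simp add: rot1_coords quat_unit_coords quat_minus_coords vec_eq_iff forall_3)

lemma cyc_2: "cyc 2 = {quat_1, quat_i, - quat_1, - quat_i}"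
proof
  show "cyc 2 \<subseteq> {quat_1, quat_i, - quat_1, - quat_i}"
  proof
    fix q assume "q \<in> cyc 2"
    then obtain k :: int where k: "q = rot1 (k * pi / 2)" by (auto simp: cyclic_quat_def)
    define r where "r = k mod 4"
    have "k = r + 4 * (k div 4)" by (simp add: r_def)
    then have "real_of_int k = real_of_int r + 4 * real_of_int (k div 4)" by (metis of_int_add of_int_mult of_int_numeral)
    then have "real_of_int k * pi / 2 = real_of_int r * pi / 2 + 2 * pi * real_of_int (k div 4)"
      by (simp add: field_simps)
    then have q: "q = rot1 (r * pi / 2)" unfolding k by (simp only: qrot_period)
    have "r \<in> {0, 1, 2, 3}" using pos_mod_bound[of 4 k] pos_mod_sign[of 4 k] unfolding r_def by auto
    moreover have "rot1 (3 * pi / 2) = - quat_i"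
      using qrot_pi[of "axis 1 1" "pi / 2"] rot1_pi2 by (simp add: field_simps)
    ultimately show "q \<in> {quat_1, quat_i, - quat_1, - quat_i}"
      unfolding q by (auto simp: rot1_pi2 rot1_pi)
  qed
  have "quat_1 \<in> cyc 2" "quat_i \<in> cyc 2"
    using cyclic_quatI[of "axis 1 1" 0 2] cyclic_quatI[of "axis 1 1" 1 2] by (simp_all add: rot1_pi2)
  then show "{quat_1, quat_i, - quat_1, - quat_i} \<subseteq> cyc 2" using minus_cyclic_quat[of 2] by simp
qed

lemma dic_2: "dic 2 = {quat_1, - quat_1, quat_i, - quat_i, quat_j, - quat_j, quat_k, - quat_k}"
  unfolding dic_eq cyc_2 by (auto simp: quat_units_mult)

lemma cyc_2_subset:
  assumes H: "subgroup H Sp1" and i: "quat_i \<in> H"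
  shows "cyc 2 \<subseteq> H"
proof -
  have "quat_cnj quat_i = - quat_i" by (simp add: quat_cnj_def quat_i_def)
  then show ?thesis
    using subgroup.one_closed[OF H] subgroup.m_closed[OF H i i] subgroup.m_inv_closed[OF H i] i
    by (simp add: cyc_2 quat_units_mult)
qed

lemma dic_2_subset:
  assumes H: "subgroup H Sp1" and i: "quat_i \<in> H" and j: "quat_j \<in> H"
  shows "dic 2 \<subseteq> H"
  unfolding dic_eq using cyc_2_subset[OF H i] subgroup.m_closed[OF H _ j] by auto

lemma zero_differences:
  assumes B: "subgroup B Sp1" and mem: "quat_i \<in> B" "quat_j \<in> B"
  shows "quat_i \<in> generate Sp1 (differences 0 B)" "quat_j \<in> generate Sp1 (differences 0 B)"
proof -
  have f: "fst quat_i = 0" "fst quat_j = 0" "fst (quat_i \<star> quat_j) = 0" "fst (quat_j \<star> quat_i) = 0"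
    by (simp_all add: quat_unit_coords quat_mult_coords)
  show "quat_i \<in> generate Sp1 (differences 0 B)" by (rule differences_solve[OF B mem f(2,3)])
  show "quat_j \<in> generate Sp1 (differences 0 B)" by (rule differences_solve[OF B mem(2,1) f(1,4)])
qed

lemma fst_dic_2: "q \<in> dic 2 \<Longrightarrow> fst q \<in> {0, 1, - 1}"
  by (auto simp: dic_2 quat_1_def quat_i_def quat_j_def quat_k_def)

lemma fst_dic_cases:
  assumes "q \<in> dic n"
  obtains k :: int where "q = rot1 (k * pi / n)" "fst q = cos (k * pi / n)"
    | k :: int where "q = rot1 (k * pi / n) \<star> quat_j" "fst q = 0"
  using assms fst_rot1_j by (auto simp: dic_eq cyclic_quat_def)

section \<open>Two cyclic groups\<close>

text \<open>
  Let \<open>a = rot1 (j \<pi> / (d m'))\<close>, \<open>b = rot1 (k \<pi> / (d n'))\<close> and \<open>L = j n' - k m'\<close>.  The real parts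
  of \<open>a\<close> and \<open>b\<close> agree iff the angles agree up to sign modulo \<open>2 \<pi>\<close>.  For equal angles \<open>L\<close> is a
  multiple of \<open>2 d m' n'\<close>; for opposite ones coprimality makes \<open>j\<close> a multiple of \<open>m'\<close> and \<open>k\<close> one of
  \<open>n'\<close>, and \<open>L\<close> is a multiple of \<open>2 m' n'\<close>.  Sums of both kinds yield all pairs with \<open>L\<close> divisible
  by \<open>2 m' n'\<close>, so \<open>L\<close> induces the isomorphism.
\<close>

theorem quotient_group_cyc_cyc:
  assumes d: "d > 0" and m': "m' > 0" and n': "n' > 0" and cop: "coprime m' n'"
  shows "quotient_group (cyc (d * m')) (cyc (d * n')) \<cong> integer_mod_group (2 * m' * n')"
proof -
  let ?m = "d * m'" and ?n = "d * n'"
  interpret binary_pair "cyc ?m" "cyc ?n" by (intro binary_pair.intro subgroup_cyc)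
  have mn: "?m > 0" "?n > 0" using assms by simp_all
  define a b :: "int \<Rightarrow> quaternion" where "a j = rot1 (j * pi / ?m)" and "b k = rot1 (k * pi / ?n)" for j k
  have a_add: "a (j + k) = a j \<star> a k" and b_add: "b (j + k) = b j \<star> b k" for j k
    unfolding a_def b_def rot1_add[symmetric] by (simp_all add: distrib_right add_divide_distrib)
  have a_in: "a j \<in> cyc ?m" and b_in: "b j \<in> cyc ?n" for j
    unfolding a_def b_def by (rule cyclic_quatI)+
  have a_cases: "\<exists>j. x = a j" if "x \<in> cyc ?m" for x using that by (auto simp: cyclic_quat_def a_def)
  have b_cases: "\<exists>j. x = b j" if "x \<in> cyc ?n" for x using that by (auto simp: cyclic_quat_def b_def)
  let ?L = "\<lambda>j k. j * int n' - k * int m'"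
  let ?P = "2 * int m' * int n'"
  define M where "M = {(a j, b k) | j k. ?P dvd ?L j k}"
  have M_iff: "(a j, b k) \<in> M \<longleftrightarrow> ?P dvd ?L j k" for j k
  proof
    assume "(a j, b k) \<in> M"
    then obtain j' k' where jk: "a j = a j'" "b k = b k'" "?P dvd ?L j' k'" by (auto simp: M_def)
    have "2 * int ?m dvd j - j'" "2 * int ?n dvd k - k'"
      using jk(1,2) rot1_multiple_eq mn unfolding a_def b_def by blast+
    then obtain x y where "j = j' + 2 * int ?m * x" "k = k' + 2 * int ?n * y"
      by (auto simp: dvd_def algebra_simps)
    then have "?L j k = ?L j' k' + ?P * (int d * (x - y))" by (simp add: algebra_simps)
    then show "?P dvd ?L j k" using jk(3) by (metis dvd_add dvd_triv_left)
  qed (auto simp: M_def)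
  have M_sub: "subgroup M (Sp1 \<times>\<times> Sp1)"
  proof (rule Sp1xSp1.subgroupI)
    show "M \<subseteq> carrier (Sp1 \<times>\<times> Sp1)" using A_closed(4)[OF a_in] B_closed(4)[OF b_in] by (auto simp: M_def)
    show "M \<noteq> {}" using M_iff[of 0 0] by auto
    fix x assume "x \<in> M"
    then obtain j k where x: "x = (a j, b k)" "?P dvd ?L j k" by (auto simp: M_def)
    have cnj: "quat_cnj (a j) = a (- j)" "quat_cnj (b k) = b (- k)" by (simp_all add: a_def b_def rot1_cnj)
    have "inv\<^bsub>Sp1 \<times>\<times> Sp1\<^esub> x = (a (- j), b (- k))"
      using A_closed(4)[OF a_in[of j]] B_closed(4)[OF b_in[of k]]
      by (simp add: x(1) inv_DirProd[OF group_Sp1 group_Sp1] cnj)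
    moreover have "?P dvd ?L (- j) (- k)"
    proof -
      have "?L (- j) (- k) = - ?L j k" by simp
      then show ?thesis using x(2) by (metis dvd_minus_iff)
    qed
    ultimately show "inv\<^bsub>Sp1 \<times>\<times> Sp1\<^esub> x \<in> M" using M_iff by simp
    fix y assume "y \<in> M"
    then obtain j' k' where y: "y = (a j', b k')" "?P dvd ?L j' k'" by (auto simp: M_def)
    have "?L (j + j') (k + k') = ?L j k + ?L j' k'" by (simp add: algebra_simps)
    then have "(a (j + j'), b (k + k')) \<in> M" using M_iff x(2) y(2) by (metis dvd_add)
    then show "x \<otimes>\<^bsub>Sp1 \<times>\<times> Sp1\<^esub> y \<in> M" by (simp add: x(1) y(1) a_add b_add)
  qed
  have "N \<subseteq> M"
  proof (rule N_least[OF M_sub])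
    fix x y assume xy: "x \<in> cyc ?m" "y \<in> cyc ?n" "fst x = fst y"
    obtain j k where jk: "x = a j" "y = b k" using a_cases[OF xy(1)] b_cases[OF xy(2)] by blast
    have "cos (j * pi / ?m) = cos (k * pi / ?n)" using xy(3) by (simp add: jk a_def b_def)
    from cos_multiple_eq[OF mn this]
    consider z where "j * int ?n = k * int ?m + 2 * int ?m * int ?n * z"
      | z where "j * int ?n = - k * int ?m + 2 * int ?m * int ?n * z" by blast
    then have "?P dvd ?L j k"
    proof cases
      case 1
      then have "int d * ?L j k = int d * (?P * (int d * z))" by (simp add: algebra_simps)
      then have "?L j k = ?P * (int d * z)" using d by simp
      then show ?thesis by simp
    next
      case 2
      then have "int d * (j * int n' + k * int m') = int d * (?P * (int d * z))" by (simp add: algebra_simps)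
      then have e: "j * int n' + k * int m' = ?P * (int d * z)" using d by simp
      have "int m' dvd j * int n'"
      proof -
        have "j * int n' = int m' * (2 * int n' * (int d * z) - k)" using e by (simp add: algebra_simps)
        then show ?thesis by simp
      qed
      then have "int m' dvd j" using cop by (simp add: coprime_dvd_mult_left_iff)
      have "int n' dvd k * int m'"
      proof -
        have "k * int m' = int n' * (2 * int m' * (int d * z) - j)" using e by (simp add: algebra_simps)
        then show ?thesis by simp
      qed
      then have "int n' dvd k" using cop by (simp add: coprime_dvd_mult_left_iff coprime_commute)
      then obtain k1 where k1: "k = int n' * k1" by (auto simp: dvd_def)
      have "?L j k = ?P * (int d * z) - 2 * (k * int m')" using e by (simp add: algebra_simps)
      also have "\<dots> = ?P * (int d * z - k1)" by (simp add: k1 algebra_simps)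
      finally show ?thesis by simp
    qed
    then show "(x, y) \<in> M" using M_iff jk by simp
  qed
  moreover have "M \<subseteq> N"
  proof
    fix x assume "x \<in> M"
    then obtain j k where x: "x = (a j, b k)" "?P dvd ?L j k" by (auto simp: M_def)
    then obtain z where z: "j * int n' = k * int m' + ?P * z" by (auto simp: dvd_def algebra_simps)
    have "int m' dvd j * int n'"
    proof -
      have "j * int n' = int m' * (k + 2 * int n' * z)" using z by (simp add: algebra_simps)
      then show ?thesis by simp
    qed
    then have "int m' dvd j" using cop by (simp add: coprime_dvd_mult_left_iff)
    then obtain j1 where j1: "j = int m' * j1" by (auto simp: dvd_def)
    have "int n' dvd k * int m'"
    proof -
      have "k * int m' = int n' * (j - 2 * int m' * z)" using z by (simp add: algebra_simps)
      then show ?thesis by simp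
    qed
    then have "int n' dvd k" using cop by (simp add: coprime_dvd_mult_left_iff coprime_commute)
    then obtain k1 where k1: "k = int n' * k1" by (auto simp: dvd_def)
    have "int m' * int n' * j1 = int m' * int n' * (k1 + 2 * z)" using z by (simp add: j1 k1 algebra_simps)
    then have jz: "j1 = (k1 + z) + z" using m' n' by simp
    have fst: "fst (a (int m' * l)) = cos (real_of_int l * pi / d)" "fst (b (int n' * l)) = cos (real_of_int l * pi / d)" for l
      using m' n' d by (simp_all add: a_def b_def)
    have "(a (int m' * l), b (int n' * l)) \<in> N" "(a (int m' * l), b (int n' * (- l))) \<in> N" for l
      by (rule N_gen[OF a_in b_in], simp add: fst del: mult_minus_right)+
    then have "(a (int m' * (k1 + z)) \<star> a (int m' * z), b (int n' * (k1 + z)) \<star> b (int n' * (- z))) \<in> N"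
      by (intro N_mult)
    then show "x \<in> N" unfolding a_add[symmetric] b_add[symmetric] x j1 k1 jz by (simp add: algebra_simps)
  qed
  ultimately have NM: "N = M" by blast
  \<comment> \<open>the exponents of a pair with \<open>L = 1\<close>\<close>
  obtain s t where st: "s * int n' - t * int m' = 1"
  proof -
    obtain x y where "x * int n' + y * int m' = 1"
      using bezout_int[of "int n'" "int m'"] cop by (auto simp: coprime_iff_gcd_eq_1 gcd.commute)
    then show ?thesis using that[of x "- y"] by simp
  qed
  show ?thesis
  proof (rule quotient_group_cyclic[of _ "\<lambda>k. a (s * k)" "\<lambda>k. b (t * k)"])
    show "2 * m' * n' > 0" using m' n' by simp
    show "a (s * (k + l)) = a (s * k) \<star> a (s * l)" "b (t * (k + l)) = b (t * k) \<star> b (t * l)" for k l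
      by (simp_all add: distrib_left a_add b_add)
    have "?L (s * k) (t * k) = k * (s * int n' - t * int m')" for k by (simp add: algebra_simps)
    then have "?L (s * k) (t * k) = k" for k by (simp add: st)
    then show "(a (s * k), b (t * k)) \<in> N \<longleftrightarrow> int (2 * m' * n') dvd k" for k
      unfolding NM M_iff by simp
    fix x y assume xy: "x \<in> cyc ?m" "y \<in> cyc ?n"
    obtain j k where jk: "x = a j" "y = b k" using a_cases[OF xy(1)] b_cases[OF xy(2)] by blast
    define l where "l = ?L j k"
    have "?L (j - s * l) (k - t * l) = ?L j k - l * (s * int n' - t * int m')" by (simp add: algebra_simps)
    then have "?L (j - s * l) (k - t * l) = 0" by (simp add: st l_def)
    then have "(a (j - s * l), b (k - t * l)) \<in> N" unfolding NM M_iff by simp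
    moreover have "x = a (j - s * l) \<star> a (s * l)" "y = b (k - t * l) \<star> b (t * l)"
      by (simp_all add: jk a_add[symmetric] b_add[symmetric])
    ultimately show "\<exists>l c d. (c, d) \<in> N \<and> x = c \<star> a (s * l) \<and> y = d \<star> b (t * l)" by blast
  qed (rule a_in b_in)+
qed

section \<open>The binary tetrahedral group\<close>

text \<open>
  The powers of \<open>w\<close>, with the exponent in the angle so that negative exponents need no
  separate treatment.
\<close>

definition wpow :: "int \<Rightarrow> quaternion" where
  "wpow k = qrot (vector [1 / sqrt 3, 1 / sqrt 3, 1 / sqrt 3]) (k * pi / 3)"

lemma wpow_axis: "norm (vector [1 / sqrt 3, 1 / sqrt 3, 1 / sqrt 3] :: real^3) = 1"
  by (simp add: norm_eq_sqrt_inner inner_coords)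

lemma wpow_add: "wpow (k + l) = wpow k \<star> wpow l"
  unfolding wpow_def qrot_add[OF wpow_axis, symmetric] by (simp add: distrib_right add_divide_distrib)

lemma wpow_0 [simp]: "wpow 0 = quat_1" by (simp add: wpow_def)

lemma wpow_1: "wpow 1 = quat_w"
  by (simp add: wpow_def qrot_def vector_3_ops quat_w_def cos_60 sin_60)

lemma wpow_3: "wpow (3 * k) \<in> {quat_1, - quat_1}"
proof -
  have "sin (real_of_int k * pi) = 0" using sin_zero_iff_int2 by blast
  moreover from this have "cos (real_of_int k * pi) = 1 \<or> cos (real_of_int k * pi) = - 1"
    using sin_cos_squared_add[of "real_of_int k * pi"] by (simp add: power2_eq_1_iff)
  ultimately show ?thesis by (auto simp: wpow_def qrot_def quat_1_def)
qed

lemma wpow_2: "wpow 2 = (- 1/2, vector [1/2, 1/2, 1/2])"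
  using wpow_add[of 1 1] by (simp add: wpow_1 quat_w_def quat_mult_coords)

lemma norm_wpow [simp]: "norm (wpow k) = 1" by (simp add: wpow_def wpow_axis)

lemma wpow_minus: "wpow (- k) = quat_cnj (wpow k)" by (simp add: wpow_def qrot_minus)

lemma subgroup_dic_2: "subgroup (dic 2) Sp1" by (rule subgroup_dic) simp

lemma minus_dic: "n > 0 \<Longrightarrow> q \<in> dic n \<Longrightarrow> - q \<in> dic n" by (rule minus_dicyclic_quat)

lemma w_normalizes:
  assumes "p \<in> dic 2"
  shows "quat_w \<star> p \<star> quat_cnj quat_w \<in> dic 2" "quat_cnj quat_w \<star> p \<star> quat_w \<in> dic 2"
proof -
  have 1: "quat_w \<star> quat_1 \<star> quat_cnj quat_w = quat_1" "quat_w \<star> quat_i \<star> quat_cnj quat_w = quat_j"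
    "quat_w \<star> quat_j \<star> quat_cnj quat_w = quat_k" "quat_w \<star> quat_k \<star> quat_cnj quat_w = quat_i"
    "quat_cnj quat_w \<star> quat_1 \<star> quat_w = quat_1" "quat_cnj quat_w \<star> quat_j \<star> quat_w = quat_i"
    "quat_cnj quat_w \<star> quat_k \<star> quat_w = quat_j" "quat_cnj quat_w \<star> quat_i \<star> quat_w = quat_k"
    by (simp_all add: quat_w_def quat_unit_coords quat_cnj_coords quat_mult_coords)
  show "quat_w \<star> p \<star> quat_cnj quat_w \<in> dic 2" using assms unfolding dic_2
    by (elim insertE emptyE) (simp_all only: quat_mult_minus 1 insert_iff simp_thms)
  show "quat_cnj quat_w \<star> p \<star> quat_w \<in> dic 2" using assms unfolding dic_2
    by (elim insertE emptyE) (simp_all only: quat_mult_minus 1 insert_iff simp_thms)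
qed

lemma wpow_normalizes: "p \<in> dic 2 \<Longrightarrow> wpow k \<star> p \<star> wpow (- k) \<in> dic 2"
proof (induction k arbitrary: p rule: int_induct[of _ 0])
  case (step1 i)
  have "wpow (i + 1) \<star> p \<star> wpow (- (i + 1)) = wpow i \<star> (quat_w \<star> p \<star> quat_cnj quat_w) \<star> wpow (- i)"
  proof -
    have "wpow (- (i + 1)) = wpow (- 1) \<star> wpow (- i)"
      unfolding wpow_add[symmetric] by (rule arg_cong[of _ _ wpow]) simp
    then show ?thesis unfolding wpow_add[of i 1] wpow_minus[of 1] wpow_1 by (simp only: quat_mult_assoc)
  qed
  then show ?case using step1.IH[OF w_normalizes(1)[OF step1.prems]] by simp
next
  case (step2 i)
  have "wpow (i - 1) \<star> p \<star> wpow (- (i - 1)) = wpow i \<star> (quat_cnj quat_w \<star> p \<star> quat_w) \<star> wpow (- i)"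
  proof -
    have "wpow (- (i - 1)) = wpow 1 \<star> wpow (- i)"
      unfolding wpow_add[symmetric] by (rule arg_cong[of _ _ wpow]) simp
    moreover have "wpow (i - 1) = wpow i \<star> wpow (- 1)"
      unfolding wpow_add[symmetric] by (rule arg_cong[of _ _ wpow]) simp
    ultimately show ?thesis unfolding wpow_minus[of 1] wpow_1 by (simp only: quat_mult_assoc)
  qed
  then show ?case using step2.IH[OF w_normalizes(2)[OF step2.prems]] by simp
qed simp

lemma dic_2_T: "dic 2 \<subseteq> binary_T"
  by (rule dic_2_subset[OF binary_T(1) unit_quats_in_T(1,2)])

text \<open>
  Conjugation by \<open>w\<close> permutes the imaginary units cyclically, so \<open>w\<close> normalizes the quaternion group
  \<open>dic 2\<close>, and the products \<open>p w\<^sup>k\<close> form a group that contains the generators.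
\<close>

lemma T_decomposition:
  assumes "q \<in> binary_T"
  obtains p k where "p \<in> dic 2" "q = p \<star> wpow k"
proof -
  let ?U = "{p \<star> wpow k | p k. p \<in> dic 2}"
  have cl: "p \<star> p' \<in> dic 2" if "p \<in> dic 2" "p' \<in> dic 2" for p p'
    using subgroup.m_closed[OF subgroup_dic_2 that] by simp
  have nd: "norm p = 1" if "p \<in> dic 2" for p using subgroup.mem_carrier[OF subgroup_dic_2 that] by simp
  have cn: "quat_cnj p \<in> dic 2" if "p \<in> dic 2" for p
    using subgroup.m_inv_closed[OF subgroup_dic_2 that] nd[OF that] by simp
  have one: "quat_1 \<in> dic 2" by (simp add: dic_2)
  have "subgroup ?U Sp1"
  proof (rule Sp1.subgroupI)
    show "?U \<subseteq> carrier Sp1" using nd by (auto simp: norm_quat_mult)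
    show "?U \<noteq> {}" using one by blast
    fix x assume "x \<in> ?U"
    then obtain p k where x: "x = p \<star> wpow k" "p \<in> dic 2" by blast
    have "quat_cnj x = (wpow (- k) \<star> quat_cnj p \<star> wpow (- (- k))) \<star> wpow (- k)"
      by (simp add: x(1) quat_cnj_mult wpow_minus quat_mult_assoc quat_mult_cnj)
    then have "quat_cnj x \<in> ?U" using wpow_normalizes[OF cn[OF x(2)], of "- k"] by blast
    then show "inv\<^bsub>Sp1\<^esub> x \<in> ?U" using nd[OF x(2)] by (simp add: x(1) norm_quat_mult)
    fix y assume "y \<in> ?U"
    then obtain p' l where y: "y = p' \<star> wpow l" "p' \<in> dic 2" by blast
    have "x \<star> y = (p \<star> (wpow k \<star> p' \<star> wpow (- k))) \<star> wpow (k + l)"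
    proof -
      have "wpow (- k) \<star> wpow (k + l) = wpow l" by (simp add: wpow_add[symmetric])
      then show ?thesis by (simp add: x(1) y(1) quat_mult_assoc)
    qed
    then have "x \<star> y \<in> ?U" using cl[OF x(2) wpow_normalizes[OF y(2), of k]] by blast
    then show "x \<otimes>\<^bsub>Sp1\<^esub> y \<in> ?U" by simp
  qed
  moreover have "{quat_i, quat_j, quat_w} \<subseteq> ?U"
  proof -
    have "quat_i = quat_i \<star> wpow 0" "quat_j = quat_j \<star> wpow 0" "quat_w = quat_1 \<star> wpow 1" by (simp_all add: wpow_1)
    moreover have "quat_i \<in> dic 2" "quat_j \<in> dic 2" by (simp_all add: dic_2)
    ultimately show ?thesis using one by blast
  qed
  ultimately have "binary_T \<subseteq> ?U" unfolding binary_T_def by (intro Sp1.generate_subgroup_incl)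
  then show ?thesis using assms that by blast
qed

lemma fst_wpow_coset:
  assumes "p \<in> dic 2"
  shows "fst (p \<star> wpow 1) \<in> {1/2, - 1/2}" "fst (p \<star> wpow 2) \<in> {1/2, - 1/2}"
proof -
  have "fst (quat_1 \<star> wpow 1) = 1/2" "fst (quat_i \<star> wpow 1) = - 1/2" "fst (quat_j \<star> wpow 1) = - 1/2"
    "fst (quat_k \<star> wpow 1) = - 1/2" "fst (quat_1 \<star> wpow 2) = - 1/2" "fst (quat_i \<star> wpow 2) = - 1/2"
    "fst (quat_j \<star> wpow 2) = - 1/2" "fst (quat_k \<star> wpow 2) = - 1/2"
    unfolding wpow_1 wpow_2 quat_w_def quat_unit_coords quat_mult_coords by simp_all
  moreover obtain q where "q \<in> {quat_1, quat_i, quat_j, quat_k}" "p = q \<or> p = - q"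
    using assms unfolding dic_2 by blast
  ultimately show "fst (p \<star> wpow 1) \<in> {1/2, - 1/2}" "fst (p \<star> wpow 2) \<in> {1/2, - 1/2}"
    by (auto simp: quat_mult_minus)
qed

lemma T_residue:
  assumes "p \<in> dic 2"
  obtains p' where "p' \<in> dic 2" "p \<star> wpow k = p' \<star> wpow (k mod 3)"
proof -
  have "wpow k = wpow (3 * (k div 3)) \<star> wpow (k mod 3)" by (simp add: wpow_add[symmetric])
  then have "p \<star> wpow k = (p \<star> wpow (3 * (k div 3))) \<star> wpow (k mod 3)" by (simp add: quat_mult_assoc)
  moreover have "p \<star> wpow (3 * (k div 3)) \<in> dic 2"
    using wpow_3[of "k div 3"] assms minus_dic[of 2 p] by auto
  ultimately show ?thesis using that by blast
qed

lemma T_cases: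
  assumes "p \<in> dic 2"
  shows "3 dvd k \<Longrightarrow> p \<star> wpow k \<in> dic 2" "\<not> 3 dvd k \<Longrightarrow> fst (p \<star> wpow k) \<in> {1/2, - 1/2}"
proof -
  obtain p' where p': "p' \<in> dic 2" "p \<star> wpow k = p' \<star> wpow (k mod 3)" using T_residue[OF assms] by blast
  show "3 dvd k \<Longrightarrow> p \<star> wpow k \<in> dic 2" using p' by simp
  assume "\<not> 3 dvd k"
  then have "k mod 3 = 1 \<or> k mod 3 = 2" by presburger
  then show "fst (p \<star> wpow k) \<in> {1/2, - 1/2}" using p' fst_wpow_coset[OF p'(1)] by auto
qed

lemma wpow_dic_2_iff: "wpow k \<in> dic 2 \<longleftrightarrow> 3 dvd k"
proof
  have one: "quat_1 \<in> dic 2" by (simp add: dic_2)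
  show "3 dvd k \<Longrightarrow> wpow k \<in> dic 2" using T_cases(1)[OF one, of k] by simp
  assume k: "wpow k \<in> dic 2"
  show "3 dvd k"
  proof (rule ccontr)
    assume "\<not> 3 dvd k"
    from T_cases(2)[OF one this] show False using fst_dic_2[OF k] by auto
  qed
qed

lemma T_not_half:
  assumes q: "q \<in> binary_T" and half: "fst q \<noteq> 1/2" "fst q \<noteq> - 1/2"
  shows "q \<in> dic 2"
proof -
  obtain p k where pk: "p \<in> dic 2" "q = p \<star> wpow k" using T_decomposition[OF q] by blast
  have "3 dvd k"
  proof (rule ccontr)
    assume "\<not> 3 dvd k"
    from T_cases(2)[OF pk(1) this] show False using half unfolding pk(2) by blast
  qed
  then show ?thesis unfolding pk(2) by (rule T_cases(1)[OF pk(1)])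
qed

lemma wpow_T: "wpow k \<in> binary_T"
proof (induction k rule: int_induct[of _ 0])
  case (step1 i)
  then show ?case using wpow_add[of i 1] binary_T(4)[of "wpow i" quat_w] unit_quats_in_T by (simp add: wpow_1)
next
  case (step2 i)
  then show ?case using wpow_add[of i "- 1"] binary_T(4)[of "wpow i" "quat_cnj quat_w"] binary_T(5)[of quat_w]
      unit_quats_in_T wpow_minus[of 1] by (simp add: wpow_1)
qed (simp add: unit_quats_in_T)

lemma fst_dic_not_half:
  assumes "n \<in> {2, 4}" "q \<in> dic n"
  shows "fst q \<noteq> 1/2" "fst q \<noteq> - 1/2"
proof -
  have "cos (real_of_int k * pi / n) \<noteq> 1/2 \<and> cos (real_of_int k * pi / n) \<noteq> - 1/2" for k
  proof (intro conjI notI)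
    have n: "n > 0" using assms by auto
    assume "cos (real_of_int k * pi / n) = 1/2"
    then have "cos (real_of_int k * pi / n) = cos (real_of_int 1 * pi / real 3)" by (simp add: cos_60)
    from cos_multiple_eq[OF n _ this]
    obtain z where "k * int 3 = 1 * int n + 2 * int n * int 3 * z \<or> k * int 3 = - 1 * int n + 2 * int n * int 3 * z"
      by auto
    moreover have "n = 2 \<or> n = 4" using assms(1) by blast
    ultimately have "k * 3 = 2 + 12 * z \<or> k * 3 = - 2 + 12 * z \<or> k * 3 = 4 + 24 * z \<or> k * 3 = - 4 + 24 * z"
      by (elim disjE) simp_all
    then show False by presburger
  next
    have n: "n > 0" using assms by auto
    assume "cos (real_of_int k * pi / n) = - 1/2"
    then have "cos (real_of_int k * pi / n) = cos (real_of_int 2 * pi / real 3)" by (simp add: cos_120)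
    from cos_multiple_eq[OF n _ this]
    obtain z where "k * int 3 = 2 * int n + 2 * int n * int 3 * z \<or> k * int 3 = - 2 * int n + 2 * int n * int 3 * z"
      by auto
    moreover have "n = 2 \<or> n = 4" using assms(1) by blast
    ultimately have "k * 3 = 4 + 12 * z \<or> k * 3 = - 4 + 12 * z \<or> k * 3 = 8 + 24 * z \<or> k * 3 = - 8 + 24 * z"
      by (elim disjE) simp_all
    then show False by presburger
  qed
  then show "fst q \<noteq> 1/2" "fst q \<noteq> - 1/2" using assms(2) by (auto elim!: fst_dic_cases)
qed

text \<open>
  The real parts that \<open>binary_T\<close> shares with \<open>dic n\<close> are \<open>0\<close>, \<open>1\<close> and \<open>-1\<close>; they belong to the
  elements of the quaternion group, and the quotient is \<open>binary_T\<close> modulo that group.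
\<close>

lemma quotient_group_T_dic:
  assumes n: "n \<in> {2, 4}"
  shows "quotient_group binary_T (dic n) \<cong> integer_mod_group 3"
proof -
  have n0: "n > 0" "even n" using n by auto
  interpret binary_pair binary_T "dic n" by (intro binary_pair.intro binary_T(1) subgroup_dic[OF n0(1)])
  show ?thesis
  proof (rule quotient_group_cyclic_left[OF real_parts_TOI(1) dic_full[OF n0] subgroup_dic_2, of 3 wpow])
    show "a \<in> dic 2" if "a \<in> binary_T" "fst a \<in> fst ` dic n" for a
      using T_not_half[OF that(1)] that(2) fst_dic_not_half[OF n] by auto
    show "dic 2 \<subseteq> generate Sp1 {a \<in> binary_T. fst a \<in> fst ` dic n}"
    proof
      fix q assume q: "q \<in> dic 2"
      have "quat_1 \<in> dic n" using subgroup.one_closed[OF subgroup_dic[OF n0(1)]] by simp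
      then have "quat_1 \<in> dic n" "- quat_1 \<in> dic n" using minus_dic[OF n0(1)] by auto
      then have "fst quat_1 \<in> fst ` dic n" "fst (- quat_1) \<in> fst ` dic n" by blast+
      then have "fst q \<in> fst ` dic n"
        using fst_dic_2[OF q] real_parts_dic(1)[OF n0(1)] by (elim insertE emptyE) (simp_all only: quat_1_def fst_uminus fst_conv)
      then show "q \<in> generate Sp1 {a \<in> binary_T. fst a \<in> fst ` dic n}"
        using q dic_2_T by (intro generate.incl) auto
    qed
    show "\<exists>k. \<exists>c\<in>dic 2. a = c \<star> wpow k" if "a \<in> binary_T" for a using T_decomposition[OF that] by metis
    show "wpow k \<in> dic 2 \<longleftrightarrow> int 3 dvd k" for k by (simp add: wpow_dic_2_iff)
  qed (simp_all add: wpow_T wpow_add)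
qed

lemma cyc_subset_dic: "cyc n \<subseteq> dic n" by (auto simp: dic_eq)

text \<open>
  The real parts common to \<open>cyc n\<close> and \<open>binary_T\<close> are \<open>0\<close>, \<open>1\<close> and \<open>-1\<close>.
\<close>

lemma real_part_subgroup_cyc_T:
  assumes n: "n \<in> {2, 4}"
  shows "real_part_subgroup (cyc n) binary_T = cyc 2 \<times> dic 2"
proof -
  have n0: "n > 0" "even n" using n by auto
  interpret binary_pair "cyc n" binary_T by (intro binary_pair.intro binary_T(1) subgroup_cyc)
  have i: "quat_i \<in> cyc n" using cyc_dvd1[of 2 n] n0 rot1_pi2 by simp
  show ?thesis
  proof
    show "N \<subseteq> cyc 2 \<times> dic 2"
    proof (rule N_least[OF subgroup_pair[OF subgroup_cyc subgroup_dic_2]])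
      fix a b assume ab: "a \<in> cyc n" "b \<in> binary_T" "fst a = fst b"
      have "a \<in> dic n" using ab(1) cyc_subset_dic by blast
      then have b: "b \<in> dic 2" using T_not_half[OF ab(2)] fst_dic_not_half[OF n, of a] ab(3) by simp
      have "a \<in> cyc 2"
      proof (cases "n = 2")
        case False
        then have n4: "n = 4" using n by simp
        obtain k :: int where k: "a = rot1 (k * pi / 4)" using ab(1) by (auto simp: cyclic_quat_def n4)
        have "cos (k * pi / 4) \<in> {0, 1, - 1}" using fst_dic_2[OF b] ab(3) by (simp add: k)
        then have "cos (real_of_int k * pi / real 4) = cos (real_of_int 1 * pi / real 2) \<or>
            cos (real_of_int k * pi / real 4) = cos (real_of_int 0 * pi / real 2) \<or>
            cos (real_of_int k * pi / real 4) = cos (real_of_int 2 * pi / real 2)" by auto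
        then obtain l where "l \<in> {0, 1, 2}" "cos (real_of_int k * pi / real 4) = cos (real_of_int l * pi / real 2)"
          by blast
        moreover from cos_multiple_eq[OF _ _ this(2)]
        obtain z where "k * 2 = l * 4 + 16 * z \<or> k * 2 = - l * 4 + 16 * z" by auto
        ultimately have "2 dvd k" by presburger
        then show ?thesis by (simp add: k rot1_cyc_2_iff)
      qed (use ab in simp)
      then show "(a, b) \<in> cyc 2 \<times> dic 2" using b by simp
    qed
    have fi: "fst quat_i = 0" by (simp add: quat_i_def)
    have D: "differences 0 binary_T \<subseteq> carrier Sp1" using subgroup.subset[OF binary_T(1)] by (rule differences_carrier)
    have ij: "quat_i \<in> generate Sp1 (differences 0 binary_T)" "quat_j \<in> generate Sp1 (differences 0 binary_T)"
      using zero_differences[OF binary_T(1)] by (simp_all add: unit_quats_in_T)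
    have R: "(quat_1, b) \<in> N" if "b \<in> dic 2" for b
    proof -
      have "b \<in> generate Sp1 (differences 0 binary_T)"
        using dic_2_subset[OF Sp1.generate_is_subgroup[OF D] ij] that by blast
      then show ?thesis using right_kernel_differences[OF i, of b] by (simp add: fi)
    qed
    have "(quat_i, quat_i) \<in> N" by (rule N_gen) (simp_all add: i unit_quats_in_T)
    from N_mult[OF this R[of "- quat_i"]] have "(quat_i, quat_1) \<in> N" by (simp add: dic_2 quat_units_mult)
    then have "cyc 2 \<subseteq> {a \<in> cyc n. (a, quat_1) \<in> N}" using i by (intro cyc_2_subset[OF left_kernel]) simp
    then have L: "(a, quat_1) \<in> N" if "a \<in> cyc 2" for a using that by blast
    show "cyc 2 \<times> dic 2 \<subseteq> N"
    proof
      fix x assume "x \<in> cyc 2 \<times> dic 2"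
      then obtain a b where "x = (a, b)" "a \<in> cyc 2" "b \<in> dic 2" by blast
      then show "x \<in> N" using N_mult[OF L R, of a b] by simp
    qed
  qed
qed

lemma quotient_group_C2_T: "quotient_group (cyc 2) binary_T \<cong> integer_mod_group 3"
proof -
  interpret binary_pair "cyc 2" binary_T by (intro binary_pair.intro binary_T(1) subgroup_cyc)
  have N: "N = cyc 2 \<times> dic 2" by (rule real_part_subgroup_cyc_T) simp
  show ?thesis
  proof (rule quotient_group_cyclic[of 3 "\<lambda>_. quat_1" wpow])
    show "\<exists>k c d. (c, d) \<in> N \<and> a = c \<star> quat_1 \<and> b = d \<star> wpow k" if a: "a \<in> cyc 2" and b: "b \<in> binary_T" for a b
    proof -
      obtain p k where "p \<in> dic 2" "b = p \<star> wpow k" using T_decomposition[OF b] by blast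
      then have "(a, p) \<in> N" "a = a \<star> quat_1" "b = p \<star> wpow k" unfolding N using a by simp_all
      then show ?thesis by blast
    qed
  qed (simp_all add: A_closed wpow_T wpow_add N wpow_dic_2_iff)
qed

lemma quotient_group_C4_T: "quotient_group (cyc 4) binary_T \<cong> integer_mod_group 6"
proof -
  interpret binary_pair "cyc 4" binary_T by (intro binary_pair.intro binary_T(1) subgroup_cyc)
  have N: "N = cyc 2 \<times> dic 2" by (rule real_part_subgroup_cyc_T) simp
  define a :: "int \<Rightarrow> quaternion" where "a k = rot1 (k * pi / 4)" for k
  have a_add: "a (j + k) = a j \<star> a k" for j k
    unfolding a_def rot1_add[symmetric] by (simp add: distrib_right add_divide_distrib)
  have a2: "a k \<in> cyc 2 \<longleftrightarrow> 2 dvd k" for k unfolding a_def by (rule rot1_cyc_2_iff)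
  show ?thesis
  proof (rule quotient_group_cyclic[of 6 a wpow])
    show "a k \<in> cyc 4" for k using cyclic_quatI[of "axis 1 1" k 4] by (simp add: a_def)
    show "(a k, wpow k) \<in> N \<longleftrightarrow> int 6 dvd k" for k
    proof -
      have "2 dvd k \<and> 3 dvd k \<longleftrightarrow> 6 dvd k" by presburger
      then show ?thesis by (simp add: N a2 wpow_dic_2_iff)
    qed
    show "\<exists>k c d. (c, d) \<in> N \<and> x = c \<star> a k \<and> y = d \<star> wpow k" if x: "x \<in> cyc 4" and y: "y \<in> binary_T" for x y
    proof -
      obtain j where j: "x = a j" using x by (auto simp: cyclic_quat_def a_def)
      obtain p l where pl: "p \<in> dic 2" "y = p \<star> wpow l" using T_decomposition[OF y] by blast
      \<comment> \<open>congruent to \<open>j\<close> modulo 2 and to \<open>l\<close> modulo 3\<close>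
      define k where "k = 3 * j + 4 * l"
      have "2 dvd j - k" "3 dvd l - k" unfolding k_def by presburger+
      then have "a (j - k) \<in> cyc 2" "p \<star> wpow (l - k) \<in> dic 2" using a2 T_cases(1)[OF pl(1)] by auto
      moreover have "x = a (j - k) \<star> a k" "y = (p \<star> wpow (l - k)) \<star> wpow k"
        by (simp_all add: j pl quat_mult_assoc a_add[symmetric] wpow_add[symmetric])
      ultimately show ?thesis unfolding N by blast
    qed
  qed (simp_all add: a_add wpow_T wpow_add)
qed

section \<open>Cyclic groups of order 4 and 6\<close>

text \<open>
  The last assumption says that only elements of \<open>cyc 2\<close> have a real part that occurs in \<open>B\<close>, so the
  quotient is \<open>cyc (2 m)\<close> modulo \<open>cyc 2\<close>.
\<close>

lemma quotient_group_cyc_left: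
  assumes m: "m > 0" and B: "subgroup B Sp1" "B \<subseteq> generate Sp1 (differences 0 B)" "0 \<in> fst ` B"
    and shared: "\<And>k. cos (real_of_int k * pi / real (m * 2)) \<in> fst ` B \<Longrightarrow> int m dvd k"
  shows "quotient_group (cyc (m * 2)) B \<cong> integer_mod_group m"
proof -
  interpret binary_pair "cyc (m * 2)" B by (intro binary_pair.intro B(1) subgroup_cyc)
  define a where "a k = rot1 (real_of_int k * pi / real (m * 2))" for k :: int
  have a_add: "a (j + k) = a j \<star> a k" for j k
    unfolding a_def rot1_add[symmetric] by (simp add: distrib_right add_divide_distrib)
  have a_in: "a k \<in> cyc (m * 2)" for k unfolding a_def by (rule cyclic_quatI)
  have a_cyc_2: "a k \<in> cyc 2 \<longleftrightarrow> int m dvd k" for k unfolding a_def using m by (rule rot1_in_cyc_iff) simp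
  have a_cases: "\<exists>k. x = a k" if "x \<in> cyc (m * 2)" for x
    using that unfolding cyclic_quat_def a_def by blast
  have i: "quat_i \<in> cyc (m * 2)" using cyc_dvd1[of 2 "m * 2"] m by (simp add: rot1_pi2)
  have fi: "fst quat_i = 0" by (simp add: quat_i_def)
  let ?S = "{a \<in> cyc (m * 2). fst a \<in> fst ` B}"
  have S: "?S \<subseteq> carrier Sp1" using subgroup.subset[OF subgroup_A] by blast
  show ?thesis
  proof (rule quotient_group_cyclic_left[OF _ B(2) subgroup_cyc[of 2] _ _ m a_in a_add])
    show "0 \<in> fst ` cyc (m * 2)" using i fi by force
    show "x \<in> cyc 2" if x_in: "x \<in> cyc (m * 2)" and fx: "fst x \<in> fst ` B" for x
    proof -
      obtain k where k: "x = a k" using a_cases[OF x_in] by blast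
      have "cos (real_of_int k * pi / real (m * 2)) \<in> fst ` B" using fx by (simp add: k a_def)
      then show ?thesis unfolding k a_cyc_2 by (rule shared)
    qed
    show "cyc 2 \<subseteq> generate Sp1 ?S"
      by (rule cyc_2_subset[OF Sp1.generate_is_subgroup[OF S]], rule generate.incl) (use i fi B(3) in simp)
    show "\<exists>k. \<exists>c\<in>cyc 2. x = c \<star> a k" if x_in: "x \<in> cyc (m * 2)" for x
    proof -
      obtain k where "x = a k" using a_cases[OF x_in] by blast
      then have "x = quat_1 \<star> a k" by simp
      moreover have "quat_1 \<in> cyc 2" using subgroup.one_closed[OF subgroup_cyc[of 2]] by simp
      ultimately show ?thesis by blast
    qed
  qed (rule a_cyc_2)
qed

lemma cos_in_dic:
  assumes m: "m > 0" and n: "n > 0" "even n" and k: "cos (real_of_int k * pi / real m) \<in> fst ` dic n"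
  shows "\<exists>l z::int. k * int n = l * int m + 2 * int m * int n * z"
proof -
  have "\<exists>l. cos (real_of_int k * pi / real m) = cos (real_of_int l * pi / real n)"
  proof -
    obtain q where q: "q \<in> dic n" "cos (real_of_int k * pi / real m) = fst q" using k by blast
    from q(1) show ?thesis
    proof (cases rule: fst_dic_cases)
      case (1 l)
      then show ?thesis unfolding q(2) by blast
    next
      case (2 l)
      obtain n' where n': "n = 2 * n'" using n(2) by (rule evenE)
      have "fst q = cos (real_of_int (int n') * pi / real n)" using 2 n(1) by (simp add: n')
      then show ?thesis unfolding q(2) by blast
    qed
  qed
  then obtain l where "cos (real_of_int k * pi / real m) = cos (real_of_int l * pi / real n)" by blast
  from cos_multiple_eq[OF m n(1) this] show ?thesis by blast
qed

lemma quotient_group_C4_dic: "quotient_group (cyc 4) (dic 2) \<cong> integer_mod_group 2"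
  "quotient_group (cyc 4) (dic 6) \<cong> integer_mod_group 2"
proof -
  have sh: "2 dvd k" if n: "n = 2 \<or> n = 6" and k: "cos (real_of_int k * pi / 4) \<in> fst ` dic n" for n :: nat and k :: int
  proof -
    have "n > 0" "even n" using n by auto
    then obtain l z where "k * int n = l * 4 + 2 * 4 * int n * z" using cos_in_dic[of 4 n k] k by auto
    then have "k * 2 = l * 4 + 16 * z \<or> k * 6 = l * 4 + 48 * z" using n by auto
    then show ?thesis by presburger
  qed
  show "quotient_group (cyc 4) (dic 2) \<cong> integer_mod_group 2"
    using quotient_group_cyc_left[of 2 "dic 2"] sh[of 2] subgroup_dic[of 2] dic_full[of 2] real_parts_dic(1)[of 2]
    by simp
  show "quotient_group (cyc 4) (dic 6) \<cong> integer_mod_group 2"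
    using quotient_group_cyc_left[of 2 "dic 6"] sh[of 6] subgroup_dic[of 6] dic_full[of 6] real_parts_dic(1)[of 6]
    by simp
qed

lemma quotient_group_C6_dic:
  assumes n: "n = 2 \<or> n = 4"
  shows "quotient_group (cyc 6) (dic n) \<cong> integer_mod_group 3"
proof -
  have n0: "n > 0" "even n" using n by auto
  have "3 dvd k" if k: "cos (real_of_int k * pi / 6) \<in> fst ` dic n" for k
  proof -
    obtain l z where "k * int n = l * 6 + 2 * 6 * int n * z" using cos_in_dic[of 6 n k] n0 k by auto
    then have "k * 2 = l * 6 + 24 * z \<or> k * 4 = l * 6 + 48 * z" using n by auto
    then show ?thesis by presburger
  qed
  then show ?thesis
    using quotient_group_cyc_left[of 3 "dic n"] subgroup_dic[of n] dic_full[of n] real_parts_dic(1)[of n] n0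
    by simp
qed

text \<open>
  Such a \<open>q\<close>, with imaginary part \<open>u\<close>, would be a quarter turn \<open>R\<close> that preserves the icosahedron.
  For a vertex \<open>v\<close> one has \<open>v \<bullet> R v = 2 (u \<bullet> v)\<^sup>2\<close> and \<open>v \<bullet> R\<^sup>2 v = 4 (u \<bullet> v)\<^sup>2 - |v|\<^sup>2\<close>.  Both are
  inner products of vertices, which take only the values \<open>\<plusminus>|v|\<^sup>2\<close> and \<open>\<plusminus>\<phi>\<close>, and this leaves only
  \<open>2 (u \<bullet> v)\<^sup>2 = |v|\<^sup>2\<close>.  As \<open>2 |u|\<^sup>2 = 1\<close>, every vertex would lie on the axis of \<open>R\<close>.
\<close>

lemma I_no_quarter_turn:
  assumes q: "q \<in> binary_I"
  shows "fst q * fst q \<noteq> 1/2"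
proof
  assume h: "fst q * fst q = 1/2"
  obtain a b c d where qe: "q = (a, vector [b, c, d])"
  proof
    have "snd q = vector [snd q $ 1, snd q $ 2, snd q $ 3]" by (simp add: vec_eq_iff forall_3)
    then show "q = (fst q, vector [snd q $ 1, snd q $ 2, snd q $ 3])" by (simp add: prod_eq_iff)
  qed
  have nq: "norm q = 1" using subgroup.mem_carrier[OF binary_I(1) q] by simp
  have aa: "a * a = 1/2" using h by (simp add: qe)
  have "a * a + b * b + c * c + d * d = 1"
    using nq by (simp add: qe norm_quat_coords power2_eq_square real_sqrt_eq_1_iff)
  then have bcd: "b * b + c * c + d * d = 1/2" using aa by simp
  have stable: "double_cover p *v v \<in> icosa_vertices" if "p \<in> binary_I" "v \<in> icosa_vertices" for p v
    using that unfolding stab_icosa[symmetric] stab_def by blast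
  \<comment> \<open>the only property of the golden ratio used below is \<open>g\<^sup>2 = g + 1\<close>, so that \<open>|v|\<^sup>2 = g + 2\<close>\<close>
  define g :: real where "g = golden"
  have gg: "g * g = g + 1" by (simp add: g_def field_simps)
  have g: "g > 3/2" "g < 2" unfolding g_def by (simp_all add: real_less_rsqrt real_less_lsqrt)
  have V: "icosa_vertices = {vector [1, g, 0], vector [1, - g, 0], vector [-1, g, 0], vector [-1, - g, 0],
     vector [0, 1, g], vector [0, 1, - g], vector [0, -1, g], vector [0, -1, - g],
     vector [g, 0, 1], vector [g, 0, -1], vector [- g, 0, 1], vector [- g, 0, -1]}"
    by (simp add: icosa_vertices_def g_def)
  have inner: "v \<bullet> v' \<in> {g + 2, - (g + 2), g, - g}" if "v \<in> icosa_vertices" "v' \<in> icosa_vertices" for v v'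
    using that unfolding V by (elim insertE emptyE; simp add: inner_coords gg)
  let ?\<rho> = "g + 2"
  have half: "2 * ((x * b + y * c + z * d) * (x * b + y * c + z * d)) = ?\<rho>"
    if v: "vector [x, y, z] \<in> icosa_vertices" for x y z
  proof -
    let ?s = "x * b + y * c + z * d" and ?v = "vector [x, y, z] :: real^3"
    have xyz: "x * x + y * y + z * z = ?\<rho>"
      using v unfolding V by (elim insertE emptyE; simp add: vector_3_eq_iff gg)
    have "?v \<bullet> (double_cover q *v ?v) = (a * a - (b * b + c * c + d * d)) * (x * x + y * y + z * z) + 2 * (?s * ?s)"
      unfolding qe double_cover_coords inner_coords by (simp add: algebra_simps)
    then have e1: "?v \<bullet> (double_cover q *v ?v) = 2 * (?s * ?s)" by (simp add: aa bcd)
    have qq: "q \<star> q = (0, vector [2 * a * b, 2 * a * c, 2 * a * d])"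
      using aa bcd by (simp add: qe quat_mult_coords algebra_simps)
    have "?v \<bullet> (double_cover (q \<star> q) *v ?v) =
        2 * (2 * (a * a)) * (2 * (?s * ?s)) - 2 * (2 * (a * a)) * (b * b + c * c + d * d) * (x * x + y * y + z * z)"
      unfolding qq double_cover_coords inner_coords by (simp add: algebra_simps)
    then have e2: "?v \<bullet> (double_cover (q \<star> q) *v ?v) = 2 * (2 * (?s * ?s)) - ?\<rho>" by (simp add: aa bcd xyz)
    have "2 * (?s * ?s) \<in> {?\<rho>, - ?\<rho>, g, - g}"
      unfolding e1[symmetric] by (intro inner v stable q)
    moreover have "2 * (2 * (?s * ?s)) - ?\<rho> \<in> {?\<rho>, - ?\<rho>, g, - g}"
      unfolding e2[symmetric] by (intro inner v stable q binary_I(4))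
    moreover have "?s * ?s \<ge> 0" by simp
    ultimately show ?thesis using g by (elim insertE emptyE; linarith)
  qed
  have g0: "g \<noteq> 0" using g by simp
  have prod: "u * w = 0" if "2 * ((u + g * w) * (u + g * w)) = ?\<rho>" "2 * ((u - g * w) * (u - g * w)) = ?\<rho>" for u w
  proof -
    have "(u + g * w) * (u + g * w) - (u - g * w) * (u - g * w) = 4 * g * (u * w)" by (simp add: algebra_simps)
    moreover have "(u + g * w) * (u + g * w) - (u - g * w) * (u - g * w) = 0" using that by linarith
    ultimately show ?thesis using g0 by simp
  qed
  have "b * c = 0" using half[of 1 g 0] half[of 1 "- g" 0] by (intro prod) (simp_all add: V)
  moreover have "c * d = 0" using half[of 0 1 g] half[of 0 1 "- g"] by (intro prod) (simp_all add: V)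
  moreover have "d * b = 0" using half[of g 0 1] half[of "- g" 0 1]
    by (intro prod) (simp_all add: V algebra_simps)
  ultimately show False
    using half[of 1 g 0] half[of 0 1 g] half[of g 0 1] bcd g by (auto simp: V)
qed

lemma cos_odd_quarter:
  assumes "odd k"
  shows "cos (real_of_int k * pi / 4) * cos (real_of_int k * pi / 4) = 1/2"
proof -
  have "cos (2 * (real_of_int k * pi / 4)) = 0"
    unfolding cos_zero_iff_int using assms by (intro exI[of _ k]) simp
  then show ?thesis unfolding cos_double_cos by (simp add: power2_eq_square)
qed

lemma quotient_group_C4_I: "quotient_group (cyc 4) binary_I \<cong> integer_mod_group 2"
proof -
  have "2 dvd k" if "cos (real_of_int k * pi / 4) \<in> fst ` binary_I" for k
    using that cos_odd_quarter[of k] I_no_quarter_turn by force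
  then show ?thesis using quotient_group_cyc_left[of 2 binary_I] binary_I(1) I_full real_parts_TOI(6) by simp
qed

section \<open>The dihedral group of order 6\<close>

text \<open>
  Membership of \<open>A1\<close> behaves like a sign on \<open>A0\<close>; the case \<open>A1 = A0\<close> is not excluded.
\<close>

definition index_two :: "quaternion set \<Rightarrow> quaternion set \<Rightarrow> bool" where
  "index_two A0 A1 \<longleftrightarrow> subgroup A0 Sp1 \<and> A1 \<subseteq> A0 \<and>
     (\<forall>a\<in>A0. \<forall>b\<in>A0. a \<star> b \<in> A1 \<longleftrightarrow> (a \<in> A1 \<longleftrightarrow> b \<in> A1))"

lemma index_two_cnj:
  assumes "index_two A0 A1" "a \<in> A0"
  shows "quat_cnj a \<in> A0" "quat_cnj a \<in> A1 \<longleftrightarrow> a \<in> A1" "quat_1 \<in> A0" "quat_1 \<in> A1"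
proof -
  have sub: "subgroup A0 Sp1" and rule: "\<And>a b. a \<in> A0 \<Longrightarrow> b \<in> A0 \<Longrightarrow> a \<star> b \<in> A1 \<longleftrightarrow> (a \<in> A1 \<longleftrightarrow> b \<in> A1)"
    using assms(1) unfolding index_two_def by blast+
  have na: "norm a = 1" using subgroup.mem_carrier[OF sub assms(2)] by simp
  show one: "quat_1 \<in> A0" using subgroup.one_closed[OF sub] by simp
  show one1: "quat_1 \<in> A1" using rule[OF one one] by simp
  show c: "quat_cnj a \<in> A0" using subgroup.m_inv_closed[OF sub assms(2)] na by simp
  show "quat_cnj a \<in> A1 \<longleftrightarrow> a \<in> A1" using rule[OF assms(2) c] one1 by (simp add: quat_mult_cnj[OF na])
qed

lemma index_two_cyc:
  assumes m: "m > 0"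
  shows "index_two (cyc (2 * m)) (cyc m)"
  unfolding index_two_def
proof (intro conjI ballI subgroup_cyc)
  show "cyc m \<subseteq> cyc (2 * m)" using cyc_dvd[of m "2 * m"] m by (auto simp: cyclic_quat_def)
  fix a b assume "a \<in> cyc (2 * m)" "b \<in> cyc (2 * m)"
  then obtain j k :: int where jk: "a = rot1 (j * pi / real (2 * m))" "b = rot1 (k * pi / real (2 * m))"
    unfolding cyclic_quat_def by blast
  have "a \<star> b = rot1 (real_of_int (j + k) * pi / real (2 * m))"
    unfolding jk rot1_add[symmetric] by (simp add: distrib_right add_divide_distrib)
  then show "a \<star> b \<in> cyc m \<longleftrightarrow> (a \<in> cyc m \<longleftrightarrow> b \<in> cyc m)"
    using rot1_in_cyc_iff[of 2 m] m by (simp only: jk) simp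
qed

lemma j_part_not_cyc: "rot1 t \<star> quat_j \<notin> cyc n"
proof
  assume "rot1 t \<star> quat_j \<in> cyc n"
  then obtain s where "rot1 t \<star> quat_j = rot1 s" by (auto simp: cyclic_quat_def)
  then have "cos t = 0" "sin t = 0" by (simp_all add: rot1_coords quat_unit_coords quat_mult_coords vector_3_eq_iff)
  then show False using sin_cos_squared_add[of t] by simp
qed

lemma dic_cases:
  assumes "q \<in> dic n"
  obtains k :: int where "q = rot1 (k * pi / n)" "q \<in> cyc n"
    | k :: int where "q = rot1 (k * pi / n) \<star> quat_j" "q \<notin> cyc n" "fst q = 0"
  using assms j_part_not_cyc fst_rot1_j cyclic_quatI unfolding dic_eq cyclic_quat_def
  by (smt (verit) UnE imageE mem_Collect_eq)

lemma j_rot1: "quat_j \<star> rot1 t = rot1 (- t) \<star> quat_j"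
  by (simp add: rot1_coords quat_unit_coords quat_mult_coords)

lemma index_two_dic:
  assumes n: "n > 0"
  shows "index_two (dic n) (cyc n)"
  unfolding index_two_def
proof (intro conjI ballI subgroup_dic[OF n])
  show "cyc n \<subseteq> dic n" by (rule cyc_subset_dic)
  fix a b assume a: "a \<in> dic n" and b: "b \<in> dic n"
  have rj: "rot1 s \<star> (rot1 t \<star> quat_j) = rot1 (s + t) \<star> quat_j" for s t by (simp add: rot1_add quat_mult_assoc)
  have rjr: "(rot1 s \<star> quat_j) \<star> rot1 t = rot1 (s - t) \<star> quat_j" for s t
    using rot1_add[of s "- t"] by (simp add: quat_mult_assoc j_rot1)
  from a show "a \<star> b \<in> cyc n \<longleftrightarrow> (a \<in> cyc n \<longleftrightarrow> b \<in> cyc n)"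
  proof (cases rule: dic_cases)
    case (1 k)
    from b show ?thesis
    proof (cases rule: dic_cases)
      case (1 l)
      then show ?thesis using \<open>a \<in> cyc n\<close> subgroup.m_closed[OF subgroup_cyc, of a n b] by simp
    next
      case (2 l)
      then show ?thesis using \<open>a \<in> cyc n\<close> 1 j_part_not_cyc by (simp add: rj)
    qed
  next
    case (2 k)
    note A = 2
    from b show ?thesis
    proof (cases rule: dic_cases)
      case (1 l)
      then show ?thesis using A j_part_not_cyc by (simp add: rjr)
    next
      case (2 l)
      have "a \<star> b = rot1 (real_of_int (k - l) * pi / n) \<star> (quat_j \<star> quat_j)"
      proof -
        have "a \<star> b = ((rot1 (k * pi / n) \<star> quat_j) \<star> rot1 (l * pi / n)) \<star> quat_j"
          by (simp add: A(1) 2(1) quat_mult_assoc)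
        then show ?thesis unfolding rjr by (simp add: quat_mult_assoc left_diff_distrib diff_divide_distrib)
      qed
      then have "a \<star> b = - rot1 (real_of_int (k - l) * pi / n)" by (simp add: quat_units_mult quat_mult_minus)
      then have "a \<star> b \<in> cyc n" using minus_cyclic_quat[OF n cyclic_quatI] by (simp only:)
      then show ?thesis using A(2) 2(2) by simp
    qed
  qed
qed

lemma subgroup_parity:
  assumes A: "index_two A0 A1" and B: "index_two B0 B1"
  shows "subgroup {(a, b). a \<in> A0 \<and> b \<in> B0 \<and> (a \<in> A1 \<longleftrightarrow> b \<in> B1)} (Sp1 \<times>\<times> Sp1)" (is "subgroup ?M _")
proof (rule Sp1xSp1.subgroupI)
  have subA: "subgroup A0 Sp1" and subB: "subgroup B0 Sp1" using A B unfolding index_two_def by blast+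
  have nA: "norm a = 1" if "a \<in> A0" for a using subgroup.mem_carrier[OF subA that] by simp
  have nB: "norm a = 1" if "a \<in> B0" for a using subgroup.mem_carrier[OF subB that] by simp
  show "?M \<subseteq> carrier (Sp1 \<times>\<times> Sp1)" using nA nB by auto
  have "quat_1 \<in> A0" "quat_1 \<in> B0" using subgroup.one_closed[OF subA] subgroup.one_closed[OF subB] by simp_all
  then have "(quat_1, quat_1) \<in> ?M" using index_two_cnj(4)[OF A] index_two_cnj(4)[OF B] by blast
  then show "?M \<noteq> {}" by blast
  fix x assume "x \<in> ?M"
  then obtain a b where x: "x = (a, b)" "a \<in> A0" "b \<in> B0" "a \<in> A1 \<longleftrightarrow> b \<in> B1" by blast
  have "inv\<^bsub>Sp1 \<times>\<times> Sp1\<^esub> x = (quat_cnj a, quat_cnj b)"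
    using nA[OF x(2)] nB[OF x(3)] by (simp add: x(1) inv_DirProd[OF group_Sp1 group_Sp1])
  then show "inv\<^bsub>Sp1 \<times>\<times> Sp1\<^esub> x \<in> ?M"
    using x index_two_cnj(1,2)[OF A x(2)] index_two_cnj(1,2)[OF B x(3)] by simp
  fix y assume "y \<in> ?M"
  then obtain c d where y: "y = (c, d)" "c \<in> A0" "d \<in> B0" "c \<in> A1 \<longleftrightarrow> d \<in> B1" by blast
  have "a \<star> c \<in> A0" "b \<star> d \<in> B0"
    using subgroup.m_closed[OF subA x(2) y(2)] subgroup.m_closed[OF subB x(3) y(3)] by simp_all
  moreover have "a \<star> c \<in> A1 \<longleftrightarrow> b \<star> d \<in> B1"
    using A B x y unfolding index_two_def by metis
  ultimately show "x \<otimes>\<^bsub>Sp1 \<times>\<times> Sp1\<^esub> y \<in> ?M" by (simp add: x(1) y(1))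
qed

lemma fst_cyc_3:
  assumes "q \<in> cyc 3"
  shows "fst q \<in> {1, - 1, 1/2, - 1/2}"
proof -
  obtain k :: int where k: "q = rot1 (k * pi / 3)" using assms by (auto simp: cyclic_quat_def)
  define r where "r = k mod 6"
  have "k = r + 6 * (k div 6)" by (simp add: r_def)
  then have "real_of_int k = real_of_int r + 6 * real_of_int (k div 6)" by (metis of_int_add of_int_mult of_int_numeral)
  then have "real_of_int k * pi / 3 = real_of_int r * pi / 3 + 2 * pi * real_of_int (k div 6)"
    by (simp add: field_simps)
  then have q: "q = rot1 (r * pi / 3)" unfolding k by (simp only: qrot_period)
  have "r \<in> {0, 1, 2, 3, 4, 5}" using pos_mod_bound[of 6 k] pos_mod_sign[of 6 k] unfolding r_def by auto
  moreover have "cos (4 * pi / 3) = - 1/2" "cos (5 * pi / 3) = 1/2"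
  proof -
    have "cos (4 * pi / 3) = cos (pi / 3 + pi)" "cos (5 * pi / 3) = cos (2 * pi / 3 + pi)" by simp_all
    then show "cos (4 * pi / 3) = - 1/2" "cos (5 * pi / 3) = 1/2"
      unfolding cos_periodic_pi cos_60 cos_120 by simp_all
  qed
  ultimately show ?thesis unfolding q by (auto simp: cos_60 cos_120)
qed

lemma fst_cyc_3_onto: "{1, - 1, 1/2, - 1/2} \<subseteq> fst ` cyc 3"
proof -
  have "fst (rot1 (real_of_int k * pi / real 3)) \<in> fst ` cyc 3" for k by (intro imageI cyclic_quatI)
  from this[of 0] this[of 3] this[of 1] this[of 2] show ?thesis by (simp add: cos_60 cos_120 quat_1_def)
qed

text \<open>
  In \<open>dic 3\<close> the real part determines the sign with respect to \<open>cyc 3\<close>: it is \<open>\<plusminus>1\<close> or \<open>\<plusminus>1/2\<close> on \<open>cyc 3\<close>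
  and \<open>0\<close> outside.  The assumptions say that the real parts shared with \<open>A\<close> determine the sign
  with respect to \<open>A1\<close> in the same way, so \<open>N\<close> consists of pairs of equal sign.  Conversely \<open>N\<close>
  contains \<open>A1 \<times> cyc 3\<close> and the pair \<open>(z, j)\<close> of negative signs.
\<close>

lemma real_part_subgroup_D3:
  assumes A: "subgroup A Sp1" and A0: "index_two A0 A1" "A0 \<subseteq> A"
    and h1: "\<And>a. \<lbrakk>a \<in> A; fst a \<in> {1, - 1, 1/2, - 1/2}\<rbrakk> \<Longrightarrow> a \<in> A1"
    and h2: "\<And>a. \<lbrakk>a \<in> A; fst a = 0\<rbrakk> \<Longrightarrow> a \<in> A0 - A1"
    and h3: "A1 \<subseteq> cyc 3"
    and z: "z \<in> A" "fst z = 0"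
  shows "real_part_subgroup A (dic 3) = {(a, b). a \<in> A0 \<and> b \<in> dic 3 \<and> (a \<in> A1 \<longleftrightarrow> b \<in> cyc 3)}" (is "_ = ?M")
proof
  have d3: "subgroup (dic 3) Sp1" by (rule subgroup_dic) simp
  interpret binary_pair A "dic 3" by (intro binary_pair.intro A d3)
  have i3: "index_two (dic 3) (cyc 3)" by (rule index_two_dic) simp
  have A10: "A1 \<subseteq> A0" using A0(1) by (simp add: index_two_def)
  show "N \<subseteq> ?M"
  proof (rule N_least[OF subgroup_parity[OF A0(1) i3]])
    fix a b assume ab: "a \<in> A" "b \<in> dic 3" "fst a = fst b"
    from ab(2) show "(a, b) \<in> ?M"
    proof (cases rule: dic_cases)
      case 1
      then have "a \<in> A1" using h1[OF ab(1)] fst_cyc_3[of b] unfolding ab(3) by blast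
      then show ?thesis using 1 ab(2) A10 by blast
    next
      case 2
      then show ?thesis using h2[OF ab(1)] ab(2,3) by simp
    qed
  qed
  have R: "(quat_1, b) \<in> N" if "b \<in> cyc 3" for b
  proof (rule right_kernel_differences[OF z(1)])
    show "b \<in> generate Sp1 (differences (fst z) (dic 3))"
      using dic_differences[of 3] that unfolding z(2) by (intro generate.incl) auto
  qed
  have L: "(a, quat_1) \<in> N" if a: "a \<in> A1" for a
  proof -
    obtain b where b: "b \<in> cyc 3" "fst a = fst b" using fst_cyc_3_onto fst_cyc_3[of a] h3 a by blast
    have nb: "norm b = 1" using subgroup.mem_carrier[OF subgroup_cyc b(1)] by simp
    have "(a, b) \<in> N" using b a A10 A0(2) cyc_subset_dic by (intro N_gen) auto
    moreover have "quat_cnj b \<in> cyc 3" using subgroup.m_inv_closed[OF subgroup_cyc b(1)] nb by simp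
    ultimately have "(a \<star> quat_1, b \<star> quat_cnj b) \<in> N" by (intro N_mult R)
    then show ?thesis by (simp add: quat_mult_cnj[OF nb])
  qed
  have LR: "(a, b) \<in> N" if "a \<in> A1" "b \<in> cyc 3" for a b using N_mult[OF L[OF that(1)] R[OF that(2)]] by simp
  have jd: "quat_j \<in> dic 3" "quat_j \<notin> cyc 3" "fst quat_j = 0"
    using dic_eq[of 3] subgroup.one_closed[OF subgroup_cyc[of 3]] j_part_not_cyc[of 0 3] by (force simp: quat_j_def)+
  have z': "z \<in> A0" "z \<notin> A1" using h2[OF z] by blast+
  have nz: "norm z = 1" by (rule A_closed(4)[OF z(1)])
  have zj: "(z, quat_j) \<in> N" using z jd by (intro N_gen) simp_all
  show "?M \<subseteq> N"
  proof
    fix x assume "x \<in> ?M"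
    then obtain a b where x: "x = (a, b)" "a \<in> A0" "b \<in> dic 3" "a \<in> A1 \<longleftrightarrow> b \<in> cyc 3" by blast
    show "x \<in> N"
    proof (cases "a \<in> A1")
      case True
      then show ?thesis using LR x by simp
    next
      case False
      have "a \<star> quat_cnj z \<in> A1"
        using A0(1) False x(2) z' index_two_cnj(1,2)[OF A0(1) z'(1)] unfolding index_two_def by metis
      moreover have "b \<star> quat_cnj quat_j \<in> cyc 3"
        using i3 False x(3,4) jd index_two_cnj(1,2)[OF i3 jd(1)] unfolding index_two_def by metis
      ultimately have "((a \<star> quat_cnj z) \<star> z, (b \<star> quat_cnj quat_j) \<star> quat_j) \<in> N" by (intro N_mult[OF LR zj])
      then show ?thesis by (simp add: x(1) quat_mult_assoc quat_mult_cnj nz)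
    qed
  qed
qed

text \<open>
  With \<open>A0 = cyc (2 m)\<close> and \<open>A1 = cyc m\<close> in \<open>real_part_subgroup_D3\<close>, multiplication by an element of
  negative sign in \<open>A0\<close> reduces every pair to one of the form \<open>(a, 1)\<close>.
\<close>

lemma quotient_group_cyc_D3:
  assumes md: "(m, d) \<in> {(1, 1), (1, 2), (3, 1)}"
  shows "quotient_group (cyc (2 * d * m)) (dic 3) \<cong> integer_mod_group (2 * d)"
proof -
  let ?n = "2 * d * m"
  have m: "m > 0" and d: "d > 0" using md by auto
  have d3: "subgroup (dic 3) Sp1" by (rule subgroup_dic) simp
  interpret binary_pair "cyc ?n" "dic 3" by (intro binary_pair.intro subgroup_cyc d3)
  define a where "a k = rot1 (real_of_int k * pi / real ?n)" for k :: int
  have a_add: "a (j + k) = a j \<star> a k" for j k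
    unfolding a_def rot1_add[symmetric] by (simp add: distrib_right add_divide_distrib)
  have a_in: "a k \<in> cyc ?n" for k unfolding a_def by (rule cyclic_quatI)
  have a_cases: "\<exists>k. x = a k" if "x \<in> cyc ?n" for x
    using that unfolding cyclic_quat_def a_def by blast
  have a1: "a k \<in> cyc m \<longleftrightarrow> int (2 * d) dvd k" for k
    unfolding a_def by (rule rot1_in_cyc_iff) (use m d in simp_all)
  have a0: "a k \<in> cyc (2 * m) \<longleftrightarrow> int d dvd k" for k
    using rot1_in_cyc_iff[of d "2 * m" k] m d by (simp add: a_def mult.assoc mult.left_commute)
  have cos_a: "fst (a k) = cos (real_of_int k * pi / real ?n)" for k by (simp add: a_def)
  have n0: "?n > 0" using m d by simp
  have h1: "int (2 * d) dvd k" if f: "fst (a k) \<in> {1, - 1, 1/2, - 1/2}" for k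
  proof -
    obtain q where "q \<in> cyc 3" "fst (a k) = fst q" using fst_cyc_3_onto f by blast
    then obtain j :: int where "cos (real_of_int k * pi / real ?n) = cos (real_of_int j * pi / real 3)"
      by (auto simp: cyclic_quat_def cos_a)
    from cos_multiple_eq[OF n0 _ this]
    obtain z where "k * int 3 = j * int ?n + 2 * int ?n * int 3 * z \<or> k * int 3 = - j * int ?n + 2 * int ?n * int 3 * z"
      by auto
    then show ?thesis using md by auto presburger+
  qed
  have h2: "int d dvd k \<and> \<not> int (2 * d) dvd k" if f: "fst (a k) = 0" for k
  proof -
    have "cos (real_of_int k * pi / real ?n) = cos (real_of_int 1 * pi / real 2)" using f by (simp add: cos_a)
    from cos_multiple_eq[OF n0 _ this]
    obtain z where "k * int 2 = 1 * int ?n + 2 * int ?n * int 2 * z \<or> k * int 2 = - 1 * int ?n + 2 * int ?n * int 2 * z"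
      by auto
    then show ?thesis using md by auto presburger+
  qed
  have i: "quat_i \<in> cyc ?n" using cyc_dvd1[of 2 ?n] n0 by (simp add: rot1_pi2)
  have N: "N = {(a, b). a \<in> cyc (2 * m) \<and> b \<in> dic 3 \<and> (a \<in> cyc m \<longleftrightarrow> b \<in> cyc 3)}"
  proof (rule real_part_subgroup_D3[OF subgroup_cyc index_two_cyc[OF m] _ _ _ _ i])
    show "cyc (2 * m) \<subseteq> cyc ?n" using cyc_dvd[of "2 * m" ?n] n0 by (auto simp: cyclic_quat_def)
    show "cyc m \<subseteq> cyc 3" using cyc_dvd[of m 3] md by (auto simp: cyclic_quat_def)
    show "x \<in> cyc m" if "x \<in> cyc ?n" "fst x \<in> {1, - 1, 1/2, - 1/2}" for x
      using a_cases[OF that(1)] that(2) h1 a1 by metis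
    show "x \<in> cyc (2 * m) - cyc m" if "x \<in> cyc ?n" "fst x = 0" for x
      using a_cases[OF that(1)] that(2) h2 a1 a0 by (metis DiffI)
  qed (simp add: quat_i_def)
  show ?thesis
  proof (rule quotient_group_cyclic[of "2 * d" a "\<lambda>_. quat_1"])
    have one: "quat_1 \<in> dic 3" "quat_1 \<in> cyc 3"
      using subgroup.one_closed[OF d3] subgroup.one_closed[OF subgroup_cyc[of 3]] by simp_all
    show "(a k, quat_1) \<in> N \<longleftrightarrow> int (2 * d) dvd k" for k
    proof -
      have "int (2 * d) dvd k \<Longrightarrow> int d dvd k" by (metis dvd_mult_left mult.commute of_nat_mult)
      then show ?thesis unfolding N using one a0 a1 by auto
    qed
    show "\<exists>k c e. (c, e) \<in> N \<and> x = c \<star> a k \<and> y = e \<star> quat_1" if x: "x \<in> cyc ?n" and y: "y \<in> dic 3" for x y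
    proof -
      obtain k where k: "x = a k" using a_cases[OF x] by blast
      define l where "l = (if y \<in> cyc 3 then 0 else int d)"
      have "\<not> int (2 * d) dvd int d" using d by (auto dest: zdvd_imp_le)
      then have "(a l, y) \<in> N" unfolding N using a0[of l] a1[of l] y by (simp add: l_def)
      moreover have "x = a l \<star> a (k - l)" unfolding a_add[symmetric] by (simp add: k)
      ultimately show ?thesis by (metis quat_mult_1(2))
    qed
  qed (use d in \<open>simp_all add: a_in a_add B_closed\<close>)
qed

definition jpow :: "int \<Rightarrow> quaternion" where
  "jpow k = qrot (axis 2 1) (k * pi / 2)"

lemma jpow_add: "jpow (k + l) = jpow k \<star> jpow l"
  unfolding jpow_def by (subst qrot_add[symmetric]) (simp_all add: distrib_right add_divide_distrib)

lemma jpow_0_1: "jpow 0 = quat_1" "jpow 1 = quat_j"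
  by (simp_all add: jpow_def qrot_def quat_j_def quat_1_def)

lemma jpow_2_3: "jpow 2 = - quat_1" "jpow 3 = - quat_j"
  using jpow_add[of 1 1] jpow_add[of 1 2] by (simp_all add: jpow_0_1 quat_units_mult)

lemma jpow_mod: "jpow k = jpow (k mod 4)"
proof -
  have "jpow (4 * l) = quat_1" for l
  proof (induction l rule: int_induct[of _ 0])
    case (step1 i)
    have "jpow (4 * (i + 1)) = jpow (4 * i) \<star> (jpow 2 \<star> jpow 2)"
      unfolding jpow_add[symmetric] by (rule arg_cong[of _ _ jpow]) simp
    then show ?case using step1 by (simp add: jpow_2_3)
  next
    case (step2 i)
    have "jpow (4 * i) = jpow (4 * (i - 1)) \<star> (jpow 2 \<star> jpow 2)"
      unfolding jpow_add[symmetric] by (rule arg_cong[of _ _ jpow]) simp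
    then show ?case using step2 by (simp add: jpow_2_3)
  qed (simp add: jpow_0_1)
  moreover have "jpow k = jpow (4 * (k div 4)) \<star> jpow (k mod 4)" unfolding jpow_add[symmetric] by simp
  ultimately show ?thesis by simp
qed

lemma jpow_cases: "k mod 4 = 0 \<and> jpow k = quat_1 \<or> k mod 4 = 1 \<and> jpow k = quat_j \<or>
    k mod 4 = 2 \<and> jpow k = - quat_1 \<or> k mod 4 = 3 \<and> jpow k = - quat_j"
proof -
  have "k mod 4 = 0 \<or> k mod 4 = 1 \<or> k mod 4 = 2 \<or> k mod 4 = 3" by presburger
  then show ?thesis using jpow_mod[of k] by (elim disjE) (simp_all add: jpow_0_1 jpow_2_3)
qed

lemma j_in_dic: "quat_j \<in> dic n" "quat_j \<notin> cyc n" "- quat_j \<notin> cyc n"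
proof -
  have "quat_1 \<in> cyc n" using subgroup.one_closed[OF subgroup_cyc[of n]] by simp
  then have "quat_1 \<star> quat_j \<in> dic n" unfolding dic_eq by blast
  then show "quat_j \<in> dic n" by simp
  show "quat_j \<notin> cyc n" using j_part_not_cyc[of 0 n] by simp
  show "- quat_j \<notin> cyc n" using j_part_not_cyc[of pi n] by (simp add: rot1_pi)
qed

lemma jpow_dic:
  assumes n: "n > 0"
  shows "jpow k \<in> dic n"
proof -
  have one: "quat_1 \<in> dic n" using subgroup.one_closed[OF subgroup_dic[OF n]] by simp
  then show ?thesis
    using jpow_cases[of k] j_in_dic(1)[of n] minus_dic[OF n one] minus_dic[OF n j_in_dic(1)]
    by (elim disjE conjE) simp_all
qed

lemma jpow_cyc_iff:
  assumes n: "n > 0"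
  shows "jpow k \<in> cyc n \<longleftrightarrow> 2 dvd k"
proof -
  have "quat_1 \<in> cyc n" using subgroup.one_closed[OF subgroup_cyc[of n]] by simp
  then have one: "quat_1 \<in> cyc n" "- quat_1 \<in> cyc n" using minus_cyclic_quat[OF n] by auto
  show ?thesis
    using jpow_cases[of k] one j_in_dic(2,3)[of n] by (elim disjE conjE) (simp_all, presburger+)
qed

lemma quotient_group_D3_D3: "quotient_group (dic 3) (dic 3) \<cong> integer_mod_group 2"
proof -
  have d3: "subgroup (dic 3) Sp1" by (rule subgroup_dic) simp
  interpret binary_pair "dic 3" "dic 3" by (intro binary_pair.intro d3)
  have i3: "index_two (dic 3) (cyc 3)" by (rule index_two_dic) simp
  have one: "quat_1 \<in> dic 3" "quat_1 \<in> cyc 3"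
    using subgroup.one_closed[OF d3] subgroup.one_closed[OF subgroup_cyc[of 3]] by simp_all
  have N: "N = {(a, b). a \<in> dic 3 \<and> b \<in> dic 3 \<and> (a \<in> cyc 3 \<longleftrightarrow> b \<in> cyc 3)}"
  proof (rule real_part_subgroup_D3[OF d3 i3 subset_refl _ _ subset_refl j_in_dic(1)])
    show "a \<in> cyc 3" if a: "a \<in> dic 3" and "fst a \<in> {1, - 1, 1/2, - 1/2}" for a
      using a by (cases rule: dic_cases) (use that(2) in auto)
    show "a \<in> dic 3 - cyc 3" if a: "a \<in> dic 3" and "fst a = 0" for a
      using that fst_cyc_3[of a] by auto
  qed (simp add: quat_j_def)
  have jd: "jpow k \<in> dic 3" and jc: "jpow k \<in> cyc 3 \<longleftrightarrow> 2 dvd k" for k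
    by (simp_all add: jpow_dic jpow_cyc_iff)
  show ?thesis
  proof (rule quotient_group_cyclic[of 2 jpow "\<lambda>_. quat_1"])
    show "(jpow k, quat_1) \<in> N \<longleftrightarrow> int 2 dvd k" for k unfolding N using jd jc one by simp
    show "\<exists>k c e. (c, e) \<in> N \<and> x = c \<star> jpow k \<and> y = e \<star> quat_1" if x: "x \<in> dic 3" and y: "y \<in> dic 3" for x y
    proof (cases "x \<in> cyc 3 \<longleftrightarrow> y \<in> cyc 3")
      case True
      then have "(x, y) \<in> N" "x = x \<star> jpow 0" "y = y \<star> quat_1" unfolding N using x y by (simp_all add: jpow_0_1)
      then show ?thesis by blast
    next
      case False
      have "x \<star> jpow (- 1) \<in> dic 3" "x \<star> jpow (- 1) \<in> cyc 3 \<longleftrightarrow> (x \<in> cyc 3 \<longleftrightarrow> jpow (- 1) \<in> cyc 3)"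
        using i3 x jd A_closed(2)[OF x jd] unfolding index_two_def by blast+
      then have "(x \<star> jpow (- 1), y) \<in> N" unfolding N using False y jc by simp
      moreover have "x = (x \<star> jpow (- 1)) \<star> jpow 1" "y = y \<star> quat_1"
        by (simp_all add: quat_mult_assoc jpow_add[symmetric], simp add: jpow_0_1)
      ultimately show ?thesis by blast
    qed
  qed (simp_all add: jd jpow_add B_closed)
qed

section \<open>The cyclic group of order 3 and dihedral groups\<close>

text \<open>
  The common real parts are those of \<open>cyc 3\<close>, and real parts agree iff \<open>l\<close> and \<open>k\<close> agree up to sign
  modulo \<open>6\<close>; then \<open>l + k\<close> is even.  Conversely, if \<open>l + k = 2 s\<close>, then \<open>(l, k)\<close> is the sum of
  \<open>(s, s)\<close> and \<open>(l - s, s - l)\<close>.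
\<close>

lemma real_part_subgroup_C3_dic:
  assumes n: "n \<in> {3, 6}"
  shows "real_part_subgroup (cyc 3) (dic n) =
    {(rot1 (real_of_int l * pi / 3), rot1 (real_of_int k * pi / 3)) | k l. 2 dvd l + k}" (is "_ = ?M")
proof -
  have n0: "n > 0" "3 dvd n" using n by auto
  interpret binary_pair "cyc 3" "dic n" by (intro binary_pair.intro subgroup_cyc subgroup_dic[OF n0(1)])
  define a where "a k = rot1 (real_of_int k * pi / 3)" for k :: int
  have a_add: "a (j + k) = a j \<star> a k" for j k
    unfolding a_def rot1_add[symmetric] by (simp add: distrib_right add_divide_distrib)
  have a_in: "a k \<in> cyc 3" for k unfolding a_def using cyclic_quatI[of _ k 3] by simp
  have a_dic: "a k \<in> dic n" for k
    using cyc_dvd[OF n0(2,1), of k] cyc_subset_dic unfolding a_def by auto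
  have M: "?M = {(a l, b) | l b. \<exists>k. b = a k \<and> 2 dvd l + k}" unfolding a_def by blast
  have MI: "(a l, a k) \<in> ?M" if "2 dvd l + k" for l k unfolding M using that by blast
  have M_sub: "subgroup ?M (Sp1 \<times>\<times> Sp1)"
  proof (rule Sp1xSp1.subgroupI)
    show "?M \<subseteq> carrier (Sp1 \<times>\<times> Sp1)" by auto
    have "(a 0, a 0) \<in> ?M" by (rule MI) simp
    then show "?M \<noteq> {}" by (metis empty_iff)
    fix x assume "x \<in> ?M"
    then obtain l k where x: "x = (a l, a k)" "2 dvd l + k" unfolding M by blast
    have "inv\<^bsub>Sp1 \<times>\<times> Sp1\<^esub> x = (a (- l), a (- k))"
      unfolding x(1) by (subst inv_DirProd[OF group_Sp1 group_Sp1]) (simp_all add: a_def rot1_cnj)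
    moreover have "2 dvd - l + - k" using x(2) by presburger
    ultimately show "inv\<^bsub>Sp1 \<times>\<times> Sp1\<^esub> x \<in> ?M" using MI[of "- l" "- k"] by simp
    fix y assume "y \<in> ?M"
    then obtain l' k' where y: "y = (a l', a k')" "2 dvd l' + k'" unfolding M by blast
    have "2 dvd (l + l') + (k + k')" using x(2) y(2) by presburger
    then show "x \<otimes>\<^bsub>Sp1 \<times>\<times> Sp1\<^esub> y \<in> ?M" using MI[of "l + l'" "k + k'"] by (simp add: x(1) y(1) a_add)
  qed
  have "N \<subseteq> ?M"
  proof (rule N_least[OF M_sub])
    fix x y assume x: "x \<in> cyc 3" and y: "y \<in> dic n" and xy: "fst x = fst y"
    obtain l where l: "x = a l" using x unfolding cyclic_quat_def a_def by auto
    from y show "(x, y) \<in> ?M"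
    proof (cases rule: dic_cases)
      case (1 k)
      have "cos (real_of_int l * pi / real 3) = cos (real_of_int k * pi / real n)"
        using xy by (simp add: l 1 a_def)
      from cos_multiple_eq[OF _ n0(1) this]
      obtain z where z: "l * int n = k * 3 + 6 * int n * z \<or> l * int n = - k * 3 + 6 * int n * z" by auto
      obtain d where d: "n = 3 * d" using n0(2) by (rule dvdE)
      then have d0: "d > 0" using n0(1) by simp
      obtain k' where k': "k = int d * k'"
      proof -
        have "int d * (l - 6 * z) = k \<or> int d * (6 * z - l) = k" using z unfolding d by (auto simp: algebra_simps)
        then show thesis using that by blast
      qed
      have "int d * l = int d * (k' + 6 * z) \<or> int d * l = int d * (- k' + 6 * z)"
        using z unfolding d k' by (auto simp: algebra_simps)
      then have "l = k' + 6 * z \<or> l = - k' + 6 * z" using d0 by simp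
      then have "2 dvd l + k'" by presburger
      moreover have "y = a k'" using d0 by (simp add: 1 a_def k' d)
      ultimately show ?thesis using MI l by simp
    next
      case (2 k)
      then show ?thesis using fst_cyc_3[OF x] xy by simp
    qed
  qed
  moreover have "?M \<subseteq> N"
  proof
    fix x assume "x \<in> ?M"
    then obtain l k where x: "x = (a l, a k)" "2 dvd l + k" unfolding M by blast
    obtain s where s: "l + k = 2 * s" using x(2) by (rule dvdE)
    have "(a s, a s) \<in> N" by (intro N_gen a_in a_dic refl)
    moreover have "(a (l - s), a (- (l - s))) \<in> N"
    proof (intro N_gen a_in a_dic)
      have "fst (a (- t)) = fst (a t)" for t by (simp add: a_def)
      then show "fst (a (l - s)) = fst (a (- (l - s)))" by (rule sym)
    qed
    ultimately have "(a s \<star> a (l - s), a s \<star> a (- (l - s))) \<in> N" by (rule N_mult)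
    moreover have "s - (l - s) = k" using s by simp
    ultimately show "x \<in> N" unfolding a_add[symmetric] x(1) by simp
  qed
  ultimately show ?thesis by blast
qed

text \<open>
  The coset of \<open>(1, j)\<close> generates; its square is the coset of \<open>(1, -1)\<close>, which is not in \<open>N\<close>
  because \<open>-1 = rot1 (3 \<pi> / 3)\<close> has an odd exponent.
\<close>

lemma quotient_group_C3_D3: "quotient_group (cyc 3) (dic 3) \<cong> integer_mod_group 4"
proof -
  have d3: "subgroup (dic 3) Sp1" by (rule subgroup_dic) simp
  interpret binary_pair "cyc 3" "dic 3" by (intro binary_pair.intro subgroup_cyc d3)
  define a where "a k = rot1 (real_of_int k * pi / 3)" for k :: int
  have a_add: "a (j + k) = a j \<star> a k" for j k
    unfolding a_def rot1_add[symmetric] by (simp add: distrib_right add_divide_distrib)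
  have a_eq: "a j = a k \<longleftrightarrow> 6 dvd j - k" for j k using rot1_multiple_eq[of 3 j k] by (simp add: a_def)
  have a0: "a 0 = quat_1" "a 3 = - quat_1" by (simp_all add: a_def rot1_pi)
  have "N = {(a l, a k) | k l. 2 dvd l + k}" unfolding a_def by (rule real_part_subgroup_C3_dic) simp
  then have NI: "(a l, a k) \<in> N" if "2 dvd l + k" for l k using that by blast
  have ND: "2 dvd l + k" if mem: "(a l, a k) \<in> N" for l k
  proof -
    obtain l' k' where lk: "a l = a l'" "a k = a k'" "2 dvd l' + k'" using mem \<open>N = _\<close> by blast
    then have "6 dvd l - l'" "6 dvd k - k'" using a_eq by blast+
    then show ?thesis using lk(3) by presburger
  qed
  have Ncyc: "b \<in> cyc 3" if mem: "(c, b) \<in> N" for b c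
  proof -
    obtain k where "b = a k" using mem \<open>N = _\<close> by blast
    then show ?thesis using cyclic_quatI[of "axis 1 1" k 3] by (simp add: a_def)
  qed
  show ?thesis
  proof (rule quotient_group_cyclic[of 4 "\<lambda>_. quat_1" jpow])
    show "(quat_1, jpow k) \<in> N \<longleftrightarrow> int 4 dvd k" for k
    proof -
      have "(quat_1, quat_1) \<in> N" by (rule N_one)
      moreover have "(quat_1, - quat_1) \<notin> N" using ND[of 0 3] by (auto simp: a0)
      moreover have "(quat_1, quat_j) \<notin> N" "(quat_1, - quat_j) \<notin> N" using Ncyc j_in_dic(2,3) by blast+
      ultimately show ?thesis using jpow_cases[of k] by (elim disjE conjE) (simp_all, presburger+)
    qed
    show "\<exists>k c e. (c, e) \<in> N \<and> x = c \<star> quat_1 \<and> y = e \<star> jpow k" if x: "x \<in> cyc 3" and y: "y \<in> dic 3" for x y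
    proof -
      obtain l where l: "x = a l" using x unfolding cyclic_quat_def a_def by auto
      have "\<exists>m k. y = a m \<star> jpow k"
        using y
      proof (cases rule: dic_cases)
        case (1 m)
        then have "y = a m \<star> jpow 0" by (simp add: a_def jpow_0_1)
        then show ?thesis by blast
      next
        case (2 m)
        then have "y = a m \<star> jpow 1" by (simp add: a_def jpow_0_1)
        then show ?thesis by blast
      qed
      then obtain m k where mk: "y = a m \<star> jpow k" by blast
      have ex: "\<exists>m k. y = a m \<star> jpow k \<and> 2 dvd l + m"
      proof (cases "2 dvd l + m")
        case False
        have "a (m + 3) \<star> jpow (2 + k) = y" unfolding a_add jpow_add mk by (simp add: a0 jpow_2_3)
        moreover have "2 dvd l + (m + 3)" using False by presburger
        ultimately show ?thesis by metis
      qed (use mk in blast)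
      then obtain m k where "y = a m \<star> jpow k" "2 dvd l + m" by blast
      then have "(a l, a m) \<in> N" "x = a l \<star> quat_1" "y = a m \<star> jpow k" using NI l by simp_all
      then show ?thesis by blast
    qed
  qed (simp_all add: A_closed jpow_dic jpow_add)
qed

text \<open>
  The quaternion group \<open>1 \<times> dic 2\<close> is a complement of \<open>N\<close>.
\<close>

lemma quotient_group_C3_D6: "quotient_group (cyc 3) (dic 6) \<cong> Q8"
proof -
  have d6: "subgroup (dic 6) Sp1" by (rule subgroup_dic) simp
  interpret binary_pair "cyc 3" "dic 6" by (intro binary_pair.intro subgroup_cyc d6)
  interpret Q: group "Sp1\<lparr>carrier := dic 2\<rparr>" by (rule Sp1.subgroup_imp_group[OF subgroup_dic_2])
  have Q8: "Q8 = Sp1\<lparr>carrier := dic 2\<rparr>" by (simp add: Q8_def dic_2)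
  have d26: "dic 2 \<subseteq> dic 6"
    using dic_2_subset[OF d6] j_in_dic(1)[of 6] cyc_dvd1[of 2 6] cyc_subset_dic[of 6] by (auto simp: rot1_pi2)
  define a where "a k = rot1 (real_of_int k * pi / 3)" for k :: int
  have a_eq: "a j = a k \<longleftrightarrow> 6 dvd j - k" for j k using rot1_multiple_eq[of 3 j k] by (simp add: a_def)
  have N: "N = {(a l, a k) | k l. 2 dvd l + k}" unfolding a_def by (rule real_part_subgroup_C3_dic) simp
  show ?thesis unfolding quotient_group_def Q8
  proof (rule Mod_complement[OF group_pair[OF subgroup_A subgroup_B] normal_N Q.is_group])
    show "(\<lambda>b. (quat_1, b)) \<in> hom (Sp1\<lparr>carrier := dic 2\<rparr>) (pair_group (cyc 3) (dic 6))"
      by (rule homI) (use d26 A_closed(1) in auto)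
    show "b = \<one>\<^bsub>Sp1\<lparr>carrier := dic 2\<rparr>\<^esub>" if b: "b \<in> carrier (Sp1\<lparr>carrier := dic 2\<rparr>)" and bN: "(quat_1, b) \<in> N" for b
    proof -
      obtain l k where lk: "quat_1 = a l" "b = a k" "2 dvd l + k" using bN unfolding N by blast
      have "a 0 = quat_1" by (simp add: a_def)
      then have "6 dvd l - 0" using lk(1) a_eq[of l 0] by simp
      have "fst b \<in> {0, 1, - 1}" using fst_dic_2 b by simp
      then have "cos (real_of_int k * pi / real 3) = cos (real_of_int 1 * pi / real 2) \<or>
          cos (real_of_int k * pi / real 3) = cos (real_of_int 0 * pi / real 2) \<or>
          cos (real_of_int k * pi / real 3) = cos (real_of_int 2 * pi / real 2)" by (auto simp: lk a_def)
      then obtain m where m: "m \<in> {0, 1, 2}" "cos (real_of_int k * pi / real 3) = cos (real_of_int m * pi / real 2)"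
        by blast
      from cos_multiple_eq[OF _ _ m(2)]
      obtain z where "k * 2 = m * 3 + 12 * z \<or> k * 2 = - m * 3 + 12 * z" by auto
      then have "6 dvd k - 0" using m(1) \<open>6 dvd l - 0\<close> lk(3) by (elim insertE emptyE) (simp_all, presburger+)
      then have "b = a 0" using lk(2) a_eq by blast
      then show ?thesis by (simp add: a_def)
    qed
    fix x assume "x \<in> carrier (pair_group (cyc 3) (dic 6))"
    then obtain p q where x: "x = (p, q)" "p \<in> cyc 3" "q \<in> dic 6" by auto
    obtain l where l: "p = a l" using x(2) unfolding cyclic_quat_def a_def by auto
    \<comment> \<open>the first exponent has the parity of \<open>l\<close>\<close>
    have split: "rot1 (real_of_int m * pi / 6) = a (3 * l + 2 * m) \<star> rot1 (real_of_int (- m - 2 * l) * pi / 2)" for m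
    proof -
      have "real_of_int m * pi / 6 = real_of_int (3 * l + 2 * m) * pi / 3 + real_of_int (- m - 2 * l) * pi / 2"
        by (simp add: field_simps)
      then show ?thesis unfolding a_def by (simp only: rot1_add)
    qed
    have mem: "rot1 (real_of_int (- m - 2 * l) * pi / 2) \<in> cyc 2" for m using cyclic_quatI[of _ "- m - 2 * l" 2] by simp
    have "\<exists>m. \<exists>b\<in>dic 2. q = a (3 * l + 2 * m) \<star> b"
      using x(3)
    proof (cases rule: dic_cases)
      case (1 m)
      have "q = a (3 * l + 2 * m) \<star> rot1 (real_of_int (- m - 2 * l) * pi / 2)" using 1 split[of m] by simp
      then show ?thesis using mem[of m] cyc_subset_dic by blast
    next
      case (2 m)
      have "q = a (3 * l + 2 * m) \<star> (rot1 (real_of_int (- m - 2 * l) * pi / 2) \<star> quat_j)"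
        using 2 split[of m] by (simp add: quat_mult_assoc)
      moreover have "rot1 (real_of_int (- m - 2 * l) * pi / 2) \<star> quat_j \<in> dic 2" using mem[of m] by (simp only: dic_eq) blast
      ultimately show ?thesis by blast
    qed
    then obtain m b where mb: "b \<in> dic 2" "q = a (3 * l + 2 * m) \<star> b" by blast
    have "2 dvd l + (3 * l + 2 * m)" by presburger
    then have "(a l, a (3 * l + 2 * m)) \<in> N" unfolding N by blast
    then show "\<exists>b\<in>carrier (Sp1\<lparr>carrier := dic 2\<rparr>). \<exists>y\<in>N. x = y \<otimes>\<^bsub>pair_group (cyc 3) (dic 6)\<^esub> (quat_1, b)"
      using mb by (intro bexI[of _ b] bexI[of _ "(a l, a (3 * l + 2 * m))"]) (simp_all add: x(1) l)
  qed
qed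

text \<open>
  The common real parts are \<open>1\<close> and \<open>-1\<close>, so \<open>N\<close> has only the elements \<open>(1, 1)\<close> and \<open>(-1, -1)\<close>.  A
  complement is the product of the subgroup of order 3 of \<open>cyc 3\<close>, which avoids \<open>-1\<close>, with all of
  \<open>dic n\<close>.
\<close>

lemma quotient_group_C3_even_dic:
  assumes n: "n \<in> {2, 4}"
  shows "quotient_group (cyc 3) (dic n) \<cong> integer_mod_group 3 \<times>\<times> Sp1\<lparr>carrier := dic n\<rparr>" (is "_ \<cong> ?K")
proof -
  have n0: "n > 0" using n by auto
  interpret binary_pair "cyc 3" "dic n" by (intro binary_pair.intro subgroup_cyc subgroup_dic[OF n0])
  have one: "quat_1 \<in> cyc 3" "quat_1 \<in> dic n" by (rule A_closed(1), rule B_closed(1))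
  have minus: "- quat_1 \<in> cyc 3" "- quat_1 \<in> dic n"
    using minus_cyclic_quat[OF _ one(1)] minus_dic[OF n0 one(2)] by simp_all
  have N: "N = {(quat_1, quat_1), (- quat_1, - quat_1)}" (is "_ = ?M")
  proof
    show "?M \<subseteq> N" using N_one N_minus minus by blast
    show "N \<subseteq> ?M"
    proof (rule N_least)
      show "subgroup ?M (Sp1 \<times>\<times> Sp1)"
      proof -
        have "quat_cnj quat_1 = quat_1" "quat_cnj (- quat_1) = - quat_1" by (simp_all add: quat_cnj_def quat_1_def)
        then show ?thesis
          by (intro Sp1xSp1.subgroupI) (auto simp: inv_DirProd[OF group_Sp1 group_Sp1])
      qed
      fix a b assume ab: "a \<in> cyc 3" "b \<in> dic n" "fst a = fst b"
      have f: "fst a = 1 \<or> fst a = - 1" using fst_cyc_3[OF ab(1)] fst_dic_not_half[OF n ab(2)] ab(3) by auto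
      have unit: "q = quat_1 \<or> q = - quat_1" if "norm q = 1" "fst q = 1 \<or> fst q = - 1" for q :: quaternion
      proof -
        have "(fst q)\<^sup>2 + (norm (snd q))\<^sup>2 = 1" using that(1) by (cases q) (simp add: norm_Pair real_sqrt_eq_1_iff)
        then have "snd q = 0" using that(2) by auto
        then show ?thesis using that(2) by (auto simp: quat_1_def prod_eq_iff)
      qed
      have "a = quat_1 \<or> a = - quat_1" "b = quat_1 \<or> b = - quat_1"
        using unit[OF A_closed(4)[OF ab(1)]] unit[OF B_closed(4)[OF ab(2)]] f ab(3) by simp_all
      then show "(a, b) \<in> ?M" using ab(3) by (auto simp: quat_1_def)
    qed
  qed
  define a where "a k = rot1 (real_of_int k * pi / 3)" for k :: int
  have a_add: "a (j + k) = a j \<star> a k" for j k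
    unfolding a_def rot1_add[symmetric] by (simp add: distrib_right add_divide_distrib)
  have a_in: "a k \<in> cyc 3" for k unfolding a_def using cyclic_quatI[of _ k 3] by simp
  have a_eq: "a j = a k \<longleftrightarrow> 6 dvd j - k" for j k using rot1_multiple_eq[of 3 j k] by (simp add: a_def)
  have a0: "a 0 = quat_1" "a 3 = - quat_1" by (simp_all add: a_def rot1_pi)
  interpret D: group "Sp1\<lparr>carrier := dic n\<rparr>" by (rule Sp1.subgroup_imp_group[OF subgroup_B])
  have K: "group ?K" by (rule DirProd_group[OF group_integer_mod_group D.is_group])
  let ?f = "\<lambda>(k, b). (a (2 * k), b)"
  show ?thesis unfolding quotient_group_def
  proof (rule Mod_complement[OF group_pair[OF subgroup_A subgroup_B] normal_N K])
    show "?f \<in> hom ?K (pair_group (cyc 3) (dic n))"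
    proof (rule homI)
      show "?f x \<in> carrier (pair_group (cyc 3) (dic n))" if "x \<in> carrier ?K" for x
        using that a_in by (cases x) simp
      fix x y assume "x \<in> carrier ?K" "y \<in> carrier ?K"
      obtain k b l c where xy: "x = (k, b)" "y = (l, c)" by (metis prod.exhaust)
      have "a (2 * ((k + l) mod 3)) = a (2 * k + 2 * l)" unfolding a_eq by presburger
      then show "?f (x \<otimes>\<^bsub>?K\<^esub> y) = ?f x \<otimes>\<^bsub>pair_group (cyc 3) (dic n)\<^esub> ?f y"
        by (simp add: xy a_add)
    qed
    show "x = \<one>\<^bsub>?K\<^esub>" if x_in: "x \<in> carrier ?K" and xN: "?f x \<in> N" for x
    proof -
      obtain k b where x: "x = (k, b)" by (rule prod.exhaust)
      have k: "0 \<le> k" "k < 3" using x_in by (simp_all add: x carrier_integer_mod_group)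
      have kb: "a (2 * k) = a 0 \<and> b = quat_1 \<or> a (2 * k) = a 3 \<and> b = - quat_1"
        using xN unfolding N x a0 by simp
      have "\<not> 6 dvd 2 * k - 3" by presburger
      then have "6 dvd 2 * k" "b = quat_1" using kb unfolding a_eq by auto
      then have "k = 0" using k by presburger
      then show ?thesis using \<open>b = quat_1\<close> by (simp add: x)
    qed
    fix x assume "x \<in> carrier (pair_group (cyc 3) (dic n))"
    then obtain p q where x: "x = (p, q)" "p \<in> cyc 3" "q \<in> dic n" by auto
    obtain l where l: "p = a l" using x(2) unfolding cyclic_quat_def a_def by auto
    \<comment> \<open>2 is its own inverse modulo 3, so \<open>2 k\<close> and \<open>l\<close> agree modulo 3, that is, up to sign of the quaternion\<close>
    define k where "k = 2 * l mod 3"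
    have k: "k \<in> carrier (integer_mod_group 3)" by (simp add: k_def carrier_integer_mod_group)
    have "6 dvd l - 2 * k \<or> 6 dvd l - (3 + 2 * k)" unfolding k_def by presburger
    then have "p = a (0 + 2 * k) \<or> p = a (3 + 2 * k)" unfolding l a_eq by simp
    then have "p = quat_1 \<star> a (2 * k) \<or> p = - quat_1 \<star> a (2 * k)" unfolding a_add a0 .
    then show "\<exists>y\<in>carrier ?K. \<exists>z\<in>N. x = z \<otimes>\<^bsub>pair_group (cyc 3) (dic n)\<^esub> ?f y"
    proof
      assume "p = quat_1 \<star> a (2 * k)"
      then show ?thesis using k x N_one by (intro bexI[of _ "(k, q)"] bexI[of _ "(quat_1, quat_1)"]) simp_all
    next
      assume "p = - quat_1 \<star> a (2 * k)"
      then show ?thesis using k x N_minus[OF minus] minus_dic[OF n0 x(3)]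
        by (intro bexI[of _ "(k, - q)"] bexI[of _ "(- quat_1, - quat_1)"]) simp_all
    qed
  qed
qed

section \<open>The cyclic group of order 3 and the octahedral group\<close>

lemma subgroup_conj_preimage:
  assumes H: "subgroup H Sp1" and p: "norm p = 1"
  shows "subgroup {x. norm x = 1 \<and> p \<star> x \<star> quat_cnj p \<in> H} Sp1"
proof (rule Sp1.subgroupI)
  let ?U = "{x. norm x = 1 \<and> p \<star> x \<star> quat_cnj p \<in> H}"
  show "?U \<subseteq> carrier Sp1" by auto
  have "quat_1 \<in> H" using subgroup.one_closed[OF H] by simp
  then have "quat_1 \<in> ?U" by (simp add: quat_mult_cnj[OF p])
  then show "?U \<noteq> {}" by blast
  fix x assume x: "x \<in> ?U"
  have "quat_cnj (p \<star> x \<star> quat_cnj p) \<in> H"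
    using subgroup.m_inv_closed[OF H, of "p \<star> x \<star> quat_cnj p"] x p by (simp add: norm_quat_mult)
  then show "inv\<^bsub>Sp1\<^esub> x \<in> ?U" using x by (simp add: quat_cnj_mult quat_mult_assoc)
  fix y assume y: "y \<in> ?U"
  have "(p \<star> x \<star> quat_cnj p) \<star> (p \<star> y \<star> quat_cnj p) = p \<star> x \<star> (quat_cnj p \<star> p) \<star> y \<star> quat_cnj p"
    by (simp only: quat_mult_assoc)
  then have "p \<star> (x \<star> y) \<star> quat_cnj p = (p \<star> x \<star> quat_cnj p) \<star> (p \<star> y \<star> quat_cnj p)"
    by (simp add: quat_mult_cnj[OF p] quat_mult_assoc)
  then show "x \<otimes>\<^bsub>Sp1\<^esub> y \<in> ?U" using x y subgroup.m_closed[OF H] by (simp add: norm_quat_mult)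
qed

lemma ti_normalizes:
  assumes "t \<in> binary_T"
  shows "quat_ti \<star> t \<star> quat_cnj quat_ti \<in> binary_T" "quat_cnj quat_ti \<star> t \<star> quat_ti \<in> binary_T"
proof -
  have c: "norm (quat_cnj quat_ti) = 1" by simp
  have minus: "- quat_k \<in> binary_T" using binary_T(4)[OF unit_quats_in_T(3,6)] by simp
  have kw: "quat_k \<star> quat_cnj quat_w \<in> binary_T" "quat_i \<star> quat_cnj quat_w \<in> binary_T"
    by (intro binary_T(4) binary_T(5) unit_quats_in_T)+
  have e: "quat_ti \<star> quat_i \<star> quat_cnj quat_ti = quat_i" "quat_ti \<star> quat_j \<star> quat_cnj quat_ti = quat_k"
    "quat_ti \<star> quat_w \<star> quat_cnj quat_ti = quat_k \<star> quat_cnj quat_w"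
    "quat_cnj quat_ti \<star> quat_i \<star> quat_ti = quat_i" "quat_cnj quat_ti \<star> quat_j \<star> quat_ti = - quat_k"
    "quat_cnj quat_ti \<star> quat_w \<star> quat_ti = quat_i \<star> quat_cnj quat_w"
    by (simp_all add: quat_ti_def quat_w_def quat_unit_coords quat_cnj_coords quat_mult_coords quat_minus_coords
        vector_3_eq_iff vector_3_ops)
  have "{quat_i, quat_j, quat_w} \<subseteq> {x. norm x = 1 \<and> quat_ti \<star> x \<star> quat_cnj quat_ti \<in> binary_T}"
    using kw unit_quats_in_T by (simp add: e)
  then have "binary_T \<subseteq> {x. norm x = 1 \<and> quat_ti \<star> x \<star> quat_cnj quat_ti \<in> binary_T}"
    by (rule Sp1.generate_subgroup_incl[OF _ subgroup_conj_preimage[OF binary_T(1) norm_unit_quats(6)],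
        of "{quat_i, quat_j, quat_w}", folded binary_T_def])
  then show "quat_ti \<star> t \<star> quat_cnj quat_ti \<in> binary_T" using assms by blast
  have "{quat_i, quat_j, quat_w} \<subseteq> {x. norm x = 1 \<and> quat_cnj quat_ti \<star> x \<star> quat_cnj (quat_cnj quat_ti) \<in> binary_T}"
    using kw unit_quats_in_T minus by (simp add: e)
  then have "binary_T \<subseteq> {x. norm x = 1 \<and> quat_cnj quat_ti \<star> x \<star> quat_cnj (quat_cnj quat_ti) \<in> binary_T}"
    by (rule Sp1.generate_subgroup_incl[OF _ subgroup_conj_preimage[OF binary_T(1) c],
        of "{quat_i, quat_j, quat_w}", folded binary_T_def])
  then show "quat_cnj quat_ti \<star> t \<star> quat_ti \<in> binary_T" using assms by auto
qed

text \<open>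
  The quarter turn \<open>quat_ti\<close> normalizes \<open>binary_T\<close> and its square \<open>i\<close> lies in \<open>binary_T\<close>, so
  \<open>binary_T\<close> and its coset by \<open>quat_ti\<close> together form a group, which contains the generators.
\<close>

lemma O_cases:
  assumes "x \<in> binary_O"
  shows "x \<in> binary_T \<or> x \<star> quat_cnj quat_ti \<in> binary_T"
proof -
  let ?c = "quat_cnj quat_ti"
  have tc: "?c \<star> quat_ti = quat_1" "quat_ti \<star> ?c = quat_1" by (simp_all add: quat_mult_cnj)
  have cc: "?c \<star> ?c \<in> binary_T"
  proof -
    have "?c \<star> ?c = quat_cnj quat_i" unfolding quat_cnj_mult[symmetric] by (simp add: O_products)
    then show ?thesis using binary_T(5)[OF unit_quats_in_T(1)] by simp
  qed
  let ?U = "{x. norm x = 1 \<and> (x \<in> binary_T \<or> x \<star> ?c \<in> binary_T)}"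
  have "subgroup ?U Sp1"
  proof (rule Sp1.subgroupI)
    show "?U \<subseteq> carrier Sp1" by auto
    have "quat_1 \<in> ?U" using unit_quats_in_T(5) by simp
    then show "?U \<noteq> {}" by blast
    fix x assume x: "x \<in> ?U"
    then have "quat_cnj x \<in> ?U"
    proof (cases "x \<in> binary_T")
      case True
      then show ?thesis using x binary_T(5) by simp
    next
      case False
      then have t: "quat_cnj (x \<star> ?c) \<in> binary_T" using x binary_T(5) by blast
      have "quat_cnj x \<star> ?c = ((?c \<star> quat_ti) \<star> quat_cnj x) \<star> ((quat_ti \<star> ?c) \<star> ?c)" by (simp add: tc)
      also have "\<dots> = (?c \<star> quat_cnj (x \<star> ?c) \<star> quat_ti) \<star> (?c \<star> ?c)" by (simp add: quat_cnj_mult quat_mult_assoc)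
      also have "\<dots> \<in> binary_T" by (rule binary_T(4)[OF ti_normalizes(2)[OF t] cc])
      finally show ?thesis using x by simp
    qed
    then show "inv\<^bsub>Sp1\<^esub> x \<in> ?U" using x by simp
    fix y assume y: "y \<in> ?U"
    have n: "norm (x \<star> y) = 1" using x y by (simp add: norm_quat_mult)
    have "x \<star> y \<in> binary_T \<or> x \<star> y \<star> ?c \<in> binary_T"
    proof (cases "x \<in> binary_T")
      case True
      then show ?thesis using y binary_T(4)[of x y] binary_T(4)[of x "y \<star> ?c"] by (auto simp: quat_mult_assoc)
    next
      case False
      then have xc: "x \<star> ?c \<in> binary_T" using x by blast
      have step: "x \<star> z \<star> ?c = (x \<star> ?c) \<star> (quat_ti \<star> z \<star> ?c)" for z
      proof -
        have "x \<star> z \<star> ?c = x \<star> (?c \<star> quat_ti) \<star> z \<star> ?c" by (simp add: tc)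
        then show ?thesis by (simp only: quat_mult_assoc)
      qed
      show ?thesis
      proof (cases "y \<in> binary_T")
        case True
        then show ?thesis unfolding step using binary_T(4)[OF xc ti_normalizes(1)] by blast
      next
        case False
        then have yc: "y \<star> ?c \<in> binary_T" using y by blast
        have "x \<star> y = (x \<star> (y \<star> ?c) \<star> ?c) \<star> (quat_ti \<star> quat_ti)"
        proof -
          have "(x \<star> (y \<star> ?c) \<star> ?c) \<star> (quat_ti \<star> quat_ti) = x \<star> (y \<star> (?c \<star> (?c \<star> quat_ti) \<star> quat_ti))"
            by (simp only: quat_mult_assoc)
          then show ?thesis by (simp add: tc)
        qed
        also have "\<dots> \<in> binary_T"
          unfolding step O_products by (intro binary_T(4)[OF binary_T(4)[OF xc ti_normalizes(1)[OF yc]]] unit_quats_in_T)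
        finally show ?thesis by blast
      qed
    qed
    then show "x \<otimes>\<^bsub>Sp1\<^esub> y \<in> ?U" using n by simp
  qed
  moreover have "{quat_ti, quat_tj, quat_tk} \<subseteq> ?U"
  proof -
    have "quat_j \<star> quat_cnj quat_w \<in> binary_T" "quat_w \<star> quat_cnj quat_i \<in> binary_T"
      by (intro binary_T(4) binary_T(5) unit_quats_in_T)+
    moreover have "quat_tj \<star> ?c = quat_j \<star> quat_cnj quat_w" "quat_tk \<star> ?c = quat_w \<star> quat_cnj quat_i"
      by (simp_all add: quat_ti_def quat_tj_def quat_tk_def quat_w_def quat_unit_coords quat_cnj_coords quat_mult_coords)
    ultimately show ?thesis using unit_quats_in_T(5) by (simp add: tc)
  qed
  ultimately have "binary_O \<subseteq> ?U" unfolding binary_O_def by (intro Sp1.generate_subgroup_incl)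
  then show ?thesis using assms by blast
qed

lemma fst_T: "t \<in> binary_T \<Longrightarrow> fst t \<in> {0, 1, - 1, 1/2, - 1/2}"
  using T_not_half[of t] fst_dic_2[of t] by blast

lemma fst_T_ti:
  assumes "t \<in> binary_T"
  shows "fst (t \<star> quat_ti) \<in> {0, sqrt 2 / 2, - sqrt 2 / 2}"
proof -
  obtain p k where pk: "p \<in> dic 2" "t = p \<star> wpow k" using T_decomposition[OF assms] by blast
  obtain p' where p': "p' \<in> dic 2" "t = p' \<star> wpow (k mod 3)" using T_residue[OF pk(1), of k] pk(2) by metis
  have k: "k mod 3 = 0 \<or> k mod 3 = 1 \<or> k mod 3 = 2" by presburger
  obtain q where q: "q \<in> {quat_1, quat_i, quat_j, quat_k}" "p' = q \<or> p' = - q"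
    using p'(1) unfolding dic_2 by blast
  have "fst (q \<star> wpow (k mod 3) \<star> quat_ti) \<in> {0, sqrt 2 / 2, - sqrt 2 / 2}"
    using q(1) k
    by (elim insertE emptyE disjE)
      (simp_all add: wpow_1 wpow_2 quat_ti_def quat_w_def quat_unit_coords quat_mult_coords)
  then show ?thesis using q(2) unfolding p'(2) by auto
qed

text \<open>
  The elements of \<open>binary_O\<close> outside \<open>binary_T\<close> have real part \<open>0\<close> or \<open>\<plusminus>\<surd>2/2\<close>, which does not occur in
  \<open>cyc 3\<close>.  Hence \<open>N = cyc 3 \<times> binary_T\<close>, of index two.
\<close>

lemma quotient_group_C3_O: "quotient_group (cyc 3) binary_O \<cong> integer_mod_group 2"
proof -
  interpret binary_pair "cyc 3" binary_O by (intro binary_pair.intro subgroup_cyc binary_O(1))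
  have w_ti: "quat_ti = rot1 (pi / 4)" by (simp add: rot1_coords quat_ti_def cos_45 sin_45)
  have TO: "binary_T \<subseteq> binary_O"
    unfolding binary_T_def
    by (rule Sp1.generate_subgroup_incl[OF _ binary_O(1)]) (simp add: unit_quats_in_O)
  have N: "N = cyc 3 \<times> binary_T"
  proof
    show "N \<subseteq> cyc 3 \<times> binary_T"
    proof (rule N_least[OF subgroup_pair[OF subgroup_cyc binary_T(1)]])
      fix a b assume ab: "a \<in> cyc 3" "b \<in> binary_O" "fst a = fst b"
      have "b \<in> binary_T"
      proof (rule ccontr)
        assume "b \<notin> binary_T"
        then have "b \<star> quat_cnj quat_ti \<in> binary_T" using O_cases[OF ab(2)] by blast
        from fst_T_ti[OF this] have "fst b \<in> {0, sqrt 2 / 2, - sqrt 2 / 2}"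
          by (simp add: quat_mult_assoc quat_mult_cnj)
        moreover have "x * x \<in> {0, 1/2}" if "x \<in> {0, sqrt 2 / 2, - sqrt 2 / 2}" for x :: real
          using that by (elim insertE emptyE; hypsubst; simp)
        moreover have "x * x \<in> {1, 1/4}" if "x \<in> {1, - 1, 1/2, - 1/2}" for x :: real
          using that by (elim insertE emptyE; hypsubst; simp)
        ultimately have "fst b * fst b \<in> {0, 1/2}" "fst b * fst b \<in> {1, 1/4}"
          using fst_cyc_3[OF ab(1)] unfolding ab(3) by blast+
        then have "fst b * fst b \<in> {0, 1/2} \<inter> {1, 1/4}" by blast
        moreover have "{0, 1/2} \<inter> {1, 1/4} = ({} :: real set)" by simp
        ultimately show False by auto
      qed
      then show "(a, b) \<in> cyc 3 \<times> binary_T" using ab(1) by simp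
    qed
    have half: "rot1 (pi / 3) \<in> cyc 3" "fst (rot1 (pi / 3)) = 1/2"
      using cyc_dvd1[of 3 3] by (simp_all add: cos_60)
    have D: "differences (1/2) binary_O \<subseteq> carrier Sp1" using subgroup.subset[OF binary_O(1)] by (rule differences_carrier)
    have "binary_T \<subseteq> generate Sp1 (differences (1/2) binary_O)"
      unfolding binary_T_def
    proof (rule Sp1.generate_subgroup_incl[OF _ Sp1.generate_is_subgroup[OF D]])
      show "{quat_i, quat_j, quat_w} \<subseteq> generate Sp1 (differences (1/2) binary_O)"
        using half_differences[OF binary_O(1)] unit_quats_in_O by simp
    qed
    then have R: "(quat_1, b) \<in> N" if "b \<in> binary_T" for b
      using right_kernel_differences[OF half(1), of b] that unfolding half(2) by blast
    have "(a, b) \<in> N" if ab: "a \<in> cyc 3" "b \<in> binary_T" for a b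
    proof -
      have "quat_w \<star> quat_w \<in> binary_T" "- quat_w \<in> binary_T"
        using binary_T(4)[OF unit_quats_in_T(4,4)] binary_T(4)[OF unit_quats_in_T(6,4)] by simp_all
      then have "{1, - 1, 1/2, - 1/2} \<subseteq> fst ` binary_T"
        using imageI[OF unit_quats_in_T(4), of fst] imageI[OF unit_quats_in_T(5), of fst]
          imageI[OF unit_quats_in_T(6), of fst] imageI[of "- quat_w" binary_T fst]
        by (simp add: quat_1_def quat_w_def)
      then obtain c where c: "c \<in> binary_T" "fst a = fst c" using fst_cyc_3[OF ab(1)] by blast
      have "quat_cnj c \<star> b \<in> binary_T" using binary_T(4)[OF binary_T(5)] c ab by blast
      moreover have "(a, c) \<in> N" using ab c TO by (intro N_gen) auto
      ultimately have "(a \<star> quat_1, c \<star> (quat_cnj c \<star> b)) \<in> N" by (intro N_mult R)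
      moreover have "c \<star> (quat_cnj c \<star> b) = b"
        unfolding quat_mult_assoc[symmetric] by (simp add: quat_mult_cnj binary_T(6)[OF c(1)])
      ultimately show ?thesis by simp
    qed
    then show "cyc 3 \<times> binary_T \<subseteq> N" by auto
  qed
  define h where "h k = rot1 (real_of_int k * pi / 4)" for k :: int
  have h_add: "h (j + k) = h j \<star> h k" for j k
    unfolding h_def rot1_add[symmetric] by (simp add: distrib_right add_divide_distrib)
  have h1: "h 0 = quat_1" "h 1 = quat_ti" by (simp_all add: h_def w_ti)
  have h2: "h (2 * l) \<in> binary_T" for l
  proof -
    have e: "h (2 * l) = rot1 (real_of_int l * pi / 2)" unfolding h_def by (rule arg_cong[of _ _ rot1]) simp
    have "h (2 * l) \<in> cyc 2" using cyclic_quatI[of "axis 1 1" l 2] unfolding e by simp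
    then show ?thesis using cyc_2_subset[OF binary_T(1) unit_quats_in_T(1)] by blast
  qed
  show ?thesis
  proof (rule quotient_group_cyclic[of 2 "\<lambda>_. quat_1" h])
    show "h k \<in> binary_O" for k
    proof (cases "2 dvd k")
      case True
      then show ?thesis using h2 TO by (auto elim!: dvdE)
    next
      case False
      then obtain l where "k = 2 * l + 1" by (rule oddE)
      then show ?thesis using h2[of l] TO binary_O(4)[of "h (2 * l)" quat_ti] unit_quats_in_O(5)
        by (auto simp: h_add[of "2 * l" 1] h1)
    qed
    show "(quat_1, h k) \<in> N \<longleftrightarrow> int 2 dvd k" for k
    proof -
      have "h k \<notin> binary_T" if odd: "\<not> 2 dvd k"
      proof
        assume "h k \<in> binary_T"
        from fst_T[OF this] have "cos (real_of_int k * pi / 4) \<in> {0, 1, - 1, 1/2, - 1/2}" by (simp add: h_def)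
        moreover have "y * y \<in> {0, 1, 1/4}" if "y \<in> {0, 1, - 1, 1/2, - 1/2}" for y :: real
          using that by (elim insertE emptyE; hypsubst; simp)
        ultimately have "cos (real_of_int k * pi / 4) * cos (real_of_int k * pi / 4) \<in> {0, 1, 1/4}" by blast
        then show False using cos_odd_quarter[OF odd] by simp
      qed
      moreover have "h k \<in> binary_T" if "2 dvd k" using that h2 by (auto elim!: dvdE)
      ultimately show ?thesis unfolding N using A_closed(1) by auto
    qed
    show "\<exists>k c e. (c, e) \<in> N \<and> x = c \<star> quat_1 \<and> y = e \<star> h k" if x: "x \<in> cyc 3" and y: "y \<in> binary_O" for x y
    proof -
      from O_cases[OF y] obtain e k where "e \<in> binary_T" "y = e \<star> h k"
      proof
        assume "y \<in> binary_T"
        moreover have "y = y \<star> h 0" by (simp add: h1)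
        ultimately show thesis by (rule that)
      next
        assume t: "y \<star> quat_cnj quat_ti \<in> binary_T"
        have "y = (y \<star> quat_cnj quat_ti) \<star> h 1" by (simp add: h1 quat_mult_assoc quat_mult_cnj)
        with t show thesis by (rule that)
      qed
      moreover from this have "(x, e) \<in> N" "x = x \<star> quat_1" unfolding N using x by simp_all
      ultimately show ?thesis by blast
    qed
  qed (simp_all add: A_closed h_add)
qed

section \<open>Trivial entries\<close>

text \<open>
  A difference of elements of real part \<open>s\<close> is a product of elements whose real part \<open>s\<close> occurs
  in \<open>B\<close>.
\<close>

lemma shared_if_full:
  assumes B: "subgroup A Sp1" "A \<subseteq> generate Sp1 (differences s A)" and s: "s \<in> fst ` B"
  shows "A \<subseteq> generate Sp1 {a \<in> A. fst a \<in> fst ` B}"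
proof -
  let ?S = "{a \<in> A. fst a \<in> fst ` B}"
  have S: "?S \<subseteq> carrier Sp1" using subgroup.subset[OF B(1)] by blast
  have "differences s A \<subseteq> generate Sp1 ?S"
  proof
    fix x assume "x \<in> differences s A"
    then obtain p q where pq: "x = p \<star> quat_cnj q" "p \<in> A" "q \<in> A" "fst p = s" "fst q = s"
      unfolding differences_def by blast
    have "p \<in> ?S" "q \<in> ?S" using s pq(2,3) by (simp_all add: pq(4,5))
    with pq(1) show "x \<in> generate Sp1 ?S" using generate_Sp1I[OF S] by blast
  qed
  then show ?thesis using Sp1.generate_subgroup_incl[OF _ Sp1.generate_is_subgroup[OF S]] B(2) by blast
qed

lemma shared_dic:
  assumes n: "n > 0" and B: "0 \<in> fst ` B"
  shows "dic n \<subseteq> generate Sp1 {a \<in> dic n. fst a \<in> fst ` B}"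
proof -
  have "{a \<in> dic n. fst a = 0} \<subseteq> {a \<in> dic n. fst a \<in> fst ` B}"
    by (intro Collect_mono impI conjI; elim conjE) (simp_all only: B)
  then show ?thesis using dic_generated[OF n] Sp1.mono_generate by blast
qed

lemma cyc_subset:
  assumes H: "subgroup H Sp1" and n: "n > 0" and g: "rot1 (pi / n) \<in> H"
  shows "cyc n \<subseteq> H"
proof -
  have mem: "rot1 (real_of_int k * pi / n) \<in> H" for k
  proof (induction k rule: int_induct[of _ 0])
    case base
    then show ?case using subgroup.one_closed[OF H] by simp
  next
    case (step1 i)
    have "rot1 (real_of_int (i + 1) * pi / n) = rot1 (real_of_int i * pi / n) \<star> rot1 (pi / n)"
      unfolding rot1_add[symmetric] by (simp add: distrib_right add_divide_distrib)
    then show ?case using subgroup.m_closed[OF H step1(2) g] by simp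
  next
    case (step2 i)
    have "rot1 (real_of_int (i - 1) * pi / n) = rot1 (real_of_int i * pi / n) \<star> quat_cnj (rot1 (pi / n))"
      unfolding rot1_cnj rot1_add[symmetric] by (simp add: left_diff_distrib diff_divide_distrib)
    moreover have "quat_cnj (rot1 (pi / n)) \<in> H" using subgroup.m_inv_closed[OF H g] by simp
    ultimately show ?case using subgroup.m_closed[OF H step2(2)] by simp
  qed
  then show ?thesis by (auto simp: cyclic_quat_def)
qed

text \<open>
  In each case the listed real parts belong to elements that generate the group: \<open>i\<close>, \<open>rot1 (\<pi>/3)\<close>,
  \<open>rot1 (\<pi>/4)\<close>, and both \<open>i\<close> and \<open>rot1 (\<pi>/3)\<close>.
\<close>

lemma shared_cyc:
  shows "0 \<in> fst ` B \<Longrightarrow> cyc 2 \<subseteq> generate Sp1 {a \<in> cyc 2. fst a \<in> fst ` B}"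
    and "1/2 \<in> fst ` B \<Longrightarrow> cyc 3 \<subseteq> generate Sp1 {a \<in> cyc 3. fst a \<in> fst ` B}"
    and "sqrt 2 / 2 \<in> fst ` B \<Longrightarrow> cyc 4 \<subseteq> generate Sp1 {a \<in> cyc 4. fst a \<in> fst ` B}"
    and "0 \<in> fst ` B \<Longrightarrow> 1/2 \<in> fst ` B \<Longrightarrow> cyc 6 \<subseteq> generate Sp1 {a \<in> cyc 6. fst a \<in> fst ` B}"
proof -
  have S: "{a \<in> cyc n. fst a \<in> fst ` B} \<subseteq> carrier Sp1" for n using subgroup.subset[OF subgroup_cyc] by blast
  note gen = Sp1.generate_is_subgroup[OF S]
  have mem: "rot1 (pi / m) \<in> generate Sp1 {a \<in> cyc n. fst a \<in> fst ` B}"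
    if "m dvd n" "n > 0" "cos (pi / m) \<in> fst ` B" for m n :: nat
    using cyc_dvd1[OF that(1,2)] that(3) by (intro generate.incl) simp
  show "0 \<in> fst ` B \<Longrightarrow> cyc 2 \<subseteq> generate Sp1 {a \<in> cyc 2. fst a \<in> fst ` B}"
    using mem[of 2 2] by (intro cyc_subset[OF gen]) simp_all
  show "1/2 \<in> fst ` B \<Longrightarrow> cyc 3 \<subseteq> generate Sp1 {a \<in> cyc 3. fst a \<in> fst ` B}"
    using mem[of 3 3] by (intro cyc_subset[OF gen]) (simp_all add: cos_60)
  show "sqrt 2 / 2 \<in> fst ` B \<Longrightarrow> cyc 4 \<subseteq> generate Sp1 {a \<in> cyc 4. fst a \<in> fst ` B}"
    using mem[of 4 4] by (intro cyc_subset[OF gen]) (simp_all add: cos_45)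
  assume B: "0 \<in> fst ` B" "1/2 \<in> fst ` B"
  let ?H = "generate Sp1 {a \<in> cyc 6. fst a \<in> fst ` B}"
  have g: "rot1 (pi / 2) \<in> ?H" "rot1 (pi / 3) \<in> ?H" using mem[of 2 6] mem[of 3 6] B by (simp_all add: cos_60)
  have "rot1 (pi / 6) = rot1 (pi / 2) \<star> quat_cnj (rot1 (pi / 3))"
    unfolding rot1_cnj rot1_add[symmetric] by simp
  then have "rot1 (pi / 6) \<in> ?H" using generate_Sp1I(3,4)[OF S] g by simp
  then show "cyc 6 \<subseteq> ?H" by (intro cyc_subset[OF gen]) simp_all
qed

lemma trivial_entry:
  assumes "subgroup A Sp1" "subgroup B Sp1" "s \<in> fst ` A" "B \<subseteq> generate Sp1 (differences s B)"
    "A \<subseteq> generate Sp1 {a \<in> A. fst a \<in> fst ` B}"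
  shows "trivial_group (quotient_group A B)"
  using binary_pair.quotient_group_trivial[OF binary_pair.intro[OF assms(1,2)] assms(3-5)] .

lemma full_zero:
  assumes "B \<in> {dic 2, dic 4, dic 6, binary_O, binary_I}"
  shows "subgroup B Sp1" "B \<subseteq> generate Sp1 (differences 0 B)" "0 \<in> fst ` B"
proof -
  show "subgroup B Sp1" using assms subgroup_dic binary_O(1) binary_I(1) by auto
  show "B \<subseteq> generate Sp1 (differences 0 B)"
    using assms by (elim insertE emptyE; hypsubst) (rule dic_full O_full I_full; simp)+
  show "0 \<in> fst ` B"
    using assms by (elim insertE emptyE; hypsubst) (rule real_parts_dic real_parts_TOI; simp)+
qed

lemma trivial_entry_zero:
  assumes B: "B \<in> {dic 2, dic 4, dic 6, binary_O, binary_I}" and A: "subgroup A Sp1" "0 \<in> fst ` A"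
    and "A \<subseteq> generate Sp1 {a \<in> A. fst a \<in> fst ` B}"
  shows "trivial_group (quotient_group A B)"
  using trivial_entry[OF A(1) full_zero(1)[OF B] A(2) full_zero(2)[OF B] assms(4)] .

lemma trivial_entry_T:
  assumes A: "subgroup A Sp1" "1/2 \<in> fst ` A" "A \<subseteq> generate Sp1 {a \<in> A. fst a \<in> fst ` binary_T}"
  shows "trivial_group (quotient_group A binary_T)"
  using trivial_entry[OF A(1) binary_T(1) A(2) T_full A(3)] .

lemma trivial_cyc:
  "B \<in> {dic 2, dic 4, dic 6, binary_O, binary_I} \<Longrightarrow> trivial_group (quotient_group (cyc 2) B)"
  "trivial_group (quotient_group (cyc 3) binary_T)" "trivial_group (quotient_group (cyc 3) binary_I)"
  "trivial_group (quotient_group (cyc 4) (dic 4))" "trivial_group (quotient_group (cyc 4) binary_O)"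
  "trivial_group (quotient_group (cyc 6) (dic 6))" "trivial_group (quotient_group (cyc 6) binary_T)"
  "trivial_group (quotient_group (cyc 6) binary_O)" "trivial_group (quotient_group (cyc 6) binary_I)"
proof -
  note re = real_parts_cyc real_parts_dic real_parts_TOI
  show "trivial_group (quotient_group (cyc 2) B)" if "B \<in> {dic 2, dic 4, dic 6, binary_O, binary_I}" for B
    using that full_zero(3)[OF that] by (intro trivial_entry_zero subgroup_cyc shared_cyc re) simp_all
  show "trivial_group (quotient_group (cyc 3) binary_T)"
    by (intro trivial_entry_T subgroup_cyc shared_cyc re) simp_all
  show "trivial_group (quotient_group (cyc 3) binary_I)"
    by (intro trivial_entry[OF _ _ _ I_full_half] subgroup_cyc binary_I(1) shared_cyc re) simp_all
  show "trivial_group (quotient_group (cyc 4) (dic 4))" "trivial_group (quotient_group (cyc 4) binary_O)"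
    by (intro trivial_entry_zero subgroup_cyc shared_cyc re; simp)+
  show "trivial_group (quotient_group (cyc 6) binary_T)"
    by (intro trivial_entry_T subgroup_cyc shared_cyc re) simp_all
  show "trivial_group (quotient_group (cyc 6) (dic 6))" "trivial_group (quotient_group (cyc 6) binary_O)"
    "trivial_group (quotient_group (cyc 6) binary_I)"
    by (intro trivial_entry_zero subgroup_cyc shared_cyc re; simp)+
qed

lemma trivial_dic:
  "n > 0 \<Longrightarrow> B \<in> {dic 2, dic 4, dic 6, binary_O, binary_I} \<Longrightarrow> trivial_group (quotient_group (dic n) B)"
  "3 dvd n \<Longrightarrow> n > 0 \<Longrightarrow> trivial_group (quotient_group (dic n) binary_T)"
proof -
  show "trivial_group (quotient_group (dic n) B)" if "n > 0" "B \<in> {dic 2, dic 4, dic 6, binary_O, binary_I}"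
    by (intro trivial_entry_zero subgroup_dic shared_dic real_parts_dic that full_zero(3))
  show "trivial_group (quotient_group (dic n) binary_T)" if "3 dvd n" "n > 0"
    by (intro trivial_entry_T subgroup_dic shared_dic real_parts_dic that real_parts_TOI)
qed

lemma trivial_TOI:
  "trivial_group (quotient_group binary_T binary_T)"
  "trivial_group (quotient_group binary_T binary_O)" "trivial_group (quotient_group binary_T binary_I)"
  "trivial_group (quotient_group binary_O binary_O)" "trivial_group (quotient_group binary_O binary_I)"
  "trivial_group (quotient_group binary_I binary_I)"
proof -
  note re = real_parts_TOI
  show "trivial_group (quotient_group binary_T binary_T)"
    by (intro trivial_entry_T binary_T(1) shared_if_full[OF _ T_full] re)
  show "trivial_group (quotient_group binary_T binary_O)" "trivial_group (quotient_group binary_T binary_I)"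
    by (intro trivial_entry_zero binary_T(1) shared_if_full[OF _ T_full] re; simp)+
  show "trivial_group (quotient_group binary_O binary_O)" "trivial_group (quotient_group binary_O binary_I)"
    by (intro trivial_entry_zero binary_O(1) shared_if_full[OF _ O_full] re; simp)+
  show "trivial_group (quotient_group binary_I binary_I)"
    by (intro trivial_entry_zero binary_I(1) shared_if_full[OF _ I_full] re) simp
qed

section \<open>Assembling the table\<close>

lemma double_cover_qrot_axis:
  assumes u: "norm u = 1"
  shows "double_cover (qrot u t) *v u = u"
proof -
  have "qrot u t \<star> (0, u) = (0, u) \<star> qrot u t" by (simp add: qrot_def quat_mult_def cross_mult_left cross_mult_right)
  then have "(0, double_cover (qrot u t) *v u) = (0 :: real, u)"
    unfolding double_cover_conj using u by (simp add: quat_mult_assoc quat_mult_cnj)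
  then show ?thesis by simp
qed

lemma axial_rotation_qrot:
  assumes u: "norm u = 1" and n: "n > 0"
  shows "axial_rotation u n (double_cover (qrot u (pi / n)))"
proof -
  let ?q = "qrot u (pi / n)"
  have q: "norm ?q = 1" using u by simp
  have pow: "double_cover ?q [^]\<^bsub>SO3\<^esub> k = double_cover (qrot u (real k * (pi / n)))" for k :: nat
    using double_cover_pow[OF q, of "int k"] u by (simp add: qrot_pow_nat int_pow_int)
  have "double_cover ?q [^]\<^bsub>SO3\<^esub> k = \<one>\<^bsub>SO3\<^esub> \<longleftrightarrow> n dvd k" for k :: nat
  proof -
    have "double_cover ?q [^]\<^bsub>SO3\<^esub> k = \<one>\<^bsub>SO3\<^esub> \<longleftrightarrow> (\<exists>z::int. real k * (pi / n) = z * pi)"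
      unfolding pow using double_cover_qrot_eq_1[OF u] by simp
    also have "\<dots> \<longleftrightarrow> (\<exists>z::int. int k = int n * z)"
    proof -
      have "real k * (pi / n) = z * pi \<longleftrightarrow> int k = int n * z" for z :: int
      proof -
        have "real k * (pi / n) = z * pi \<longleftrightarrow> pi * real k = pi * (n * real_of_int z)" using n by (simp add: field_simps)
        also have "\<dots> \<longleftrightarrow> real_of_int (int k) = real_of_int (int n * z)" by simp
        finally show ?thesis by (simp only: of_int_eq_iff)
      qed
      then show ?thesis by simp
    qed
    also have "\<dots> \<longleftrightarrow> n dvd k" by (simp add: dvd_def[symmetric])
    finally show ?thesis .
  qed
  moreover have carr: "double_cover ?q \<in> carrier SO3" using double_cover_rotation[OF q] by simp
  ultimately have "SO3.ord (double_cover ?q) = n" using SO3.ord_unique[OF carr, of n] by metis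
  moreover have "double_cover ?q *v u = u" by (rule double_cover_qrot_axis[OF u])
  ultimately show ?thesis using carr u unfolding axial_rotation_def by auto
qed

lemma binary_group_standard_D4: "binary_group standard_D4 = Sp1\<lparr>carrier := dic 4\<rparr>"
proof -
  let ?e = "axis 1 1 :: real^3" and ?f = "axis 2 1 :: real^3"
  let ?A = "double_cover (qrot ?e (pi / real 4))" and ?B = "double_cover (qrot ?f (pi / real 2))"
  have "standard_D4 = generate SO3 {?A, ?B}"
    unfolding standard_D4_def double_cover_D4_generators[symmetric] by (simp add: qrot_def quat_j_def)
  moreover have "axial_rotation ?e 4 ?A" "axial_rotation ?f 2 ?B" by (rule axial_rotation_qrot; simp)+
  from generate_dihedral[OF _ _ _ _ this] have "cover_preimage (generate SO3 {?A, ?B}) = dic 4"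
    by (simp add: inner_axis_axis)
  ultimately show ?thesis unfolding binary_group_eq by (simp only:)
qed

lemma is_entry_iso:
  assumes G: "group G" and H: "group H" and iso: "G \<cong> H" and e: "is_entry e G"
  shows "is_entry e H"
proof -
  have sym: "H \<cong> G" using iso group.iso_sym[OF G] by blast
  show ?thesis
  proof (cases e)
    case Trivial
    then show ?thesis using e isomorphic_group_triviality[OF iso G H] by simp
  qed (use e iso_trans[OF sym] in simp_all)
qed

lemma standard_entry:
  assumes "i \<le> j" "j < length group_list"
  shows "is_entry (pi1_table ! i ! (j - i))
    (quotient_group (standard_binary (group_list ! i)) (standard_binary (group_list ! j)))"
proof -
  have cyc: "quotient_group (cyc 2) (cyc 2) \<cong> integer_mod_group 2"
    "quotient_group (cyc 2) (cyc 3) \<cong> integer_mod_group 12" "quotient_group (cyc 2) (cyc 4) \<cong> integer_mod_group 4"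
    "quotient_group (cyc 2) (cyc 6) \<cong> integer_mod_group 6" "quotient_group (cyc 3) (cyc 3) \<cong> integer_mod_group 2"
    "quotient_group (cyc 3) (cyc 4) \<cong> integer_mod_group 24" "quotient_group (cyc 3) (cyc 6) \<cong> integer_mod_group 4"
    "quotient_group (cyc 4) (cyc 4) \<cong> integer_mod_group 2" "quotient_group (cyc 4) (cyc 6) \<cong> integer_mod_group 12"
    "quotient_group (cyc 6) (cyc 6) \<cong> integer_mod_group 2"
  proof -
    have c: "coprime (2::nat) 3" "coprime (3::nat) 4" by (simp_all add: coprime_iff_gcd_eq_1 gcd_nat.simps)
    show "quotient_group (cyc 2) (cyc 2) \<cong> integer_mod_group 2" using quotient_group_cyc_cyc[of 2 1 1] by simp
    show "quotient_group (cyc 2) (cyc 3) \<cong> integer_mod_group 12" using quotient_group_cyc_cyc[of 1 2 3] c by simp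
    show "quotient_group (cyc 2) (cyc 4) \<cong> integer_mod_group 4" using quotient_group_cyc_cyc[of 2 1 2] by simp
    show "quotient_group (cyc 2) (cyc 6) \<cong> integer_mod_group 6" using quotient_group_cyc_cyc[of 2 1 3] by simp
    show "quotient_group (cyc 3) (cyc 3) \<cong> integer_mod_group 2" using quotient_group_cyc_cyc[of 3 1 1] by simp
    show "quotient_group (cyc 3) (cyc 4) \<cong> integer_mod_group 24" using quotient_group_cyc_cyc[of 1 3 4] c by simp
    show "quotient_group (cyc 3) (cyc 6) \<cong> integer_mod_group 4" using quotient_group_cyc_cyc[of 3 1 2] by simp
    show "quotient_group (cyc 4) (cyc 4) \<cong> integer_mod_group 2" using quotient_group_cyc_cyc[of 4 1 1] by simp
    show "quotient_group (cyc 4) (cyc 6) \<cong> integer_mod_group 12" using quotient_group_cyc_cyc[of 2 2 3] c by simp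
    show "quotient_group (cyc 6) (cyc 6) \<cong> integer_mod_group 2" using quotient_group_cyc_cyc[of 6 1 1] by simp
  qed
  have D3: "quotient_group (cyc 2) (dic 3) \<cong> integer_mod_group 2" "quotient_group (cyc 4) (dic 3) \<cong> integer_mod_group 4"
    "quotient_group (cyc 6) (dic 3) \<cong> integer_mod_group 2"
    using quotient_group_cyc_D3[of 1 1] quotient_group_cyc_D3[of 1 2] quotient_group_cyc_D3[of 3 1] by simp_all
  have C3: "quotient_group (cyc 3) (dic 2) \<cong> integer_mod_group 3 \<times>\<times> Q8"
    "quotient_group (cyc 3) (dic 4) \<cong> integer_mod_group 3 \<times>\<times> binary_group standard_D4"
  proof -
    have "Q8 = Sp1\<lparr>carrier := dic 2\<rparr>" by (simp add: Q8_def dic_2)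
    then show "quotient_group (cyc 3) (dic 2) \<cong> integer_mod_group 3 \<times>\<times> Q8"
      using quotient_group_C3_even_dic[of 2] by simp
    show "quotient_group (cyc 3) (dic 4) \<cong> integer_mod_group 3 \<times>\<times> binary_group standard_D4"
      unfolding binary_group_standard_D4 by (rule quotient_group_C3_even_dic) simp
  qed
  have T: "quotient_group (dic n) binary_T \<cong> integer_mod_group 3" if n: "n \<in> {2, 4}" for n
  proof -
    have "subgroup (dic n) Sp1" using n by (intro subgroup_dic) auto
    then show ?thesis using iso_trans[OF quotient_group_swap[OF _ binary_T(1)] quotient_group_T_dic[OF n]] by blast
  qed
  have C6: "quotient_group (cyc 6) (dic 2) \<cong> integer_mod_group 3" "quotient_group (cyc 6) (dic 4) \<cong> integer_mod_group 3"
    by (rule quotient_group_C6_dic; simp)+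
  note facts = cyc D3 C3 T C6 quotient_group_C4_dic quotient_group_C4_I quotient_group_C2_T quotient_group_C4_T
    quotient_group_D3_D3 quotient_group_C3_D3 quotient_group_C3_D6 quotient_group_C3_O
    trivial_cyc trivial_dic trivial_TOI
  have "i \<in> {0, 1, 2, 3, 4, 5, 6, 7, 8, 9, 10}" "j \<in> {0, 1, 2, 3, 4, 5, 6, 7, 8, 9, 10}"
  proof -
    have "j < 11" using assms(2) by (simp add: group_list_def)
    moreover from this assms(1) have "i < 11" by simp
    moreover have "k \<in> {0, 1, 2, 3, 4, 5, 6, 7, 8, 9, 10}" if "k < 11" for k :: nat using that by (simp, presburger)
    ultimately show "i \<in> {0, 1, 2, 3, 4, 5, 6, 7, 8, 9, 10}" "j \<in> {0, 1, 2, 3, 4, 5, 6, 7, 8, 9, 10}" by blast+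
  qed
  then show ?thesis using assms(1)
    by (elim insertE emptyE; simp add: pi1_table_def group_list_def facts)
qed

theorem theorem2p9:
  fixes G1 G2 :: "(real^3^3) set" and i j :: nat and x :: "(real^3^3) set"
  assumes "i \<le> j" and "j < length group_list"
    and "has_type (group_list ! i) G1" and "has_type (group_list ! j) G2"
    and "x \<in> topspace (misorientation_space G1 G2)"
  shows "is_entry (pi1_table ! i ! (j - i))
           (fundamental_group (misorientation_space G1 G2) x)"
proof -
  have "\<forall>\<tau>\<in>set group_list. proper_type \<tau>" by (simp add: group_list_def)
  then have p: "proper_type (group_list ! i)" "proper_type (group_list ! j)" using assms(1,2) by simp_all
  let ?A = "standard_binary (group_list ! i)" and ?B = "standard_binary (group_list ! j)"
  obtain R where R: "rotation_matrix R" "cover_preimage G1 = quat_rotate R ` ?A"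
    using has_type_cover_preimage[OF assms(3) p(1)] by blast
  obtain S where S: "rotation_matrix S" "cover_preimage G2 = quat_rotate S ` ?B"
    using has_type_cover_preimage[OF assms(4) p(2)] by blast
  note sub = has_type_subgroup[OF assms(3)] has_type_subgroup[OF assms(4)]
  note A = subgroup_standard_binary[OF p(1)] and B = subgroup_standard_binary[OF p(2)]
  note \<pi>1 = fundamental_group_misorientation_space[OF sub(1) has_type_finite[OF assms(3) p(1)] sub(2)
      has_type_finite[OF assms(4) p(2)] assms(5)]
  have "quotient_group ?A ?B \<cong> quotient_group (cover_preimage G1) (cover_preimage G2)"
    using quotient_group_rotate[OF R(1) S(1) A B] subgroup_cover_preimage[OF sub(1)] subgroup_cover_preimage[OF sub(2)]
    unfolding R(2) S(2) by blast
  also have "\<dots> \<cong> fundamental_group (misorientation_space G1 G2) x"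
    using \<pi>1(1) by (simp only: quotient_group_def)
  finally have iso: "quotient_group ?A ?B \<cong> fundamental_group (misorientation_space G1 G2) x" .
  have "group (quotient_group ?A ?B)"
    unfolding quotient_group_def by (rule normal.factorgroup_is_group[OF normal_real_part_subgroup[OF A B]])
  then show ?thesis using is_entry_iso[OF _ \<pi>1(2) iso] standard_entry[OF assms(1,2)] by blast
qed

end
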